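(* Suppose $A$ is an $n\times n$ positive matrix. Then there is a $\delta>0$ such that for any $B,C$ in $\mathcal N^{\mathrm{SE}}_\delta(A)$ and any integer $m\ge n^2/2$, there are row splittings of $B,C$ to positive conjugate $m\times m$ matrices $B',C'$ (respectively) such that there exists a path of positive conjugate matrices from $B'$ to $C'$, and therefore the matrices $B,C$ are SSE over $\mathbb R_+$, through positive matrices not larger than $(n^2/2)\times(n^2/2)$. Moreover, if $B$ and $C$ have their entries in a nondiscrete subring $\mathcal U$ of $\mathbb R$, then the splittings to $B'$ and $C'$ can be done through matrices over $\mathcal U_+$. If in addition $\mathcal U$ is a field, then the matrices $B,C$ are SSE over $\mathcal U_+$, through positive matrices not larger than $(n^2/2)\times(n^2/2)$.
   Context: A matrix is positive if all its entries are positive real numbers. Rings contain $1$; $\mathcal U_+=\mathcal U\cap[0,\infty)$ and $\mathbb R_+=[0,\infty)$. Conjugate means conjugate (similar) over $\mathbb R$; paths are continuous maps from $[0,1]$, and a path of positive conjugate matrices is a path of positive matrices all lying in one conjugacy class over $\mathbb R$. Square matrices $A,B$ are shift equivalent over $\mathbb R$ if there are real matrices $R,S$ and $\ell\in\mathbb N$ with $A^\ell=RS$, $B^\ell=SR$, $AR=RB$, $BS=SA$. $\mathcal N^{\mathrm{SE}}_\delta(A)$ is the set of $n\times n$ real matrices $B$ which are shift equivalent over $\mathbb R$ to $A$ and satisfy $\|B-A\|_{\max}<\delta$, where $\|\cdot\|_{\max}$ is the maximum absolute value of an entry. Matrices $A,B$ are elementary strong shift equivalent (ESSE) over a semiring $\mathcal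 S$ if $A=RS$, $B=SR$ for some matrices $R,S$ over $\mathcal S$. "SSE (strong shift equivalent) over $\mathcal S$, through positive matrices not larger than $k\times k$" means there is a finite chain of positive square matrices over $\mathcal S$ from one matrix to the other, none larger than $k\times k$, with consecutive matrices ESSE over $\mathcal S$. A subdivision matrix is a $0$-$1$ matrix in which every column has exactly one $1$ and every row has at least one $1$. A matrix $C$ is an elementary row splitting of $A$ if $A=UX$ and $C=XU$ for some matrix $X$ and some subdivision matrix $U$. Row splittings from $B$ to $B'$ means a finite sequence of elementary row splittings starting at $B$ and ending at $B'$; it is done through matrices over $\mathcal U_+$ if all the matrices involved have entries in $\mathcal U_+$.
   Formalization: The size bound on the SSE chains is max(n, n²/2) instead of n²/2; this differs only for n = 1, where the bound 1/2 would exclude the 1×1 matrices B, C themselves and make the claim false; n ≥ 1 is assumed. *)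

theory Defs
  imports "HOL-Analysis.Analysis" "HOL-Algebra.Subrings" "Jordan_Normal_Form.VS_Connect"
begin

definition positive_mat :: "real mat \<Rightarrow> bool" where
  "positive_mat A \<longleftrightarrow> elements_mat A \<subseteq> {0<..}"

(* Only meaningful for matrices with at least one entry. *)
definition max_norm :: "real mat \<Rightarrow> real" where
  "max_norm A = Max (abs ` elements_mat A)"

(* The lag l is taken to be positive.  Allowing l = 0 would not change the relation:
   l = 0 forces A and B to be similar, and then (R, S * A) is an equivalence of lag 1. *)
definition shift_equivalent :: "real mat \<Rightarrow> real mat \<Rightarrow> bool" where
  "shift_equivalent A B \<longleftrightarrow> square_mat A \<and> square_mat B \<and>
     (\<exists>R \<in> carrier_mat (dim_row A) (dim_row B).
      \<exists>S \<in> carrier_mat (dim_row B) (dim_row A).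
      \<exists>l>0. A ^\<^sub>m l = R * S \<and> B ^\<^sub>m l = S * R \<and> A * R = R * B \<and> B * S = S * A)"

definition SE_nbhd :: "real \<Rightarrow> real mat \<Rightarrow> real mat set" where
  "SE_nbhd \<delta> A = {B \<in> carrier_mat (dim_row A) (dim_col A).
      shift_equivalent B A \<and> max_norm (B - A) < \<delta>}"

(* In the following definitions the semiring is given by its underlying set T of reals. *)
definition ESSE :: "real set \<Rightarrow> real mat \<Rightarrow> real mat \<Rightarrow> bool" where
  "ESSE T A B \<longleftrightarrow> square_mat A \<and> square_mat B \<and>
     (\<exists>R \<in> carrier_mat (dim_row A) (dim_row B).
      \<exists>S \<in> carrier_mat (dim_row B) (dim_row A).
        elements_mat R \<subseteq> T \<and> elements_mat S \<subseteq> T \<and> A = R * S \<and> B = S * R)"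

(* The size bound k is real, so that it can be a number such as n^2/2 for odd n. *)
definition admissible_mat :: "real set \<Rightarrow> real \<Rightarrow> real mat \<Rightarrow> bool" where
  "admissible_mat T k M \<longleftrightarrow>
     square_mat M \<and> real (dim_row M) \<le> k \<and> positive_mat M \<and> elements_mat M \<subseteq> T"

(* The first matrix of the chain is required to be admissible separately, so that
   a chain of length zero is subject to the same conditions. *)
definition SSE_through_positive :: "real set \<Rightarrow> real \<Rightarrow> real mat \<Rightarrow> real mat \<Rightarrow> bool" where
  "SSE_through_positive T k A B \<longleftrightarrow> admissible_mat T k A \<and>
     (\<lambda>M N. ESSE T M N \<and> admissible_mat T k N)\<^sup>*\<^sup>* A B"

definition subdivision_mat :: "real mat \<Rightarrow> bool" where
  "subdivision_mat U \<longleftrightarrow> elements_mat U \<subseteq> {0, 1} \<and>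
     (\<forall>j < dim_col U. \<exists>!i. i < dim_row U \<and> U $$ (i, j) = 1) \<and>
     (\<forall>i < dim_row U. \<exists>j < dim_col U. U $$ (i, j) = 1)"

(* C is an elementary row splitting of A, all matrices involved having entries in T. *)
definition elem_row_splitting :: "real set \<Rightarrow> real mat \<Rightarrow> real mat \<Rightarrow> bool" where
  "elem_row_splitting T A C \<longleftrightarrow> square_mat A \<and> square_mat C \<and>
     elements_mat A \<subseteq> T \<and> elements_mat C \<subseteq> T \<and>
     (\<exists>U \<in> carrier_mat (dim_row A) (dim_row C).
      \<exists>X \<in> carrier_mat (dim_row C) (dim_row A).
        subdivision_mat U \<and> elements_mat U \<subseteq> T \<and> elements_mat X \<subseteq> T \<and>
        A = U * X \<and> C = X * U)"

definition row_splittings :: "real set \<Rightarrow> real mat \<Rightarrow> real mat \<Rightarrow> bool" where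
  "row_splittings T B B' \<longleftrightarrow> square_mat B \<and> elements_mat B \<subseteq> T \<and> (elem_row_splitting T)\<^sup>*\<^sup>* B B'"

(* The type of matrices carries no topology; continuity of a path of m x m matrices
   is continuity of every entry. *)
definition positive_conjugate_path :: "nat \<Rightarrow> (real \<Rightarrow> real mat) \<Rightarrow> bool" where
  "positive_conjugate_path m \<gamma> \<longleftrightarrow>
     (\<forall>t\<in>{0..1}. \<gamma> t \<in> carrier_mat m m \<and> positive_mat (\<gamma> t)) \<and>
     (\<forall>s\<in>{0..1}. \<forall>t\<in>{0..1}. similar_mat (\<gamma> s) (\<gamma> t)) \<and>
     (\<forall>i<m. \<forall>j<m. continuous_on {0..1} (\<lambda>t. \<gamma> t $$ (i, j)))"

end

theory Submission
  imports Defs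
begin

text \<open>
  Shift equivalence to \<open>A\<close> fixes the invertible part of a matrix up to conjugacy and the size of its
  nilpotent part, but not the conjugacy class of the nilpotent part.  Two matrices \<open>B\<close>, \<open>C\<close> near \<open>A\<close>
  therefore need not be conjugate, and the point of the proof is to split rows until they are, while
  keeping hold of a path between them.

  Matrices act on row vectors.  If \<open>A\<close> has an invertible part of size \<open>r\<close>, given by \<open>J\<close>, and a nilpotent
  part of size \<open>k\<close>, with \<open>n = r + k\<close>, then a matrix \<open>B\<close> shift equivalent to \<open>A\<close> satisfies
  \<open>L B = diag(J, T) L\<close> with \<open>L\<close> invertible and \<open>T\<close> strictly lower triangular.  Such a pair \<open>(L, T)\<close> is
  called a frame of \<open>B\<close>.  A frame determines its matrix, \<open>J\<close> is the same for all these matrices, and \<open>T\<close>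
  may vary freely among strictly lower triangular matrices; so the frames of positive matrices form an
  open subset of the vector space of all pairs \<open>(L, T)\<close>, and nearby frames are joined by straight lines.

  The frames of all matrices near \<open>A\<close> can be joined by paths of frames of positive matrices
  (\<open>shift_equivalent_frames_joined\<close>).  If this failed there would be a sequence of matrices tending
  to \<open>A\<close> without such joins.  Their solutions of \<open>X B = J X\<close> tend to those for \<open>A\<close>, because shift
  equivalence preserves the dimension of the space of solutions (\<open>intertwiner_limit\<close>), and orthonormal rows for the
  nilpotent part have a convergent subsequence; hence some frames tend to a frame of \<open>A\<close>, and the straight
  line to that limit eventually stays positive (\<open>eventually_joined\<close>).  The limit depends on the sequence,
  so frames of one and the same matrix have to be joined as well.  They differ by a choice of a full flag
  invariant under a nilpotent matrix, and such flags form a connected space (\<open>adapted_connected\<close>).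
  Changing the frame inside \<open>B\<close> also makes it possible to take the last \<open>k\<close> rows of \<open>L\<close> over the ring of
  the entries of \<open>B\<close>.

  Along such a path \<open>T\<close> varies, and the conjugacy class may still jump.  The matrix is therefore
  bordered by new rows, whose entries are read off from the lower rows of \<open>L\<close>, in such a way that \<open>T\<close> is
  replaced by its leading principal block of one size less (\<open>staircase_step\<close>).  When \<open>T\<close> is used up the
  path consists of conjugates of one matrix of size \<open>n + k (k - 1) / 2\<close>.  A positive matrix is not
  nilpotent, so \<open>k \<le> n - 1\<close>, and this size is at most \<open>n\<^sup>2 / 2\<close> for \<open>n \<ge> 2\<close>
  (\<open>staircase_size\<close>).

  A border \<open>z\<close> is not positive, but adding a small multiple of it to a fraction of the first row
  turns the bordered matrix into an elementary row splitting of a positive matrix.  This is a conjugation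
  by a matrix that, by compactness of \<open>[0,1]\<close>, can be chosen independent of the parameter of the path, and
  with the required entries in the ring \<open>U\<close> (\<open>split_paths\<close>).  So \<open>B\<close> and \<open>C\<close> split, over \<open>U\<close>, to the end points
  of a path of positive conjugate matrices.

  If \<open>U\<close> is a field, then a path of positive matrices conjugate to a matrix over \<open>U\<close> can be followed by finitely
  many elementary strong shift equivalences over \<open>U\<close> (\<open>SSE_along_conjugation_path\<close>): neighbours
  \<open>P B P\<^sup>-\<^sup>1\<close> and \<open>X B X\<^sup>-\<^sup>1\<close> are linked by \<open>X P\<^sup>-\<^sup>1\<close> and \<open>P B X\<^sup>-\<^sup>1\<close>,
  both positive for a suitable \<open>X\<close> close to \<open>P\<close>.  A nondiscrete subring of \<open>\<real>\<close> is dense, which is what makes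
  all approximations over \<open>U\<close> possible.
\<close>

section \<open>Limits and paths of matrices, entry by entry\<close>

text \<open>
  The type of matrices carries no topology.  The carrier condition holds for every index, not only
  eventually, so that products and inverses of convergent families need no further side condition.
\<close>

definition mtends :: "nat \<Rightarrow> nat \<Rightarrow> ('a \<Rightarrow> real mat) \<Rightarrow> real mat \<Rightarrow> 'a filter \<Rightarrow> bool" where
  "mtends nr nc f M F \<longleftrightarrow> M \<in> carrier_mat nr nc \<and> (\<forall>x. f x \<in> carrier_mat nr nc) \<and>
     (\<forall>i<nr. \<forall>j<nc. ((\<lambda>x. f x $$ (i, j)) \<longlongrightarrow> M $$ (i, j)) F)"

lemma mtendsI:
  assumes "M \<in> carrier_mat nr nc" "\<And>x. f x \<in> carrier_mat nr nc"
    "\<And>i j. i < nr \<Longrightarrow> j < nc \<Longrightarrow> ((\<lambda>x. f x $$ (i, j)) \<longlongrightarrow> M $$ (i, j)) F"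
  shows "mtends nr nc f M F"
  using assms unfolding mtends_def by blast

lemma mtendsD:
  assumes "mtends nr nc f M F"
  shows "M \<in> carrier_mat nr nc" "f x \<in> carrier_mat nr nc"
    "i < nr \<Longrightarrow> j < nc \<Longrightarrow> ((\<lambda>x. f x $$ (i, j)) \<longlongrightarrow> M $$ (i, j)) F"
  using assms unfolding mtends_def by blast+

lemma mtends_const: "M \<in> carrier_mat nr nc \<Longrightarrow> mtends nr nc (\<lambda>x. M) M F"
  by (rule mtendsI) auto

lemma mtends_mult:
  assumes f: "mtends nr n f M F" and g: "mtends n nc g N F"
  shows "mtends nr nc (\<lambda>x. f x * g x) (M * N) F"
proof (rule mtendsI)
  fix i j assume ij: "i < nr" "j < nc"
  note c = mtendsD[OF f] mtendsD[OF g]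
  have e: "(A * B) $$ (i, j) = (\<Sum>k<n. A $$ (i, k) * B $$ (k, j))"
    if "A \<in> carrier_mat nr n" "B \<in> carrier_mat n nc" for A B :: "real mat"
    using that ij by (auto simp: scalar_prod_def atLeast0LessThan intro!: sum.cong)
  show "((\<lambda>x. (f x * g x) $$ (i, j)) \<longlongrightarrow> (M * N) $$ (i, j)) F"
    unfolding e[OF c(2) c(5)] e[OF c(1) c(4)]
    by (intro tendsto_sum tendsto_mult c(3) c(6)) (use ij in auto)
qed (blast intro: mult_carrier_mat mtendsD(1,2)[OF f] mtendsD(1,2)[OF g])+

lemma mtends_add:
  assumes f: "mtends nr nc f M F" and g: "mtends nr nc g N F"
  shows "mtends nr nc (\<lambda>x. f x + g x) (M + N) F"
proof (rule mtendsI)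
  fix i j assume ij: "i < nr" "j < nc"
  note c = mtendsD[OF f] mtendsD[OF g]
  have e: "(A + B) $$ (i, j) = A $$ (i, j) + B $$ (i, j)"
    if "A \<in> carrier_mat nr nc" "B \<in> carrier_mat nr nc" for A B :: "real mat"
    using that ij by auto
  show "((\<lambda>x. (f x + g x) $$ (i, j)) \<longlongrightarrow> (M + N) $$ (i, j)) F"
    unfolding e[OF c(2) c(5)] e[OF c(1) c(4)]
    by (intro tendsto_add c(3) c(6) ij)
qed (use mtendsD[OF f] mtendsD[OF g] in auto)

lemma mtends_smult:
  assumes f: "mtends nr nc f M F" and g: "(g \<longlongrightarrow> a) F"
  shows "mtends nr nc (\<lambda>x. g x \<cdot>\<^sub>m f x) (a \<cdot>\<^sub>m M) F"
proof (rule mtendsI)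
  fix i j assume ij: "i < nr" "j < nc"
  note c = mtendsD[OF f]
  have e: "(b \<cdot>\<^sub>m A) $$ (i, j) = b * A $$ (i, j)"
    if "A \<in> carrier_mat nr nc" for A :: "real mat" and b
    using that ij by auto
  show "((\<lambda>x. (g x \<cdot>\<^sub>m f x) $$ (i, j)) \<longlongrightarrow> (a \<cdot>\<^sub>m M) $$ (i, j)) F"
    unfolding e[OF c(2)] e[OF c(1)]
    by (intro tendsto_mult c(3) g ij)
qed (use mtendsD[OF f] in auto)

lemma mtends_four_block:
  assumes "mtends nr1 nc1 a A F" "mtends nr1 nc2 b B F" "mtends nr2 nc1 c C F" "mtends nr2 nc2 d D F"
  shows "mtends (nr1 + nr2) (nc1 + nc2) (\<lambda>x. four_block_mat (a x) (b x) (c x) (d x))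
     (four_block_mat A B C D) F"
proof (rule mtendsI)
  note ca = mtendsD[OF assms(1)]
  note cb = mtendsD[OF assms(2)]
  note cc = mtendsD[OF assms(3)]
  note cd = mtendsD[OF assms(4)]
  fix i j assume ij: "i < nr1 + nr2" "j < nc1 + nc2"
  have d: "dim_row (a x) = nr1" "dim_col (a x) = nc1" "dim_row A = nr1" "dim_col A = nc1"
     "dim_row (d x) = nr2" "dim_col (d x) = nc2" "dim_row D = nr2" "dim_col D = nc2" for x
    using ca(1,2) cd(1,2) by (metis carrier_matD)+
  show "((\<lambda>x. four_block_mat (a x) (b x) (c x) (d x) $$ (i, j)) \<longlongrightarrow> four_block_mat A B C D $$ (i, j)) F"
  proof (cases "i < nr1"; cases "j < nc1")
    assume "i < nr1" "j < nc1"
    then show ?thesis using ca(3)[of i j] ij by (simp add: d)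
  next
    assume "i < nr1" "\<not> j < nc1"
    then show ?thesis using cb(3)[of i "j - nc1"] ij by (simp add: d)
  next
    assume "\<not> i < nr1" "j < nc1"
    then show ?thesis using cc(3)[of "i - nr1" j] ij by (simp add: d)
  next
    assume "\<not> i < nr1" "\<not> j < nc1"
    then show ?thesis using cd(3)[of "i - nr1" "j - nc1"] ij by (simp add: d)
  qed
qed (use mtendsD[OF assms(1)] mtendsD[OF assms(4)] in auto)

lemma tendsto_det:
  assumes f: "mtends n n f M F"
  shows "((\<lambda>x. det (f x)) \<longlongrightarrow> det M) F"
proof -
  note c = mtendsD[OF f]
  show ?thesis
    unfolding det_def'[OF c(1)] det_def'[OF c(2)]
    by (intro tendsto_sum tendsto_mult tendsto_prod tendsto_const c(3))
       (auto simp: permutes_in_image)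
qed

lemma mtends_mat_delete:
  assumes f: "mtends n n f M F" and "i < n" "j < n"
  shows "mtends (n - 1) (n - 1) (\<lambda>x. mat_delete (f x) i j) (mat_delete M i j) F"
proof (rule mtendsI)
  note c = mtendsD[OF f]
  have d: "dim_row (f x) = n" "dim_col (f x) = n" "dim_row M = n" "dim_col M = n" for x
    using c(1,2) by (metis carrier_matD)+
  fix a b assume ab: "a < n - 1" "b < n - 1"
  show "((\<lambda>x. mat_delete (f x) i j $$ (a, b)) \<longlongrightarrow> mat_delete M i j $$ (a, b)) F"
    using ab by (auto simp: mat_delete_def d intro!: c(3))
qed (simp_all only: mat_delete_carrier[OF mtendsD(1)[OF f]] mat_delete_carrier[OF mtendsD(2)[OF f]])

lemma mtends_adj:
  assumes f: "mtends n n f M F"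
  shows "mtends n n (\<lambda>x. adj_mat (f x)) (adj_mat M) F"
proof (rule mtendsI)
  note c = mtendsD[OF f]
  have d: "dim_row (f x) = n" "dim_col (f x) = n" "dim_row M = n" "dim_col M = n" for x
    using c(1,2) by (metis carrier_matD)+
  fix i j assume ij: "i < n" "j < n"
  show "((\<lambda>x. adj_mat (f x) $$ (i, j)) \<longlongrightarrow> adj_mat M $$ (i, j)) F"
    using ij by (auto simp: adj_mat_def d cofactor_def
        intro!: tendsto_mult tendsto_det mtends_mat_delete[OF f])
qed (blast intro: adj_mat(1) mtendsD(1,2)[OF f])+

text \<open>
  The adjugate formula shows both that the inverse depends continuously on the matrix and that its
  entries stay in a field containing the entries of the matrix.  For a singular matrix the value is zero.
\<close>

definition minv :: "real mat \<Rightarrow> real mat" where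
  "minv A = inverse (det A) \<cdot>\<^sub>m adj_mat A"

lemma minv:
  assumes "A \<in> carrier_mat n n"
  shows minv_carrier: "minv A \<in> carrier_mat n n"
    and minv_right: "det A \<noteq> 0 \<Longrightarrow> A * minv A = 1\<^sub>m n"
    and minv_left: "det A \<noteq> 0 \<Longrightarrow> minv A * A = 1\<^sub>m n"
  using adj_mat[OF assms] assms unfolding minv_def
  by (auto simp: mult_smult_distrib[of _ n n _ n] mult_smult_assoc_mat[of _ n n _ n])

lemma mtends_minv:
  assumes f: "mtends n n f M F" and "det M \<noteq> 0"
  shows "mtends n n (\<lambda>x. minv (f x)) (minv M) F"
  unfolding minv_def by (intro mtends_smult mtends_adj f tendsto_inverse tendsto_det[OF f] assms(2))

lemma mtends_eventually_det:
  assumes "mtends n n f M F" "det M \<noteq> 0"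
  shows "eventually (\<lambda>x. det (f x) \<noteq> 0) F"
  by (rule tendsto_imp_eventually_ne[OF tendsto_det[OF assms(1)] assms(2)])

lemma positive_mat_iff:
  "A \<in> carrier_mat nr nc \<Longrightarrow> positive_mat A \<longleftrightarrow> (\<forall>i<nr. \<forall>j<nc. A $$ (i, j) > 0)"
  unfolding positive_mat_def by (auto 4 4)

lemma mtends_eventually_positive:
  assumes f: "mtends nr nc f M F" and "positive_mat M"
  shows "eventually (\<lambda>x. positive_mat (f x)) F"
proof -
  note c = mtendsD[OF f]
  have "eventually (\<lambda>x. \<forall>i\<in>{..<nr}. \<forall>j\<in>{..<nc}. f x $$ (i, j) > 0) F"
  proof (intro eventually_ball_finite finite_lessThan ballI)
    fix i j assume "i \<in> {..<nr}" "j \<in> {..<nc}"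
    then show "eventually (\<lambda>x. f x $$ (i, j) > 0) F"
      using order_tendstoD(1)[OF c(3)] assms(2) unfolding positive_mat_iff[OF c(1)] by auto
  qed
  then show ?thesis unfolding positive_mat_iff[OF c(2)] by (auto elim: eventually_mono)
qed

lemma mtends_compose:
  assumes "mtends nr nc f M F" "filterlim g F G"
  shows "mtends nr nc (\<lambda>x. f (g x)) M G"
  using assms unfolding mtends_def by (auto intro: filterlim_compose[where g = "\<lambda>x. f x $$ (i, j)" for i j])

lemma mtends_unique:
  assumes "mtends nr nc f M F" "mtends nr nc f N F" "F \<noteq> bot"
  shows "M = N"
proof (rule eq_matI)
  note c = mtendsD[OF assms(1)] mtendsD[OF assms(2)]
  show "M $$ (i, j) = N $$ (i, j)" if "i < dim_row N" "j < dim_col N" for i j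
    by (rule tendsto_unique[OF assms(3) c(3) c(6)]) (use that c(4) in auto)
qed (use mtendsD[OF assms(1)] mtendsD[OF assms(2)] in auto)

text \<open>
  As for limits, the carrier condition is imposed at all real parameters.
\<close>

definition mpath :: "nat \<Rightarrow> nat \<Rightarrow> (real \<Rightarrow> real mat) \<Rightarrow> bool" where
  "mpath nr nc f \<longleftrightarrow> (\<forall>x. f x \<in> carrier_mat nr nc) \<and>
     (\<forall>i<nr. \<forall>j<nc. continuous_on {0..1} (\<lambda>t. f t $$ (i, j)))"

lemma mpath_iff: "mpath nr nc f \<longleftrightarrow> (\<forall>x. f x \<in> carrier_mat nr nc) \<and>
    (\<forall>t\<in>{0..1}. mtends nr nc f (f t) (at t within {0..1}))"
  unfolding mpath_def mtends_def continuous_on_def by blast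

lemma mpath_const: "M \<in> carrier_mat nr nc \<Longrightarrow> mpath nr nc (\<lambda>t. M)"
  unfolding mpath_def by auto

lemma mpath_carrier: "mpath nr nc f \<Longrightarrow> f t \<in> carrier_mat nr nc"
  unfolding mpath_def by auto

lemma mpath_mult: "mpath nr n f \<Longrightarrow> mpath n nc g \<Longrightarrow> mpath nr nc (\<lambda>t. f t * g t)"
  unfolding mpath_iff by (auto intro: mtends_mult mult_carrier_mat)

lemma mpath_add: "mpath nr nc f \<Longrightarrow> mpath nr nc g \<Longrightarrow> mpath nr nc (\<lambda>t. f t + g t)"
  unfolding mpath_iff by (auto intro: mtends_add)

lemma mpath_smult: "mpath nr nc f \<Longrightarrow> continuous_on {0..1} g \<Longrightarrow> mpath nr nc (\<lambda>t. g t \<cdot>\<^sub>m f t)"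
  unfolding mpath_iff continuous_on_def by (auto intro: mtends_smult)

lemma mpath_four_block:
  "mpath nr1 nc1 a \<Longrightarrow> mpath nr1 nc2 b \<Longrightarrow> mpath nr2 nc1 c \<Longrightarrow> mpath nr2 nc2 d \<Longrightarrow>
   mpath (nr1 + nr2) (nc1 + nc2) (\<lambda>t. four_block_mat (a t) (b t) (c t) (d t))"
  unfolding mpath_iff by (auto intro: mtends_four_block)

lemma mpath_minv:
  assumes "mpath n n f" "\<And>t. t \<in> {0..1} \<Longrightarrow> det (f t) \<noteq> 0"
  shows "mpath n n (\<lambda>t. minv (f t))"
  using assms unfolding mpath_iff by (auto intro: mtends_minv minv_carrier)

section \<open>Linear equations over subrings of the reals\<close>

definition real_subring :: "real set \<Rightarrow> bool" where
  "real_subring U \<longleftrightarrow> 1 \<in> U \<and> (\<forall>x\<in>U. \<forall>y\<in>U. x - y \<in> U \<and> x * y \<in> U)"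

lemma real_subringD:
  assumes "real_subring U"
  shows "1 \<in> U" "0 \<in> U" "x \<in> U \<Longrightarrow> y \<in> U \<Longrightarrow> x - y \<in> U" "x \<in> U \<Longrightarrow> y \<in> U \<Longrightarrow> x * y \<in> U"
    "x \<in> U \<Longrightarrow> - x \<in> U" "x \<in> U \<Longrightarrow> y \<in> U \<Longrightarrow> x + y \<in> U"
proof -
  show 1: "1 \<in> U" and d: "x \<in> U \<Longrightarrow> y \<in> U \<Longrightarrow> x - y \<in> U" and "x \<in> U \<Longrightarrow> y \<in> U \<Longrightarrow> x * y \<in> U" for x y
    using assms unfolding real_subring_def by auto
  show 0: "0 \<in> U" using d[OF 1 1] by simp
  show m: "x \<in> U \<Longrightarrow> - x \<in> U" for x using d[OF 0] by simp
  show "x \<in> U \<Longrightarrow> y \<in> U \<Longrightarrow> x + y \<in> U" using d[OF _ m, of x y] by simp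
qed

lemma real_subring_sum:
  assumes "real_subring U" "\<And>i. i \<in> I \<Longrightarrow> f i \<in> U"
  shows "sum f I \<in> U"
  using assms(2) by (induction I rule: infinite_finite_induct) (auto intro: real_subringD[OF assms(1)])

lemma real_subring_prod:
  assumes "real_subring U" "\<And>i. i \<in> I \<Longrightarrow> f i \<in> U"
  shows "prod f I \<in> U"
  using assms(2) by (induction I rule: infinite_finite_induct) (auto intro: real_subringD[OF assms(1)])

definition dense_ring :: "real set \<Rightarrow> bool" where
  "dense_ring U \<longleftrightarrow> real_subring U \<and> (\<forall>a b. a < b \<longrightarrow> (\<exists>u\<in>U. a < u \<and> u < b))"

lemma dense_ringD:
  assumes "dense_ring U" shows "real_subring U" "a < b \<Longrightarrow> \<exists>u\<in>U. a < u \<and> u < b"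
  using assms unfolding dense_ring_def by auto

lemma dense_ring_UNIV: "dense_ring UNIV"
  unfolding dense_ring_def real_subring_def using dense by auto

definition indep_over :: "real set \<Rightarrow> real set \<Rightarrow> bool" where
  "indep_over U S \<longleftrightarrow> (\<forall>c. (\<forall>x\<in>S. c x \<in> U) \<longrightarrow> (\<Sum>x\<in>S. c x * x) = 0 \<longrightarrow> (\<forall>x\<in>S. c x = 0))"

lemma indep_overD:
  "indep_over U S \<Longrightarrow> \<forall>x\<in>S. c x \<in> U \<Longrightarrow> (\<Sum>x\<in>S. c x * x) = 0 \<Longrightarrow> \<forall>x\<in>S. c x = 0"
  unfolding indep_over_def by blast

definition span_over :: "real set \<Rightarrow> real set \<Rightarrow> real set" where
  "span_over U S = {v. \<exists>c. (\<forall>x\<in>S. c x \<in> U) \<and> v = (\<Sum>x\<in>S. c x * x)}"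

text \<open>
  Over a field the entries of a real solution of a linear system are spanned by a basis chosen among
  them.  Over a subring a relation cannot be divided by its leading coefficient, so the coefficients of
  all relations are collected in one common denominator \<open>d\<close>.
\<close>

lemma subring_basis:
  assumes U: "real_subring U" and "finite V"
  shows "\<exists>S d. finite S \<and> d \<in> U \<and> d \<noteq> 0 \<and> indep_over U S \<and> (\<forall>v\<in>V. d * v \<in> span_over U S)"
  using \<open>finite V\<close>
proof (induction V rule: finite_induct)
  case empty
  show ?case by (rule exI[of _ "{}"], rule exI[of _ 1]) (auto simp: indep_over_def intro: real_subringD(1)[OF U])
next
  case (insert v V)
  note Us = real_subringD[OF U]
  from insert.IH obtain S d where S: "finite S" "d \<in> U" "d \<noteq> 0"
    and ind: "indep_over U S" and sp: "\<And>w. w \<in> V \<Longrightarrow> d * w \<in> span_over U S"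
    by blast
  consider "v \<in> S" | "v \<notin> S" "indep_over U (insert v S)"
    | c where "v \<notin> S" "\<forall>x\<in>insert v S. c x \<in> U" "(\<Sum>x\<in>insert v S. c x * x) = 0" "\<not> (\<forall>x\<in>insert v S. c x = 0)"
    unfolding indep_over_def[of U "insert v S"] by blast
  then show ?case
  proof cases
    case 1
    have "(\<Sum>x\<in>S. (if x = v then d else 0) * x) = (\<Sum>x\<in>S. if x = v then d * x else 0)"
      by (intro sum.cong) auto
    then have "d * v \<in> span_over U S"
      using 1 S Us(2) unfolding span_over_def
      by (intro CollectI exI[of _ "\<lambda>x. if x = v then d else 0"]) auto
    then show ?thesis using S ind sp by (intro exI[of _ S] exI[of _ d]) blast
  next
    case 2
    have "d * w \<in> span_over U (insert v S)" if w: "w \<in> insert v V" for w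
    proof (cases "w = v")
      case True
      then show ?thesis
        using 2(1) S Us(2) unfolding span_over_def
        by (intro CollectI exI[of _ "\<lambda>x. if x = v then d else 0"]) (auto intro!: sum.neutral)
    next
      case False
      with w sp obtain c where "\<forall>x\<in>S. c x \<in> U" "d * w = (\<Sum>x\<in>S. c x * x)"
        unfolding span_over_def by blast
      moreover have "(\<Sum>x\<in>S. (c(v := 0)) x * x) = (\<Sum>x\<in>S. c x * x)"
        using 2(1) by (intro sum.cong) auto
      ultimately show ?thesis
        using 2(1) S Us(2) unfolding span_over_def by (intro CollectI exI[of _ "c(v := 0)"]) auto
    qed
    then show ?thesis using S 2(2) by (intro exI[of _ "insert v S"] exI[of _ d]) blast
  next
    case 3
    have eq: "c v * v = - (\<Sum>x\<in>S. c x * x)" using 3(1,3) S by simp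
    have nz: "c v \<noteq> 0"
    proof
      assume "c v = 0"
      with eq have "(\<Sum>x\<in>S. c x * x) = 0" by simp
      from indep_overD[OF ind _ this] 3(2,4) \<open>c v = 0\<close> show False by simp
    qed
    have "(d * c v) * w \<in> span_over U S" if w: "w \<in> insert v V" for w
    proof (cases "w = v")
      case True
      have "(d * c v) * v = d * (c v * v)" by simp
      also have "\<dots> = (\<Sum>x\<in>S. (- (d * c x)) * x)"
        unfolding eq by (simp add: sum_distrib_left sum_negf mult.assoc)
      finally show ?thesis
        unfolding True span_over_def using 3(2) S Us(4,5) by (intro CollectI exI[of _ "\<lambda>x. - (d * c x)"]) auto
    next
      case False
      with w sp obtain e where e: "\<forall>x\<in>S. e x \<in> U" "d * w = (\<Sum>x\<in>S. e x * x)"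
        unfolding span_over_def by blast
      have "(d * c v) * w = c v * (d * w)" by simp
      also have "\<dots> = (\<Sum>x\<in>S. (c v * e x) * x)"
        unfolding e(2) by (simp add: sum_distrib_left mult.assoc)
      finally show ?thesis
        using 3(2) e(1) S Us(4) unfolding span_over_def by (intro CollectI exI[of _ "\<lambda>x. c v * e x"]) auto
    qed
    moreover have "d * c v \<in> U" "d * c v \<noteq> 0" using nz S 3(2) Us(4) by auto
    ultimately show ?thesis using S ind by (intro exI[of _ S] exI[of _ "d * c v"]) blast
  qed
qed

text \<open>
  Expanding the solution \<open>v\<close> in an independent set of reals, each coefficient vector is again a
  solution, by independence over \<open>U\<close>, and has its entries in \<open>U\<close>.
\<close>

lemma subring_solutions_span:
  fixes a :: "'e \<Rightarrow> 'i \<Rightarrow> real"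
  assumes U: "real_subring U" and I: "finite I"
    and a: "\<And>e i. e \<in> E \<Longrightarrow> i \<in> I \<Longrightarrow> a e i \<in> U"
    and v: "\<And>e. e \<in> E \<Longrightarrow> (\<Sum>i\<in>I. a e i * v i) = 0"
  shows "\<exists>(S :: real set) w b. finite S \<and> (\<forall>x\<in>S. \<forall>i\<in>I. w x i \<in> U) \<and>
    (\<forall>x\<in>S. \<forall>e\<in>E. (\<Sum>i\<in>I. a e i * w x i) = 0) \<and> (\<forall>i\<in>I. v i = (\<Sum>x\<in>S. b x * w x i))"
proof -
  note Us = real_subringD[OF U] real_subring_sum[OF U]
  obtain S d where S: "finite S" "d \<in> U" "d \<noteq> 0"
    and ind: "indep_over U S" and sp: "\<And>y. y \<in> v ` I \<Longrightarrow> d * y \<in> span_over U S"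
    using subring_basis[OF U finite_imageI[OF I, of v]] by blast
  from sp have "\<forall>i\<in>I. \<exists>c. (\<forall>x\<in>S. c x \<in> U) \<and> d * v i = (\<Sum>x\<in>S. c x * x)"
    unfolding span_over_def by blast
  from bchoice[OF this] obtain c where c: "\<And>i x. i \<in> I \<Longrightarrow> x \<in> S \<Longrightarrow> c i x \<in> U"
    "\<And>i. i \<in> I \<Longrightarrow> d * v i = (\<Sum>x\<in>S. c i x * x)" by metis
  show ?thesis
  proof (intro exI[of _ S] exI[of _ "\<lambda>x i. c i x"] exI[of _ "\<lambda>x. x / d"] conjI ballI)
    fix x e assume x: "x \<in> S" and e: "e \<in> E"
    have "(\<Sum>x\<in>S. (\<Sum>i\<in>I. a e i * c i x) * x) = (\<Sum>i\<in>I. a e i * (\<Sum>x\<in>S. c i x * x))"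
      unfolding sum_distrib_left sum_distrib_right by (subst sum.swap) (simp add: mult.assoc)
    also have "\<dots> = (\<Sum>i\<in>I. d * (a e i * v i))"
      by (intro sum.cong) (simp_all add: c(2)[symmetric])
    also have "\<dots> = 0" using v[OF e] by (simp add: sum_distrib_left[symmetric])
    finally have "\<forall>x\<in>S. (\<Sum>i\<in>I. a e i * c i x) = 0"
      by (intro indep_overD[OF ind]) (auto intro!: Us(7) Us(4) a[OF e] c(1))
    then show "(\<Sum>i\<in>I. a e i * c i x) = 0" using x by blast
  next
    fix i assume "i \<in> I"
    from c(2)[OF this] have "v i = (\<Sum>x\<in>S. c i x * x) / d" using S(3) by (simp add: field_simps)
    also have "\<dots> = (\<Sum>x\<in>S. x / d * c i x)"
      unfolding sum_divide_distrib by (intro sum.cong) auto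
    finally show "v i = (\<Sum>x\<in>S. x / d * c i x)" .
  qed (use S c in auto)
qed

text \<open>
  The real coefficients of \<open>v\<close> in the spanning solutions over \<open>U\<close> are replaced by close elements
  of \<open>U\<close>; this moves each entry by a controlled amount and keeps the equations exact.
\<close>

lemma subring_solution_approx:
  fixes a :: "'e \<Rightarrow> 'i \<Rightarrow> real"
  assumes U: "dense_ring U" and I: "finite I"
    and a: "\<And>e i. e \<in> E \<Longrightarrow> i \<in> I \<Longrightarrow> a e i \<in> U"
    and v: "\<And>e. e \<in> E \<Longrightarrow> (\<Sum>i\<in>I. a e i * v i) = 0"
    and "\<eta> > 0"
  obtains u where "\<And>i. i \<in> I \<Longrightarrow> u i \<in> U" "\<And>e. e \<in> E \<Longrightarrow> (\<Sum>i\<in>I. a e i * u i) = 0"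
    "\<And>i. i \<in> I \<Longrightarrow> \<bar>u i - v i\<bar> < \<eta>"
proof -
  note R = dense_ringD(1)[OF U]
  note Us = real_subringD[OF R] real_subring_sum[OF R]
  have "\<exists>(S :: real set) w b. finite S \<and> (\<forall>x\<in>S. \<forall>i\<in>I. w x i \<in> U) \<and>
    (\<forall>x\<in>S. \<forall>e\<in>E. (\<Sum>i\<in>I. a e i * w x i) = 0) \<and> (\<forall>i\<in>I. v i = (\<Sum>x\<in>S. b x * w x i))"
    by (rule subring_solutions_span[OF R I]) (use a v in auto)
  then obtain S :: "real set" and w b where S0: "finite S" "\<forall>x\<in>S. \<forall>i\<in>I. w x i \<in> U"
    "\<forall>x\<in>S. \<forall>e\<in>E. (\<Sum>i\<in>I. a e i * w x i) = 0" "\<forall>i\<in>I. v i = (\<Sum>x\<in>S. b x * w x i)"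
    by (elim exE conjE)
  note S = S0(1) S0(2)[rule_format] S0(3)[rule_format] S0(4)[rule_format]
  define W where "W = (\<Sum>i\<in>I. \<Sum>x\<in>S. \<bar>w x i\<bar>) + 1"
  have W0: "W > 0" unfolding W_def by (intro add_nonneg_pos sum_nonneg) auto
  have "\<eta> / W > 0" using \<open>\<eta> > 0\<close> W0 by simp
  have "\<exists>q. q \<in> U \<and> \<bar>q - b x\<bar> < \<eta> / W" for x
  proof -
    obtain u where "u \<in> U" "b x - \<eta> / W < u" "u < b x + \<eta> / W"
      using dense_ringD(2)[OF U, of "b x - \<eta> / W" "b x + \<eta> / W"] \<open>\<eta> / W > 0\<close> by auto
    then show ?thesis by (intro exI[of _ u]) (simp add: abs_less_iff)
  qed
  then obtain q where q: "\<And>x. q x \<in> U" "\<And>x. \<bar>q x - b x\<bar> < \<eta> / W" by metis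
  show thesis
  proof (rule that[of "\<lambda>i. \<Sum>x\<in>S. q x * w x i"])
    fix e assume e: "e \<in> E"
    have "(\<Sum>i\<in>I. a e i * (\<Sum>x\<in>S. q x * w x i)) = (\<Sum>x\<in>S. q x * (\<Sum>i\<in>I. a e i * w x i))"
      unfolding sum_distrib_left by (subst sum.swap) (simp add: algebra_simps)
    then show "(\<Sum>i\<in>I. a e i * (\<Sum>x\<in>S. q x * w x i)) = 0" using S(3)[OF _ e] by simp
  next
    fix i assume i: "i \<in> I"
    have "\<bar>(\<Sum>x\<in>S. q x * w x i) - v i\<bar> = \<bar>\<Sum>x\<in>S. (q x - b x) * w x i\<bar>"
      unfolding S(4)[OF i] by (simp add: sum_subtractf algebra_simps)
    also have "\<dots> \<le> (\<Sum>x\<in>S. \<bar>q x - b x\<bar> * \<bar>w x i\<bar>)"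
      by (rule order_trans[OF sum_abs]) (simp add: abs_mult)
    also have "\<dots> \<le> (\<Sum>x\<in>S. \<eta> / W * \<bar>w x i\<bar>)"
      using q(2) by (intro sum_mono mult_right_mono) (auto intro: less_imp_le)
    also have "\<dots> = \<eta> / W * (\<Sum>x\<in>S. \<bar>w x i\<bar>)" by (simp add: sum_distrib_left)
    also have "\<dots> \<le> \<eta> / W * (\<Sum>i\<in>I. \<Sum>x\<in>S. \<bar>w x i\<bar>)"
      using \<open>\<eta> > 0\<close> W0 i I by (intro mult_left_mono member_le_sum[where f = "\<lambda>i. \<Sum>x\<in>S. \<bar>w x i\<bar>"] sum_nonneg) auto
    also have "\<dots> < \<eta> / W * W"
      using \<open>\<eta> > 0\<close> W0 by (intro mult_strict_left_mono) (auto simp: W_def)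
    also have "\<dots> = \<eta>" using W0 by simp
    finally show "\<bar>(\<Sum>x\<in>S. q x * w x i) - v i\<bar> < \<eta>" .
  qed (use S q in \<open>auto intro!: Us(7) Us(4)\<close>)
qed

lemma elements_mat_subset_iff:
  "A \<in> carrier_mat nr nc \<Longrightarrow> elements_mat A \<subseteq> U \<longleftrightarrow> (\<forall>i<nr. \<forall>j<nc. A $$ (i, j) \<in> U)"
  by (auto 4 4)

lemma elements_mat_mult:
  assumes U: "real_subring U" and A: "A \<in> carrier_mat nr n" "elements_mat A \<subseteq> U"
    and B: "B \<in> carrier_mat n nc" "elements_mat B \<subseteq> U"
  shows "elements_mat (A * B) \<subseteq> U"
proof -
  have "(A * B) $$ (i, j) \<in> U" if "i < nr" "j < nc" for i j
    using A B that unfolding elements_mat_subset_iff[OF A(1)] elements_mat_subset_iff[OF B(1)]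
    by (auto simp: scalar_prod_def intro!: real_subring_sum[OF U] real_subringD[OF U])
  then show ?thesis unfolding elements_mat_subset_iff[OF mult_carrier_mat[OF A(1) B(1)]] by blast
qed

lemma det_in_subring:
  assumes U: "real_subring U" and A: "A \<in> carrier_mat n n" "elements_mat A \<subseteq> U"
  shows "det A \<in> U"
  unfolding det_def'[OF A(1)] using A(2) unfolding elements_mat_subset_iff[OF A(1)]
  by (intro real_subring_sum[OF U] real_subringD(4)[OF U] real_subring_prod[OF U])
     (auto simp: sign_def permutes_in_image intro: real_subringD[OF U])

lemma elements_adj_mat:
  assumes U: "real_subring U" and A: "A \<in> carrier_mat n n" "elements_mat A \<subseteq> U"
  shows "elements_mat (adj_mat A) \<subseteq> U"
proof -
  have "cofactor A j i \<in> U" if "i < n" "j < n" for i j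
  proof -
    have "elements_mat (mat_delete A j i) \<subseteq> U"
      using A that unfolding elements_mat_subset_iff[OF A(1)]
        elements_mat_subset_iff[OF mat_delete_carrier[OF A(1)]]
      by (auto simp: mat_delete_def)
    moreover have "(- 1) ^ p \<in> U" for p :: nat
      by (induction p) (auto intro: real_subringD[OF U])
    ultimately show ?thesis unfolding cofactor_def
      by (intro real_subringD(4)[OF U] det_in_subring[OF U mat_delete_carrier[OF A(1)]])
  qed
  then show ?thesis unfolding elements_mat_subset_iff[OF adj_mat(1)[OF A(1)]]
    using A by (auto simp: adj_mat_def)
qed

lemma elements_minv:
  assumes U: "real_subring U" and F: "\<And>x. x \<in> U \<Longrightarrow> inverse x \<in> U"
    and A: "A \<in> carrier_mat n n" "elements_mat A \<subseteq> U"
  shows "elements_mat (minv A) \<subseteq> U"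
  using elements_adj_mat[OF U A] F[OF det_in_subring[OF U A]]
  unfolding elements_mat_subset_iff[OF adj_mat(1)[OF A(1)]] elements_mat_subset_iff[OF minv_carrier[OF A(1)]]
  using adj_mat(1)[OF A(1)] real_subringD(4)[OF U]
  by (auto simp: minv_def)

definition mclose :: "nat \<Rightarrow> nat \<Rightarrow> real \<Rightarrow> real mat \<Rightarrow> real mat \<Rightarrow> bool" where
  "mclose nr nc \<eta> P G \<longleftrightarrow> P \<in> carrier_mat nr nc \<and> (\<forall>i<nr. \<forall>j<nc. \<bar>P $$ (i, j) - G $$ (i, j)\<bar> < \<eta>)"

text \<open>
  Turns a statement about all convergent sequences into one about a neighbourhood, so that openness of
  the conditions below follows from the limit theorems above.
\<close>

lemma near_by_sequences:
  assumes G: "G \<in> carrier_mat nr nc"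
    and "\<And>f. mtends nr nc f G sequentially \<Longrightarrow> eventually (\<lambda>N. Q (f N)) sequentially"
  shows "\<exists>\<eta>>0. \<forall>P. mclose nr nc \<eta> P G \<longrightarrow> Q P"
proof (rule ccontr)
  assume "\<not> ?thesis"
  then have "\<exists>P. mclose nr nc (inverse (real (Suc N))) P G \<and> \<not> Q P" for N
    by (metis inverse_positive_iff_positive of_nat_0_less_iff zero_less_Suc)
  then obtain f where f: "\<And>N. mclose nr nc (inverse (real (Suc N))) (f N) G" "\<And>N. \<not> Q (f N)" by metis
  have "mtends nr nc f G sequentially"
  proof (rule mtendsI)
    fix i j assume ij: "i < nr" "j < nc"
    show "(\<lambda>N. f N $$ (i, j)) \<longlonglongrightarrow> G $$ (i, j)"
    proof (rule LIM_zero_cancel, rule Lim_null_comparison[OF _ LIMSEQ_inverse_real_of_nat])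
      show "\<forall>\<^sub>F N in sequentially. norm (f N $$ (i, j) - G $$ (i, j)) \<le> inverse (real (Suc N))"
        using f(1) ij unfolding mclose_def by (intro always_eventually) (auto intro: less_imp_le)
    qed
  qed (use G f in \<open>auto simp: mclose_def\<close>)
  from eventually_happens'[OF _ assms(2)[OF this]] f(2) show False by auto
qed

lemma subring_approx_mat:
  assumes U: "dense_ring U" and "G \<in> carrier_mat nr nc" "\<eta> > 0"
  obtains P where "mclose nr nc \<eta> P G" "elements_mat P \<subseteq> U"
proof -
  have "\<exists>q. q \<in> U \<and> \<bar>q - G $$ p\<bar> < \<eta>" for p
  proof -
    obtain u where "u \<in> U" "G $$ p - \<eta> < u" "u < G $$ p + \<eta>"
      using dense_ringD(2)[OF U, of "G $$ p - \<eta>" "G $$ p + \<eta>"] \<open>\<eta> > 0\<close> by auto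
    then show ?thesis by (intro exI[of _ u]) auto
  qed
  then obtain q where q: "\<And>p. q p \<in> U" "\<And>p. \<bar>q p - G $$ p\<bar> < \<eta>" by metis
  show thesis by (rule that[of "mat nr nc q"]) (use q in \<open>auto simp: mclose_def\<close>)
qed

section \<open>Strong shift equivalence along a path of conjugate matrices\<close>

text \<open>
  The inner dimensions in these rules do not occur in their conclusions, so rewriting cannot determine them;
  the rules are applied with explicit dimensions instead.
\<close>

declare assoc_mult_mat [simp del] mult_carrier_mat [simp del]

lemma ESSE_sym: "ESSE T A B \<Longrightarrow> ESSE T B A"
  unfolding ESSE_def by blast

lemma minv_unique:
  assumes "A \<in> carrier_mat n n" "B \<in> carrier_mat n n" "A * B = 1\<^sub>m n"
  shows "det A \<noteq> 0" "minv A = B"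
proof -
  have "det A * det B = 1" using det_mult[OF assms(1,2)] assms(3) by simp
  then show d: "det A \<noteq> 0" by auto
  have "minv A = minv A * (A * B)" using minv_carrier[OF assms(1)] assms(3) by simp
  also have "\<dots> = (minv A * A) * B"
    using assms minv_carrier[OF assms(1)] by (simp add: assoc_mult_mat[of _ n n _ n _ n] mult_carrier_mat[of _ n n _ n])
  also have "\<dots> = B" using minv_left[OF assms(1) d] assms(2) by simp
  finally show "minv A = B" .
qed

definition conj_by :: "real mat \<Rightarrow> real mat \<Rightarrow> real mat" where
  "conj_by P B = P * B * minv P"

lemma conj_by_carrier: "P \<in> carrier_mat m m \<Longrightarrow> B \<in> carrier_mat m m \<Longrightarrow> conj_by P B \<in> carrier_mat m m"
  unfolding conj_by_def by (metis minv_carrier mult_carrier_mat)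

lemma conj_by_one: "B \<in> carrier_mat m m \<Longrightarrow> conj_by (1\<^sub>m m) B = B"
  unfolding conj_by_def using minv_unique(2)[of "1\<^sub>m m" m "1\<^sub>m m"] by simp

lemma conj_by_eq:
  assumes "P \<in> carrier_mat m m" "B \<in> carrier_mat m m" "C \<in> carrier_mat m m" "det P \<noteq> 0" "P * B = C * P"
  shows "conj_by P B = C"
  unfolding conj_by_def assms(5) using assms minv_carrier[OF assms(1)] minv_right[OF assms(1)]
  by (simp add: assoc_mult_mat[of _ m m _ m _ m] mult_carrier_mat[of _ m m _ m])

lemma conj_by_intertwines:
  assumes "P \<in> carrier_mat m m" "B \<in> carrier_mat m m" "det P \<noteq> 0"
  shows "P * B = conj_by P B * P"
  unfolding conj_by_def using assms minv_carrier[OF assms(1)] minv_left[OF assms(1)]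
  by (simp add: assoc_mult_mat[of _ m m _ m _ m] mult_carrier_mat[of _ m m _ m])

text \<open>
  The factors are \<open>P B P\<^sup>-\<^sup>1 = (P B X\<^sup>-\<^sup>1) (X P\<^sup>-\<^sup>1)\<close> and, in the opposite order,
  \<open>X B X\<^sup>-\<^sup>1 = (X P\<^sup>-\<^sup>1) (P B X\<^sup>-\<^sup>1)\<close>.
\<close>

lemma ESSE_conj_by:
  assumes c: "P \<in> carrier_mat m m" "X \<in> carrier_mat m m" "B \<in> carrier_mat m m"
    and d: "det P \<noteq> 0" "det X \<noteq> 0"
    and e: "elements_mat (X * minv P) \<subseteq> T" "elements_mat (P * B * minv X) \<subseteq> T"
  shows "ESSE T (conj_by P B) (conj_by X B)"
proof -
  note ci = minv_carrier[OF c(1)] minv_carrier[OF c(2)]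
  note mc = mult_carrier_mat[of _ m m _ m]
  note as = assoc_mult_mat[of _ m m _ m _ m]
  have "(X * minv P) * (P * B * minv X) = X * ((minv P * P) * (B * minv X))"
    using c ci by (simp add: as mc)
  also have "\<dots> = conj_by X B"
    using c ci minv_left[OF c(1) d(1)] by (simp add: as mc conj_by_def)
  finally have 1: "conj_by X B = (X * minv P) * (P * B * minv X)" ..
  have "(P * B * minv X) * (X * minv P) = P * (B * ((minv X * X) * minv P))"
    using c ci by (simp add: as mc)
  also have "\<dots> = conj_by P B"
    using c ci minv_left[OF c(2) d(2)] by (simp add: as mc conj_by_def)
  finally have 2: "conj_by P B = (P * B * minv X) * (X * minv P)" ..
  have cc: "conj_by P B \<in> carrier_mat m m" "conj_by X B \<in> carrier_mat m m"
    using c conj_by_carrier by auto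
  have "P * B * minv X \<in> carrier_mat (dim_row (conj_by P B)) (dim_row (conj_by X B))"
    "X * minv P \<in> carrier_mat (dim_row (conj_by X B)) (dim_row (conj_by P B))"
    using cc c ci by (auto simp: mc)
  moreover have "square_mat (conj_by P B)" "square_mat (conj_by X B)" using cc by auto
  ultimately show ?thesis unfolding ESSE_def using 1 2 e by blast
qed

text \<open>
  A symmetric form of one step in the definition of strong shift equivalence, in which chains can be
  reversed.
\<close>

definition positive_ESSE :: "real set \<Rightarrow> real \<Rightarrow> real mat \<Rightarrow> real mat \<Rightarrow> bool" where
  "positive_ESSE T k M N \<longleftrightarrow> ESSE T M N \<and> admissible_mat T k M \<and> admissible_mat T k N"

lemma positive_ESSE_chain_sym: "(positive_ESSE T k)\<^sup>*\<^sup>* M N \<Longrightarrow> (positive_ESSE T k)\<^sup>*\<^sup>* N M"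
  by (rule sympD[OF symp_rtranclp]) (auto intro!: sympI simp: positive_ESSE_def ESSE_sym)

lemma positive_ESSE_chain_SSE:
  assumes "(positive_ESSE T k)\<^sup>*\<^sup>* M N" "admissible_mat T k M"
  shows "SSE_through_positive T k M N"
proof -
  have "(positive_ESSE T k)\<^sup>*\<^sup>* \<le> (\<lambda>M N. ESSE T M N \<and> admissible_mat T k N)\<^sup>*\<^sup>*"
    by (rule rtranclp_mono) (auto simp: positive_ESSE_def)
  with assms show ?thesis unfolding SSE_through_positive_def by blast
qed

lemma positive_elements_mat_subset:
  "positive_mat A \<Longrightarrow> elements_mat A \<subseteq> U \<Longrightarrow> elements_mat A \<subseteq> U \<inter> {0..}"
  unfolding positive_mat_def by force

definition ones_mat :: "nat \<Rightarrow> real mat" where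
  "ones_mat m = mat m m (\<lambda>_. 1)"

text \<open>
  Take \<open>X\<close> near \<open>G + a E G\<close>, where \<open>E\<close> is the matrix of ones and \<open>a > 0\<close> is small.  Then
  \<open>X G\<^sup>-\<^sup>1\<close> is near \<open>1 + a E\<close>, hence positive, while \<open>G B X\<^sup>-\<^sup>1\<close> is near the positive
  matrix \<open>G B G\<^sup>-\<^sup>1\<close>.  All conditions are open, so one \<open>X\<close> over \<open>U\<close> serves every \<open>P\<close> near \<open>G\<close>.
\<close>

lemma nearby_conjugates_positive_ESSE:
  assumes U: "dense_ring U" and F: "\<And>x. x \<in> U \<Longrightarrow> inverse x \<in> U"
    and B: "B \<in> carrier_mat m m" "elements_mat B \<subseteq> U"
    and G: "G \<in> carrier_mat m m" "det G \<noteq> 0" "positive_mat (conj_by G B)"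
    and mk: "real m \<le> k"
  shows "\<exists>X. \<exists>\<eta>>0. \<forall>P. mclose m m \<eta> P G \<longrightarrow> elements_mat P \<subseteq> U \<longrightarrow>
     positive_ESSE (U \<inter> {0..}) k (conj_by P B) X"
proof -
  note R = dense_ringD(1)[OF U]
  define good where "good X P \<longleftrightarrow> det P \<noteq> 0 \<and> positive_mat (X * minv P) \<and>
    positive_mat (P * B * minv X) \<and> positive_mat (conj_by P B)" for X P
  define good' where "good' X \<longleftrightarrow> det X \<noteq> 0 \<and> positive_mat (X * minv G) \<and>
    positive_mat (G * B * minv X) \<and> positive_mat (conj_by X B)" for X
  have cm: "minv G \<in> carrier_mat m m" using minv_carrier[OF G(1)] .
  have J: "ones_mat m \<in> carrier_mat m m" unfolding ones_mat_def by simp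
  \<comment> \<open>multiplying by \<open>1 + a E\<close> with \<open>E\<close> all ones makes \<open>Y a * minv G\<close> strictly positive\<close>
  define Y where "Y a = G + a \<cdot>\<^sub>m (ones_mat m * G)" for a
  have Yc: "Y a \<in> carrier_mat m m" for a unfolding Y_def using G mult_carrier_mat[OF J G(1)] by auto
  have lim: "mtends m m Y G (at_right 0)"
  proof -
    have "mtends m m (\<lambda>a. G + a \<cdot>\<^sub>m (ones_mat m * G)) (G + 0 \<cdot>\<^sub>m (ones_mat m * G)) (at_right 0)"
      by (intro mtends_add mtends_smult mtends_const G(1) mult_carrier_mat[OF J G(1)] tendsto_ident_at)
    moreover have "G + 0 \<cdot>\<^sub>m (ones_mat m * G) = G"
      using G J by (intro eq_matI) auto
    ultimately show ?thesis unfolding Y_def by simp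
  qed
  have YG: "Y a * minv G = 1\<^sub>m m + a \<cdot>\<^sub>m ones_mat m" for a
  proof -
    have "Y a * minv G = G * minv G + (a \<cdot>\<^sub>m (ones_mat m * G)) * minv G"
      unfolding Y_def using G cm mult_carrier_mat[OF J G(1)] by (intro add_mult_distrib_mat[of _ m m _ _ m]) auto
    also have "(a \<cdot>\<^sub>m (ones_mat m * G)) * minv G = a \<cdot>\<^sub>m (ones_mat m * (G * minv G))"
      using mult_smult_assoc_mat[OF mult_carrier_mat[OF J G(1)] cm] assoc_mult_mat[OF J G(1) cm] by simp
    finally show ?thesis using minv_right[OF G(1,2)] J by simp
  qed
  have "eventually (\<lambda>a. det (Y a) \<noteq> 0) (at_right 0)"
    by (rule mtends_eventually_det[OF lim G(2)])
  moreover have "eventually (\<lambda>a. positive_mat (Y a * minv G)) (at_right 0)"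
    unfolding eventually_at_right_field
  proof (intro exI[of _ 1] conjI allI impI)
    fix a :: real assume "0 < a"
    then show "positive_mat (Y a * minv G)"
      unfolding YG by (subst positive_mat_iff[of _ m m]) (auto simp: ones_mat_def)
  qed auto
  moreover have "eventually (\<lambda>a. positive_mat (G * B * minv (Y a))) (at_right 0)"
    by (rule mtends_eventually_positive[OF mtends_mult[OF mtends_const mtends_minv[OF lim G(2)]]])
       (use G B in \<open>auto simp: conj_by_def\<close>)
  moreover have "eventually (\<lambda>a. positive_mat (conj_by (Y a) B)) (at_right 0)"
    unfolding conj_by_def
    by (rule mtends_eventually_positive[OF mtends_mult[OF mtends_mult[OF lim mtends_const[OF B(1)]] mtends_minv[OF lim G(2)]]])
       (use G B in \<open>auto simp: conj_by_def\<close>)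
  ultimately have "eventually (\<lambda>a. good' (Y a)) (at_right 0)"
    unfolding good'_def by eventually_elim auto
  from eventually_happens'[OF _ this] obtain a where a: "good' (Y a)" by auto
  have "\<exists>\<eta>>0. \<forall>P. mclose m m \<eta> P (Y a) \<longrightarrow> good' P"
  proof (rule near_by_sequences[OF Yc])
    fix f assume f: "mtends m m f (Y a) sequentially"
    have da: "det (Y a) \<noteq> 0" using a unfolding good'_def by auto
    have "eventually (\<lambda>N. det (f N) \<noteq> 0) sequentially"
      by (rule mtends_eventually_det[OF f da])
    moreover have "eventually (\<lambda>N. positive_mat (f N * minv G)) sequentially"
      by (rule mtends_eventually_positive[OF mtends_mult[OF f mtends_const[OF cm]]]) (use a good'_def in auto)
    moreover have "eventually (\<lambda>N. positive_mat (G * B * minv (f N))) sequentially"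
      by (rule mtends_eventually_positive[OF mtends_mult[OF mtends_const mtends_minv[OF f da]]])
         (use a good'_def mult_carrier_mat[OF G(1) B(1)] in auto)
    moreover have "eventually (\<lambda>N. positive_mat (conj_by (f N) B)) sequentially"
      unfolding conj_by_def
      by (rule mtends_eventually_positive[OF mtends_mult[OF mtends_mult[OF f mtends_const[OF B(1)]] mtends_minv[OF f da]]])
         (use a good'_def conj_by_def in auto)
    ultimately show "eventually (\<lambda>N. good' (f N)) sequentially"
      unfolding good'_def by eventually_elim auto
  qed
  then obtain \<eta>1 where "\<eta>1 > 0" and e1: "\<And>P. mclose m m \<eta>1 P (Y a) \<Longrightarrow> good' P" by blast
  obtain X where X: "mclose m m \<eta>1 X (Y a)" "elements_mat X \<subseteq> U"
    using subring_approx_mat[OF U Yc \<open>\<eta>1 > 0\<close>] by metis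
  have gX: "good' X" using e1[OF X(1)] .
  have Xc: "X \<in> carrier_mat m m" using X(1) unfolding mclose_def by auto
  have mX: "minv X \<in> carrier_mat m m" using minv_carrier[OF Xc] .
  have "\<exists>\<eta>>0. \<forall>P. mclose m m \<eta> P G \<longrightarrow> good X P"
  proof (rule near_by_sequences[OF G(1)])
    fix f assume f: "mtends m m f G sequentially"
    have "eventually (\<lambda>N. det (f N) \<noteq> 0) sequentially"
      by (rule mtends_eventually_det[OF f G(2)])
    moreover have "eventually (\<lambda>N. positive_mat (X * minv (f N))) sequentially"
      by (rule mtends_eventually_positive[OF mtends_mult[OF mtends_const[OF Xc] mtends_minv[OF f G(2)]]]) (use gX good'_def in auto)
    moreover have "eventually (\<lambda>N. positive_mat (f N * B * minv X)) sequentially"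
      by (rule mtends_eventually_positive[OF mtends_mult[OF mtends_mult[OF f mtends_const[OF B(1)]] mtends_const[OF mX]]])
         (use gX good'_def in auto)
    moreover have "eventually (\<lambda>N. positive_mat (conj_by (f N) B)) sequentially"
      unfolding conj_by_def
      by (rule mtends_eventually_positive[OF mtends_mult[OF mtends_mult[OF f mtends_const[OF B(1)]] mtends_minv[OF f G(2)]]])
         (use G conj_by_def in auto)
    ultimately show "eventually (\<lambda>N. good X (f N)) sequentially"
      unfolding good_def by eventually_elim auto
  qed
  then obtain \<eta> where "\<eta> > 0" and e: "\<And>P. mclose m m \<eta> P G \<Longrightarrow> good X P" by blast
  have mu: "elements_mat (M * N) \<subseteq> U" if "M \<in> carrier_mat m m" "N \<in> carrier_mat m m"
    "elements_mat M \<subseteq> U" "elements_mat N \<subseteq> U" for M N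
    using elements_mat_mult[OF R that(1,3,2,4)] .
  have iX: "elements_mat (minv X) \<subseteq> U" by (rule elements_minv[OF R F Xc X(2)])
  show ?thesis
  proof (intro exI[of _ "conj_by X B"] exI[of _ \<eta>] conjI allI impI \<open>\<eta> > 0\<close>)
    fix P assume P: "mclose m m \<eta> P G" "elements_mat P \<subseteq> U"
    have Pc: "P \<in> carrier_mat m m" using P unfolding mclose_def by auto
    have mP: "minv P \<in> carrier_mat m m" using minv_carrier[OF Pc] .
    have iP: "elements_mat (minv P) \<subseteq> U" by (rule elements_minv[OF R F Pc P(2)])
    have g: "good X P" using e[OF P(1)] .
    have adm: "admissible_mat (U \<inter> {0..}) k (conj_by Q B)"
      if "Q \<in> carrier_mat m m" "minv Q \<in> carrier_mat m m" "elements_mat Q \<subseteq> U" "elements_mat (minv Q) \<subseteq> U"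
        "positive_mat (conj_by Q B)" for Q
    proof -
      have "elements_mat (conj_by Q B) \<subseteq> U"
        unfolding conj_by_def by (intro mu mult_carrier_mat[OF that(1) B(1)] that B)
      then show ?thesis
        using that(5) positive_elements_mat_subset[OF that(5)] conj_by_carrier[OF that(1) B(1)] mk
        unfolding admissible_mat_def by auto
    qed
    have "elements_mat (X * minv P) \<subseteq> U" "elements_mat (P * B * minv X) \<subseteq> U"
      by (intro mu mult_carrier_mat[OF Pc B(1)] Xc mP iP X(2) Pc B P(2) mX iX)+
    moreover have "positive_mat (X * minv P)" "positive_mat (P * B * minv X)" "det P \<noteq> 0" "det X \<noteq> 0"
      "positive_mat (conj_by P B)" "positive_mat (conj_by X B)"
      using g gX unfolding good_def good'_def by auto
    ultimately show "positive_ESSE (U \<inter> {0..}) k (conj_by P B) (conj_by X B)"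
      unfolding positive_ESSE_def
      by (intro conjI ESSE_conj_by[OF Pc Xc B(1)] adm positive_elements_mat_subset Pc mP P(2) iP Xc mX X(2) iX)
  qed
qed

text \<open>
  Being connected by a chain, for all matrices over \<open>U\<close> close to two points of the path, is a
  locally constant equivalence relation on the parameters, so it holds between the end points.  At the
  end \<open>G 1\<close> must be approximated by a matrix \<open>Q\<close> over \<open>U\<close> that conjugates \<open>B\<close> exactly to \<open>C\<close>; this is
  possible because \<open>Q B = C Q\<close> is a linear system over \<open>U\<close>.
\<close>

lemma SSE_along_conjugation_path:
  assumes U: "dense_ring U" and F: "\<And>x. x \<in> U \<Longrightarrow> inverse x \<in> U"
    and B: "B \<in> carrier_mat m m" "elements_mat B \<subseteq> U" and C: "C \<in> carrier_mat m m" "elements_mat C \<subseteq> U"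
    and G: "mpath m m G" "\<And>t. t \<in> {0..1} \<Longrightarrow> det (G t) \<noteq> 0" "\<And>t. t \<in> {0..1} \<Longrightarrow> positive_mat (conj_by (G t) B)"
    and G0: "G 0 = 1\<^sub>m m" and G1: "G 1 * B = C * G 1"
    and mk: "real m \<le> k"
  shows "(positive_ESSE (U \<inter> {0..}) k)\<^sup>*\<^sup>* B C"
proof -
  note R = dense_ringD(1)[OF U]
  note Us = real_subringD[OF R]
  have Gc: "G t \<in> carrier_mat m m" for t using mpath_carrier[OF G(1)] .
  define near where "near \<eta> s t \<longleftrightarrow> (\<forall>P Q. mclose m m \<eta> P (G s) \<longrightarrow> mclose m m \<eta> Q (G t) \<longrightarrow>
     elements_mat P \<subseteq> U \<longrightarrow> elements_mat Q \<subseteq> U \<longrightarrow> (positive_ESSE (U \<inter> {0..}) k)\<^sup>*\<^sup>* (conj_by P B) (conj_by Q B))" for \<eta> s t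
  define Rel where "Rel s t \<longleftrightarrow> (\<exists>\<eta>>0. near \<eta> s t)" for s t
  have nearD: "(positive_ESSE (U \<inter> {0..}) k)\<^sup>*\<^sup>* (conj_by P B) (conj_by Q B)"
    if "near \<eta> s t" "mclose m m \<eta> P (G s)" "mclose m m \<eta> Q (G t)" "elements_mat P \<subseteq> U" "elements_mat Q \<subseteq> U"
    for \<eta> s t P Q
    using that unfolding near_def by blast
  have cl: "mclose m m \<eta>' P M" if "mclose m m \<eta> P M" "\<eta> \<le> \<eta>'" for \<eta> \<eta>' P M
    using that unfolding mclose_def by force
  have "Rel 0 1"
  proof (rule connected_equivalence_relation[where S = "{0..1::real}" and R = Rel])
    show "Rel y x" if "Rel x y" "x \<in> {0..1}" "y \<in> {0..1}" for x y
      using that unfolding Rel_def near_def by (blast intro: positive_ESSE_chain_sym)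
    show "Rel x z" if xyz: "Rel x y" "Rel y z" "x \<in> {0..1}" "y \<in> {0..1}" "z \<in> {0..1}" for x y z
    proof -
      obtain \<eta>1 where 1: "\<eta>1 > 0" "near \<eta>1 x y"
        using xyz(1) unfolding Rel_def by blast
      obtain \<eta>2 where 2: "\<eta>2 > 0" "near \<eta>2 y z"
        using xyz(2) unfolding Rel_def by blast
      have m0: "min \<eta>1 \<eta>2 > 0" using 1 2 by auto
      obtain Q where Q: "mclose m m (min \<eta>1 \<eta>2) Q (G y)" "elements_mat Q \<subseteq> U"
        using subring_approx_mat[OF U Gc m0] by metis
      have "(positive_ESSE (U \<inter> {0..}) k)\<^sup>*\<^sup>* (conj_by P B) (conj_by P' B)"
        if "mclose m m (min \<eta>1 \<eta>2) P (G x)" "mclose m m (min \<eta>1 \<eta>2) P' (G z)"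
          "elements_mat P \<subseteq> U" "elements_mat P' \<subseteq> U" for P P'
        using rtranclp_trans[OF nearD[OF 1(2), of P Q] nearD[OF 2(2), of Q P']] that Q cl by simp
      then show ?thesis using m0 unfolding Rel_def near_def by blast
    qed
    fix a :: real assume a: "a \<in> {0..1}"
    obtain X \<eta> where \<eta>: "\<eta> > 0" and X: "\<And>P. mclose m m \<eta> P (G a) \<Longrightarrow> elements_mat P \<subseteq> U \<Longrightarrow>
      positive_ESSE (U \<inter> {0..}) k (conj_by P B) X"
      using nearby_conjugates_positive_ESSE[OF U F B Gc G(2)[OF a] G(3)[OF a] mk] by metis
    define T where "T = {t \<in> {0..1}. \<forall>i<m. \<forall>j<m. \<bar>G t $$ (i, j) - G a $$ (i, j)\<bar> < \<eta> / 2}"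
    have "\<forall>\<^sub>F t in at a within {0..1}. \<forall>i\<in>{..<m}. \<forall>j\<in>{..<m}. \<bar>G t $$ (i, j) - G a $$ (i, j)\<bar> < \<eta> / 2"
    proof (intro eventually_ball_finite finite_lessThan ballI)
      fix i j assume ij: "i \<in> {..<m}" "j \<in> {..<m}"
      have "((\<lambda>t. G t $$ (i, j)) \<longlongrightarrow> G a $$ (i, j)) (at a within {0..1})"
        using G(1) a ij unfolding mpath_iff mtends_def by blast
      from tendstoD[OF this, of "\<eta> / 2"] \<eta>
      show "\<forall>\<^sub>F t in at a within {0..1}. \<bar>G t $$ (i, j) - G a $$ (i, j)\<bar> < \<eta> / 2"
        by (simp add: dist_real_def)
    qed
    then have "\<forall>\<^sub>F t in at a within {0..1}. \<forall>i<m. \<forall>j<m. \<bar>G t $$ (i, j) - G a $$ (i, j)\<bar> < \<eta> / 2"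
      unfolding Ball_def lessThan_iff .
    then obtain T' where T': "open T'" "a \<in> T'" "\<And>t. t \<in> T' \<Longrightarrow> t \<noteq> a \<Longrightarrow> t \<in> {0..1} \<Longrightarrow>
       \<forall>i<m. \<forall>j<m. \<bar>G t $$ (i, j) - G a $$ (i, j)\<bar> < \<eta> / 2"
      unfolding eventually_at_topological by blast
    have nr: "\<forall>i<m. \<forall>j<m. \<bar>G t $$ (i, j) - G a $$ (i, j)\<bar> < \<eta> / 2" if "t \<in> {0..1} \<inter> T'" for t
      using T'(3)[of t] that \<eta> by (cases "t = a") auto
    have "Rel a t" if t: "t \<in> {0..1} \<inter> T'" for t
    proof -
      have c2: "mclose m m \<eta> Q (G a)" if "mclose m m (\<eta> / 2) Q (G t)" for Q
        using that nr[OF t] unfolding mclose_def by (smt (verit) field_sum_of_halves)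
      have "(positive_ESSE (U \<inter> {0..}) k)\<^sup>*\<^sup>* (conj_by P B) (conj_by Q B)"
        if "mclose m m (\<eta> / 2) P (G a)" "mclose m m (\<eta> / 2) Q (G t)" "elements_mat P \<subseteq> U" "elements_mat Q \<subseteq> U" for P Q
      proof -
        have "positive_ESSE (U \<inter> {0..}) k (conj_by P B) X" using X[OF cl[OF that(1)] that(3)] \<eta> by simp
        moreover have "positive_ESSE (U \<inter> {0..}) k (conj_by Q B) X" using X[OF c2[OF that(2)] that(4)] .
        ultimately show ?thesis by (meson positive_ESSE_chain_sym r_into_rtranclp rtranclp_trans)
      qed
      then show ?thesis unfolding Rel_def near_def using \<eta> by (intro exI[of _ "\<eta> / 2"]) auto
    qed
    then show "\<exists>T. openin (top_of_set {0..1}) T \<and> a \<in> T \<and> (\<forall>x\<in>T. Rel a x)"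
      using T' a by (intro exI[of _ "{0..1} \<inter> T'"]) (auto simp: openin_open)
  qed auto
  then obtain \<eta> where \<eta>: "\<eta> > 0" and L0: "near \<eta> 0 1"
    unfolding Rel_def by blast
  have "\<exists>\<eta>>0. \<forall>P. mclose m m \<eta> P (G 1) \<longrightarrow> det P \<noteq> 0"
    by (rule near_by_sequences[OF Gc]) (use G(2)[of 1] in \<open>auto elim!: mtends_eventually_det\<close>)
  then obtain \<eta>' where \<eta>': "\<eta>' > 0" "\<And>P. mclose m m \<eta>' P (G 1) \<Longrightarrow> det P \<noteq> 0" by blast
  \<comment> \<open>the coefficients of the linear system \<open>Q B = C Q\<close> for the entries of \<open>Q\<close>\<close>
  define a where "a = (\<lambda>(i, j) (p, q). (if p = i then B $$ (q, j) else 0) - (if q = j then C $$ (i, p) else 0))"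
  have sol: "(\<Sum>e'\<in>{..<m} \<times> {..<m}. a (i, j) e' * v e') = (\<Sum>q<m. v (i, q) * B $$ (q, j)) - (\<Sum>p<m. C $$ (i, p) * v (p, j))"
    if "i < m" "j < m" for i j and v :: "nat \<times> nat \<Rightarrow> real"
  proof -
    have "(\<Sum>e'\<in>{..<m} \<times> {..<m}. a (i, j) e' * v e') =
      (\<Sum>p<m. \<Sum>q<m. (if p = i then v (i, q) * B $$ (q, j) else 0) - (if q = j then C $$ (i, p) * v (p, j) else 0))"
      unfolding sum.cartesian_product by (intro sum.cong) (auto simp: a_def algebra_simps)
    moreover have "(\<Sum>p<m. \<Sum>q<m. if p = i then v (i, q) * B $$ (q, j) else 0) = (\<Sum>q<m. v (i, q) * B $$ (q, j))"
      using that by (subst sum.swap) simp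
    moreover have "(\<Sum>p<m. \<Sum>q<m. if q = j then C $$ (i, p) * v (p, j) else 0) = (\<Sum>p<m. C $$ (i, p) * v (p, j))"
      using that by simp
    ultimately show ?thesis by (simp add: sum_subtractf)
  qed
  have prodB: "(M * B) $$ (i, j) = (\<Sum>q<m. M $$ (i, q) * B $$ (q, j))"
    and prodC: "(C * M) $$ (i, j) = (\<Sum>p<m. C $$ (i, p) * M $$ (p, j))"
    if "M \<in> carrier_mat m m" "i < m" "j < m" for M i j
    using that B C by (auto simp: scalar_prod_def atLeast0LessThan intro!: sum.cong)
  have "min \<eta> \<eta>' > 0" using \<eta> \<eta>' by simp
  obtain u where u: "\<And>e. e \<in> {..<m} \<times> {..<m} \<Longrightarrow> u e \<in> U"
    "\<And>e. e \<in> {..<m} \<times> {..<m} \<Longrightarrow> (\<Sum>e'\<in>{..<m} \<times> {..<m}. a e e' * u e') = 0"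
    "\<And>e. e \<in> {..<m} \<times> {..<m} \<Longrightarrow> \<bar>u e - G 1 $$ e\<bar> < min \<eta> \<eta>'"
  proof (rule subring_solution_approx[OF U _ _ _ \<open>min \<eta> \<eta>' > 0\<close>, of "{..<m} \<times> {..<m}" "{..<m} \<times> {..<m}" a "\<lambda>e. G 1 $$ e"])
    show "a e i \<in> U" if "e \<in> {..<m} \<times> {..<m}" "i \<in> {..<m} \<times> {..<m}" for e i
      using that B C unfolding elements_mat_subset_iff[OF B(1)] elements_mat_subset_iff[OF C(1)]
      by (auto simp: a_def intro!: Us(2,3))
    show "(\<Sum>i\<in>{..<m} \<times> {..<m}. a e i * G 1 $$ i) = 0" if "e \<in> {..<m} \<times> {..<m}" for e
      using that sol[of "fst e" "snd e" "\<lambda>e. G 1 $$ e"] prodB[OF Gc, of "fst e" "snd e" 1] prodC[OF Gc, of "fst e" "snd e" 1] G1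
      by auto
  qed auto
  define Q where "Q = mat m m u"
  have Q: "Q \<in> carrier_mat m m" "elements_mat Q \<subseteq> U" "mclose m m (min \<eta> \<eta>') Q (G 1)"
    unfolding Q_def using u by (auto simp: mclose_def)
  have "Q * B = C * Q"
  proof (rule eq_matI)
    fix i j assume "i < dim_row (C * Q)" "j < dim_col (C * Q)"
    then have ij: "i < m" "j < m" using C Q by auto
    show "(Q * B) $$ (i, j) = (C * Q) $$ (i, j)"
      using sol[OF ij, of u] u(2)[of "(i, j)"] ij unfolding prodB[OF Q(1) ij] prodC[OF Q(1) ij]
      by (simp add: Q_def)
  qed (use Q B C in auto)
  then have "conj_by Q B = C"
    by (intro conj_by_eq[OF Q(1) B(1) C(1) \<eta>'(2)[OF cl[OF Q(3)]]]) auto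
  moreover have "mclose m m \<eta> (1\<^sub>m m) (G 0)" unfolding mclose_def G0 using \<eta> by auto
  moreover have "elements_mat (1\<^sub>m m) \<subseteq> U"
    using Us(1,2) by (subst elements_mat_subset_iff[of _ m m]) auto
  ultimately show ?thesis
    using nearD[OF L0, of "1\<^sub>m m" Q] cl[OF Q(3)] Q(2) conj_by_one[OF B(1)] by simp
qed

section \<open>Invariant flags of the nilpotent part\<close>

text \<open>
  Entries of a product are expanded into sums over an initial segment rather than into scalar products of vectors.
\<close>

declare index_mult_mat(1) [simp del]

lemma mult_entry:
  "A \<in> carrier_mat nr n \<Longrightarrow> B \<in> carrier_mat n nc \<Longrightarrow> i < nr \<Longrightarrow> j < nc \<Longrightarrow>
   (A * B) $$ (i, j) = (\<Sum>k<n. A $$ (i, k) * (B $$ (k, j) :: real))"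
  by (auto simp: index_mult_mat(1) scalar_prod_def atLeast0LessThan intro!: sum.cong)

lemma mult_entry_row:
  "A \<in> carrier_mat 1 n \<Longrightarrow> B \<in> carrier_mat n nc \<Longrightarrow> j < nc \<Longrightarrow>
   (A * B) $$ (0, j) = (\<Sum>k<n. A $$ (0, k) * (B $$ (k, j) :: real))"
  by (rule mult_entry) auto

lemma sum_lessThan_add: "(\<Sum>i<a + (b :: nat). f i) = (\<Sum>i<a. f i) + (\<Sum>i<b. f (a + i) :: real)"
  by (induction b) (auto simp: add.assoc)

lemma append_rows_entry:
  "X \<in> carrier_mat r n \<Longrightarrow> W \<in> carrier_mat k n \<Longrightarrow> i < r + k \<Longrightarrow> j < n \<Longrightarrow>
   (X @\<^sub>r W) $$ (i, j) = (if i < r then X $$ (i, j) else W $$ (i - r, j))"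
  unfolding append_rows_def by auto

lemma append_rows_mult:
  fixes B :: "real mat"
  assumes X: "X \<in> carrier_mat r n" and W: "W \<in> carrier_mat k n" and B: "B \<in> carrier_mat n p"
  shows "(X @\<^sub>r W) * B = (X * B) @\<^sub>r (W * B)"
proof (rule eq_matI)
  note c = carrier_append_rows[OF X W] mult_carrier_mat[OF X B] mult_carrier_mat[OF W B]
  show "dim_row ((X @\<^sub>r W) * B) = dim_row ((X * B) @\<^sub>r (W * B))"
    "dim_col ((X @\<^sub>r W) * B) = dim_col ((X * B) @\<^sub>r (W * B))"
    using carrier_matD[OF mult_carrier_mat[OF c(1) B]] carrier_matD[OF carrier_append_rows[OF c(2,3)]] by simp_all
  fix i j assume "i < dim_row ((X * B) @\<^sub>r (W * B))" "j < dim_col ((X * B) @\<^sub>r (W * B))"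
  then have ij: "i < r + k" "j < p" using carrier_append_rows[OF c(2,3)] by auto
  show "((X @\<^sub>r W) * B) $$ (i, j) = ((X * B) @\<^sub>r (W * B)) $$ (i, j)"
    unfolding append_rows_entry[OF c(2,3) ij] mult_entry[OF c(1) B ij]
    using ij X W B by (auto simp: append_rows_entry[OF X W] mult_entry)
qed

lemma mult_append_rows:
  fixes C :: "real mat"
  assumes C: "C1 \<in> carrier_mat p r" "C2 \<in> carrier_mat p k" and X: "X \<in> carrier_mat r n" and W: "W \<in> carrier_mat k n"
    and C3: "C \<in> carrier_mat p (r + k)" "\<And>i j. i < p \<Longrightarrow> j < r \<Longrightarrow> C $$ (i, j) = C1 $$ (i, j)"
      "\<And>i j. i < p \<Longrightarrow> j < k \<Longrightarrow> C $$ (i, r + j) = C2 $$ (i, j)"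
  shows "C * (X @\<^sub>r W) = C1 * X + C2 * W"
proof (rule eq_matI)
  note c = carrier_append_rows[OF X W] mult_carrier_mat[OF C(1) X] mult_carrier_mat[OF C(2) W]
  show "dim_row (C * (X @\<^sub>r W)) = dim_row (C1 * X + C2 * W)" "dim_col (C * (X @\<^sub>r W)) = dim_col (C1 * X + C2 * W)"
    using c C3 by auto
  fix i j assume "i < dim_row (C1 * X + C2 * W)" "j < dim_col (C1 * X + C2 * W)"
  then have ij: "i < p" "j < n" using c by auto
  show "(C * (X @\<^sub>r W)) $$ (i, j) = (C1 * X + C2 * W) $$ (i, j)"
    using ij c C3 C X W unfolding mult_entry[OF C3(1) c(1) ij] sum_lessThan_add
    by (simp add: append_rows_entry[OF X W] mult_entry[OF C(1) X] mult_entry[OF C(2) W])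
qed

lemma split_cols:
  fixes C :: "real mat"
  assumes C: "C \<in> carrier_mat p (r + k)" and X: "X \<in> carrier_mat r n" and W: "W \<in> carrier_mat k n"
  shows "\<exists>C1\<in>carrier_mat p r. \<exists>C2\<in>carrier_mat p k. C * (X @\<^sub>r W) = C1 * X + C2 * W \<and>
    (C1 = 0\<^sub>m p r \<and> C2 = 0\<^sub>m p k \<longrightarrow> C = 0\<^sub>m p (r + k))"
proof -
  define C1 where "C1 = mat p r (\<lambda>e. C $$ e)"
  define C2 where "C2 = mat p k (\<lambda>(i, j). C $$ (i, r + j))"
  have c: "C1 \<in> carrier_mat p r" "C2 \<in> carrier_mat p k" unfolding C1_def C2_def by auto
  have e: "C $$ (i, j) = C1 $$ (i, j)" "j' < k \<Longrightarrow> C $$ (i, r + j') = C2 $$ (i, j')" if "i < p" "j < r" for i j j'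
    unfolding C1_def C2_def using that by auto
  have e2: "C $$ (i, r + j') = C2 $$ (i, j')" if "i < p" "j' < k" for i j'
    unfolding C2_def using that by auto
  show ?thesis
  proof (intro bexI[OF _ c(1)] bexI[OF _ c(2)] conjI impI)
    show "C * (X @\<^sub>r W) = C1 * X + C2 * W" by (rule mult_append_rows[OF c X W C]) (use e e2 in auto)
    assume z: "C1 = 0\<^sub>m p r \<and> C2 = 0\<^sub>m p k"
    show "C = 0\<^sub>m p (r + k)"
    proof (rule eq_matI)
      fix i j assume ij: "i < dim_row (0\<^sub>m p (r + k) :: real mat)" "j < dim_col (0\<^sub>m p (r + k) :: real mat)"
      show "C $$ (i, j) = 0\<^sub>m p (r + k) $$ (i, j)"
        using ij e(1)[of i j] e2[of i "j - r"] z by (cases "j < r") auto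
    qed (use C in auto)
  qed
qed

definition join_cols :: "real mat \<Rightarrow> real mat \<Rightarrow> real mat" where
  "join_cols C1 C2 = mat (dim_row C1) (dim_col C1 + dim_col C2)
     (\<lambda>(i, j). if j < dim_col C1 then C1 $$ (i, j) else C2 $$ (i, j - dim_col C1))"

lemma join_cols:
  assumes C: "C1 \<in> carrier_mat p r" "C2 \<in> carrier_mat p k" and X: "X \<in> carrier_mat r n" and W: "W \<in> carrier_mat k n"
  shows "join_cols C1 C2 \<in> carrier_mat p (r + k)" "join_cols C1 C2 * (X @\<^sub>r W) = C1 * X + C2 * W"
    "join_cols C1 C2 = 0\<^sub>m p (r + k) \<Longrightarrow> C1 = 0\<^sub>m p r"
proof -
  show c: "join_cols C1 C2 \<in> carrier_mat p (r + k)" unfolding join_cols_def using C by auto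
  show "join_cols C1 C2 * (X @\<^sub>r W) = C1 * X + C2 * W"
    by (rule mult_append_rows[OF C X W c]) (use C in \<open>auto simp: join_cols_def\<close>)
  assume z: "join_cols C1 C2 = 0\<^sub>m p (r + k)"
  show "C1 = 0\<^sub>m p r"
  proof (rule eq_matI)
    fix i j assume ij: "i < dim_row (0\<^sub>m p r :: real mat)" "j < dim_col (0\<^sub>m p r :: real mat)"
    then have "join_cols C1 C2 $$ (i, j) = C1 $$ (i, j)" unfolding join_cols_def using C by auto
    then show "C1 $$ (i, j) = 0\<^sub>m p r $$ (i, j)" using ij z by auto
  qed (use C in auto)
qed

text \<open>
  Rows are handled as a matrix, and a linear combination of them as a product with a \<open>1 \<times> k\<close> matrix.
\<close>

definition rows_indep :: "nat \<Rightarrow> nat \<Rightarrow> real mat \<Rightarrow> bool" where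
  "rows_indep k n W \<longleftrightarrow> W \<in> carrier_mat k n \<and> (\<forall>c\<in>carrier_mat 1 k. c * W = 0\<^sub>m 1 n \<longrightarrow> c = 0\<^sub>m 1 k)"

lemma rows_indepD: "rows_indep k n W \<Longrightarrow> c \<in> carrier_mat 1 k \<Longrightarrow> c * W = 0\<^sub>m 1 n \<Longrightarrow> c = 0\<^sub>m 1 k"
  unfolding rows_indep_def by blast

lemma det_nonzero_rows_indep:
  assumes L: "L \<in> carrier_mat n n"
  shows "det L \<noteq> 0 \<longleftrightarrow> rows_indep n n L"
proof
  assume d: "det L \<noteq> 0"
  show "rows_indep n n L" unfolding rows_indep_def
  proof (intro conjI ballI impI L)
    fix c assume c: "c \<in> carrier_mat 1 n" "c * L = 0\<^sub>m 1 n"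
    have "c = c * (L * minv L)" using minv_right[OF L d] c by simp
    also have "\<dots> = (c * L) * minv L" using assoc_mult_mat[OF c(1) L minv_carrier[OF L]] by simp
    also have "\<dots> = 0\<^sub>m 1 n" unfolding c(2) using minv_carrier[OF L] by (metis left_mult_zero_mat)
    finally show "c = 0\<^sub>m 1 n" .
  qed
next
  assume r: "rows_indep n n L"
  show "det L \<noteq> 0"
  proof
    assume "det L = 0"
    then have "det (L\<^sup>T) = 0" using det_transpose[OF L] by simp
    then obtain v where v: "v \<in> carrier_vec n" "v \<noteq> 0\<^sub>v n" "L\<^sup>T *\<^sub>v v = 0\<^sub>v n"
      using det_0_iff_vec_prod_zero[of "L\<^sup>T" n] L by auto
    define c where "c = mat 1 n (\<lambda>(i, j). v $ j)"
    have c: "c \<in> carrier_mat 1 n" unfolding c_def by simp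
    have "c * L = 0\<^sub>m 1 n"
    proof (rule eq_matI)
      fix i j assume "i < dim_row (0\<^sub>m 1 n :: real mat)" "j < dim_col (0\<^sub>m 1 n :: real mat)"
      then have ij: "i < 1" "j < n" by auto
      have "(c * L) $$ (i, j) = (L\<^sup>T *\<^sub>v v) $ j"
        unfolding mult_entry[OF c L ij] using ij L v(1)
        by (auto simp: c_def scalar_prod_def atLeast0LessThan intro!: sum.cong)
      then show "(c * L) $$ (i, j) = 0\<^sub>m 1 n $$ (i, j)" using v(3) ij by simp
    qed (use c L in auto)
    then have "c = 0\<^sub>m 1 n" using rows_indepD[OF r c] by blast
    then have "c $$ (0, j) = 0" if "j < n" for j using that by simp
    then have "v = 0\<^sub>v n" using v(1) unfolding c_def by (intro eq_vecI) auto
    with v(2) show False by blast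
  qed
qed

text \<open>
  There are more unknowns than equations; padding \<open>M\<close> with zero columns makes it a singular square
  matrix.
\<close>

lemma homogeneous_solution:
  fixes M :: "real mat"
  assumes M: "M \<in> carrier_mat m q" and "q < m"
  obtains c where "c \<in> carrier_mat 1 m" "c \<noteq> 0\<^sub>m 1 m" "c * M = 0\<^sub>m 1 q"
proof -
  define M' where "M' = mat m m (\<lambda>(i, j). if j < q then M $$ (i, j) else 0)"
  have M': "M' \<in> carrier_mat m m" unfolding M'_def by simp
  have "M' *\<^sub>v unit_vec m (m - 1) = 0\<^sub>v m"
  proof (rule eq_vecI)
    fix i assume i: "i < dim_vec (0\<^sub>v m :: real vec)"
    then have "(M' *\<^sub>v unit_vec m (m - 1)) $ i = M' $$ (i, m - 1)"
      using M' \<open>q < m\<close> by simp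
    then show "(M' *\<^sub>v unit_vec m (m - 1)) $ i = 0\<^sub>v m $ i"
      using i \<open>q < m\<close> unfolding M'_def by simp
  qed (use M' in simp)
  moreover have "unit_vec m (m - 1) \<noteq> (0\<^sub>v m :: real vec)"
    using \<open>q < m\<close> by (metis diff_less index_unit_vec(1) index_zero_vec(1) not_gr_zero less_nat_zero_code zero_less_one zero_neq_one)
  ultimately have "det M' = 0"
    using det_0_iff_vec_prod_zero[OF M'] unit_vec_carrier by blast
  then obtain c where c: "c \<in> carrier_mat 1 m" "c * M' = 0\<^sub>m 1 m" "c \<noteq> 0\<^sub>m 1 m"
    using det_nonzero_rows_indep[OF M'] M' unfolding rows_indep_def by blast
  have "c * M = 0\<^sub>m 1 q"
  proof (rule eq_matI)
    fix i j assume "i < dim_row (0\<^sub>m 1 q :: real mat)" "j < dim_col (0\<^sub>m 1 q :: real mat)"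
    then have ij: "i < 1" "j < q" by auto
    then have j: "j < m" using \<open>q < m\<close> by simp
    have "(c * M) $$ (i, j) = (c * M') $$ (i, j)"
      unfolding mult_entry[OF c(1) M ij] mult_entry[OF c(1) M' ij(1) j]
      using ij j by (intro sum.cong) (auto simp: M'_def)
    then show "(c * M) $$ (i, j) = 0\<^sub>m 1 q $$ (i, j)" using c(2) ij j by simp
  qed (use c M in auto)
  with c show thesis using that by blast
qed

lemma rows_indep_le:
  assumes "rows_indep k n W" shows "k \<le> n"
proof (rule ccontr)
  assume "\<not> k \<le> n"
  then have "n < k" by simp
  have W: "W \<in> carrier_mat k n" using assms unfolding rows_indep_def by blast
  obtain c where "c \<in> carrier_mat 1 k" "c \<noteq> 0\<^sub>m 1 k" "c * W = 0\<^sub>m 1 n"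
    by (rule homogeneous_solution[OF W \<open>n < k\<close>])
  with assms show False unfolding rows_indep_def by blast
qed

lemma one_by_one_mult:
  fixes x :: "real mat" assumes "x \<in> carrier_mat 1 1" "v \<in> carrier_mat 1 n"
  shows "x * v = x $$ (0, 0) \<cdot>\<^sub>m v"
  using assms by (intro eq_matI) (auto simp: mult_entry[OF assms])

lemma rows_indep_append_left:
  assumes "rows_indep (r + k) n (X @\<^sub>r W)" and X: "X \<in> carrier_mat r n" and W: "W \<in> carrier_mat k n"
    and a: "a \<in> carrier_mat 1 r" and b: "b \<in> carrier_mat 1 k" and eq: "a * X = b * W"
  shows "a = 0\<^sub>m 1 r"
proof -
  have nb: "(- 1) \<cdot>\<^sub>m b \<in> carrier_mat 1 k" using b by simp
  note j = join_cols[OF a nb X W]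
  have "join_cols a ((- 1) \<cdot>\<^sub>m b) * (X @\<^sub>r W) = 0\<^sub>m 1 n"
    unfolding j(2) eq mult_smult_assoc_mat[OF b W] using mult_carrier_mat[OF b W] b W by (intro eq_matI) auto
  from j(3)[OF rows_indepD[OF assms(1) j(1) this]] show ?thesis .
qed

lemma rows_indep_appendI:
  assumes X: "X \<in> carrier_mat r n" and W: "rows_indep k n W"
    and "\<And>a b. a \<in> carrier_mat 1 r \<Longrightarrow> b \<in> carrier_mat 1 k \<Longrightarrow> a * X = b * W \<Longrightarrow> a = 0\<^sub>m 1 r"
  shows "rows_indep (r + k) n (X @\<^sub>r W)"
  unfolding rows_indep_def
proof (intro conjI ballI impI)
  have Wc: "W \<in> carrier_mat k n" using W unfolding rows_indep_def by blast
  show "X @\<^sub>r W \<in> carrier_mat (r + k) n" using carrier_append_rows[OF X Wc] .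
  fix c assume c: "c \<in> carrier_mat 1 (r + k)" "c * (X @\<^sub>r W) = 0\<^sub>m 1 n"
  obtain a b where ab: "a \<in> carrier_mat 1 r" "b \<in> carrier_mat 1 k" "c * (X @\<^sub>r W) = a * X + b * W"
    "a = 0\<^sub>m 1 r \<and> b = 0\<^sub>m 1 k \<longrightarrow> c = 0\<^sub>m 1 (r + k)"
    using split_cols[OF c(1) X Wc] by (elim bexE conjE) (rule that)
  note cc = mult_carrier_mat[OF ab(1) X] mult_carrier_mat[OF ab(2) Wc]
  have nb: "(- 1) \<cdot>\<^sub>m b \<in> carrier_mat 1 k" using ab by simp
  have e: "a * X + b * W = 0\<^sub>m 1 n" using ab(3) c(2) by simp
  have "a * X = ((- 1) \<cdot>\<^sub>m b) * W"
  proof (rule eq_matI)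
    fix i j assume ij: "i < dim_row (((- 1) \<cdot>\<^sub>m b) * W)" "j < dim_col (((- 1) \<cdot>\<^sub>m b) * W)"
    have "(a * X + b * W) $$ (i, j) = 0" unfolding e using ij ab Wc by simp
    then show "(a * X) $$ (i, j) = (((- 1) \<cdot>\<^sub>m b) * W) $$ (i, j)"
      unfolding mult_smult_assoc_mat[OF ab(2) Wc] using ij cc ab Wc by simp
  qed (use ab X Wc in auto)
  from assms(3)[OF ab(1) nb this] have a0: "a = 0\<^sub>m 1 r" .
  have "b * W = 0\<^sub>m 1 n" using e cc unfolding a0 left_mult_zero_mat[OF X] by simp
  then have "b = 0\<^sub>m 1 k" using rows_indepD[OF W ab(2)] by blast
  with a0 ab(4) show "c = 0\<^sub>m 1 (r + k)" by blast
qed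

definition strictly_lower :: "nat \<Rightarrow> real mat \<Rightarrow> bool" where
  "strictly_lower k T \<longleftrightarrow> T \<in> carrier_mat k k \<and> (\<forall>i<k. \<forall>j<k. i \<le> j \<longrightarrow> T $$ (i, j) = 0)"

text \<open>
  The rows of \<open>W\<close> span a subspace invariant under \<open>B\<close>, and the spans of the first \<open>i\<close> rows form a
  flag that \<open>B\<close> shifts down; in particular \<open>B\<close> is nilpotent on it.
\<close>

definition nil_frame :: "nat \<Rightarrow> nat \<Rightarrow> real mat \<Rightarrow> real mat \<Rightarrow> bool" where
  "nil_frame n k B W \<longleftrightarrow> rows_indep k n W \<and> (\<exists>T. strictly_lower k T \<and> W * B = T * W)"

text \<open>
  The second condition says that the span of \<open>W\<close> cannot be enlarged by a vector that \<open>B\<close> maps into it,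
  that is, that it is the whole generalized kernel of \<open>B\<close>.
\<close>

definition full_frame :: "nat \<Rightarrow> nat \<Rightarrow> real mat \<Rightarrow> real mat \<Rightarrow> bool" where
  "full_frame n k B W \<longleftrightarrow> nil_frame n k B W \<and>
     (\<forall>v\<in>carrier_mat 1 n. (\<exists>a\<in>carrier_mat 1 k. v * B = a * W) \<longrightarrow> (\<exists>a\<in>carrier_mat 1 k. v = a * W))"

lemma nil_frame_carrier: "nil_frame n k B W \<Longrightarrow> W \<in> carrier_mat k n"
  unfolding nil_frame_def rows_indep_def by blast

lemma nil_frame_extend:
  assumes B: "B \<in> carrier_mat n n" and W: "nil_frame n k B W"
    and v: "v \<in> carrier_mat 1 n" "\<And>b. b \<in> carrier_mat 1 k \<Longrightarrow> v \<noteq> b * W"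
    and a: "a \<in> carrier_mat 1 k" "v * B = a * W"
  shows "nil_frame n (k + 1) B (W @\<^sub>r v)"
proof -
  have Wc: "W \<in> carrier_mat k n" using nil_frame_carrier[OF W] .
  obtain T where T: "T \<in> carrier_mat k k" "strictly_lower k T" "W * B = T * W"
    using W unfolding nil_frame_def strictly_lower_def by blast
  have "rows_indep (k + 1) n (W @\<^sub>r v)"
    unfolding rows_indep_def
  proof (intro conjI ballI impI)
    show "W @\<^sub>r v \<in> carrier_mat (k + 1) n" using carrier_append_rows[OF Wc v(1)] .
    fix c assume c: "c \<in> carrier_mat 1 (k + 1)" "c * (W @\<^sub>r v) = 0\<^sub>m 1 n"
    obtain b x where bx: "b \<in> carrier_mat 1 k" "x \<in> carrier_mat 1 1" "c * (W @\<^sub>r v) = b * W + x * v"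
      "b = 0\<^sub>m 1 k \<and> x = 0\<^sub>m 1 1 \<longrightarrow> c = 0\<^sub>m 1 (k + 1)"
      using split_cols[OF c(1) Wc v(1)] by (elim bexE conjE) (rule that)
    define y where "y = x $$ (0, 0)"
    note bW = mult_carrier_mat[OF bx(1) Wc]
    have e: "b * W + y \<cdot>\<^sub>m v = 0\<^sub>m 1 n" using bx(3) c(2) unfolding one_by_one_mult[OF bx(2) v(1)] y_def by simp
    have y0: "y = 0"
    proof (rule ccontr)
      assume y: "y \<noteq> 0"
      have "v = (- inverse y) \<cdot>\<^sub>m (b * W)"
      proof (rule eq_matI)
        fix i j assume ij: "i < dim_row ((- inverse y) \<cdot>\<^sub>m (b * W))" "j < dim_col ((- inverse y) \<cdot>\<^sub>m (b * W))"
        have "(b * W + y \<cdot>\<^sub>m v) $$ (i, j) = 0" unfolding e using ij bx(1) Wc by simp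
        then have "y * v $$ (i, j) = - (b * W) $$ (i, j)" using ij bW v(1) bx(1) Wc by simp
        then have "v $$ (i, j) = - (b * W) $$ (i, j) / y" using y by (simp add: field_simps)
        then show "v $$ (i, j) = ((- inverse y) \<cdot>\<^sub>m (b * W)) $$ (i, j)"
          using ij bW bx(1) Wc by (simp add: field_simps)
      qed (use v(1) bx(1) Wc in auto)
      also have "\<dots> = ((- inverse y) \<cdot>\<^sub>m b) * W" using mult_smult_assoc_mat[OF bx(1) Wc] by simp
      finally show False using v(2)[of "(- inverse y) \<cdot>\<^sub>m b"] bx(1) by simp
    qed
    have "b * W + y \<cdot>\<^sub>m v = b * W" using y0 v(1) bW bx(1) Wc by (intro eq_matI) auto
    with e have "b * W = 0\<^sub>m 1 n" by simp
    then have "b = 0\<^sub>m 1 k" using W bx(1) unfolding nil_frame_def rows_indep_def by blast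
    moreover have "x = 0\<^sub>m 1 1" using bx(2) y0 unfolding y_def by (intro eq_matI) auto
    ultimately show "c = 0\<^sub>m 1 (k + 1)" using bx(4) by blast
  qed
  moreover have "\<exists>T'. strictly_lower (k + 1) T' \<and> (W @\<^sub>r v) * B = T' * (W @\<^sub>r v)"
  proof (intro exI conjI)
    define T' where "T' = four_block_mat T (0\<^sub>m k 1) a (0\<^sub>m 1 1)"
    show "strictly_lower (k + 1) T'"
      using T a unfolding strictly_lower_def T'_def by auto
    have T'c: "T' \<in> carrier_mat (k + 1) (k + 1)" using T a unfolding T'_def by auto
    note c = mult_carrier_mat[OF T(1) Wc] mult_carrier_mat[OF a(1) Wc]
    have "T' * (W @\<^sub>r v) = (T @\<^sub>r a) * W + ((0\<^sub>m k 1) @\<^sub>r (0\<^sub>m 1 1)) * v"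
    proof (rule mult_append_rows[OF _ _ Wc v(1) T'c])
      show "T @\<^sub>r a \<in> carrier_mat (k + 1) k" using carrier_append_rows[OF T(1) a(1)] .
      show "0\<^sub>m k 1 @\<^sub>r 0\<^sub>m 1 1 \<in> carrier_mat (k + 1) 1" using carrier_append_rows[of "0\<^sub>m k 1" k 1 "0\<^sub>m 1 1" 1] by simp
    qed (use T a in \<open>auto simp: T'_def append_rows_def\<close>)
    also have "(0\<^sub>m k 1) @\<^sub>r (0\<^sub>m 1 1) = (0\<^sub>m (k + 1) 1 :: real mat)"
      by (intro eq_matI) (auto simp: append_rows_def)
    also have "0\<^sub>m (k + 1) 1 * v = 0\<^sub>m (k + 1) n" using v(1) by (rule left_mult_zero_mat)
    also have "(T @\<^sub>r a) * W + 0\<^sub>m (k + 1) n = (T @\<^sub>r a) * W"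
      using mult_carrier_mat[OF carrier_append_rows[OF T(1) a(1)] Wc] by (rule right_add_zero_mat)
    also have "\<dots> = (W @\<^sub>r v) * B"
      unfolding append_rows_mult[OF T(1) a(1) Wc] append_rows_mult[OF Wc v(1) B] T(3) a(2) ..
    finally show "(W @\<^sub>r v) * B = T' * (W @\<^sub>r v)" by simp
  qed
  ultimately show ?thesis unfolding nil_frame_def by blast
qed

text \<open>
  Stated for an arbitrary property \<open>P\<close> that can be maintained while rows are added, because frames
  with entries in a subring and frames with orthonormal rows are both needed.  A frame of maximal size is
  full.
\<close>

lemma full_frame_exists:
  assumes "\<exists>W. P 0 W" and P: "\<And>k W. P k W \<Longrightarrow> nil_frame n k B W"
    and ext: "\<And>k W v a. P k W \<Longrightarrow> v \<in> carrier_mat 1 n \<Longrightarrow> a \<in> carrier_mat 1 k \<Longrightarrow> v * B = a * W \<Longrightarrow>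
      (\<And>b. b \<in> carrier_mat 1 k \<Longrightarrow> v \<noteq> b * W) \<Longrightarrow> \<exists>W'. P (k + 1) W'"
  shows "\<exists>k W. P k W \<and> full_frame n k B W"
proof -
  have b: "k \<le> n" if PW: "\<exists>W. P k W" for k
  proof -
    obtain W where "P k W" using PW by blast
    from P[OF this] have "rows_indep k n W" unfolding nil_frame_def by blast
    then show ?thesis by (rule rows_indep_le)
  qed
  define k where "k = (GREATEST k. \<exists>W. P k W)"
  have k: "\<exists>W. P k W" unfolding k_def by (rule GreatestI_nat[of "\<lambda>k. \<exists>W. P k W", OF assms(1)]) (use b in blast)
  have k': "\<not> (\<exists>W. P (k + 1) W)"
  proof
    assume "\<exists>W. P (k + 1) W"
    from Greatest_le_nat[of "\<lambda>k. \<exists>W. P k W", OF this] b have "k + 1 \<le> k" unfolding k_def by blast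
    then show False by simp
  qed
  obtain W where W: "P k W" using k by blast
  have "full_frame n k B W"
    unfolding full_frame_def
  proof (intro conjI ballI impI P[OF W])
    fix v assume v: "v \<in> carrier_mat 1 n" "\<exists>a\<in>carrier_mat 1 k. v * B = a * W"
    obtain a where a: "a \<in> carrier_mat 1 k" "v * B = a * W" using v(2) by blast
    show "\<exists>a\<in>carrier_mat 1 k. v = a * W"
    proof (rule ccontr)
      assume "\<not> ?thesis"
      then have "\<And>b. b \<in> carrier_mat 1 k \<Longrightarrow> v \<noteq> b * W" by blast
      from ext[OF W v(1) a this] k' show False by blast
    qed
  qed
  with W show ?thesis by blast
qed

lemma empty_nil_frame: "B \<in> carrier_mat n n \<Longrightarrow> nil_frame n 0 B (0\<^sub>m 0 n)"
  unfolding nil_frame_def rows_indep_def strictly_lower_def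
  by (intro conjI exI[of _ "0\<^sub>m 0 0"]) (auto intro!: eq_matI)

text \<open>
  A further row \<open>v\<close> with \<open>v B = a W\<close> is a real solution of a linear system over \<open>U\<close> that is not a
  combination of \<open>W\<close>.  It is a real combination of solutions over \<open>U\<close>, so one of these is not a combination
  of \<open>W\<close> either.
\<close>

lemma full_frame_over_subring:
  assumes U: "real_subring U" and B: "B \<in> carrier_mat n n" "elements_mat B \<subseteq> U"
  shows "\<exists>k W. elements_mat W \<subseteq> U \<and> full_frame n k B W"
proof -
  have "\<exists>k W. (nil_frame n k B W \<and> elements_mat W \<subseteq> U) \<and> full_frame n k B W"
  proof (rule full_frame_exists)
    show "\<exists>W. nil_frame n 0 B W \<and> elements_mat W \<subseteq> U"
      using empty_nil_frame[OF B(1)] elements_mat_subset_iff[of "0\<^sub>m 0 n" 0 n U]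
      by (intro exI[of _ "0\<^sub>m 0 n"] conjI) simp_all
    fix k W v a assume W: "nil_frame n k B W \<and> elements_mat W \<subseteq> U" and v: "v \<in> carrier_mat 1 n"
      and a: "a \<in> carrier_mat 1 k" "v * B = a * W" and nv: "\<And>b. b \<in> carrier_mat 1 k \<Longrightarrow> v \<noteq> b * W"
    have Wc: "W \<in> carrier_mat k n" using nil_frame_carrier W by blast
    \<comment> \<open>the system \<open>v B = a W\<close>, with \<open>v\<close> and \<open>a\<close> as unknowns\<close>
    define co where "co e i = (if i < n then B $$ (i, e) else - W $$ (i - n, e))" for e i
    define y where "y i = (if i < n then v $$ (0, i) else a $$ (0, i - n))" for i
    have co: "(\<Sum>i\<in>{..<n + k}. co e i * z i) = (\<Sum>i<n. z i * B $$ (i, e)) - (\<Sum>i<k. z (n + i) * W $$ (i, e))" for e z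
      unfolding sum_lessThan_add by (simp add: co_def sum_negf mult.commute)
    have "\<exists>(S :: real set) w b. finite S \<and> (\<forall>x\<in>S. \<forall>i\<in>{..<n + k}. w x i \<in> U) \<and>
      (\<forall>x\<in>S. \<forall>e\<in>{..<n}. (\<Sum>i\<in>{..<n + k}. co e i * w x i) = 0) \<and> (\<forall>i\<in>{..<n + k}. y i = (\<Sum>x\<in>S. b x * w x i))"
    proof (rule subring_solutions_span[OF U])
      show "co e i \<in> U" if "e \<in> {..<n}" "i \<in> {..<n + k}" for e i
        using that W B(2) unfolding co_def elements_mat_subset_iff[OF B(1)] elements_mat_subset_iff[OF Wc]
        by (auto intro: real_subringD(5)[OF U])
      show "(\<Sum>i\<in>{..<n + k}. co e i * y i) = 0" if "e \<in> {..<n}" for e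
      proof -
        have "(v * B) $$ (0, e) = (a * W) $$ (0, e)" using a(2) by simp
        then show ?thesis unfolding co using that
          by (simp add: mult_entry[OF v B(1)] mult_entry[OF a(1) Wc] y_def)
      qed
    qed auto
    then obtain S :: "real set" and w b where S: "finite S" "\<forall>x\<in>S. \<forall>i\<in>{..<n + k}. w x i \<in> U"
      "\<forall>x\<in>S. \<forall>e\<in>{..<n}. (\<Sum>i\<in>{..<n + k}. co e i * w x i) = 0" "\<forall>i\<in>{..<n + k}. y i = (\<Sum>x\<in>S. b x * w x i)"
      by (elim exE conjE)
    define vx where "vx x = mat 1 n (\<lambda>(i, j). w x j)" for x
    define ax where "ax x = mat 1 k (\<lambda>(i, j). w x (n + j))" for x
    have c: "vx x \<in> carrier_mat 1 n" "ax x \<in> carrier_mat 1 k" for x unfolding vx_def ax_def by auto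
    have eqx: "vx x * B = ax x * W" if "x \<in> S" for x
    proof (rule eq_matI)
      fix i j assume ij: "i < dim_row (ax x * W)" "j < dim_col (ax x * W)"
      then have i: "i = 0" "j < n" using c(2)[of x] Wc by auto
      have e1: "(vx x * B) $$ (0, j) = (\<Sum>l<n. vx x $$ (0, l) * B $$ (l, j))"
        by (rule mult_entry_row[OF c(1) B(1) i(2)])
      have e2: "(ax x * W) $$ (0, j) = (\<Sum>l<k. ax x $$ (0, l) * W $$ (l, j))"
        by (rule mult_entry_row[OF c(2) Wc i(2)])
      show "(vx x * B) $$ (i, j) = (ax x * W) $$ (i, j)"
        unfolding i(1) e1 e2 using S(3) that i(2) unfolding co by (simp add: vx_def ax_def)
    qed (use B Wc in \<open>auto simp: vx_def ax_def\<close>)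
    have "\<exists>x\<in>S. \<forall>d\<in>carrier_mat 1 k. vx x \<noteq> d * W"
    proof (rule ccontr)
      assume "\<not> ?thesis"
      then have "\<forall>x\<in>S. \<exists>d. d \<in> carrier_mat 1 k \<and> vx x = d * W" by blast
      from bchoice[OF this] obtain d where d: "\<forall>x\<in>S. d x \<in> carrier_mat 1 k \<and> vx x = d x * W" by (elim exE)
      define d' where "d' = mat 1 k (\<lambda>e. \<Sum>x\<in>S. b x * d x $$ e)"
      have d'c: "d' \<in> carrier_mat 1 k" unfolding d'_def by simp
      have "v = d' * W"
      proof (rule eq_matI)
        fix i j assume "i < dim_row (d' * W)" "j < dim_col (d' * W)"
        then have i: "i = 0" "j < n" using d'c Wc by auto
        have "v $$ (0, j) = (\<Sum>x\<in>S. b x * w x j)"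
          using S(4)[rule_format, of j] i unfolding y_def by simp
        also have "\<dots> = (\<Sum>x\<in>S. b x * (d x * W) $$ (0, j))"
        proof (intro sum.cong refl)
          fix x assume "x \<in> S"
          then have "(d x * W) $$ (0, j) = vx x $$ (0, j)" using d by simp
          then show "b x * w x j = b x * (d x * W) $$ (0, j)" using i by (simp add: vx_def)
        qed
        also have "\<dots> = (\<Sum>x\<in>S. b x * (\<Sum>l<k. d x $$ (0, l) * W $$ (l, j)))"
          using d i by (intro sum.cong) (auto simp: mult_entry_row[OF _ Wc])
        also have "\<dots> = (\<Sum>l<k. (\<Sum>x\<in>S. b x * d x $$ (0, l)) * W $$ (l, j))"
          unfolding sum_distrib_left sum_distrib_right by (subst sum.swap) (simp add: mult.assoc)
        also have "\<dots> = (d' * W) $$ (0, j)"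
          unfolding mult_entry_row[OF d'c Wc i(2)] by (simp add: d'_def)
        finally show "v $$ (i, j) = (d' * W) $$ (i, j)" using i by simp
      qed (use v d'c Wc in auto)
      with nv[OF d'c] show False by blast
    qed
    then obtain x where x: "x \<in> S" "\<And>d. d \<in> carrier_mat 1 k \<Longrightarrow> vx x \<noteq> d * W" by blast
    have fr: "nil_frame n (k + 1) B (W @\<^sub>r vx x)"
      using nil_frame_extend[OF B(1) _ c(1) x(2) c(2) eqx[OF x(1)]] W by blast
    have Wv: "W @\<^sub>r vx x \<in> carrier_mat (k + 1) n" using carrier_append_rows[OF Wc c(1)] .
    have "(W @\<^sub>r vx x) $$ (i, j) \<in> U" if ij: "i < k + 1" "j < n" for i j
    proof (cases "i < k")
      case True
      then show ?thesis using W ij unfolding append_rows_entry[OF Wc c(1) ij] elements_mat_subset_iff[OF Wc] by simp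
    next
      case False
      then have "vx x $$ (i - k, j) = w x j" using ij unfolding vx_def by simp
      then show ?thesis using S(2) x(1) ij False unfolding append_rows_entry[OF Wc c(1) ij] by simp
    qed
    then have "elements_mat (W @\<^sub>r vx x) \<subseteq> U"
      unfolding elements_mat_subset_iff[OF Wv] by blast
    with fr show "\<exists>W'. nil_frame n (k + 1) B W' \<and> elements_mat W' \<subseteq> U" by blast
  qed auto
  then show ?thesis by blast
qed

lemma strictly_lower_pow:
  assumes T: "strictly_lower k T" and "i < k" "j < k" "i < j + p"
  shows "(T ^\<^sub>m p) $$ (i, j) = 0"
  using assms(2-)
proof (induction p arbitrary: i j)
  case 0
  have Tc: "T \<in> carrier_mat k k" using T unfolding strictly_lower_def by blast
  then show ?case using 0 by auto
next
  case (Suc p)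
  have Tc: "T \<in> carrier_mat k k" using T unfolding strictly_lower_def by blast
  have "(T ^\<^sub>m p) $$ (i, l) * T $$ (l, j) = 0" if l: "l < k" for l
  proof (cases "l \<le> j")
    case True
    then show ?thesis using T l Suc.prems unfolding strictly_lower_def by auto
  next
    case False
    then show ?thesis using Suc.IH[OF Suc.prems(1) l] Suc.prems by auto
  qed
  then show ?case
    unfolding pow_mat.simps mult_entry[OF pow_carrier_mat[OF Tc] Tc Suc.prems(1,2)]
    by (intro sum.neutral ballI) simp
qed

lemma intertwine_pow:
  fixes B :: "real mat"
  assumes W: "W \<in> carrier_mat k n" and B: "B \<in> carrier_mat n n" and T: "T \<in> carrier_mat k k" and e: "W * B = T * W"
  shows "W * (B ^\<^sub>m p) = (T ^\<^sub>m p) * W"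
proof (induction p)
  case 0
  then show ?case using W B T by auto
next
  case (Suc p)
  note Bp = pow_carrier_mat[OF B, of p] and Tp = pow_carrier_mat[OF T, of p]
  have "W * (B ^\<^sub>m Suc p) = (W * (B ^\<^sub>m p)) * B" using assoc_mult_mat[OF W Bp B] by simp
  also have "\<dots> = (T ^\<^sub>m p) * (W * B)" unfolding Suc.IH using assoc_mult_mat[OF Tp W B] by simp
  also have "\<dots> = (T ^\<^sub>m Suc p) * W" unfolding e using assoc_mult_mat[OF Tp T W] by simp
  finally show ?case .
qed

lemma nil_frame_pow:
  assumes B: "B \<in> carrier_mat n n" and W: "nil_frame n k B W"
  shows "W * (B ^\<^sub>m k) = 0\<^sub>m k n"
proof -
  have Wc: "W \<in> carrier_mat k n" using nil_frame_carrier[OF W] .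
  obtain T where T: "T \<in> carrier_mat k k" "strictly_lower k T" "W * B = T * W"
    using W unfolding nil_frame_def strictly_lower_def by blast
  have "T ^\<^sub>m k = 0\<^sub>m k k"
    using strictly_lower_pow[OF T(2)] pow_carrier_mat[OF T(1), of k] by (intro eq_matI) auto
  then show ?thesis using intertwine_pow[OF Wc B T(1,3), of k] left_mult_zero_mat[OF Wc] by simp
qed

lemma full_frame_pow:
  assumes B: "B \<in> carrier_mat n n" and W: "full_frame n k B W"
    and v: "v \<in> carrier_mat 1 n" and a: "a \<in> carrier_mat 1 k" "v * (B ^\<^sub>m p) = a * W"
  shows "\<exists>b\<in>carrier_mat 1 k. v = b * W"
  using a
proof (induction p arbitrary: a)
  case 0
  then show ?case using v B by auto
next
  case (Suc p)
  note Bp = pow_carrier_mat[OF B, of p]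
  note vB = mult_carrier_mat[OF v Bp]
  have "(v * (B ^\<^sub>m p)) * B = a * W" using Suc.prems assoc_mult_mat[OF v Bp B] by simp
  then have "\<exists>b\<in>carrier_mat 1 k. v * (B ^\<^sub>m p) = b * W"
    using W vB Suc.prems(1) unfolding full_frame_def by blast
  then show ?case using Suc.IH by blast
qed

text \<open>
  A nonzero row orthogonal to all rows of \<open>W\<close> exists as long as there are fewer than the dimension.
\<close>

lemma complete_rows:
  assumes "rows_indep k (r + k) W"
  shows "\<exists>X\<in>carrier_mat r (r + k). rows_indep (r + k) (r + k) (X @\<^sub>r W)"
  using assms
proof (induction r arbitrary: k W)
  case 0
  have W: "W \<in> carrier_mat k k" using 0 unfolding rows_indep_def by simp
  have "0\<^sub>m 0 k @\<^sub>r W = W" unfolding append_rows_def using W by (intro eq_matI) auto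
  then show ?case using 0 by (intro bexI[of _ "0\<^sub>m 0 k"]) auto
next
  case (Suc r)
  let ?n = "Suc r + k"
  have W: "W \<in> carrier_mat k ?n" using Suc.prems unfolding rows_indep_def by blast
  have WT: "W\<^sup>T \<in> carrier_mat ?n k" using W by simp
  obtain c where c: "c \<in> carrier_mat 1 ?n" "c \<noteq> 0\<^sub>m 1 ?n" "c * W\<^sup>T = 0\<^sub>m 1 k"
    by (rule homogeneous_solution[OF WT]) auto
  have cT: "c\<^sup>T \<in> carrier_mat ?n 1" using c by simp
  have Wc: "W * c\<^sup>T = 0\<^sub>m k 1"
  proof -
    have "(c * W\<^sup>T)\<^sup>T = W * c\<^sup>T" using transpose_mult[OF c(1) WT] by simp
    then show ?thesis using c(3) by simp
  qed
  have "rows_indep (1 + k) ?n (c @\<^sub>r W)"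
  proof (rule rows_indep_appendI[OF c(1) Suc.prems])
    fix x b assume x: "x \<in> carrier_mat 1 1" and b: "b \<in> carrier_mat 1 k" and e: "x * c = b * W"
    have "(x * c) * c\<^sup>T = b * (W * c\<^sup>T)" unfolding e using assoc_mult_mat[OF b W cT] .
    also have "\<dots> = 0\<^sub>m 1 1" unfolding Wc using b by (rule right_mult_zero_mat)
    finally have z: "x * (c * c\<^sup>T) = 0\<^sub>m 1 1" using assoc_mult_mat[OF x c(1) cT] by simp
    have cc: "c * c\<^sup>T \<in> carrier_mat 1 1" using mult_carrier_mat[OF c(1) cT] .
    have "(c * c\<^sup>T) $$ (0, 0) = (\<Sum>j<?n. (c $$ (0, j))\<^sup>2)"
      using c by (simp add: mult_entry[OF c(1) cT] power2_eq_square del: sum.lessThan_Suc)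
    moreover have "(\<Sum>j<?n. (c $$ (0, j))\<^sup>2) \<noteq> 0"
    proof
      assume "(\<Sum>j<?n. (c $$ (0, j))\<^sup>2) = 0"
      then have "\<forall>j\<in>{..<?n}. (c $$ (0, j))\<^sup>2 = 0" by (subst (asm) sum_nonneg_eq_0_iff) auto
      then have "c = 0\<^sub>m 1 ?n" using c(1) by (intro eq_matI) auto
      with c(2) show False by blast
    qed
    moreover have "(x $$ (0, 0) \<cdot>\<^sub>m (c * c\<^sup>T)) $$ (0, 0) = 0"
      using z unfolding one_by_one_mult[OF x cc] by simp
    then have "x $$ (0, 0) * (c * c\<^sup>T) $$ (0, 0) = 0" using c by simp
    ultimately have "x $$ (0, 0) = 0" by simp
    then show "x = 0\<^sub>m 1 1" using x by (intro eq_matI) auto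
  qed
  then have "rows_indep (Suc k) (r + Suc k) (c @\<^sub>r W)" by simp
  from Suc.IH[OF this] obtain X where X: "X \<in> carrier_mat r (r + Suc k)"
    "rows_indep (r + Suc k) (r + Suc k) (X @\<^sub>r (c @\<^sub>r W))" by blast
  have "X @\<^sub>r (c @\<^sub>r W) = (X @\<^sub>r c) @\<^sub>r W"
    using X(1) c(1) W unfolding append_rows_def by (intro eq_matI) auto
  moreover have "X @\<^sub>r c \<in> carrier_mat (Suc r) ?n"
    using carrier_append_rows[of X r ?n c 1] X(1) c(1) by simp
  ultimately show ?case using X(2) by (intro bexI[of _ "X @\<^sub>r c"]) auto
qed

text \<open>
  An invertible \<open>J\<close> has no generalized kernel; this separates the two parts of the Fitting decomposition.
\<close>

lemma mult_pow_zero: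
  fixes J :: "real mat"
  assumes J: "J \<in> carrier_mat r r" "det J \<noteq> 0" and c: "c \<in> carrier_mat 1 r" "c * (J ^\<^sub>m p) = 0\<^sub>m 1 r"
  shows "c = 0\<^sub>m 1 r"
  using c(2)
proof (induction p)
  case 0
  then show ?case using c J by auto
next
  case (Suc p)
  note Jp = pow_carrier_mat[OF J(1), of p]
  have "(c * (J ^\<^sub>m p)) * J = 0\<^sub>m 1 r" using Suc.prems assoc_mult_mat[OF c(1) Jp J(1)] by simp
  then have "c * (J ^\<^sub>m p) = 0\<^sub>m 1 r"
    using J(2) mult_carrier_mat[OF c(1) Jp] unfolding det_nonzero_rows_indep[OF J(1)] rows_indep_def by blast
  then show ?case using Suc.IH by blast
qed

text \<open>
  The Fitting decomposition.  If \<open>L0\<close> completes \<open>W\<close> to a basis and \<open>L0 B = J L0 + Y W\<close>, then \<open>J\<close> is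
  invertible because \<open>W\<close> is full.  As \<open>W B\<^sup>k = 0\<close>, the rows \<open>X = L0 B\<^sup>k\<close> satisfy \<open>X B = J X\<close>.
\<close>

lemma full_frame_complement:
  assumes B: "B \<in> carrier_mat n n" and W: "full_frame n k B W" and n: "n = r + k"
  shows "\<exists>X\<in>carrier_mat r n. \<exists>J\<in>carrier_mat r r. det J \<noteq> 0 \<and> X * B = J * X \<and> rows_indep n n (X @\<^sub>r W)"
proof -
  have fr: "nil_frame n k B W" and Wi: "rows_indep k n W" using W unfolding full_frame_def nil_frame_def by auto
  have Wc: "W \<in> carrier_mat k n" using nil_frame_carrier[OF fr] .
  obtain L0 where L0: "L0 \<in> carrier_mat r n" "rows_indep n n (L0 @\<^sub>r W)"
    using complete_rows[of k r W] Wi n by auto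
  define L where "L = L0 @\<^sub>r W"
  have L: "L \<in> carrier_mat n n" using L0(2) unfolding L_def rows_indep_def by blast
  have dL: "det L \<noteq> 0" using L0(2) det_nonzero_rows_indep[OF L] unfolding L_def by blast
  note iL = minv_carrier[OF L]
  have C: "L0 * B * minv L \<in> carrier_mat r (r + k)"
    using mult_carrier_mat[OF mult_carrier_mat[OF L0(1) B] iL] n by simp
  obtain J Y where J: "J \<in> carrier_mat r r" and Y: "Y \<in> carrier_mat r k"
    and JY: "(L0 * B * minv L) * (L0 @\<^sub>r W) = J * L0 + Y * W"
    using split_cols[OF C L0(1) Wc] by (elim bexE conjE) (rule that)
  have L0B: "L0 * B = J * L0 + Y * W"
  proof -
    have "(L0 * B * minv L) * L = (L0 * B) * (minv L * L)"
      by (rule assoc_mult_mat[OF mult_carrier_mat[OF L0(1) B] iL L])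
    also have "\<dots> = L0 * B" unfolding minv_left[OF L dL]
      by (rule right_mult_one_mat[OF mult_carrier_mat[OF L0(1) B]])
    finally show ?thesis using JY unfolding L_def[symmetric] by simp
  qed
  have zero: "c = 0\<^sub>m 1 r" if c: "c \<in> carrier_mat 1 r" "a \<in> carrier_mat 1 k" "c * L0 = a * W" for c a
    by (rule rows_indep_append_left[OF _ L0(1) Wc c]) (use L0(2) n in auto)
  have dJ: "det J \<noteq> 0"
    unfolding det_nonzero_rows_indep[OF J] rows_indep_def
  proof (intro conjI ballI impI J)
    fix c assume c: "c \<in> carrier_mat 1 r" "c * J = 0\<^sub>m 1 r"
    have cY: "c * Y \<in> carrier_mat 1 k" using mult_carrier_mat[OF c(1) Y] .
    have "(c * L0) * B = c * (J * L0 + Y * W)" using assoc_mult_mat[OF c(1) L0(1) B] L0B by simp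
    also have "\<dots> = c * (J * L0) + c * (Y * W)"
      by (rule mult_add_distrib_mat[OF c(1) mult_carrier_mat[OF J L0(1)] mult_carrier_mat[OF Y Wc]])
    also have "c * (J * L0) = 0\<^sub>m 1 n"
      using assoc_mult_mat[OF c(1) J L0(1)] c(2) left_mult_zero_mat[OF L0(1), of 1] by simp
    also have "0\<^sub>m 1 n + c * (Y * W) = (c * Y) * W"
      using assoc_mult_mat[OF c(1) Y Wc] mult_carrier_mat[OF cY Wc] by simp
    finally have "\<exists>a\<in>carrier_mat 1 k. (c * L0) * B = a * W" using cY by blast
    then obtain a where "a \<in> carrier_mat 1 k" "c * L0 = a * W"
      using W mult_carrier_mat[OF c(1) L0(1)] unfolding full_frame_def by blast
    with zero[OF c(1)] show "c = 0\<^sub>m 1 r" by blast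
  qed
  define Bk where "Bk = B ^\<^sub>m k"
  have Bk: "Bk \<in> carrier_mat n n" unfolding Bk_def using pow_carrier_mat[OF B] .
  have comm: "B * Bk = Bk * B"
    unfolding Bk_def using intertwine_pow[OF B B B refl, of k] by simp
  define X where "X = L0 * Bk"
  have X: "X \<in> carrier_mat r n" unfolding X_def using mult_carrier_mat[OF L0(1) Bk] .
  have "X * B = (L0 * B) * Bk"
    unfolding X_def using assoc_mult_mat[OF L0(1) Bk B] assoc_mult_mat[OF L0(1) B Bk] comm by simp
  also have "\<dots> = (J * L0) * Bk + (Y * W) * Bk"
    unfolding L0B by (rule add_mult_distrib_mat[OF mult_carrier_mat[OF J L0(1)] mult_carrier_mat[OF Y Wc] Bk])
  also have "(J * L0) * Bk = J * X" unfolding X_def by (rule assoc_mult_mat[OF J L0(1) Bk])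
  also have "(Y * W) * Bk = 0\<^sub>m r n"
    using assoc_mult_mat[OF Y Wc Bk] nil_frame_pow[OF B fr] right_mult_zero_mat[OF Y] unfolding Bk_def by simp
  also have "J * X + 0\<^sub>m r n = J * X" using mult_carrier_mat[OF J X] by (rule right_add_zero_mat)
  finally have XB: "X * B = J * X" .
  have "rows_indep (r + k) n (X @\<^sub>r W)"
  proof (rule rows_indep_appendI[OF X Wi])
    fix c a assume c: "c \<in> carrier_mat 1 r" and a: "a \<in> carrier_mat 1 k" "c * X = a * W"
    have "(c * L0) * (B ^\<^sub>m k) = a * W" using a(2) assoc_mult_mat[OF c L0(1) Bk] unfolding X_def Bk_def by simp
    from full_frame_pow[OF B W mult_carrier_mat[OF c L0(1)] a(1) this]
    show "c = 0\<^sub>m 1 r" using zero[OF c] by blast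
  qed
  then show ?thesis using X J dJ XB n by blast
qed

text \<open>
  A combination of \<open>X\<close> that lies in the span of \<open>W\<close> is killed by a power of \<open>B\<close>, hence by a power
  of \<open>J\<close>.
\<close>

lemma invertible_part_indep_frame:
  assumes B: "B \<in> carrier_mat n n" and X: "rows_indep r n X" and J: "J \<in> carrier_mat r r" "det J \<noteq> 0"
    and e: "X * B = J * X" and W: "nil_frame n k B W"
  shows "rows_indep (r + k) n (X @\<^sub>r W)"
proof (rule rows_indep_appendI)
  show Xc: "X \<in> carrier_mat r n" using X unfolding rows_indep_def by blast
  show "rows_indep k n W" using W unfolding nil_frame_def by blast
  have Wc: "W \<in> carrier_mat k n" using nil_frame_carrier[OF W] .
  fix a b assume a: "a \<in> carrier_mat 1 r" and b: "b \<in> carrier_mat 1 k" and eq: "a * X = b * W"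
  note Bk = pow_carrier_mat[OF B, of k] and Jk = pow_carrier_mat[OF J(1), of k]
  have "(a * (J ^\<^sub>m k)) * X = a * (X * (B ^\<^sub>m k))"
    using assoc_mult_mat[OF a Jk Xc] intertwine_pow[OF Xc B J(1) e, of k] by simp
  also have "\<dots> = b * (W * (B ^\<^sub>m k))"
    using assoc_mult_mat[OF a Xc Bk] assoc_mult_mat[OF b Wc Bk] eq by simp
  also have "\<dots> = 0\<^sub>m 1 n" unfolding nil_frame_pow[OF B W] using b by (rule right_mult_zero_mat)
  finally have "a * (J ^\<^sub>m k) = 0\<^sub>m 1 r" using rows_indepD[OF X mult_carrier_mat[OF a Jk]] by blast
  then show "a = 0\<^sub>m 1 r" by (rule mult_pow_zero[OF J a])
qed

text \<open>
  If \<open>c X R = 0\<close> then \<open>c J\<^sup>l X = c X A\<^sup>l = c X R S = 0\<close>, and \<open>J\<close> is invertible.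
\<close>

lemma rows_indep_intertwiner:
  assumes A: "A \<in> carrier_mat n n" and X: "rows_indep r n X" and J: "J \<in> carrier_mat r r" "det J \<noteq> 0"
    and e: "X * A = J * X" and R: "R \<in> carrier_mat n n" and S: "S \<in> carrier_mat n n" and l: "A ^\<^sub>m l = R * S"
  shows "rows_indep r n (X * R)"
  unfolding rows_indep_def
proof (intro conjI ballI impI)
  have Xc: "X \<in> carrier_mat r n" using X unfolding rows_indep_def by blast
  show XR: "X * R \<in> carrier_mat r n" using mult_carrier_mat[OF Xc R] .
  fix c assume c: "c \<in> carrier_mat 1 r" "c * (X * R) = 0\<^sub>m 1 n"
  note Jl = pow_carrier_mat[OF J(1), of l]
  have "(c * (J ^\<^sub>m l)) * X = c * (X * (R * S))"
    using assoc_mult_mat[OF c(1) Jl Xc] intertwine_pow[OF Xc A J(1) e, of l] l by simp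
  also have "\<dots> = (c * (X * R)) * S"
    using assoc_mult_mat[OF Xc R S] assoc_mult_mat[OF c(1) XR S] by simp
  also have "\<dots> = 0\<^sub>m 1 n" unfolding c(2) using S by (rule left_mult_zero_mat)
  finally have "c * (J ^\<^sub>m l) = 0\<^sub>m 1 r" using rows_indepD[OF X mult_carrier_mat[OF c(1) Jl]] by blast
  then show "c = 0\<^sub>m 1 r" by (rule mult_pow_zero[OF J c(1)])
qed

lemma shift_equivalentD:
  assumes "shift_equivalent B A" "A \<in> carrier_mat n n" "B \<in> carrier_mat n n"
  obtains R S l where "R \<in> carrier_mat n n" "S \<in> carrier_mat n n" "A ^\<^sub>m l = R * S" "B ^\<^sub>m l = S * R"
    "A * R = R * B" "B * S = S * A"
  using assms unfolding shift_equivalent_def by auto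

text \<open>
  The intertwiner \<open>R\<close> carries the invertible part of \<open>A\<close> injectively to \<open>B\<close>, where it is
  independent of the nilpotent part; this bounds the size of the latter.
\<close>

lemma full_frame_size_le:
  assumes A: "A \<in> carrier_mat n n" and B: "B \<in> carrier_mat n n" and R: "R \<in> carrier_mat n n" and S: "S \<in> carrier_mat n n"
    and l: "A ^\<^sub>m l = R * S" and AR: "A * R = R * B"
    and W: "full_frame n k A W" and W': "nil_frame n k' B W'"
  shows "k' \<le> k"
proof -
  have "k \<le> n" using W rows_indep_le unfolding full_frame_def nil_frame_def by blast
  then have n: "n = (n - k) + k" by simp
  have Wc: "W \<in> carrier_mat k n" using W nil_frame_carrier unfolding full_frame_def by blast
  obtain X J where X: "X \<in> carrier_mat (n - k) n" and J: "J \<in> carrier_mat (n - k) (n - k)" "det J \<noteq> 0"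
    and e: "X * A = J * X" and XW: "rows_indep n n (X @\<^sub>r W)"
    using full_frame_complement[OF A W n] by blast
  have "rows_indep (n - k) n X"
    unfolding rows_indep_def
  proof (intro conjI ballI impI X)
    fix c assume c: "c \<in> carrier_mat 1 (n - k)" "c * X = 0\<^sub>m 1 n"
    show "c = 0\<^sub>m 1 (n - k)"
      by (rule rows_indep_append_left[OF _ X Wc c(1), of "0\<^sub>m 1 k"])
         (use XW n c(2) left_mult_zero_mat[OF Wc, of 1] in auto)
  qed
  then have XR: "rows_indep (n - k) n (X * R)" by (rule rows_indep_intertwiner[OF A _ J e R S l])
  have "(X * R) * B = J * (X * R)"
    using assoc_mult_mat[OF X R B] AR assoc_mult_mat[OF X A R] e assoc_mult_mat[OF J(1) X R] by simp
  from rows_indep_le[OF invertible_part_indep_frame[OF B XR J this W']] n show ?thesis by simp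
qed

lemma full_frame_size_unique:
  assumes "shift_equivalent B A" "A \<in> carrier_mat n n" "B \<in> carrier_mat n n"
    "full_frame n k A W" "full_frame n k' B W'"
  shows "k' = k"
proof -
  obtain R S l where RS: "R \<in> carrier_mat n n" "S \<in> carrier_mat n n" "A ^\<^sub>m l = R * S" "B ^\<^sub>m l = S * R"
    "A * R = R * B" "B * S = S * A"
    by (rule shift_equivalentD[OF assms(1-3)])
  have "nil_frame n k A W" "nil_frame n k' B W'" using assms(4,5) unfolding full_frame_def by auto
  then show ?thesis
    using full_frame_size_le[OF assms(2,3) RS(1,2,3,5) assms(4)] full_frame_size_le[OF assms(3,2) RS(2,1,4,6) assms(5)]
    by (simp add: le_antisym)
qed

section \<open>Limits of intertwiners and of orthonormal rows\<close>

text \<open>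
  Bolzano-Weierstrass for finitely many sequences at once.
\<close>

lemma bounded_family_subsequence:
  fixes f :: "'i \<Rightarrow> nat \<Rightarrow> real"
  assumes "finite I" "\<And>i j. i \<in> I \<Longrightarrow> \<bar>f i j\<bar> \<le> b"
  shows "\<exists>\<sigma>. strict_mono \<sigma> \<and> (\<forall>i\<in>I. convergent (\<lambda>j. f i (\<sigma> j)))"
  using assms
proof (induction I rule: finite_induct)
  case empty
  show ?case by (rule exI[of _ id]) (auto simp: strict_mono_def)
next
  case (insert x I)
  then obtain \<sigma> where s: "strict_mono \<sigma>" "\<forall>i\<in>I. convergent (\<lambda>j. f i (\<sigma> j))" by auto
  have "bounded (range (\<lambda>j. f x (\<sigma> j)))"
    unfolding bounded_iff using insert.prems[of x] by auto
  from bounded_imp_convergent_subsequence[OF this] obtain l \<tau> where t: "strict_mono \<tau>" "((\<lambda>j. f x (\<sigma> j)) \<circ> \<tau>) \<longlonglongrightarrow> l"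
    by blast
  have "convergent (\<lambda>j. f i ((\<sigma> \<circ> \<tau>) j))" if i: "i \<in> insert x I" for i
  proof (cases "i = x")
    case True
    then show ?thesis using t(2) unfolding convergent_def comp_def by blast
  next
    case False
    then have "convergent (\<lambda>j. f i (\<sigma> j))" using i s(2) by blast
    from convergent_subseq_convergent[OF this t(1)] show ?thesis by (simp add: comp_def)
  qed
  then show ?case using strict_mono_o[OF s(1) t(1)] by blast
qed

text \<open>
  Orthonormality bounds all entries by one, so that sequences of bases have convergent subsequences,
  and it is preserved in the limit, so that the limit is again a basis.
\<close>

definition orthonormal_rows :: "nat \<Rightarrow> nat \<Rightarrow> real mat \<Rightarrow> bool" where
  "orthonormal_rows d n w \<longleftrightarrow> w \<in> carrier_mat d n \<and> w * w\<^sup>T = 1\<^sub>m d"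

lemma orthonormal_rows_entry:
  assumes "orthonormal_rows d n w" "i < d" "j < d"
  shows "(\<Sum>l<n. w $$ (i, l) * w $$ (j, l)) = (if i = j then 1 else 0)"
proof -
  have w: "w \<in> carrier_mat d n" "w\<^sup>T \<in> carrier_mat n d" using assms unfolding orthonormal_rows_def by auto
  have "(w * w\<^sup>T) $$ (i, j) = (\<Sum>l<n. w $$ (i, l) * w $$ (j, l))"
    unfolding mult_entry[OF w assms(2,3)] using w assms by (intro sum.cong) auto
  then show ?thesis using assms unfolding orthonormal_rows_def by simp
qed

lemma orthonormal_rowsI:
  assumes w: "w \<in> carrier_mat d n"
    and e: "\<And>i j. i < d \<Longrightarrow> j < d \<Longrightarrow> (\<Sum>l<n. w $$ (i, l) * w $$ (j, l)) = (if i = j then 1 else 0)"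
  shows "orthonormal_rows d n w"
proof -
  have wT: "w\<^sup>T \<in> carrier_mat n d" using w by auto
  have "w * w\<^sup>T = 1\<^sub>m d"
  proof (rule eq_matI)
    fix i j assume "i < dim_row (1\<^sub>m d :: real mat)" "j < dim_col (1\<^sub>m d :: real mat)"
    then have ij: "i < d" "j < d" by auto
    have "(w * w\<^sup>T) $$ (i, j) = (\<Sum>l<n. w $$ (i, l) * w $$ (j, l))"
      unfolding mult_entry[OF w wT ij] using w ij by (intro sum.cong) auto
    then show "(w * w\<^sup>T) $$ (i, j) = 1\<^sub>m d $$ (i, j)" using e[OF ij] ij by simp
  qed (use w in auto)
  then show ?thesis unfolding orthonormal_rows_def using w by blast
qed

lemma orthonormal_rows_bound:
  assumes "orthonormal_rows d n w" "i < d" "l < n"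
  shows "\<bar>w $$ (i, l)\<bar> \<le> 1"
proof -
  have "(w $$ (i, l))\<^sup>2 \<le> (\<Sum>l<n. (w $$ (i, l))\<^sup>2)"
    using assms(3) by (intro member_le_sum[of l "{..<n}" "\<lambda>l. (w $$ (i, l))\<^sup>2"]) auto
  also have "\<dots> = 1" using orthonormal_rows_entry[OF assms(1,2,2)] by (simp add: power2_eq_square)
  finally show ?thesis using abs_le_square_iff[of "w $$ (i, l)" 1] by simp
qed

lemma orthonormal_rows_indep:
  assumes "orthonormal_rows d n w" shows "rows_indep d n w"
  unfolding rows_indep_def
proof (intro conjI ballI impI)
  have w: "w \<in> carrier_mat d n" "w\<^sup>T \<in> carrier_mat n d" "w * w\<^sup>T = 1\<^sub>m d" using assms unfolding orthonormal_rows_def by auto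
  show "w \<in> carrier_mat d n" by (rule w)
  fix c assume c: "c \<in> carrier_mat 1 d" "c * w = 0\<^sub>m 1 n"
  have "c = c * (w * w\<^sup>T)" unfolding w(3) using c(1) by simp
  also have "\<dots> = (c * w) * w\<^sup>T" using assoc_mult_mat[OF c(1) w(1,2)] by simp
  also have "\<dots> = 0\<^sub>m 1 d" unfolding c(2) using w(2) by (rule left_mult_zero_mat)
  finally show "c = 0\<^sub>m 1 d" .
qed

text \<open>
  One step of the Gram-Schmidt process.
\<close>

lemma orthonormal_rows_extend:
  assumes w: "orthonormal_rows d n w" and f: "f \<in> carrier_mat 1 n" "f \<noteq> 0\<^sub>m 1 n" "f * w\<^sup>T = 0\<^sub>m 1 d"
  shows "\<exists>x. x \<noteq> 0 \<and> orthonormal_rows (d + 1) n (w @\<^sub>r (x \<cdot>\<^sub>m f))"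
proof -
  have wc: "w \<in> carrier_mat d n" "w\<^sup>T \<in> carrier_mat n d" using w unfolding orthonormal_rows_def by auto
  define q where "q = (\<Sum>l<n. (f $$ (0, l))\<^sup>2)"
  have "q \<noteq> 0"
  proof
    assume "q = 0"
    then have "\<forall>l\<in>{..<n}. (f $$ (0, l))\<^sup>2 = 0" unfolding q_def by (subst (asm) sum_nonneg_eq_0_iff) auto
    then have "f = 0\<^sub>m 1 n" using f(1) by (intro eq_matI) auto
    with f(2) show False by blast
  qed
  moreover have "q \<ge> 0" unfolding q_def by (intro sum_nonneg) auto
  ultimately have q: "q > 0" by simp
  define x where "x = 1 / sqrt q"
  have x: "x \<noteq> 0" "x * x * q = 1" using q unfolding x_def by (auto simp: field_simps)
  have xf: "x \<cdot>\<^sub>m f \<in> carrier_mat 1 n" using f(1) by simp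
  have orth: "(\<Sum>l<n. f $$ (0, l) * w $$ (i, l)) = 0" if "i < d" for i
  proof -
    have "(f * w\<^sup>T) $$ (0, i) = (\<Sum>l<n. f $$ (0, l) * w $$ (i, l))"
      unfolding mult_entry_row[OF f(1) wc(2) that] using wc that by (intro sum.cong) auto
    then show ?thesis using f(3) that by simp
  qed
  have orth': "(\<Sum>l<n. w $$ (i, l) * (x * f $$ (0, l))) = 0" "(\<Sum>l<n. x * f $$ (0, l) * w $$ (i, l)) = 0" if "i < d" for i
  proof -
    have "(\<Sum>l<n. w $$ (i, l) * (x * f $$ (0, l))) = x * (\<Sum>l<n. f $$ (0, l) * w $$ (i, l))"
      unfolding sum_distrib_left by (intro sum.cong) auto
    then show "(\<Sum>l<n. w $$ (i, l) * (x * f $$ (0, l))) = 0" using orth[OF that] by simp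
    have "(\<Sum>l<n. x * f $$ (0, l) * w $$ (i, l)) = x * (\<Sum>l<n. f $$ (0, l) * w $$ (i, l))"
      unfolding sum_distrib_left by (intro sum.cong) auto
    then show "(\<Sum>l<n. x * f $$ (0, l) * w $$ (i, l)) = 0" using orth[OF that] by simp
  qed
  have self: "(\<Sum>l<n. x * f $$ (0, l) * (x * f $$ (0, l))) = 1"
  proof -
    have "(\<Sum>l<n. x * f $$ (0, l) * (x * f $$ (0, l))) = x * x * q"
      unfolding q_def sum_distrib_left by (intro sum.cong) (auto simp: power2_eq_square)
    then show ?thesis using x(2) by simp
  qed
  have ent: "(w @\<^sub>r (x \<cdot>\<^sub>m f)) $$ (i, l) = (if i < d then w $$ (i, l) else x * f $$ (0, l))" if "i < d + 1" "l < n" for i l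
    unfolding append_rows_entry[OF wc(1) xf that] using that f(1) by auto
  have "orthonormal_rows (d + 1) n (w @\<^sub>r (x \<cdot>\<^sub>m f))"
  proof (rule orthonormal_rowsI)
    show "w @\<^sub>r (x \<cdot>\<^sub>m f) \<in> carrier_mat (d + 1) n" using carrier_append_rows[OF wc(1) xf] .
    fix i j assume ij: "i < d + 1" "j < d + 1"
    have "(\<Sum>l<n. (w @\<^sub>r (x \<cdot>\<^sub>m f)) $$ (i, l) * (w @\<^sub>r (x \<cdot>\<^sub>m f)) $$ (j, l)) =
      (\<Sum>l<n. (if i < d then w $$ (i, l) else x * f $$ (0, l)) * (if j < d then w $$ (j, l) else x * f $$ (0, l)))"
      using ij by (intro sum.cong) (auto simp: ent)
    also have "\<dots> = (if i = j then 1 else 0)"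
      using ij orth' self orthonormal_rows_entry[OF w, of i j] by (cases "i < d"; cases "j < d") auto
    finally show "(\<Sum>l<n. (w @\<^sub>r (x \<cdot>\<^sub>m f)) $$ (i, l) * (w @\<^sub>r (x \<cdot>\<^sub>m f)) $$ (j, l)) = (if i = j then 1 else 0)" .
  qed
  with x(1) show ?thesis by blast
qed

lemma diff_zero_imp_eq_mat:
  fixes f :: "real mat" assumes "f \<in> carrier_mat nr nc" "g \<in> carrier_mat nr nc" "f - g = 0\<^sub>m nr nc"
  shows "f = g"
proof (rule eq_matI)
  fix i j assume ij: "i < dim_row g" "j < dim_col g"
  have "(f - g) $$ (i, j) = 0" unfolding assms(3) using ij assms(2) by simp
  then show "f $$ (i, j) = g $$ (i, j)" using ij by simp
qed (use assms in auto)

lemma orthogonal_component: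
  assumes w: "orthonormal_rows d n w" and v: "v \<in> carrier_mat 1 n"
  shows "v - (v * w\<^sup>T) * w \<in> carrier_mat 1 n" "(v - (v * w\<^sup>T) * w) * w\<^sup>T = 0\<^sub>m 1 d"
    "v - (v * w\<^sup>T) * w = 0\<^sub>m 1 n \<Longrightarrow> v = (v * w\<^sup>T) * w"
proof -
  have wc: "w \<in> carrier_mat d n" "w\<^sup>T \<in> carrier_mat n d" "w * w\<^sup>T = 1\<^sub>m d" using w unfolding orthonormal_rows_def by auto
  note vw = mult_carrier_mat[OF v wc(2)]
  note vww = mult_carrier_mat[OF vw wc(1)]
  show "v - (v * w\<^sup>T) * w \<in> carrier_mat 1 n" using minus_carrier_mat[OF vww] .
  have "(v - (v * w\<^sup>T) * w) * w\<^sup>T = v * w\<^sup>T - ((v * w\<^sup>T) * w) * w\<^sup>T"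
    by (rule minus_mult_distrib_mat[OF v vww wc(2)])
  also have "((v * w\<^sup>T) * w) * w\<^sup>T = v * w\<^sup>T"
    unfolding assoc_mult_mat[OF vw wc(1,2)] wc(3) by (rule right_mult_one_mat[OF vw])
  also have "v * w\<^sup>T - v * w\<^sup>T = 0\<^sub>m 1 d" using vw by (intro eq_matI) auto
  finally show "(v - (v * w\<^sup>T) * w) * w\<^sup>T = 0\<^sub>m 1 d" .
  show "v - (v * w\<^sup>T) * w = 0\<^sub>m 1 n \<Longrightarrow> v = (v * w\<^sup>T) * w" by (rule diff_zero_imp_eq_mat[OF v vww])
qed

lemma orthonormal_kernel_rows:
  assumes M: "M \<in> carrier_mat n p" and u: "rows_indep d n u" "u * M = 0\<^sub>m d p"
  shows "i \<le> d \<Longrightarrow> \<exists>w. orthonormal_rows i n w \<and> w * M = 0\<^sub>m i p"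
proof (induction i)
  case 0
  have "0\<^sub>m 0 n * M = 0\<^sub>m 0 p" using left_mult_zero_mat[OF M] .
  moreover have "orthonormal_rows 0 n (0\<^sub>m 0 n)" by (rule orthonormal_rowsI) auto
  ultimately show ?case by blast
next
  case (Suc i)
  then obtain w where w: "orthonormal_rows i n w" "w * M = 0\<^sub>m i p" by auto
  have wc: "w \<in> carrier_mat i n" "w\<^sup>T \<in> carrier_mat n i" using w unfolding orthonormal_rows_def by auto
  have uc: "u \<in> carrier_mat d n" using u(1) unfolding rows_indep_def by blast
  have "i < d" using Suc.prems by simp
  obtain c where c: "c \<in> carrier_mat 1 d" "c \<noteq> 0\<^sub>m 1 d" "c * (u * w\<^sup>T) = 0\<^sub>m 1 i"
    by (rule homogeneous_solution[OF mult_carrier_mat[OF uc wc(2)] \<open>i < d\<close>])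
  define f where "f = c * u"
  have f: "f \<in> carrier_mat 1 n" unfolding f_def using mult_carrier_mat[OF c(1) uc] .
  have f0: "f \<noteq> 0\<^sub>m 1 n" using rows_indepD[OF u(1) c(1)] c(2) unfolding f_def by blast
  have fw: "f * w\<^sup>T = 0\<^sub>m 1 i" using assoc_mult_mat[OF c(1) uc wc(2)] c(3) unfolding f_def by simp
  have fM: "f * M = 0\<^sub>m 1 p"
    using assoc_mult_mat[OF c(1) uc M] u(2) right_mult_zero_mat[OF c(1)] unfolding f_def by simp
  obtain x where x: "x \<noteq> 0" "orthonormal_rows (i + 1) n (w @\<^sub>r (x \<cdot>\<^sub>m f))"
    using orthonormal_rows_extend[OF w(1) f f0 fw] by blast
  have xf: "x \<cdot>\<^sub>m f \<in> carrier_mat 1 n" using f by simp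
  have "(x \<cdot>\<^sub>m f) * M = 0\<^sub>m 1 p"
    unfolding mult_smult_assoc_mat[OF f M] fM by (intro eq_matI) auto
  then have "(w @\<^sub>r (x \<cdot>\<^sub>m f)) * M = 0\<^sub>m i p @\<^sub>r 0\<^sub>m 1 p"
    unfolding append_rows_mult[OF wc(1) xf M] w(2) by simp
  also have "\<dots> = 0\<^sub>m (Suc i) p" unfolding append_rows_def by (intro eq_matI) auto
  finally show ?case using x(2) by auto
qed

text \<open>
  Orthonormal bases of the kernels have a convergent subsequence, whose limit is an orthonormal
  system of the same size in the limit kernel.  As the dimension of the kernel does not jump up in the limit,
  that system spans it, and \<open>x\<close> can be approximated with constant coefficients.
\<close>

lemma kernel_limit:
  assumes M: "mtends n p M M0 sequentially"
    and u: "\<And>j. \<exists>u. rows_indep d n u \<and> u * M j = 0\<^sub>m d p"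
    and max: "\<And>u. rows_indep (d + 1) n u \<Longrightarrow> u * M0 \<noteq> 0\<^sub>m (d + 1) p"
    and x: "x \<in> carrier_mat 1 n" "x * M0 = 0\<^sub>m 1 p"
  shows "\<exists>\<sigma> y. strict_mono (\<sigma> :: nat \<Rightarrow> nat) \<and> mtends 1 n y x sequentially \<and> (\<forall>j. y j * M (\<sigma> j) = 0\<^sub>m 1 p)"
proof -
  note Mc = mtendsD(1,2)[OF M]
  have "\<exists>w. orthonormal_rows d n w \<and> w * M j = 0\<^sub>m d p" for j
  proof -
    obtain u where "rows_indep d n u" "u * M j = 0\<^sub>m d p" using u by blast
    from orthonormal_kernel_rows[OF Mc(2) this order_refl] show ?thesis .
  qed
  then have "\<forall>j. \<exists>w. orthonormal_rows d n w \<and> w * M j = 0\<^sub>m d p" by blast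
  from choice[OF this] obtain w where w: "\<And>j. orthonormal_rows d n (w j)" "\<And>j. w j * M j = 0\<^sub>m d p" by blast
  have wc: "w j \<in> carrier_mat d n" "w j * (w j)\<^sup>T = 1\<^sub>m d" for j using w(1)[of j] unfolding orthonormal_rows_def by auto
  have "\<exists>\<sigma>. strict_mono \<sigma> \<and> (\<forall>e\<in>{..<d} \<times> {..<n}. convergent (\<lambda>j. w (\<sigma> j) $$ e))"
    by (rule bounded_family_subsequence[where b = 1]) (use orthonormal_rows_bound[OF w(1)] in auto)
  then obtain \<sigma> where s: "strict_mono \<sigma>" "\<forall>e\<in>{..<d} \<times> {..<n}. convergent (\<lambda>j. w (\<sigma> j) $$ e)" by blast
  define w0 where "w0 = mat d n (\<lambda>e. lim (\<lambda>j. w (\<sigma> j) $$ e))"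
  have w0c: "w0 \<in> carrier_mat d n" unfolding w0_def by simp
  have lw: "mtends d n (\<lambda>j. w (\<sigma> j)) w0 sequentially"
    by (rule mtendsI[OF w0c wc(1)]) (use s(2) in \<open>auto simp: w0_def convergent_LIMSEQ_iff\<close>)
  have lM: "mtends n p (\<lambda>j. M (\<sigma> j)) M0 sequentially"
    by (rule mtends_compose[OF M filterlim_subseq[OF s(1)]])
  have ow: "orthonormal_rows d n w0"
  proof (rule orthonormal_rowsI[OF w0c])
    fix i j assume ij: "i < d" "j < d"
    have "(\<lambda>m. \<Sum>l<n. w (\<sigma> m) $$ (i, l) * w (\<sigma> m) $$ (j, l)) \<longlonglongrightarrow> (\<Sum>l<n. w0 $$ (i, l) * w0 $$ (j, l))"
      using ij by (intro tendsto_sum tendsto_mult mtendsD(3)[OF lw]) auto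
    then have "(\<lambda>m :: nat. if i = j then 1 else 0) \<longlonglongrightarrow> (\<Sum>l<n. w0 $$ (i, l) * w0 $$ (j, l))"
      unfolding orthonormal_rows_entry[OF w(1) ij] .
    from LIMSEQ_unique[OF this tendsto_const] show "(\<Sum>l<n. w0 $$ (i, l) * w0 $$ (j, l)) = (if i = j then 1 else 0)" .
  qed
  have w0M: "w0 * M0 = 0\<^sub>m d p"
  proof (rule mtends_unique[OF mtends_mult[OF lw lM]])
    show "mtends d p (\<lambda>j. w (\<sigma> j) * M (\<sigma> j)) (0\<^sub>m d p) sequentially"
      unfolding w(2) by (rule mtends_const) simp
  qed simp
  have wT: "w0\<^sup>T \<in> carrier_mat n d" using w0c by simp
  note xw = mult_carrier_mat[OF x(1) wT]
  define f where "f = x - (x * w0\<^sup>T) * w0"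
  note oc = orthogonal_component[OF ow x(1), folded f_def]
  have f0: "f = 0\<^sub>m 1 n"
  proof (rule ccontr)
    assume "f \<noteq> 0\<^sub>m 1 n"
    then obtain y where y: "y \<noteq> 0" "orthonormal_rows (d + 1) n (w0 @\<^sub>r (y \<cdot>\<^sub>m f))"
      using orthonormal_rows_extend[OF ow oc(1) _ oc(2)] by blast
    have "f * M0 = x * M0 - ((x * w0\<^sup>T) * w0) * M0"
      unfolding f_def by (rule minus_mult_distrib_mat[OF x(1) mult_carrier_mat[OF xw w0c] Mc(1)])
    also have "((x * w0\<^sup>T) * w0) * M0 = 0\<^sub>m 1 p"
      using assoc_mult_mat[OF xw w0c Mc(1)] w0M right_mult_zero_mat[OF xw] by simp
    finally have fM: "f * M0 = 0\<^sub>m 1 p" using x(2) by simp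
    have yf: "y \<cdot>\<^sub>m f \<in> carrier_mat 1 n" using oc(1) by simp
    have "(y \<cdot>\<^sub>m f) * M0 = 0\<^sub>m 1 p"
      unfolding mult_smult_assoc_mat[OF oc(1) Mc(1)] fM by (intro eq_matI) auto
    then have "(w0 @\<^sub>r (y \<cdot>\<^sub>m f)) * M0 = 0\<^sub>m d p @\<^sub>r 0\<^sub>m 1 p"
      unfolding append_rows_mult[OF w0c yf Mc(1)] w0M by simp
    also have "\<dots> = 0\<^sub>m (d + 1) p" unfolding append_rows_def by (intro eq_matI) auto
    finally show False using max[OF orthonormal_rows_indep[OF y(2)]] by blast
  qed
  then have xe: "x = (x * w0\<^sup>T) * w0" by (rule oc(3))
  have "mtends 1 n (\<lambda>j. (x * w0\<^sup>T) * w (\<sigma> j)) x sequentially"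
    using mtends_mult[OF mtends_const[OF xw] lw] xe by simp
  moreover have "((x * w0\<^sup>T) * w (\<sigma> j)) * M (\<sigma> j) = 0\<^sub>m 1 p" for j
    using assoc_mult_mat[OF xw wc(1) Mc(2)] w(2) right_mult_zero_mat[OF xw] by simp
  ultimately show ?thesis using s(1) by (intro exI[of _ \<sigma>] exI[of _ "\<lambda>j. (x * w0\<^sup>T) * w (\<sigma> j)"]) blast
qed

text \<open>
  Writing \<open>X\<close> as one row turns \<open>X B = J X\<close> into a condition that the product with one square
  matrix vanishes, to which the result on kernels applies.
\<close>

definition flat :: "nat \<Rightarrow> nat \<Rightarrow> real mat \<Rightarrow> real mat" where
  "flat r n X = mat 1 (r * n) (\<lambda>(_, p). X $$ (p div n, p mod n))"

definition unflat :: "nat \<Rightarrow> nat \<Rightarrow> real mat \<Rightarrow> real mat" where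
  "unflat r n x = mat r n (\<lambda>(a, b). x $$ (0, a * n + b))"

text \<open>
  The matrix of the linear map \<open>X \<mapsto> X B - J X\<close> on flattened matrices.
\<close>

definition sylvester :: "nat \<Rightarrow> nat \<Rightarrow> real mat \<Rightarrow> real mat \<Rightarrow> real mat" where
  "sylvester r n J B = mat (r * n) (r * n) (\<lambda>(p, q).
     (if p div n = q div n then B $$ (p mod n, q mod n) else 0) -
     (if p mod n = q mod n then J $$ (q div n, p div n) else 0))"

lemma flat_index: "a < r \<Longrightarrow> b < n \<Longrightarrow> a * n + b < r * (n :: nat)"
proof -
  assume "a < r" "b < n"
  then have "a * n + b < a * n + n" by simp
  also have "\<dots> = (a + 1) * n" by simp
  also have "\<dots> \<le> r * n" using \<open>a < r\<close> by (intro mult_le_mono1) simp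
  finally show ?thesis .
qed

lemma flat_div: "p < r * (n :: nat) \<Longrightarrow> p div n < r" "p < r * n \<Longrightarrow> p mod n < n"
  by (auto simp: less_mult_imp_div_less intro: mod_less_divisor) (metis gr0I mod_less_divisor mult_0_right not_less_zero)

lemma sum_flat: "(\<Sum>p<r * (n :: nat). f p) = (\<Sum>a<r. \<Sum>b<n. f (a * n + b) :: real)"
proof -
  have "(\<Sum>p<r * n. f p) = (\<Sum>a<r. sum f {a * n..<a * n + n})" by (rule sum.nat_group[symmetric])
  also have "\<dots> = (\<Sum>a<r. \<Sum>b<n. f (a * n + b))"
  proof (rule sum.cong[OF refl])
    fix a show "sum f {a * n..<a * n + n} = (\<Sum>b<n. f (a * n + b))"
      using sum.shift_bounds_nat_ivl[of f 0 "a * n" n] by (simp add: add.commute atLeast0LessThan)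
  qed
  finally show ?thesis .
qed

lemma flat_sylvester:
  assumes X: "X \<in> carrier_mat r n" and B: "B \<in> carrier_mat n n" and J: "J \<in> carrier_mat r r"
  shows "flat r n X * sylvester r n J B = flat r n (X * B - J * X)"
proof (rule eq_matI)
  have c: "flat r n X \<in> carrier_mat 1 (r * n)" "sylvester r n J B \<in> carrier_mat (r * n) (r * n)"
    unfolding flat_def sylvester_def by auto
  fix i q assume "i < dim_row (flat r n (X * B - J * X))" "q < dim_col (flat r n (X * B - J * X))"
  then have i: "i = 0" and q: "q < r * n" unfolding flat_def by auto
  define a where "a = q div n"
  define b where "b = q mod n"
  have ab: "a < r" "b < n" using flat_div[OF q] unfolding a_def b_def by auto
  have "(flat r n X * sylvester r n J B) $$ (0, q) = (\<Sum>p<r * n. flat r n X $$ (0, p) * sylvester r n J B $$ (p, q))"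
    by (rule mult_entry_row[OF c q])
  also have "\<dots> = (\<Sum>a'<r. \<Sum>c'<n. X $$ (a', c') * ((if a' = a then B $$ (c', b) else 0) - (if c' = b then J $$ (a, a') else 0)))"
    unfolding sum_flat
  proof (intro sum.cong refl)
    fix a' c' assume "a' \<in> {..<r}" "c' \<in> {..<n}"
    then have ac: "a' < r" "c' < n" by auto
    show "flat r n X $$ (0, a' * n + c') * sylvester r n J B $$ (a' * n + c', q) =
      X $$ (a', c') * ((if a' = a then B $$ (c', b) else 0) - (if c' = b then J $$ (a, a') else 0))"
      unfolding flat_def sylvester_def using flat_index[OF ac] q ac by (simp add: a_def b_def)
  qed
  also have "\<dots> = (\<Sum>a'<r. \<Sum>c'<n. (if a' = a then X $$ (a', c') * B $$ (c', b) else 0)) -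
      (\<Sum>a'<r. \<Sum>c'<n. (if c' = b then J $$ (a, a') * X $$ (a', c') else 0))"
    unfolding sum_subtractf[symmetric] by (intro sum.cong refl) (simp add: algebra_simps)
  also have "(\<Sum>a'<r. \<Sum>c'<n. (if a' = a then X $$ (a', c') * B $$ (c', b) else 0)) = (\<Sum>c'<n. X $$ (a, c') * B $$ (c', b))"
    using ab by (subst sum.swap) simp
  also have "(\<Sum>a'<r. \<Sum>c'<n. (if c' = b then J $$ (a, a') * X $$ (a', c') else 0)) = (\<Sum>a'<r. J $$ (a, a') * X $$ (a', b))"
    using ab by simp
  also have "(\<Sum>c'<n. X $$ (a, c') * B $$ (c', b)) - (\<Sum>a'<r. J $$ (a, a') * X $$ (a', b)) = (X * B - J * X) $$ (a, b)"
    using ab mult_carrier_mat[OF X B] mult_carrier_mat[OF J X] X J by (simp add: mult_entry[OF X B] mult_entry[OF J X])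
  also have "\<dots> = flat r n (X * B - J * X) $$ (0, q)" unfolding flat_def using q by (simp add: a_def b_def)
  finally show "(flat r n X * sylvester r n J B) $$ (i, q) = flat r n (X * B - J * X) $$ (i, q)" unfolding i .
qed (auto simp: flat_def sylvester_def)

lemma flat_unflat:
  assumes "x \<in> carrier_mat 1 (r * n)" shows "flat r n (unflat r n x) = x"
  using assms flat_div unfolding flat_def unflat_def by (intro eq_matI) auto

lemma unflat_flat:
  assumes "X \<in> carrier_mat r n" shows "unflat r n (flat r n X) = X"
  using assms flat_index unfolding flat_def unflat_def by (intro eq_matI) auto

lemma flat_carrier: "flat r n X \<in> carrier_mat 1 (r * n)" "unflat r n x \<in> carrier_mat r n"
  "sylvester r n J B \<in> carrier_mat (r * n) (r * n)"
  unfolding flat_def unflat_def sylvester_def by auto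

lemma flat_zero: "flat r n (0\<^sub>m r n) = 0\<^sub>m 1 (r * n)"
  using flat_div unfolding flat_def by (intro eq_matI) auto

lemma sylvester_kernel:
  assumes X: "X \<in> carrier_mat r n" and B: "B \<in> carrier_mat n n" and J: "J \<in> carrier_mat r r"
  shows "flat r n X * sylvester r n J B = 0\<^sub>m 1 (r * n) \<longleftrightarrow> X * B = J * X"
proof
  note c = mult_carrier_mat[OF X B] mult_carrier_mat[OF J X]
  have mc: "X * B - J * X \<in> carrier_mat r n" using minus_carrier_mat[OF c(2)] .
  {
    assume "flat r n X * sylvester r n J B = 0\<^sub>m 1 (r * n)"
    then have "flat r n (X * B - J * X) = flat r n (0\<^sub>m r n)" unfolding flat_sylvester[OF assms] flat_zero .
    then have "unflat r n (flat r n (X * B - J * X)) = unflat r n (flat r n (0\<^sub>m r n))" by simp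
    then have "X * B - J * X = 0\<^sub>m r n" using unflat_flat[OF mc] unflat_flat[OF zero_carrier_mat] by simp
    then show "X * B = J * X" by (rule diff_zero_imp_eq_mat[OF c])
  }
  assume "X * B = J * X"
  then have "X * B - J * X = 0\<^sub>m r n" using c by (intro eq_matI) auto
  then show "flat r n X * sylvester r n J B = 0\<^sub>m 1 (r * n)" unfolding flat_sylvester[OF assms] flat_zero[symmetric] by simp
qed

lemma mtends_sylvester:
  assumes "mtends n n B B0 F"
  shows "mtends (r * n) (r * n) (\<lambda>j. sylvester r n J (B j)) (sylvester r n J B0) F"
proof (rule mtendsI)
  fix p q assume pq: "p < r * n" "q < r * n"
  have "((\<lambda>j. B j $$ (p mod n, q mod n)) \<longlongrightarrow> B0 $$ (p mod n, q mod n)) F"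
    using mtendsD(3)[OF assms] flat_div pq by blast
  then show "((\<lambda>j. sylvester r n J (B j) $$ (p, q)) \<longlongrightarrow> sylvester r n J B0 $$ (p, q)) F"
    unfolding sylvester_def using pq by (auto intro!: tendsto_diff)
qed (rule flat_carrier)+

text \<open>
  Right multiplication by \<open>R\<close> maps the solutions of \<open>X A = J X\<close> injectively to those of
  \<open>X B = J X\<close>.
\<close>

lemma intertwiner_space_transfer:
  assumes A: "A \<in> carrier_mat n n" and B: "B \<in> carrier_mat n n" and R: "R \<in> carrier_mat n n" and S: "S \<in> carrier_mat n n"
    and l: "A ^\<^sub>m l = R * S" and AR: "A * R = R * B" and J: "J \<in> carrier_mat r r" "det J \<noteq> 0"
    and u: "rows_indep d (r * n) u" "u * sylvester r n J A = 0\<^sub>m d (r * n)"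
  shows "\<exists>u'. rows_indep d (r * n) u' \<and> u' * sylvester r n J B = 0\<^sub>m d (r * n)"
proof -
  \<comment> \<open>right multiplication by R, on flattened matrices\<close>
  define P where "P = mat (r * n) (r * n) (\<lambda>(p, q). if p div n = q div n then R $$ (p mod n, q mod n) else 0)"
  have P: "P \<in> carrier_mat (r * n) (r * n)" unfolding P_def by simp
  have uc: "u \<in> carrier_mat d (r * n)" using u(1) unfolding rows_indep_def by blast
  have flatP: "flat r n X * P = flat r n (X * R)" if X: "X \<in> carrier_mat r n" for X
  proof (rule eq_matI)
    fix i q assume "i < dim_row (flat r n (X * R))" "q < dim_col (flat r n (X * R))"
    then have i: "i = 0" and q: "q < r * n" unfolding flat_def by auto
    define a where "a = q div n"
    define b where "b = q mod n"
    have ab: "a < r" "b < n" using flat_div[OF q] unfolding a_def b_def by auto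
    have "(flat r n X * P) $$ (0, q) = (\<Sum>p<r * n. flat r n X $$ (0, p) * P $$ (p, q))"
      by (rule mult_entry_row[OF flat_carrier(1) P q])
    also have "\<dots> = (\<Sum>a'<r. \<Sum>c'<n. (if a' = a then X $$ (a', c') * R $$ (c', b) else 0))"
      unfolding sum_flat
    proof (intro sum.cong refl)
      fix a' c' assume "a' \<in> {..<r}" "c' \<in> {..<n}"
      then have ac: "a' < r" "c' < n" by auto
      show "flat r n X $$ (0, a' * n + c') * P $$ (a' * n + c', q) = (if a' = a then X $$ (a', c') * R $$ (c', b) else 0)"
        unfolding flat_def P_def using flat_index[OF ac] q ac by (simp add: a_def b_def)
    qed
    also have "\<dots> = (\<Sum>c'<n. X $$ (a, c') * R $$ (c', b))" using ab by (subst sum.swap) simp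
    also have "\<dots> = (X * R) $$ (a, b)" using mult_entry[OF X R ab] by simp
    also have "\<dots> = flat r n (X * R) $$ (0, q)" unfolding flat_def using q by (simp add: a_def b_def)
    finally show "(flat r n X * P) $$ (i, q) = flat r n (X * R) $$ (i, q)" unfolding i .
  qed (auto simp: flat_def P_def)
  have key: "X * A = J * X" if "flat r n X = c * u" "X \<in> carrier_mat r n" "c \<in> carrier_mat 1 d" for c X
  proof -
    have "flat r n X * sylvester r n J A = c * (u * sylvester r n J A)"
      unfolding that(1) by (rule assoc_mult_mat[OF that(3) uc flat_carrier(3)])
    also have "\<dots> = 0\<^sub>m 1 (r * n)" unfolding u(2) using that(3) by (rule right_mult_zero_mat)
    finally show ?thesis unfolding sylvester_kernel[OF that(2) A J(1)] .
  qed
  have "rows_indep d (r * n) (u * P)"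
    unfolding rows_indep_def
  proof (intro conjI ballI impI)
    show uP: "u * P \<in> carrier_mat d (r * n)" using mult_carrier_mat[OF uc P] .
    fix c assume c: "c \<in> carrier_mat 1 d" "c * (u * P) = 0\<^sub>m 1 (r * n)"
    define X where "X = unflat r n (c * u)"
    have X: "X \<in> carrier_mat r n" unfolding X_def by (rule flat_carrier)
    have fX: "flat r n X = c * u" unfolding X_def by (rule flat_unflat[OF mult_carrier_mat[OF c(1) uc]])
    have XA: "X * A = J * X" by (rule key[OF fX X c(1)])
    have "flat r n (X * R) = flat r n (0\<^sub>m r n)"
      unfolding flatP[OF X, symmetric] fX flat_zero using assoc_mult_mat[OF c(1) uc P] c(2) by simp
    then have "X * R = 0\<^sub>m r n"
      using unflat_flat[OF mult_carrier_mat[OF X R]] unflat_flat[OF zero_carrier_mat[of r n]] by metis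
    then have "X * (R * S) = 0\<^sub>m r n" using assoc_mult_mat[OF X R S] left_mult_zero_mat[OF S] by simp
    then have JX: "(J ^\<^sub>m l) * X = 0\<^sub>m r n" using intertwine_pow[OF X A J(1) XA, of l] l by simp
    have X0: "X = 0\<^sub>m r n"
    proof -
      have Jl: "J ^\<^sub>m l \<in> carrier_mat r r" using pow_carrier_mat[OF J(1)] .
      have d: "det (J ^\<^sub>m l) \<noteq> 0"
        unfolding det_nonzero_rows_indep[OF Jl] rows_indep_def using Jl mult_pow_zero[OF J] by blast
      have "X = (minv (J ^\<^sub>m l) * (J ^\<^sub>m l)) * X" unfolding minv_left[OF Jl d] using X by simp
      also have "\<dots> = minv (J ^\<^sub>m l) * ((J ^\<^sub>m l) * X)" by (rule assoc_mult_mat[OF minv_carrier[OF Jl] Jl X])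
      also have "\<dots> = 0\<^sub>m r n" unfolding JX using minv_carrier[OF Jl] by (rule right_mult_zero_mat)
      finally show ?thesis .
    qed
    have "c * u = 0\<^sub>m 1 (r * n)" unfolding fX[symmetric] X0 flat_zero ..
    then show "c = 0\<^sub>m 1 d" using rows_indepD[OF u(1) c(1)] by blast
  qed
  moreover have "(u * P) * sylvester r n J B = 0\<^sub>m d (r * n)"
  proof (rule eq_matI)
    note uP = mult_carrier_mat[OF uc P]
    fix i q assume "i < dim_row (0\<^sub>m d (r * n) :: real mat)" "q < dim_col (0\<^sub>m d (r * n) :: real mat)"
    then have i: "i < d" and q: "q < r * n" by auto
    define c where "c = mat 1 d (\<lambda>(_, j). if j = i then 1 else 0 :: real)"
    have c: "c \<in> carrier_mat 1 d" unfolding c_def by simp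
    have pick: "(c * M) $$ (0, q) = M $$ (i, q)" if M: "M \<in> carrier_mat d (r * n)" for M
    proof -
      have "(c * M) $$ (0, q) = (\<Sum>j<d. (if j = i then M $$ (j, q) else 0))"
        unfolding mult_entry_row[OF c M q] by (intro sum.cong) (auto simp: c_def)
      then show ?thesis using i by simp
    qed
    define X where "X = unflat r n (c * u)"
    have X: "X \<in> carrier_mat r n" unfolding X_def by (rule flat_carrier)
    have fX: "flat r n X = c * u" unfolding X_def by (rule flat_unflat[OF mult_carrier_mat[OF c uc]])
    have XA: "X * A = J * X" by (rule key[OF fX X c])
    have XR: "X * R \<in> carrier_mat r n" using mult_carrier_mat[OF X R] .
    have "(X * R) * B = J * (X * R)"
      using assoc_mult_mat[OF X R B] AR assoc_mult_mat[OF X A R] XA assoc_mult_mat[OF J(1) X R] by simp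
    then have "flat r n (X * R) * sylvester r n J B = 0\<^sub>m 1 (r * n)" unfolding sylvester_kernel[OF XR B J(1)] .
    moreover have "flat r n (X * R) = c * (u * P)"
      unfolding flatP[OF X, symmetric] fX by (rule assoc_mult_mat[OF c uc P])
    ultimately have "c * ((u * P) * sylvester r n J B) = 0\<^sub>m 1 (r * n)"
      using assoc_mult_mat[OF c uP flat_carrier(3)] by simp
    then have "(c * ((u * P) * sylvester r n J B)) $$ (0, q) = 0" using q by simp
    then have "((u * P) * sylvester r n J B) $$ (i, q) = 0"
      unfolding pick[OF mult_carrier_mat[OF uP flat_carrier(3)]] .
    then show "((u * P) * sylvester r n J B) $$ (i, q) = 0\<^sub>m d (r * n) $$ (i, q)" using i q by simp
  qed (use uc flat_carrier(3)[of r n J B] in auto)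
  ultimately show ?thesis by blast
qed

text \<open>
  Shift equivalence makes the spaces of solutions of \<open>X B = J X\<close> at least as large as that
  for \<open>A\<close>, so that kernels converge.
\<close>

lemma intertwiner_limit:
  assumes B: "mtends n n B A sequentially" and se: "\<And>j. shift_equivalent (B j) A"
    and J: "J \<in> carrier_mat r r" "det J \<noteq> 0" and X: "X \<in> carrier_mat r n" "X * A = J * X"
  shows "\<exists>\<sigma> Y. strict_mono (\<sigma> :: nat \<Rightarrow> nat) \<and> mtends r n Y X sequentially \<and> (\<forall>j. Y j * B (\<sigma> j) = J * Y j)"
proof -
  note Bc = mtendsD(1,2)[OF B]
  define Q where "Q d \<longleftrightarrow> (\<exists>u. rows_indep d (r * n) u \<and> u * sylvester r n J A = 0\<^sub>m d (r * n))" for d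
  have "rows_indep 0 (r * n) (0\<^sub>m 0 (r * n))" unfolding rows_indep_def by (auto intro!: eq_matI)
  moreover have "0\<^sub>m 0 (r * n) * sylvester r n J A = 0\<^sub>m 0 (r * n)" using left_mult_zero_mat[OF flat_carrier(3)] .
  ultimately have Q0: "Q 0" unfolding Q_def by blast
  have Qb: "d \<le> r * n" if "Q d" for d using that rows_indep_le unfolding Q_def by blast
  define d where "d = Greatest Q"
  have Qd: "Q d" unfolding d_def by (rule GreatestI_nat[of Q, OF Q0]) (use Qb in blast)
  have nQ: "\<not> Q (d + 1)"
  proof
    assume "Q (d + 1)"
    from Greatest_le_nat[of Q, OF this] Qb have "d + 1 \<le> d" unfolding d_def by blast
    then show False by simp
  qed
  obtain u where u: "rows_indep d (r * n) u" "u * sylvester r n J A = 0\<^sub>m d (r * n)" using Qd unfolding Q_def by blast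
  have "\<exists>\<sigma> y. strict_mono (\<sigma> :: nat \<Rightarrow> nat) \<and> mtends 1 (r * n) y (flat r n X) sequentially \<and>
    (\<forall>j. y j * sylvester r n J (B (\<sigma> j)) = 0\<^sub>m 1 (r * n))"
  proof (rule kernel_limit[OF mtends_sylvester[OF B]])
    show "\<exists>u'. rows_indep d (r * n) u' \<and> u' * sylvester r n J (B j) = 0\<^sub>m d (r * n)" for j
    proof -
      obtain R S l where RS: "R \<in> carrier_mat n n" "S \<in> carrier_mat n n" "A ^\<^sub>m l = R * S" "B j ^\<^sub>m l = S * R"
        "A * R = R * B j" "B j * S = S * A"
        by (rule shift_equivalentD[OF se Bc])
      show ?thesis by (rule intertwiner_space_transfer[OF Bc RS(1,2,3,5) J u])
    qed
    show "u' * sylvester r n J A \<noteq> 0\<^sub>m (d + 1) (r * n)" if "rows_indep (d + 1) (r * n) u'" for u'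
      using that nQ unfolding Q_def by blast
    show "flat r n X * sylvester r n J A = 0\<^sub>m 1 (r * n)" unfolding sylvester_kernel[OF X(1) Bc(1) J(1)] by (rule X(2))
  qed (rule flat_carrier)
  then obtain \<sigma> y where s: "strict_mono (\<sigma> :: nat \<Rightarrow> nat)" and y: "mtends 1 (r * n) y (flat r n X) sequentially"
    and ker: "\<forall>j. y j * sylvester r n J (B (\<sigma> j)) = 0\<^sub>m 1 (r * n)" by blast
  note yc = mtendsD(2)[OF y]
  have "mtends r n (\<lambda>j. unflat r n (y j)) (unflat r n (flat r n X)) sequentially"
  proof (rule mtendsI)
    fix a b assume ab: "a < r" "b < n"
    show "(\<lambda>j. unflat r n (y j) $$ (a, b)) \<longlonglongrightarrow> unflat r n (flat r n X) $$ (a, b)"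
      unfolding unflat_def using mtendsD(3)[OF y, of 0 "a * n + b"] flat_index[OF ab] ab by simp
  qed (rule flat_carrier)+
  then have "mtends r n (\<lambda>j. unflat r n (y j)) X sequentially" unfolding unflat_flat[OF X(1)] .
  moreover have "unflat r n (y j) * B (\<sigma> j) = J * unflat r n (y j)" for j
    unfolding sylvester_kernel[OF flat_carrier(2) Bc(2) J(1), symmetric] flat_unflat[OF yc] using ker by blast
  ultimately show ?thesis using s by (intro exI[of _ \<sigma>] exI[of _ "\<lambda>j. unflat r n (y j)"]) blast
qed

text \<open>
  A new row may be replaced by its component orthogonal to the previous ones, since that changes it only
  by a vector in their span.
\<close>

lemma full_frame_orthonormal:
  assumes B: "B \<in> carrier_mat n n"
  shows "\<exists>k W. orthonormal_rows k n W \<and> full_frame n k B W"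
proof -
  have "\<exists>k W. (nil_frame n k B W \<and> orthonormal_rows k n W) \<and> full_frame n k B W"
  proof (rule full_frame_exists)
    have "orthonormal_rows 0 n (0\<^sub>m 0 n)" by (rule orthonormal_rowsI) auto
    then show "\<exists>W. nil_frame n 0 B W \<and> orthonormal_rows 0 n W" using empty_nil_frame[OF B] by blast
    fix k W v a assume W: "nil_frame n k B W \<and> orthonormal_rows k n W" and v: "v \<in> carrier_mat 1 n"
      and a: "a \<in> carrier_mat 1 k" "v * B = a * W" and nv: "\<And>b. b \<in> carrier_mat 1 k \<Longrightarrow> v \<noteq> b * W"
    have ow: "orthonormal_rows k n W" using W by blast
    have Wc: "W \<in> carrier_mat k n" "W\<^sup>T \<in> carrier_mat n k" using ow unfolding orthonormal_rows_def by auto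
    obtain T where T: "T \<in> carrier_mat k k" "W * B = T * W"
      using W unfolding nil_frame_def strictly_lower_def by blast
    define g where "g = v * W\<^sup>T"
    have g: "g \<in> carrier_mat 1 k" unfolding g_def using mult_carrier_mat[OF v Wc(2)] .
    note gW = mult_carrier_mat[OF g Wc(1)]
    define f where "f = v - g * W"
    note oc = orthogonal_component[OF ow v, folded g_def, folded f_def]
    have f0: "f \<noteq> 0\<^sub>m 1 n" using oc(3) nv[OF g] by blast
    obtain x where x: "x \<noteq> 0" "orthonormal_rows (k + 1) n (W @\<^sub>r (x \<cdot>\<^sub>m f))"
      using orthonormal_rows_extend[OF ow oc(1) f0 oc(2)] by blast
    have xf: "x \<cdot>\<^sub>m f \<in> carrier_mat 1 n" using oc(1) by simp
    have gT: "g * T \<in> carrier_mat 1 k" using mult_carrier_mat[OF g T(1)] .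
    have "f * B = v * B - (g * W) * B" unfolding f_def by (rule minus_mult_distrib_mat[OF v gW B])
    also have "(g * W) * B = (g * T) * W" using assoc_mult_mat[OF g Wc(1) B] T(2) assoc_mult_mat[OF g T(1) Wc(1)] by simp
    also have "v * B - (g * T) * W = (a - g * T) * W"
      unfolding a(2) by (rule minus_mult_distrib_mat[OF a(1) gT Wc(1), symmetric])
    finally have fB: "f * B = (a - g * T) * W" .
    have agT: "a - g * T \<in> carrier_mat 1 k" using minus_carrier_mat[OF gT] .
    have eq: "(x \<cdot>\<^sub>m f) * B = (x \<cdot>\<^sub>m (a - g * T)) * W"
      unfolding mult_smult_assoc_mat[OF oc(1) B] mult_smult_assoc_mat[OF agT Wc(1)] fB ..
    have notspan: "x \<cdot>\<^sub>m f \<noteq> b * W" if b: "b \<in> carrier_mat 1 k" for b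
    proof
      assume e: "x \<cdot>\<^sub>m f = b * W"
      have "join_cols ((- 1) \<cdot>\<^sub>m b) (1\<^sub>m 1) * (W @\<^sub>r (x \<cdot>\<^sub>m f)) = ((- 1) \<cdot>\<^sub>m b) * W + 1\<^sub>m 1 * (x \<cdot>\<^sub>m f)"
        by (rule join_cols(2)[OF _ _ Wc(1) xf]) (use b in auto)
      also have "\<dots> = 0\<^sub>m 1 n"
        unfolding mult_smult_assoc_mat[OF b Wc(1)] left_mult_one_mat[OF xf] e
        using mult_carrier_mat[OF b Wc(1)] b Wc(1) by (intro eq_matI) auto
      finally have z: "join_cols ((- 1) \<cdot>\<^sub>m b) (1\<^sub>m 1) = 0\<^sub>m 1 (k + 1)"
        using rows_indepD[OF orthonormal_rows_indep[OF x(2)] join_cols(1)[OF _ _ Wc(1) xf, of "(- 1) \<cdot>\<^sub>m b" 1 "1\<^sub>m 1"]] b by auto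
      have "join_cols ((- 1) \<cdot>\<^sub>m b) (1\<^sub>m 1) $$ (0, k) = 1" unfolding join_cols_def using b by auto
      with z show False by simp
    qed
    have "nil_frame n (k + 1) B (W @\<^sub>r (x \<cdot>\<^sub>m f))"
      by (rule nil_frame_extend[OF B _ xf notspan _ eq]) (use W agT in auto)
    with x(2) show "\<exists>W'. nil_frame n (k + 1) B W' \<and> orthonormal_rows (k + 1) n W'" by blast
  qed auto
  then show ?thesis by blast
qed

section \<open>Connectedness of the flags invariant under a nilpotent matrix\<close>

lemma conj_by_mult:
  assumes R: "R \<in> carrier_mat k k" "det R \<noteq> 0" and h: "h \<in> carrier_mat k k" "det h \<noteq> 0" and T: "T \<in> carrier_mat k k"
  shows "conj_by (R * h) T = conj_by R (conj_by h T)" "det (R * h) \<noteq> 0"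
proof -
  show d: "det (R * h) \<noteq> 0" using det_mult[OF R(1) h(1)] R(2) h(2) by simp
  note c = conj_by_carrier[OF h(1) T]
  note c2 = conj_by_carrier[OF R(1) c]
  have "(R * h) * T = R * (h * T)" by (rule assoc_mult_mat[OF R(1) h(1) T])
  also have "\<dots> = R * (conj_by h T * h)" unfolding conj_by_intertwines[OF h(1) T h(2)] ..
  also have "\<dots> = (R * conj_by h T) * h" by (rule assoc_mult_mat[OF R(1) c h(1), symmetric])
  also have "\<dots> = (conj_by R (conj_by h T) * R) * h" unfolding conj_by_intertwines[OF R(1) c R(2)] ..
  also have "\<dots> = conj_by R (conj_by h T) * (R * h)" by (rule assoc_mult_mat[OF c2 R(1) h(1)])
  finally show "conj_by (R * h) T = conj_by R (conj_by h T)"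
    by (rule conj_by_eq[OF mult_carrier_mat[OF R(1) h(1)] T c2 d])
qed

text \<open>
  Lower triangular with positive diagonal: a convex set of changes of basis that do not change
  the flag.
\<close>

definition lower_pos :: "nat \<Rightarrow> real mat \<Rightarrow> bool" where
  "lower_pos k l \<longleftrightarrow> l \<in> carrier_mat k k \<and> (\<forall>i<k. \<forall>j<k. i < j \<longrightarrow> l $$ (i, j) = 0) \<and> (\<forall>i<k. l $$ (i, i) > 0)"

lemma lower_pos_det: "lower_pos k l \<Longrightarrow> det l \<noteq> 0"
proof -
  assume l: "lower_pos k l"
  have "det l = prod_list (diag_mat l)"
    by (rule det_lower_triangular[of k]) (use l in \<open>auto simp: lower_pos_def\<close>)
  also have "\<dots> \<noteq> 0"
    using l unfolding prod_list_zero_iff diag_mat_def lower_pos_def by force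
  finally show ?thesis .
qed

text \<open>
  The columns of \<open>X\<close> are recovered from the last one backwards, as the diagonal of \<open>l\<close> has no zeros.
\<close>

lemma strictly_lower_cancel:
  assumes l: "lower_pos k l" and X: "X \<in> carrier_mat k k" and Xl: "strictly_lower k (X * l)"
  shows "strictly_lower k X"
proof -
  have lc: "l \<in> carrier_mat k k" using l unfolding lower_pos_def by blast
  have "X $$ (i, k - Suc d) = 0" if "i < k" "d < k" "i \<le> k - Suc d" for i d
    using that
  proof (induction d rule: less_induct)
    case (less d)
    define j where "j = k - Suc d"
    have j: "j < k" "i \<le> j" using less.prems unfolding j_def by auto
    have "(X * l) $$ (i, j) = 0" using Xl less.prems(1) j unfolding strictly_lower_def by blast
    then have "(\<Sum>m<k. X $$ (i, m) * l $$ (m, j)) = 0" unfolding mult_entry[OF X lc less.prems(1) j(1)] .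
    moreover have "(\<Sum>m<k. X $$ (i, m) * l $$ (m, j)) = (\<Sum>m<k. if m = j then X $$ (i, j) * l $$ (j, j) else 0)"
    proof (intro sum.cong refl)
      fix m assume m: "m \<in> {..<k}"
      consider "m < j" | "m = j" | "m > j" by linarith
      then show "X $$ (i, m) * l $$ (m, j) = (if m = j then X $$ (i, j) * l $$ (j, j) else 0)"
      proof cases
        case 1
        then show ?thesis using l m j unfolding lower_pos_def by auto
      next
        case 3
        then have e: "k - Suc (k - Suc m) = m" "k - Suc m < d" "k - Suc m < k" using m unfolding j_def by auto
        have "X $$ (i, m) = 0"
          using less.IH[of "k - Suc m"] e less.prems(1) 3 j by simp
        then show ?thesis using 3 by simp
      qed simp
    qed
    ultimately have "X $$ (i, j) * l $$ (j, j) = 0" using j by simp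
    moreover have "l $$ (j, j) > 0" using l j unfolding lower_pos_def by blast
    ultimately show ?case unfolding j_def by simp
  qed
  note key = this
  have "X $$ (i, j) = 0" if "i < k" "j < k" "i \<le> j" for i j
    using key[of i "k - Suc j"] that by simp
  then show ?thesis unfolding strictly_lower_def using X by blast
qed

lemma strictly_lower_mult:
  assumes l: "lower_pos k l" and T: "strictly_lower k T"
  shows "strictly_lower k (l * T)"
proof -
  have lc: "l \<in> carrier_mat k k" using l unfolding lower_pos_def by blast
  have Tc: "T \<in> carrier_mat k k" using T unfolding strictly_lower_def by blast
  have "(l * T) $$ (i, j) = 0" if ij: "i < k" "j < k" "i \<le> j" for i j
    unfolding mult_entry[OF lc Tc ij(1,2)]
  proof (intro sum.neutral ballI)
    fix m assume m: "m \<in> {..<k}"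
    show "l $$ (i, m) * T $$ (m, j) = 0"
    proof (cases "i < m")
      case True
      then show ?thesis using l m ij unfolding lower_pos_def by auto
    next
      case False
      then show ?thesis using T m ij unfolding strictly_lower_def by auto
    qed
  qed
  then show ?thesis unfolding strictly_lower_def using mult_carrier_mat[OF lc Tc] by blast
qed

text \<open>
  The bases in which \<open>T\<close> is strictly lower triangular, that is, those adapted to a full flag that
  \<open>T\<close> shifts down.
\<close>

definition adapted :: "nat \<Rightarrow> real mat \<Rightarrow> real mat \<Rightarrow> bool" where
  "adapted k T h \<longleftrightarrow> h \<in> carrier_mat k k \<and> det h \<noteq> 0 \<and> strictly_lower k (conj_by h T)"

definition adapted_join :: "nat \<Rightarrow> real mat \<Rightarrow> real mat \<Rightarrow> real mat \<Rightarrow> bool" where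
  "adapted_join k T h h' \<longleftrightarrow> (\<exists>g. mpath k k g \<and> g 0 = h \<and> g 1 = h' \<and> (\<forall>s\<in>{0..1}. adapted k T (g s)))"

definition mjoin :: "(real \<Rightarrow> real mat) \<Rightarrow> (real \<Rightarrow> real mat) \<Rightarrow> real \<Rightarrow> real mat" where
  "mjoin f g t = (if t \<le> 1 / 2 then f (2 * t) else g (2 * t - 1))"

lemma mpath_join:
  assumes f: "mpath nr nc f" and g: "mpath nr nc g" and "f 1 = g 0"
  shows "mpath nr nc (mjoin f g)"
  unfolding mpath_def
proof (intro conjI allI impI)
  show "mjoin f g x \<in> carrier_mat nr nc" for x using f g unfolding mpath_def mjoin_def by auto
  fix i j assume ij: "i < nr" "j < nc"
  have "path ((\<lambda>t. f t $$ (i, j)) +++ (\<lambda>t. g t $$ (i, j)))"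
    using f g ij assms(3) unfolding mpath_def by (intro path_join_imp) (auto simp: path_def pathfinish_def pathstart_def)
  moreover have "(\<lambda>t. f t $$ (i, j)) +++ (\<lambda>t. g t $$ (i, j)) = (\<lambda>t. mjoin f g t $$ (i, j))"
    unfolding joinpaths_def mjoin_def by auto
  ultimately show "continuous_on {0..1} (\<lambda>t. mjoin f g t $$ (i, j))" unfolding path_def by simp
qed

lemma mpath_reverse:
  assumes f: "mpath nr nc f" shows "mpath nr nc (\<lambda>t. f (1 - t))"
  unfolding mpath_def
proof (intro conjI allI impI)
  show "f (1 - x) \<in> carrier_mat nr nc" for x using f unfolding mpath_def by auto
  fix i j assume ij: "i < nr" "j < nc"
  have "path (reversepath (\<lambda>t. f t $$ (i, j)))" using f ij unfolding mpath_def path_reversepath by (auto simp: path_def)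
  then show "continuous_on {0..1} (\<lambda>t. f (1 - t) $$ (i, j))" unfolding path_def reversepath_def by simp
qed

lemma mjoin_ball:
  assumes "\<forall>t\<in>{0..1}. P (f t) (g t)" "\<forall>t\<in>{0..1}. P (f' t) (g' t)"
  shows "\<forall>t\<in>{0..1::real}. P (mjoin f f' t) (mjoin g g' t)"
  using assms unfolding mjoin_def by auto

lemma mjoin_ends: "mjoin f g 0 = f 0" "mjoin f g 1 = g 1"
  unfolding mjoin_def by auto

lemma adapted_join_trans:
  assumes "adapted_join k T h h'" "adapted_join k T h' h''"
  shows "adapted_join k T h h''"
proof -
  obtain g where g: "mpath k k g" "g 0 = h" "g 1 = h'" "\<forall>s\<in>{0..1}. adapted k T (g s)"
    using assms(1) unfolding adapted_join_def by blast
  obtain g' where g': "mpath k k g'" "g' 0 = h'" "g' 1 = h''" "\<forall>s\<in>{0..1}. adapted k T (g' s)"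
    using assms(2) unfolding adapted_join_def by blast
  have "mpath k k (mjoin g g')" by (rule mpath_join[OF g(1) g'(1)]) (use g g' in simp)
  moreover have "\<forall>s\<in>{0..1}. adapted k T (mjoin g g' s)"
    by (rule mjoin_ball[of "\<lambda>x y. adapted k T x", OF g(4) g'(4)])
  ultimately show ?thesis unfolding adapted_join_def using g(2) g'(3) mjoin_ends by (intro exI[of _ "mjoin g g'"]) simp
qed

lemma adapted_join_refl: "adapted k T h \<Longrightarrow> adapted_join k T h h"
  unfolding adapted_join_def by (intro exI[of _ "\<lambda>t. h"]) (auto intro: mpath_const simp: adapted_def)

lemma adapted_join_adapted: "adapted_join k T h h' \<Longrightarrow> adapted k T h'"
  unfolding adapted_join_def by force

lemma adapted_lower:
  assumes T: "T \<in> carrier_mat k k" and h: "adapted k T h" and l: "lower_pos k l"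
  shows "adapted k T (l * h)"
proof -
  have hc: "h \<in> carrier_mat k k" "det h \<noteq> 0" and sl: "strictly_lower k (conj_by h T)" using h unfolding adapted_def by auto
  have lc: "l \<in> carrier_mat k k" using l unfolding lower_pos_def by blast
  have ld: "det l \<noteq> 0" by (rule lower_pos_det[OF l])
  note c = conj_by_carrier[OF hc(1) T]
  have "strictly_lower k (conj_by l (conj_by h T))"
  proof (rule strictly_lower_cancel[OF l conj_by_carrier[OF lc c]])
    show "strictly_lower k (conj_by l (conj_by h T) * l)"
      unfolding conj_by_intertwines[OF lc c ld, symmetric] by (rule strictly_lower_mult[OF l sl])
  qed
  then show ?thesis
    unfolding adapted_def conj_by_mult(1)[OF lc ld hc T]
    using mult_carrier_mat[OF lc hc(1)] conj_by_mult(2)[OF lc ld hc T] by blast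
qed

text \<open>
  The straight line from the identity to \<open>l\<close> stays lower triangular with positive diagonal.
\<close>

lemma adapted_join_lower:
  assumes T: "T \<in> carrier_mat k k" and h: "adapted k T h" and l: "lower_pos k l"
  shows "adapted_join k T h (l * h)"
proof -
  have hc: "h \<in> carrier_mat k k" using h unfolding adapted_def by auto
  have lc: "l \<in> carrier_mat k k" using l unfolding lower_pos_def by blast
  define f where "f s = (1 - s) \<cdot>\<^sub>m 1\<^sub>m k + s \<cdot>\<^sub>m l" for s
  have f: "mpath k k f" unfolding f_def
    by (intro mpath_add mpath_smult mpath_const lc one_carrier_mat continuous_intros)
  have "lower_pos k (f s)" if "s \<in> {0..1}" for s
  proof -
    have "(1 - s) + s * l $$ (i, i) > 0" if "i < k" for i
      using \<open>s \<in> {0..1}\<close> l that unfolding lower_pos_def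
      by (cases "s = 0") (auto intro!: add_nonneg_pos)
    then show ?thesis using l unfolding lower_pos_def f_def by auto
  qed
  then have "\<forall>s\<in>{0..1}. adapted k T (f s * h)" using adapted_lower[OF T h] by blast
  moreover have "f 0 = 1\<^sub>m k" unfolding f_def using lc by (intro eq_matI) auto
  then have "f 0 * h = h" using hc by simp
  moreover have "f 1 = l" unfolding f_def using lc by (intro eq_matI) auto
  ultimately show ?thesis unfolding adapted_join_def
    by (intro exI[of _ "\<lambda>s. f s * h"] conjI mpath_mult[OF f mpath_const[OF hc]]) auto
qed

text \<open>
  A rotation in the plane of the basis vectors \<open>p\<close> and \<open>p + 1\<close>.
\<close>

definition rot :: "nat \<Rightarrow> nat \<Rightarrow> real \<Rightarrow> real \<Rightarrow> real mat" where
  "rot k p c s = mat k k (\<lambda>(i, j).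
     if i = p \<and> j = p then c else if i = p \<and> j = Suc p then s
     else if i = Suc p \<and> j = p then - s else if i = Suc p \<and> j = Suc p then c
     else if i = j then 1 else 0)"

lemma rot_carrier: "rot k p c s \<in> carrier_mat k k" unfolding rot_def by simp

lemma rot_mult_entry:
  assumes p: "Suc p < k" and M: "M \<in> carrier_mat k n" and ij: "i < k" "j < n"
  shows "(rot k p c s * M) $$ (i, j) =
    (if i = p then c * M $$ (p, j) + s * M $$ (Suc p, j)
     else if i = Suc p then - s * M $$ (p, j) + c * M $$ (Suc p, j) else M $$ (i, j))"
proof -
  have two: "(\<Sum>m<k. (if m = p then x m else if m = Suc p then y m else 0)) = x p + y (Suc p)" for x y :: "nat \<Rightarrow> real"
  proof -
    have "(\<Sum>m<k. (if m = p then x m else if m = Suc p then y m else 0)) =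
      (\<Sum>m<k. (if m = p then x m else 0) + (if m = Suc p then y m else 0))" by (intro sum.cong) auto
    then show ?thesis using p by (simp add: sum.distrib)
  qed
  have e: "(rot k p c s * M) $$ (i, j) = (\<Sum>m<k. rot k p c s $$ (i, m) * M $$ (m, j))"
    by (rule mult_entry[OF rot_carrier M ij])
  consider "i = p" | "i = Suc p" | "i \<noteq> p" "i \<noteq> Suc p" by blast
  then show ?thesis
  proof cases
    case 1
    have "(\<Sum>m<k. rot k p c s $$ (i, m) * M $$ (m, j)) =
      (\<Sum>m<k. (if m = p then c * M $$ (m, j) else if m = Suc p then s * M $$ (m, j) else 0))"
      using 1 p by (intro sum.cong) (auto simp: rot_def)
    then show ?thesis unfolding e two using 1 by simp
  next
    case 2
    have "(\<Sum>m<k. rot k p c s $$ (i, m) * M $$ (m, j)) =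
      (\<Sum>m<k. (if m = p then - s * M $$ (m, j) else if m = Suc p then c * M $$ (m, j) else 0))"
      using 2 p by (intro sum.cong) (auto simp: rot_def)
    then show ?thesis unfolding e two using 2 by simp
  next
    case 3
    have "(\<Sum>m<k. rot k p c s $$ (i, m) * M $$ (m, j)) = (\<Sum>m<k. (if m = i then M $$ (m, j) else 0))"
      using 3 p ij by (intro sum.cong) (auto simp: rot_def)
    then show ?thesis unfolding e using 3 ij by simp
  qed
qed

lemma rot_inverse:
  assumes p: "Suc p < k" and cs: "c * c + s * s = 1"
  shows "rot k p c s * rot k p c (- s) = 1\<^sub>m k"
proof (rule eq_matI)
  fix i j assume "i < dim_row (1\<^sub>m k :: real mat)" "j < dim_col (1\<^sub>m k :: real mat)"
  then have ij: "i < k" "j < k" by auto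
  show "(rot k p c s * rot k p c (- s)) $$ (i, j) = 1\<^sub>m k $$ (i, j)"
    unfolding rot_mult_entry[OF p rot_carrier ij] using ij p cs by (auto simp: rot_def algebra_simps)
qed (auto simp: rot_def)

lemma rot_transpose: "(rot k p c s)\<^sup>T = rot k p c (- s)"
  unfolding rot_def by (intro eq_matI) auto

lemma mult_rot_entry:
  assumes p: "Suc p < k" and M: "M \<in> carrier_mat n k" and ij: "i < n" "j < k"
  shows "(M * rot k p c (- s)) $$ (i, j) =
    (if j = p then c * M $$ (i, p) + s * M $$ (i, Suc p)
     else if j = Suc p then - s * M $$ (i, p) + c * M $$ (i, Suc p) else M $$ (i, j))"
proof -
  have MT: "M\<^sup>T \<in> carrier_mat k n" using M by simp
  have "(M * rot k p c (- s))\<^sup>T = rot k p c s * M\<^sup>T"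
    unfolding transpose_mult[OF M rot_carrier] using rot_transpose[of k p c "- s"] by simp
  moreover have "(M * rot k p c (- s)) $$ (i, j) = (M * rot k p c (- s))\<^sup>T $$ (j, i)"
    using ij mult_carrier_mat[OF M rot_carrier[of k p c "- s"]] by (simp add: carrier_matD[OF M] carrier_matD[OF rot_carrier])
  ultimately have "(M * rot k p c (- s)) $$ (i, j) = (rot k p c s * M\<^sup>T) $$ (j, i)" by simp
  then show ?thesis unfolding rot_mult_entry[OF p MT ij(2,1)] using M ij p by simp
qed

lemma conj_by_rot:
  assumes p: "Suc p < k" and cs: "c * c + s * s = 1" and M: "M \<in> carrier_mat k k" and ij: "i < k" "j < k"
  shows "conj_by (rot k p c s) M $$ (i, j) =
    (let N = (\<lambda>i j. if i = p then c * M $$ (p, j) + s * M $$ (Suc p, j)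
         else if i = Suc p then - s * M $$ (p, j) + c * M $$ (Suc p, j) else M $$ (i, j))
     in if j = p then c * N i p + s * N i (Suc p)
        else if j = Suc p then - s * N i p + c * N i (Suc p) else N i j)"
    "det (rot k p c s) \<noteq> 0"
proof -
  note mi = minv_unique[OF rot_carrier rot_carrier rot_inverse[OF p cs]]
  show "det (rot k p c s) \<noteq> 0" by (rule mi(1))
  have pk: "p < k" using p by simp
  show "conj_by (rot k p c s) M $$ (i, j) =
    (let N = (\<lambda>i j. if i = p then c * M $$ (p, j) + s * M $$ (Suc p, j)
         else if i = Suc p then - s * M $$ (p, j) + c * M $$ (Suc p, j) else M $$ (i, j))
     in if j = p then c * N i p + s * N i (Suc p)
        else if j = Suc p then - s * N i p + c * N i (Suc p) else N i j)"
    unfolding conj_by_def mi(2) mult_rot_entry[OF p mult_carrier_mat[OF rot_carrier M] ij] Let_def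
      rot_mult_entry[OF p M ij] rot_mult_entry[OF p M ij(1) pk] rot_mult_entry[OF p M ij(1) p] ..
qed

text \<open>
  If the entry of \<open>T\<close> at \<open>(p + 1, p)\<close> vanishes, then \<open>T\<close> maps the plane of the basis vectors \<open>p\<close> and
  \<open>p + 1\<close> into the span of the earlier ones, so every rotation of this plane keeps \<open>T\<close> strictly
  lower triangular.  The quarter turn exchanges the two vectors, up to a sign.
\<close>

lemma adapted_join_rot:
  assumes T: "T \<in> carrier_mat k k" and h: "adapted k T h" and p: "Suc p < k" and z: "conj_by h T $$ (Suc p, p) = 0"
  shows "adapted_join k T h (rot k p 0 1 * h)"
proof -
  have hc: "h \<in> carrier_mat k k" "det h \<noteq> 0" and sl: "strictly_lower k (conj_by h T)" using h unfolding adapted_def by auto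
  note c = conj_by_carrier[OF hc(1) T]
  define f where "f t = rot k p (cos (t * pi / 2)) (sin (t * pi / 2))" for t
  have f: "mpath k k f" unfolding f_def mpath_def
  proof (intro conjI allI impI)
    fix i j assume "i < k" "j < k"
    then show "continuous_on {0..1} (\<lambda>t. rot k p (cos (t * pi / 2)) (sin (t * pi / 2)) $$ (i, j))"
      unfolding rot_def
      by (cases "i = p"; cases "i = Suc p"; cases "j = p"; cases "j = Suc p"; cases "i = j") (auto intro!: continuous_intros)
  qed (rule rot_carrier)
  have "adapted k T (f t * h)" for t
  proof -
    have cs: "cos (t * pi / 2) * cos (t * pi / 2) + sin (t * pi / 2) * sin (t * pi / 2) = 1"
      using sin_cos_squared_add[of "t * pi / 2"] by (simp add: power2_eq_square)
    have fd: "det (f t) \<noteq> 0" unfolding f_def using conj_by_rot(2)[OF p cs c, of p p] p by simp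
    have fc: "f t \<in> carrier_mat k k" unfolding f_def by (rule rot_carrier)
    have "strictly_lower k (conj_by (f t) (conj_by h T))"
      unfolding strictly_lower_def
    proof (intro conjI allI impI)
      show "conj_by (f t) (conj_by h T) \<in> carrier_mat k k" by (rule conj_by_carrier[OF fc c])
      fix i j assume ij: "i < k" "j < k" "i \<le> j"
      have u: "conj_by h T $$ (a, b) = 0" if "a < k" "b < k" "a \<le> b" for a b
        using sl that unfolding strictly_lower_def by blast
      show "conj_by (f t) (conj_by h T) $$ (i, j) = 0"
        unfolding f_def conj_by_rot(1)[OF p cs c ij(1,2)] Let_def using u ij p z by auto
    qed
    then show ?thesis
      unfolding adapted_def conj_by_mult(1)[OF fc fd hc T]
      using mult_carrier_mat[OF fc hc(1)] conj_by_mult(2)[OF fc fd hc T] by blast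
  qed
  moreover have "f 0 * h = h"
  proof (rule eq_matI)
    fix i j assume "i < dim_row h" "j < dim_col h"
    then have ij: "i < k" "j < k" using hc by auto
    show "(f 0 * h) $$ (i, j) = h $$ (i, j)" unfolding f_def rot_mult_entry[OF p hc(1) ij] by auto
  qed (use hc rot_carrier in \<open>auto simp: f_def rot_def\<close>)
  moreover have "f 1 = rot k p 0 1" unfolding f_def by simp
  ultimately show ?thesis unfolding adapted_join_def
    by (intro exI[of _ "\<lambda>s. f s * h"] conjI mpath_mult[OF f mpath_const[OF hc(1)]]) auto
qed

text \<open>
  Neighbouring vectors are exchanged by quarter turns until the vector at \<open>p\<close> has arrived at \<open>q\<close>.
  It can pass the vectors in between because \<open>T\<close> maps it into the span of the first \<open>q\<close> ones.
\<close>

lemma adapted_move_down: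
  assumes T: "T \<in> carrier_mat k k" and h: "adapted k T h" and p: "q \<le> p" "p < k"
    and z: "\<And>j. q \<le> j \<Longrightarrow> j < k \<Longrightarrow> conj_by h T $$ (p, j) = 0"
  shows "\<exists>h'. adapted_join k T h h' \<and> (\<forall>j<k. h' $$ (q, j) = h $$ (p, j)) \<and> (\<forall>i<q. \<forall>j<k. h' $$ (i, j) = h $$ (i, j))"
  using h p z
proof (induction p arbitrary: h)
  case 0
  then show ?case using adapted_join_refl by (intro exI[of _ h]) auto
next
  case (Suc p)
  show ?case
  proof (cases "q = Suc p")
    case True
    then show ?thesis using Suc.prems(1) adapted_join_refl by (intro exI[of _ h]) auto
  next
    case False
    then have qp: "q \<le> p" using Suc.prems by simp
    have hc: "h \<in> carrier_mat k k" "det h \<noteq> 0" and sl: "strictly_lower k (conj_by h T)" using Suc.prems(1) unfolding adapted_def by auto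
    note c = conj_by_carrier[OF hc(1) T]
    have cs: "(0 :: real) * 0 + 1 * 1 = 1" by simp
    have pk: "p < k" using Suc.prems by simp
    define R where "R = rot k p 0 1"
    have Rc: "R \<in> carrier_mat k k" unfolding R_def by (rule rot_carrier)
    have Rd: "det R \<noteq> 0" unfolding R_def by (rule conj_by_rot(2)[OF Suc.prems(3) cs c pk pk])
    have j1: "adapted_join k T h (R * h)"
      unfolding R_def by (rule adapted_join_rot[OF T Suc.prems(1,3)]) (use Suc.prems(4)[OF qp pk] in simp)
    have z': "conj_by (R * h) T $$ (p, j) = 0" if j: "q \<le> j" "j < k" for j
      unfolding conj_by_mult(1)[OF Rc Rd hc T] unfolding R_def conj_by_rot(1)[OF Suc.prems(3) cs c pk j(2)] Let_def
      using Suc.prems(4) j qp pk Suc.prems(3) by auto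
    obtain h' where h': "adapted_join k T (R * h) h'" "\<forall>j<k. h' $$ (q, j) = (R * h) $$ (p, j)"
      "\<forall>i<q. \<forall>j<k. h' $$ (i, j) = (R * h) $$ (i, j)"
      using Suc.IH[OF adapted_join_adapted[OF j1] qp pk z'] by blast
    have "(R * h) $$ (p, j) = h $$ (Suc p, j)" if "j < k" for j
      unfolding R_def rot_mult_entry[OF Suc.prems(3) hc(1) pk that] by simp
    moreover have "(R * h) $$ (i, j) = h $$ (i, j)" if "i < q" "j < k" for i j
    proof -
      have "i < k" using that qp pk by simp
      then show ?thesis unfolding R_def rot_mult_entry[OF Suc.prems(3) hc(1) \<open>i < k\<close> that(2)] using that qp by simp
    qed
    ultimately show ?thesis using h' adapted_join_trans[OF j1 h'(1)] by (intro exI[of _ h']) simp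
  qed
qed

text \<open>
  Signs cannot be avoided, since the flags form a connected space but the bases do not: the determinant
  of a basis keeps its sign along a path.
\<close>

definition sign_fun :: "(nat \<Rightarrow> real) \<Rightarrow> bool" where
  "sign_fun s \<longleftrightarrow> (\<forall>i. s i = 1 \<or> s i = - 1)"

text \<open>
  Let the first \<open>q\<close> rows of \<open>h\<close> agree with those of \<open>g\<close> up to signs.  Expand row \<open>q\<close> of \<open>g\<close>
  in the basis \<open>h\<close> and let \<open>p \<ge> q\<close> be the last index that occurs.  A triangular move replaces row \<open>p\<close>
  of \<open>h\<close> by \<open>\<plusminus>\<close> this vector.  As \<open>T\<close> maps it into the span of the first \<open>q\<close> rows, it can then be moved
  to place \<open>q\<close>.
\<close>

lemma adapted_next_row:
  assumes T: "T \<in> carrier_mat k k" and h: "adapted k T h" and g: "adapted k T g" and q: "q < k"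
    and s: "sign_fun s" and rows: "\<And>i j. i < q \<Longrightarrow> j < k \<Longrightarrow> h $$ (i, j) = s i * g $$ (i, j)"
  shows "\<exists>h' s'. adapted_join k T h h' \<and> sign_fun s' \<and> (\<forall>i<Suc q. \<forall>j<k. h' $$ (i, j) = s' i * g $$ (i, j))"
proof -
  have hc: "h \<in> carrier_mat k k" "det h \<noteq> 0" and sl: "strictly_lower k (conj_by h T)" using h unfolding adapted_def by auto
  have gc: "g \<in> carrier_mat k k" "det g \<noteq> 0" and sg: "strictly_lower k (conj_by g T)" using g unfolding adapted_def by auto
  note ch = conj_by_carrier[OF hc(1) T] and cg = conj_by_carrier[OF gc(1) T]
  note ih = minv_carrier[OF hc(1)]
  define C where "C = g * minv h"
  have Cc: "C \<in> carrier_mat k k" unfolding C_def by (rule mult_carrier_mat[OF gc(1) ih])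
  have Ch: "C * h = g" unfolding C_def using assoc_mult_mat[OF gc(1) ih hc(1)] minv_left[OF hc] gc(1) by simp
  have Cd: "det C \<noteq> 0" using det_mult[OF Cc hc(1)] Ch gc(2) by auto
  have ss: "s i * s i = 1" for i using s unfolding sign_fun_def by (metis mult_1 mult_minus1 minus_minus)
  have Crow: "C $$ (i, j) = (if i = j then s i else 0)" if ij: "i < q" "j < k" for i j
  proof -
    have ik: "i < k" using ij q by simp
    have "C $$ (i, j) = (\<Sum>l<k. g $$ (i, l) * minv h $$ (l, j))" unfolding C_def by (rule mult_entry[OF gc(1) ih ik ij(2)])
    also have "\<dots> = (\<Sum>l<k. s i * (h $$ (i, l) * minv h $$ (l, j)))"
    proof (intro sum.cong refl)
      fix l assume "l \<in> {..<k}"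
      then have "h $$ (i, l) = s i * g $$ (i, l)" using rows ij by simp
      then have "s i * h $$ (i, l) = g $$ (i, l)" using ss[of i] by (simp add: mult.assoc[symmetric])
      then show "g $$ (i, l) * minv h $$ (l, j) = s i * (h $$ (i, l) * minv h $$ (l, j))" by (simp add: mult.assoc[symmetric])
    qed
    also have "\<dots> = s i * (h * minv h) $$ (i, j)"
      unfolding mult_entry[OF hc(1) ih ik ij(2)] by (simp add: sum_distrib_left)
    also have "\<dots> = (if i = j then s i else 0)" unfolding minv_right[OF hc] using ik ij by simp
    finally show ?thesis .
  qed
  have CT: "C * conj_by h T = conj_by g T * C"
  proof -
    have "(C * conj_by h T) * h = C * (h * T)"
      unfolding conj_by_intertwines[OF hc(1) T hc(2)] by (rule assoc_mult_mat[OF Cc ch hc(1)])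
    also have "\<dots> = g * T" using assoc_mult_mat[OF Cc hc(1) T] Ch by simp
    also have "\<dots> = (conj_by g T * C) * h"
      unfolding conj_by_intertwines[OF gc(1) T gc(2)] using assoc_mult_mat[OF cg Cc hc(1)] Ch by simp
    finally have "((C * conj_by h T) * h) * minv h = ((conj_by g T * C) * h) * minv h" by simp
    then show ?thesis
      using assoc_mult_mat[OF mult_carrier_mat[OF Cc ch] hc(1) ih] assoc_mult_mat[OF mult_carrier_mat[OF cg Cc] hc(1) ih]
        minv_right[OF hc] right_mult_one_mat[OF mult_carrier_mat[OF Cc ch]] right_mult_one_mat[OF mult_carrier_mat[OF cg Cc]] by simp
  qed
  \<comment> \<open>the first \<open>q\<close> rows of \<open>C\<close> span the first \<open>q\<close> coordinates, so row \<open>q\<close> of the invertible \<open>C\<close> must leave them\<close>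
  have ex: "\<exists>p. q \<le> p \<and> p < k \<and> C $$ (q, p) \<noteq> 0"
  proof (rule ccontr)
    assume "\<not> ?thesis"
    then have z: "\<And>p. q \<le> p \<Longrightarrow> p < k \<Longrightarrow> C $$ (q, p) = 0" by blast
    define d where "d = mat 1 k (\<lambda>(_, i). if i = q then 1 else if i < q then - s i * C $$ (q, i) else 0)"
    have d: "d \<in> carrier_mat 1 k" unfolding d_def by simp
    have "d * C = 0\<^sub>m 1 k"
    proof (rule eq_matI)
      fix i j assume "i < dim_row (0\<^sub>m 1 k :: real mat)" "j < dim_col (0\<^sub>m 1 k :: real mat)"
      then have i: "i = 0" and j: "j < k" by auto
      have "(d * C) $$ (0, j) = (\<Sum>i<k. d $$ (0, i) * C $$ (i, j))" by (rule mult_entry_row[OF d Cc j])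
      also have "\<dots> = (\<Sum>i<k. (if i = q then C $$ (q, j) else 0) + (if i = j then (if j < q then - C $$ (q, j) else 0) else 0))"
      proof (intro sum.cong refl)
        fix i assume i: "i \<in> {..<k}"
        consider "i = q" | "i < q" | "i > q" by linarith
        then show "d $$ (0, i) * C $$ (i, j) = (if i = q then C $$ (q, j) else 0) + (if i = j then (if j < q then - C $$ (q, j) else 0) else 0)"
        proof cases
          case 1
          then show ?thesis using i unfolding d_def by simp
        next
          case 2
          then show ?thesis using i j Crow[OF 2 j] ss[of i] unfolding d_def by (auto simp: mult.assoc mult.left_commute[of "s i"])
        next
          case 3
          then show ?thesis using i unfolding d_def by simp
        qed
      qed
      also have "\<dots> = 0" using q j z[of j] by (auto simp: sum.distrib not_less)
      finally show "(d * C) $$ (i, j) = 0\<^sub>m 1 k $$ (i, j)" using i j by simp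
    qed (use d Cc in auto)
    then have "d = 0\<^sub>m 1 k" using Cd d unfolding det_nonzero_rows_indep[OF Cc] rows_indep_def by blast
    then have "d $$ (0, q) = 0" using q by simp
    then show False unfolding d_def using q by simp
  qed
  define p where "p = (GREATEST p. q \<le> p \<and> p < k \<and> C $$ (q, p) \<noteq> 0)"
  have p: "q \<le> p" "p < k" "C $$ (q, p) \<noteq> 0"
    using GreatestI_ex_nat[OF ex, of k] unfolding p_def by auto
  have pz: "C $$ (q, j) = 0" if j: "p < j" "j < k" for j
  proof (rule ccontr)
    assume "C $$ (q, j) \<noteq> 0"
    then have "q \<le> j \<and> j < k \<and> C $$ (q, j) \<noteq> 0" using j p(1) by simp
    from Greatest_le_nat[of "\<lambda>p. q \<le> p \<and> p < k \<and> C $$ (q, p) \<noteq> 0", OF this, of k] have "j \<le> p" unfolding p_def by simp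
    with j show False by simp
  qed
  define e where "e = sgn (C $$ (q, p))"
  have e: "e = 1 \<or> e = - 1" "e * C $$ (q, p) > 0" using p(3) unfolding e_def by (auto simp: sgn_real_def)
  \<comment> \<open>the sign \<open>e\<close> makes the diagonal of \<open>l\<close> positive\<close>
  define l where "l = mat k k (\<lambda>(i, j). if i = p then e * C $$ (q, j) else if i = j then 1 else 0)"
  have lc: "l \<in> carrier_mat k k" unfolding l_def by simp
  have l: "lower_pos k l" unfolding lower_pos_def using lc e(2) p pz by (auto simp: l_def)
  define h1 where "h1 = l * h"
  have j1: "adapted_join k T h h1" unfolding h1_def by (rule adapted_join_lower[OF T h l])
  have h1: "adapted k T h1" by (rule adapted_join_adapted[OF j1])
  have h1c: "h1 \<in> carrier_mat k k" "det h1 \<noteq> 0" using h1 unfolding adapted_def by auto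
  have row_p: "h1 $$ (p, j) = e * g $$ (q, j)" if j: "j < k" for j
  proof -
    have "h1 $$ (p, j) = (\<Sum>m<k. e * (C $$ (q, m) * h $$ (m, j)))"
      unfolding h1_def mult_entry[OF lc hc(1) p(2) j] using p by (intro sum.cong) (auto simp: l_def)
    also have "\<dots> = e * (C * h) $$ (q, j)" unfolding mult_entry[OF Cc hc(1) q j] by (simp add: sum_distrib_left)
    finally show ?thesis unfolding Ch .
  qed
  have row_i: "h1 $$ (i, j) = h $$ (i, j)" if i: "i < k" "i \<noteq> p" and j: "j < k" for i j
  proof -
    have "h1 $$ (i, j) = (\<Sum>m<k. if m = i then h $$ (m, j) else 0)"
      unfolding h1_def mult_entry[OF lc hc(1) i(1) j] using i by (intro sum.cong) (auto simp: l_def)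
    then show ?thesis using i by simp
  qed
  have z: "conj_by h1 T $$ (p, j) = 0" if j: "q \<le> j" "j < k" for j
  proof -
    note ch1 = conj_by_carrier[OF h1c(1) T]
    note ld = lower_pos_det[OF l]
    have "conj_by h1 T = conj_by l (conj_by h T)" unfolding h1_def by (rule conj_by_mult(1)[OF lc ld hc T])
    then have eq: "l * conj_by h T = conj_by h1 T * l" using conj_by_intertwines[OF lc ch ld] by simp
    \<comment> \<open>row p of this product is supported on the columns below q\<close>
    have sup: "(l * conj_by h T) $$ (p, j) = 0" if j: "q \<le> j" "j < k" for j
    proof -
      have "(l * conj_by h T) $$ (p, j) = (\<Sum>m<k. e * (C $$ (q, m) * conj_by h T $$ (m, j)))"
        unfolding mult_entry[OF lc ch p(2) j(2)] using p by (intro sum.cong) (auto simp: l_def)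
      also have "\<dots> = e * (C * conj_by h T) $$ (q, j)" unfolding mult_entry[OF Cc ch q j(2)] by (simp add: sum_distrib_left)
      also have "(C * conj_by h T) $$ (q, j) = (\<Sum>m<k. conj_by g T $$ (q, m) * C $$ (m, j))"
        unfolding CT by (rule mult_entry[OF cg Cc q j(2)])
      also have "\<dots> = 0"
      proof (intro sum.neutral ballI)
        fix m assume m: "m \<in> {..<k}"
        show "conj_by g T $$ (q, m) * C $$ (m, j) = 0"
        proof (cases "m < q")
          case True
          then show ?thesis using Crow[OF True j(2)] j by simp
        next
          case False
          then show ?thesis using sg m q unfolding strictly_lower_def by simp
        qed
      qed
      finally show ?thesis by simp
    qed
    have low: "conj_by h1 T $$ (p, j) = 0" if "p \<le> j" "j < k" for j
      using h1 that p(2) unfolding adapted_def strictly_lower_def by blast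
    show ?thesis
    proof (cases "p \<le> j")
      case True
      then show ?thesis using low j by blast
    next
      case False
      have "(conj_by h1 T * l) $$ (p, j) = (\<Sum>m<k. if m = j then conj_by h1 T $$ (p, j) else 0)"
        unfolding mult_entry[OF ch1 lc p(2) j(2)]
        using False j p low by (intro sum.cong) (auto simp: l_def)
      then show ?thesis using sup[OF j] eq j by simp
    qed
  qed
  obtain h' where h': "adapted_join k T h1 h'" "\<forall>j<k. h' $$ (q, j) = h1 $$ (p, j)" "\<forall>i<q. \<forall>j<k. h' $$ (i, j) = h1 $$ (i, j)"
    using adapted_move_down[OF T h1 p(1,2) z] by blast
  have "\<forall>i<Suc q. \<forall>j<k. h' $$ (i, j) = (s(q := e)) i * g $$ (i, j)"
  proof (intro allI impI)
    fix i j assume i: "i < Suc q" and j: "j < k"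
    show "h' $$ (i, j) = (s(q := e)) i * g $$ (i, j)"
    proof (cases "i = q")
      case True
      then show ?thesis using h'(2) row_p j by simp
    next
      case False
      then have "i < q" using i by simp
      then show ?thesis using h'(3) j row_i[of i j] rows[of i j] p q by simp
    qed
  qed
  moreover have "sign_fun (s(q := e))" using s e(1) unfolding sign_fun_def by simp
  ultimately show ?thesis using adapted_join_trans[OF j1 h'(1)] by blast
qed

definition diag_sign :: "nat \<Rightarrow> (nat \<Rightarrow> real) \<Rightarrow> real mat" where
  "diag_sign k s = mat k k (\<lambda>(i, j). if i = j then s i else 0)"

lemma diag_sign_carrier: "diag_sign k s \<in> carrier_mat k k" unfolding diag_sign_def by simp

lemma diag_sign_mult_entry:
  assumes "M \<in> carrier_mat k n" "i < k" "j < n"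
  shows "(diag_sign k s * M) $$ (i, j) = s i * M $$ (i, j)"
proof -
  have "(diag_sign k s * M) $$ (i, j) = (\<Sum>m<k. if m = i then s i * M $$ (i, j) else 0)"
    unfolding mult_entry[OF diag_sign_carrier assms] using assms by (intro sum.cong) (auto simp: diag_sign_def)
  then show ?thesis using assms by simp
qed

text \<open>
  Any two full flags shifted down by a nilpotent matrix are joined by a path of such flags; the
  flag of \<open>g\<close> is reached one row at a time.
\<close>

lemma adapted_connected:
  assumes T: "strictly_lower k T" and g: "adapted k T g"
  shows "\<exists>s. sign_fun s \<and> adapted_join k T (1\<^sub>m k) (diag_sign k s * g)"
proof -
  have Tc: "T \<in> carrier_mat k k" using T unfolding strictly_lower_def by blast
  have gc: "g \<in> carrier_mat k k" using g unfolding adapted_def by blast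
  have one: "adapted k T (1\<^sub>m k)" unfolding adapted_def conj_by_one[OF Tc] using T by simp
  have "q \<le> k \<Longrightarrow> \<exists>h s. adapted_join k T (1\<^sub>m k) h \<and> sign_fun s \<and> (\<forall>i<q. \<forall>j<k. h $$ (i, j) = s i * g $$ (i, j))" for q
  proof (induction q)
    case 0
    show ?case using adapted_join_refl[OF one] by (intro exI[of _ "1\<^sub>m k"] exI[of _ "\<lambda>_. 1"]) (auto simp: sign_fun_def)
  next
    case (Suc q)
    then obtain h s where h: "adapted_join k T (1\<^sub>m k) h" "sign_fun s" "\<forall>i<q. \<forall>j<k. h $$ (i, j) = s i * g $$ (i, j)" by auto
    have "\<exists>h' s'. adapted_join k T h h' \<and> sign_fun s' \<and> (\<forall>i<Suc q. \<forall>j<k. h' $$ (i, j) = s' i * g $$ (i, j))"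
      by (rule adapted_next_row[OF Tc adapted_join_adapted[OF h(1)] g _ h(2)]) (use Suc.prems h(3) in auto)
    then show ?case using adapted_join_trans[OF h(1)] by blast
  qed
  from this[of k] obtain h s where h: "adapted_join k T (1\<^sub>m k) h" "sign_fun s" "\<forall>i<k. \<forall>j<k. h $$ (i, j) = s i * g $$ (i, j)"
    by auto
  have hc: "h \<in> carrier_mat k k" using adapted_join_adapted[OF h(1)] unfolding adapted_def by blast
  have "h = diag_sign k s * g"
  proof (rule eq_matI)
    fix i j assume "i < dim_row (diag_sign k s * g)" "j < dim_col (diag_sign k s * g)"
    then have "i < k" "j < k" using gc diag_sign_carrier[of k s] by auto
    then show "h $$ (i, j) = (diag_sign k s * g) $$ (i, j)" using h(3) diag_sign_mult_entry[OF gc] by simp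
  qed (use hc gc diag_sign_carrier[of k s] in auto)
  with h show ?thesis by blast
qed

section \<open>Frames of nearby shift equivalent matrices\<close>

definition block_diag :: "nat \<Rightarrow> nat \<Rightarrow> real mat \<Rightarrow> real mat \<Rightarrow> real mat" where
  "block_diag r k J T = four_block_mat J (0\<^sub>m r k) (0\<^sub>m k r) T"

lemma block_diag_carrier: "J \<in> carrier_mat r r \<Longrightarrow> T \<in> carrier_mat k k \<Longrightarrow> block_diag r k J T \<in> carrier_mat (r + k) (r + k)"
  unfolding block_diag_def by (rule four_block_carrier_mat)

lemma append_rows_inject:
  assumes "X \<in> carrier_mat r n" "W \<in> carrier_mat k n" "X' \<in> carrier_mat r n" "W' \<in> carrier_mat k n"
    and "X @\<^sub>r W = X' @\<^sub>r W'"
  shows "X = X'" "W = W'"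
proof -
  have e: "(X @\<^sub>r W) $$ (i, j) = (X' @\<^sub>r W') $$ (i, j)" for i j using assms(5) by simp
  show "X = X'"
  proof (rule eq_matI)
    fix i j assume "i < dim_row X'" "j < dim_col X'"
    then have ij: "i < r" "j < n" using assms(3) by auto
    then show "X $$ (i, j) = X' $$ (i, j)"
      using e[of i j] append_rows_entry[OF assms(1,2), of i j] append_rows_entry[OF assms(3,4), of i j] by simp
  qed (use assms in auto)
  show "W = W'"
  proof (rule eq_matI)
    fix i j assume "i < dim_row W'" "j < dim_col W'"
    then have ij: "i < k" "j < n" using assms(4) by auto
    then show "W $$ (i, j) = W' $$ (i, j)"
      using e[of "r + i" j] append_rows_entry[OF assms(1,2), of "r + i" j] append_rows_entry[OF assms(3,4), of "r + i" j] by simp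
  qed (use assms in auto)
qed

lemma block_diag_append:
  assumes J: "J \<in> carrier_mat r r" and T: "T \<in> carrier_mat k k" and X: "X \<in> carrier_mat r n" and W: "W \<in> carrier_mat k n"
  shows "block_diag r k J T * (X @\<^sub>r W) = (J * X) @\<^sub>r (T * W)"
proof (rule eq_matI)
  note XW = carrier_append_rows[OF X W] and bc = block_diag_carrier[OF J T]
  note c = mult_carrier_mat[OF J X] mult_carrier_mat[OF T W]
  note ac = carrier_append_rows[OF c]
  fix i j assume "i < dim_row ((J * X) @\<^sub>r (T * W))" "j < dim_col ((J * X) @\<^sub>r (T * W))"
  then have ij: "i < r + k" "j < n" using ac by auto
  have "(block_diag r k J T * (X @\<^sub>r W)) $$ (i, j) = (\<Sum>m<r. block_diag r k J T $$ (i, m) * (X @\<^sub>r W) $$ (m, j))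
     + (\<Sum>m<k. block_diag r k J T $$ (i, r + m) * (X @\<^sub>r W) $$ (r + m, j))"
    unfolding mult_entry[OF bc XW ij] sum_lessThan_add ..
  also have "\<dots> = ((J * X) @\<^sub>r (T * W)) $$ (i, j)"
  proof (cases "i < r")
    case True
    have "(\<Sum>m<r. block_diag r k J T $$ (i, m) * (X @\<^sub>r W) $$ (m, j)) = (\<Sum>m<r. J $$ (i, m) * X $$ (m, j))"
      using True ij J T by (intro sum.cong) (auto simp: block_diag_def append_rows_entry[OF X W])
    moreover have "(\<Sum>m<k. block_diag r k J T $$ (i, r + m) * (X @\<^sub>r W) $$ (r + m, j)) = 0"
      using True ij J T by (intro sum.neutral) (auto simp: block_diag_def)
    ultimately show ?thesis
      unfolding append_rows_entry[OF c ij] using True mult_entry[OF J X True ij(2)] by simp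
  next
    case False
    then have ir: "i - r < k" using ij by simp
    have "(\<Sum>m<r. block_diag r k J T $$ (i, m) * (X @\<^sub>r W) $$ (m, j)) = 0"
      using False ij J T by (intro sum.neutral) (auto simp: block_diag_def)
    moreover have "(\<Sum>m<k. block_diag r k J T $$ (i, r + m) * (X @\<^sub>r W) $$ (r + m, j)) = (\<Sum>m<k. T $$ (i - r, m) * W $$ (m, j))"
      using False ij J T by (intro sum.cong) (auto simp: block_diag_def append_rows_entry[OF X W])
    ultimately show ?thesis
      unfolding append_rows_entry[OF c ij] using False mult_entry[OF T W ir ij(2)] by simp
  qed
  finally show "(block_diag r k J T * (X @\<^sub>r W)) $$ (i, j) = ((J * X) @\<^sub>r (T * W)) $$ (i, j)" .
qed (use carrier_append_rows[OF X W] block_diag_carrier[OF J T] carrier_append_rows[OF mult_carrier_mat[OF J X] mult_carrier_mat[OF T W]] in auto)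

lemma block_diag_mult:
  assumes "A \<in> carrier_mat r r" "B \<in> carrier_mat k k" "A' \<in> carrier_mat r r" "B' \<in> carrier_mat k k"
  shows "block_diag r k A B * block_diag r k A' B' = block_diag r k (A * A') (B * B')"
proof -
  have "block_diag r k A B * block_diag r k A' B' = four_block_mat (A * A' + 0\<^sub>m r k * 0\<^sub>m k r) (A * 0\<^sub>m r k + 0\<^sub>m r k * B')
      (0\<^sub>m k r * A' + B * 0\<^sub>m k r) (0\<^sub>m k r * 0\<^sub>m r k + B * B')"
    unfolding block_diag_def by (rule mult_four_block_mat) (use assms in auto)
  also have "A * A' + 0\<^sub>m r k * 0\<^sub>m k r = A * A'" using mult_carrier_mat[OF assms(1,3)] left_mult_zero_mat[of "0\<^sub>m k r" k r r] by simp
  also have "A * 0\<^sub>m r k + 0\<^sub>m r k * B' = 0\<^sub>m r k" using right_mult_zero_mat[OF assms(1)] left_mult_zero_mat[OF assms(4)] by simp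
  also have "0\<^sub>m k r * A' + B * 0\<^sub>m k r = 0\<^sub>m k r" using right_mult_zero_mat[OF assms(2)] left_mult_zero_mat[OF assms(3)] by simp
  also have "0\<^sub>m k r * 0\<^sub>m r k + B * B' = B * B'" using mult_carrier_mat[OF assms(2,4)] left_mult_zero_mat[of "0\<^sub>m r k" r k k] by simp
  finally show ?thesis unfolding block_diag_def .
qed

lemma block_diag_one: "block_diag r k (1\<^sub>m r) (1\<^sub>m k) = 1\<^sub>m (r + k)"
  unfolding block_diag_def by (rule four_block_one_mat)

lemma block_diag_one_det:
  assumes h: "h \<in> carrier_mat k k" "det h \<noteq> 0"
  shows "det (block_diag r k (1\<^sub>m r) h) \<noteq> 0"
proof -
  have "block_diag r k (1\<^sub>m r) h * block_diag r k (1\<^sub>m r) (minv h) = 1\<^sub>m (r + k)"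
    unfolding block_diag_mult[OF one_carrier_mat h(1) one_carrier_mat minv_carrier[OF h(1)]]
    using minv_right[OF h] by (simp add: block_diag_one)
  then show ?thesis
    using minv_unique(1)[OF block_diag_carrier[OF one_carrier_mat h(1)] block_diag_carrier[OF one_carrier_mat minv_carrier[OF h(1)]]] by blast
qed

text \<open>
  The matrix \<open>B\<close> is determined by \<open>L\<close> and \<open>T\<close>; it is kept as an argument because positivity is a condition
  on \<open>B\<close>.
\<close>

definition frame :: "nat \<Rightarrow> nat \<Rightarrow> real mat \<Rightarrow> real mat \<Rightarrow> real mat \<Rightarrow> real mat \<Rightarrow> bool" where
  "frame r k J B L T \<longleftrightarrow> B \<in> carrier_mat (r + k) (r + k) \<and> L \<in> carrier_mat (r + k) (r + k) \<and> det L \<noteq> 0 \<and>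
     strictly_lower k T \<and> L * B = block_diag r k J T * L"

definition joined :: "nat \<Rightarrow> nat \<Rightarrow> real mat \<Rightarrow> real mat \<Rightarrow> real mat \<Rightarrow> real mat \<Rightarrow> real mat \<Rightarrow> bool" where
  "joined r k J L T L' T' \<longleftrightarrow> (\<exists>l t. mpath (r + k) (r + k) l \<and> mpath k k t \<and> l 0 = L \<and> t 0 = T \<and> l 1 = L' \<and> t 1 = T' \<and>
     (\<forall>s\<in>{0..1}. \<exists>B. positive_mat B \<and> frame r k J B (l s) (t s)))"

lemma joined_trans:
  assumes "joined r k J L T L' T'" "joined r k J L' T' L'' T''"
  shows "joined r k J L T L'' T''"
proof -
  obtain l t where a: "mpath (r + k) (r + k) l" "mpath k k t" "l 0 = L" "t 0 = T" "l 1 = L'" "t 1 = T'"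
    "\<forall>s\<in>{0..1}. \<exists>B. positive_mat B \<and> frame r k J B (l s) (t s)"
    using assms(1) unfolding joined_def by (elim exE conjE) (rule that)
  obtain l' t' where b: "mpath (r + k) (r + k) l'" "mpath k k t'" "l' 0 = L'" "t' 0 = T'" "l' 1 = L''" "t' 1 = T''"
    "\<forall>s\<in>{0..1}. \<exists>B. positive_mat B \<and> frame r k J B (l' s) (t' s)"
    using assms(2) unfolding joined_def by (elim exE conjE) (rule that)
  have "\<forall>s\<in>{0..1}. \<exists>B. positive_mat B \<and> frame r k J B (mjoin l l' s) (mjoin t t' s)"
    by (rule mjoin_ball[of "\<lambda>x y. \<exists>B. positive_mat B \<and> frame r k J B x y", OF a(7) b(7)])
  moreover have "mpath (r + k) (r + k) (mjoin l l')" by (rule mpath_join[OF a(1) b(1)]) (use a b in simp)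
  moreover have "mpath k k (mjoin t t')" by (rule mpath_join[OF a(2) b(2)]) (use a b in simp)
  ultimately show ?thesis unfolding joined_def using a b mjoin_ends
    by (intro exI[of _ "mjoin l l'"] exI[of _ "mjoin t t'"]) simp
qed

lemma joined_sym:
  assumes "joined r k J L T L' T'"
  shows "joined r k J L' T' L T"
proof -
  obtain l t where a: "mpath (r + k) (r + k) l" "mpath k k t" "l 0 = L" "t 0 = T" "l 1 = L'" "t 1 = T'"
    "\<forall>s\<in>{0..1}. \<exists>B. positive_mat B \<and> frame r k J B (l s) (t s)"
    using assms(1) unfolding joined_def by (elim exE conjE) (rule that)
  have "\<forall>s\<in>{0..1}. \<exists>B. positive_mat B \<and> frame r k J B (l (1 - s)) (t (1 - s))"
  proof
    fix s :: real assume "s \<in> {0..1}"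
    then have "1 - s \<in> {0..1}" by simp
    with a(7) show "\<exists>B. positive_mat B \<and> frame r k J B (l (1 - s)) (t (1 - s))" by blast
  qed
  then show ?thesis unfolding joined_def using a mpath_reverse[OF a(1)] mpath_reverse[OF a(2)]
    by (intro exI[of _ "\<lambda>s. l (1 - s)"] exI[of _ "\<lambda>s. t (1 - s)"]) simp
qed

lemma diag_sign_square:
  assumes "sign_fun s"
  shows "diag_sign k s * diag_sign k s = 1\<^sub>m k"
proof (rule eq_matI)
  fix i j assume "i < dim_row (1\<^sub>m k :: real mat)" "j < dim_col (1\<^sub>m k :: real mat)"
  then have ij: "i < k" "j < k" by auto
  have "s i = 1 \<or> s i = - 1" using assms unfolding sign_fun_def by blast
  then show "(diag_sign k s * diag_sign k s) $$ (i, j) = 1\<^sub>m k $$ (i, j)"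
    unfolding diag_sign_mult_entry[OF diag_sign_carrier ij] using ij by (auto simp: diag_sign_def)
qed (auto simp: diag_sign_def)

lemma strictly_lower_diag_sign:
  assumes s: "sign_fun s" and T: "strictly_lower k T"
  shows "strictly_lower k (conj_by (diag_sign k s) T)"
proof -
  have Tc: "T \<in> carrier_mat k k" using T unfolding strictly_lower_def by blast
  note D = diag_sign_carrier[of k s]
  note m = minv_unique[OF D D diag_sign_square[OF s]]
  have c: "conj_by (diag_sign k s) T \<in> carrier_mat k k" by (rule conj_by_carrier[OF D Tc])
  have "conj_by (diag_sign k s) T $$ (i, j) = 0" if ij: "i < k" "j < k" "i \<le> j" for i j
  proof -
    have "conj_by (diag_sign k s) T $$ (i, j) = (\<Sum>m<k. (diag_sign k s * T) $$ (i, m) * diag_sign k s $$ (m, j))"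
      unfolding conj_by_def m(2) by (rule mult_entry[OF mult_carrier_mat[OF D Tc] D ij(1,2)])
    also have "\<dots> = 0"
    proof (intro sum.neutral ballI)
      fix m assume m: "m \<in> {..<k}"
      show "(diag_sign k s * T) $$ (i, m) * diag_sign k s $$ (m, j) = 0"
        using diag_sign_mult_entry[OF Tc ij(1), of m s] m ij T unfolding strictly_lower_def
        by (cases "m = j") (auto simp: diag_sign_def)
    qed
    finally show ?thesis .
  qed
  then show ?thesis unfolding strictly_lower_def using c by blast
qed

lemma frame_left_mult:
  assumes J: "J \<in> carrier_mat r r" and f: "frame r k J B L T" and h: "h \<in> carrier_mat k k" "det h \<noteq> 0"
    and sl: "strictly_lower k (conj_by h T)"
  shows "frame r k J B (block_diag r k (1\<^sub>m r) h * L) (conj_by h T)"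
proof -
  have B: "B \<in> carrier_mat (r + k) (r + k)" and L: "L \<in> carrier_mat (r + k) (r + k)" "det L \<noteq> 0"
    and T: "strictly_lower k T" and e: "L * B = block_diag r k J T * L"
    using f unfolding frame_def by auto
  have Tc: "T \<in> carrier_mat k k" using T unfolding strictly_lower_def by blast
  note H = block_diag_carrier[OF one_carrier_mat h(1), of r] and Hd = block_diag_one_det[OF h, of r]
  note cT = conj_by_carrier[OF h(1) Tc]
  have "block_diag r k (1\<^sub>m r) h * block_diag r k J T = block_diag r k J (conj_by h T) * block_diag r k (1\<^sub>m r) h"
    unfolding block_diag_mult[OF one_carrier_mat h(1) J Tc] block_diag_mult[OF J cT one_carrier_mat h(1)]
      conj_by_intertwines[OF h(1) Tc h(2)] using J by simp
  then have "(block_diag r k (1\<^sub>m r) h * L) * B = block_diag r k J (conj_by h T) * (block_diag r k (1\<^sub>m r) h * L)"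
    using assoc_mult_mat[OF H L(1) B] e assoc_mult_mat[OF H block_diag_carrier[OF J Tc] L(1)]
      assoc_mult_mat[OF block_diag_carrier[OF J cT] H L(1)] by simp
  moreover have "det (block_diag r k (1\<^sub>m r) h * L) \<noteq> 0" using det_mult[OF H L(1)] Hd L(2) by simp
  ultimately show ?thesis unfolding frame_def using B mult_carrier_mat[OF H L(1)] sl by blast
qed

text \<open>
  Changing signs of the lower rows of \<open>L\<close> and of \<open>T\<close> does not change the matrix, so it may be applied to
  a whole path.
\<close>

lemma joined_sign:
  assumes J: "J \<in> carrier_mat r r" and j: "joined r k J L T L' T'" and s: "sign_fun s"
  shows "joined r k J (block_diag r k (1\<^sub>m r) (diag_sign k s) * L) (conj_by (diag_sign k s) T)
    (block_diag r k (1\<^sub>m r) (diag_sign k s) * L') (conj_by (diag_sign k s) T')"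
proof -
  obtain l t where a: "mpath (r + k) (r + k) l" "mpath k k t" "l 0 = L" "t 0 = T" "l 1 = L'" "t 1 = T'"
    "\<forall>s\<in>{0..1}. \<exists>B. positive_mat B \<and> frame r k J B (l s) (t s)"
    using j unfolding joined_def by (elim exE conjE) (rule that)
  note D = diag_sign_carrier[of k s]
  note m = minv_unique[OF D D diag_sign_square[OF s]]
  have "\<forall>u\<in>{0..1}. \<exists>B. positive_mat B \<and> frame r k J B (block_diag r k (1\<^sub>m r) (diag_sign k s) * l u) (conj_by (diag_sign k s) (t u))"
  proof
    fix u :: real assume "u \<in> {0..1}"
    then obtain B where B: "positive_mat B" "frame r k J B (l u) (t u)" using a(7) by blast
    have "strictly_lower k (t u)" using B(2) unfolding frame_def by blast
    from frame_left_mult[OF J B(2) D m(1) strictly_lower_diag_sign[OF s this]] B(1)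
    show "\<exists>B. positive_mat B \<and> frame r k J B (block_diag r k (1\<^sub>m r) (diag_sign k s) * l u) (conj_by (diag_sign k s) (t u))" by blast
  qed
  moreover have "mpath (r + k) (r + k) (\<lambda>u. block_diag r k (1\<^sub>m r) (diag_sign k s) * l u)"
    by (rule mpath_mult[OF mpath_const a(1)]) (rule block_diag_carrier[OF one_carrier_mat D])
  moreover have "mpath k k (\<lambda>u. conj_by (diag_sign k s) (t u))"
    unfolding conj_by_def by (intro mpath_mult[OF mpath_mult[OF mpath_const a(2)] mpath_const] D minv_carrier)
  ultimately show ?thesis unfolding joined_def using a
    by (intro exI[of _ "\<lambda>u. block_diag r k (1\<^sub>m r) (diag_sign k s) * l u"] exI[of _ "\<lambda>u. conj_by (diag_sign k s) (t u)"]) simp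
qed

lemma frame_append_iff:
  assumes J: "J \<in> carrier_mat r r" and T: "T \<in> carrier_mat k k" and X: "X \<in> carrier_mat r n" and W: "W \<in> carrier_mat k n"
    and B: "B \<in> carrier_mat n n"
  shows "(X @\<^sub>r W) * B = block_diag r k J T * (X @\<^sub>r W) \<longleftrightarrow> X * B = J * X \<and> W * B = T * W"
  unfolding append_rows_mult[OF X W B] block_diag_append[OF J T X W]
proof
  assume e: "X * B @\<^sub>r W * B = J * X @\<^sub>r T * W"
  show "X * B = J * X \<and> W * B = T * W"
    using append_rows_inject[OF mult_carrier_mat[OF X B] mult_carrier_mat[OF W B] mult_carrier_mat[OF J X] mult_carrier_mat[OF T W] e]
    by (rule conjI)
qed simp

lemma frame_nilpotent_part:
  assumes f: "frame r k J B (X @\<^sub>r W) T" and J: "J \<in> carrier_mat r r" and X: "X \<in> carrier_mat r (r + k)" and W: "W \<in> carrier_mat k (r + k)"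
  shows "X * B = J * X" "W * B = T * W" "nil_frame (r + k) k B W" "rows_indep r (r + k) X"
proof -
  have B: "B \<in> carrier_mat (r + k) (r + k)" and L: "X @\<^sub>r W \<in> carrier_mat (r + k) (r + k)" "det (X @\<^sub>r W) \<noteq> 0"
    and T: "strictly_lower k T" and e: "(X @\<^sub>r W) * B = block_diag r k J T * (X @\<^sub>r W)"
    using f unfolding frame_def by auto
  have Tc: "T \<in> carrier_mat k k" using T unfolding strictly_lower_def by blast
  show XB: "X * B = J * X" and WB: "W * B = T * W" using e frame_append_iff[OF J Tc X W B] by auto
  have ri: "rows_indep (r + k) (r + k) (X @\<^sub>r W)" using L(2) det_nonzero_rows_indep[OF L(1)] by blast
  show "rows_indep r (r + k) X"
    unfolding rows_indep_def
  proof (intro conjI ballI impI X)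
    fix c assume c: "c \<in> carrier_mat 1 r" "c * X = 0\<^sub>m 1 (r + k)"
    show "c = 0\<^sub>m 1 r"
      by (rule rows_indep_append_left[OF ri X W c(1), of "0\<^sub>m 1 k"]) (use c(2) left_mult_zero_mat[OF W, of 1] in auto)
  qed
  have "rows_indep k (r + k) W"
    unfolding rows_indep_def
  proof (intro conjI ballI impI W)
    fix c assume c: "c \<in> carrier_mat 1 k" "c * W = 0\<^sub>m 1 (r + k)"
    define z where "z = join_cols (0\<^sub>m 1 r) c"
    note zz = join_cols[OF zero_carrier_mat[of 1 r] c(1) X W, folded z_def]
    have "z * (X @\<^sub>r W) = 0\<^sub>m 1 (r + k)" unfolding zz(2) c(2) using left_mult_zero_mat[OF X, of 1] by simp
    then have z0: "z = 0\<^sub>m 1 (r + k)" by (rule rows_indepD[OF ri zz(1)])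
    show "c = 0\<^sub>m 1 k"
    proof (rule eq_matI)
      fix i j assume "i < dim_row (0\<^sub>m 1 k :: real mat)" "j < dim_col (0\<^sub>m 1 k :: real mat)"
      then have ij: "i = 0" "j < k" by auto
      have "z $$ (0, r + j) = c $$ (0, j)" unfolding z_def join_cols_def using c(1) ij by simp
      then show "c $$ (i, j) = 0\<^sub>m 1 k $$ (i, j)" using z0 ij by simp
    qed (use c in auto)
  qed
  then show "nil_frame (r + k) k B W" unfolding nil_frame_def using T WB by blast
qed

lemma frame_of_parts:
  assumes B: "B \<in> carrier_mat (r + k) (r + k)" and J: "J \<in> carrier_mat r r" "det J \<noteq> 0"
    and X: "rows_indep r (r + k) X" "X * B = J * X" and W: "rows_indep k (r + k) W" "W * B = T * W" and T: "strictly_lower k T"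
  shows "frame r k J B (X @\<^sub>r W) T"
proof -
  have Xc: "X \<in> carrier_mat r (r + k)" and Wc: "W \<in> carrier_mat k (r + k)" using X(1) W(1) unfolding rows_indep_def by auto
  have Tc: "T \<in> carrier_mat k k" using T unfolding strictly_lower_def by blast
  note L = carrier_append_rows[OF Xc Wc]
  have "nil_frame (r + k) k B W" unfolding nil_frame_def using W T by blast
  from invertible_part_indep_frame[OF B X(1) J X(2) this] have "det (X @\<^sub>r W) \<noteq> 0"
    using det_nonzero_rows_indep[OF L] by blast
  then show ?thesis unfolding frame_def using B L T frame_append_iff[OF J(1) Tc Xc Wc B] X W by blast
qed

text \<open>
  The rows \<open>W'\<close> lie in the span of \<open>W\<close>: a component along \<open>X\<close> would be annihilated by a power of the
  invertible \<open>J\<close>.  So \<open>W' = g W\<close>, and the path of bases from \<open>1\<close> to \<open>g\<close> adapted to \<open>T\<close> changes the frame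
  while \<open>B\<close> stays fixed.
\<close>

lemma frames_connected:
  assumes J: "J \<in> carrier_mat r r" "det J \<noteq> 0" and pos: "positive_mat B"
    and X: "X \<in> carrier_mat r (r + k)" and W: "W \<in> carrier_mat k (r + k)" and W': "W' \<in> carrier_mat k (r + k)"
    and f: "frame r k J B (X @\<^sub>r W) T" and f': "frame r k J B (X @\<^sub>r W') T'"
  shows "\<exists>s. sign_fun s \<and> joined r k J (X @\<^sub>r W) T
     (block_diag r k (1\<^sub>m r) (diag_sign k s) * (X @\<^sub>r W')) (conj_by (diag_sign k s) T')"
proof -
  let ?n = "r + k"
  define L where "L = X @\<^sub>r W"
  have B: "B \<in> carrier_mat ?n ?n" and L: "L \<in> carrier_mat ?n ?n" "det L \<noteq> 0" and T: "strictly_lower k T"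
    using f unfolding frame_def L_def by auto
  have T': "strictly_lower k T'" using f' unfolding frame_def by auto
  have Tc: "T \<in> carrier_mat k k" and Tc': "T' \<in> carrier_mat k k" using T T' unfolding strictly_lower_def by auto
  note p = frame_nilpotent_part[OF f J(1) X W] and p' = frame_nilpotent_part[OF f' J(1) X W']
  note iL = minv_carrier[OF L(1)]
  have Cc: "W' * minv L \<in> carrier_mat k (r + k)" by (rule mult_carrier_mat[OF W' iL])
  obtain a g where a: "a \<in> carrier_mat k r" and g: "g \<in> carrier_mat k k"
    and ag: "(W' * minv L) * (X @\<^sub>r W) = a * X + g * W \<and> (a = 0\<^sub>m k r \<and> g = 0\<^sub>m k k \<longrightarrow> W' * minv L = 0\<^sub>m k (r + k))"
    using split_cols[OF Cc X W] by (elim bexE) (rule that)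
  have W'e: "W' = a * X + g * W"
    using ag assoc_mult_mat[OF W' iL L(1)] minv_left[OF L] right_mult_one_mat[OF W'] unfolding L_def[symmetric] by simp
  note aX = mult_carrier_mat[OF a X] and gW = mult_carrier_mat[OF g W]
  define Bk where "Bk = B ^\<^sub>m k"
  define Jk where "Jk = J ^\<^sub>m k"
  have Bk: "Bk \<in> carrier_mat ?n ?n" unfolding Bk_def by (rule pow_carrier_mat[OF B])
  have Jk: "Jk \<in> carrier_mat r r" unfolding Jk_def by (rule pow_carrier_mat[OF J(1)])
  have XJ: "X * Bk = Jk * X" unfolding Bk_def Jk_def by (rule intertwine_pow[OF X B J(1) p(1)])
  have "0\<^sub>m k ?n = (a * X + g * W) * Bk" using nil_frame_pow[OF B p'(3)] W'e unfolding Bk_def by simp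
  also have "\<dots> = (a * X) * Bk + (g * W) * Bk" by (rule add_mult_distrib_mat[OF aX gW Bk])
  also have "(g * W) * Bk = 0\<^sub>m k ?n"
    using assoc_mult_mat[OF g W Bk] nil_frame_pow[OF B p(3)] right_mult_zero_mat[OF g] unfolding Bk_def by simp
  also have "(a * X) * Bk = (a * Jk) * X" using assoc_mult_mat[OF a X Bk] XJ assoc_mult_mat[OF a Jk X] by simp
  finally have aJX: "(a * Jk) * X = 0\<^sub>m k ?n" using mult_carrier_mat[OF mult_carrier_mat[OF a Jk] X] by simp
  have a0: "a = 0\<^sub>m k r"
  proof (rule eq_matI)
    fix i j assume "i < dim_row (0\<^sub>m k r :: real mat)" "j < dim_col (0\<^sub>m k r :: real mat)"
    then have ij: "i < k" "j < r" by auto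
    define c where "c = mat 1 r (\<lambda>(_, j). a $$ (i, j))"
    have c: "c \<in> carrier_mat 1 r" unfolding c_def by simp
    have cJ: "(c * Jk) $$ (0, m) = (a * Jk) $$ (i, m)" if "m < r" for m
      unfolding mult_entry_row[OF c Jk that] mult_entry[OF a Jk ij(1) that] by (intro sum.cong) (auto simp: c_def)
    have "(c * Jk) * X = 0\<^sub>m 1 ?n"
    proof (rule eq_matI)
      fix x m assume "x < dim_row (0\<^sub>m 1 ?n :: real mat)" "m < dim_col (0\<^sub>m 1 ?n :: real mat)"
      then have x: "x = 0" "m < ?n" by auto
      have "((c * Jk) * X) $$ (0, m) = ((a * Jk) * X) $$ (i, m)"
        unfolding mult_entry_row[OF mult_carrier_mat[OF c Jk] X x(2)] mult_entry[OF mult_carrier_mat[OF a Jk] X ij(1) x(2)]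
        by (intro sum.cong) (auto simp: cJ)
      then show "((c * Jk) * X) $$ (x, m) = 0\<^sub>m 1 ?n $$ (x, m)" using aJX x ij by simp
    qed (use c Jk X in auto)
    then have "c * Jk = 0\<^sub>m 1 r" by (rule rows_indepD[OF p(4) mult_carrier_mat[OF c Jk]])
    then have "c = 0\<^sub>m 1 r" unfolding Jk_def by (rule mult_pow_zero[OF J c])
    then have "c $$ (0, j) = 0" using ij by simp
    then show "a $$ (i, j) = 0\<^sub>m k r $$ (i, j)" using ij unfolding c_def by simp
  qed (use a in auto)
  have W'g: "W' = g * W" using W'e gW left_mult_zero_mat[OF X, of k] unfolding a0 by simp
  have gi: "rows_indep k k g"
    unfolding rows_indep_def
  proof (intro conjI ballI impI g)
    fix c assume c: "c \<in> carrier_mat 1 k" "c * g = 0\<^sub>m 1 k"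
    have "c * W' = 0\<^sub>m 1 ?n" unfolding W'g using assoc_mult_mat[OF c(1) g W] c(2) left_mult_zero_mat[OF W, of 1] by simp
    then show "c = 0\<^sub>m 1 k" using p'(3) c(1) unfolding nil_frame_def rows_indep_def by blast
  qed
  then have gd: "det g \<noteq> 0" using det_nonzero_rows_indep[OF g] by blast
  have gT: "conj_by g T = T'"
  proof (rule conj_by_eq[OF g Tc Tc' gd])
    have "(g * T) * W = (g * W) * B" using assoc_mult_mat[OF g Tc W] assoc_mult_mat[OF g W B] p(2) by simp
    also have "\<dots> = (T' * g) * W" using p'(2) assoc_mult_mat[OF Tc' g W] unfolding W'g by simp
    finally have e: "(g * T) * W = (T' * g) * W" .
    note gTc = mult_carrier_mat[OF g Tc] and T'gc = mult_carrier_mat[OF Tc' g]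
    have "(g * T - T' * g) * W = 0\<^sub>m k ?n"
      unfolding minus_mult_distrib_mat[OF gTc T'gc W] e using mult_carrier_mat[OF T'gc W] by (intro eq_matI) auto
    note z = this
    have dc: "g * T - T' * g \<in> carrier_mat k k" by (rule minus_carrier_mat[OF T'gc])
    have "g * T - T' * g = 0\<^sub>m k k"
    proof (rule eq_matI)
      fix i j assume "i < dim_row (0\<^sub>m k k :: real mat)" "j < dim_col (0\<^sub>m k k :: real mat)"
      then have ij: "i < k" "j < k" by auto
      define c where "c = mat 1 k (\<lambda>(_, j). (g * T - T' * g) $$ (i, j))"
      have c: "c \<in> carrier_mat 1 k" unfolding c_def by simp
      have "c * W = 0\<^sub>m 1 ?n"
      proof (rule eq_matI)
        fix x m assume "x < dim_row (0\<^sub>m 1 ?n :: real mat)" "m < dim_col (0\<^sub>m 1 ?n :: real mat)"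
        then have x: "x = 0" "m < ?n" by auto
        have "(c * W) $$ (0, m) = ((g * T - T' * g) * W) $$ (i, m)"
          unfolding mult_entry_row[OF c W x(2)] mult_entry[OF dc W ij(1) x(2)] by (intro sum.cong) (auto simp: c_def)
        then show "(c * W) $$ (x, m) = 0\<^sub>m 1 ?n $$ (x, m)" using z x ij by simp
      qed (use c W in auto)
      then have "c = 0\<^sub>m 1 k" using p(3) c unfolding nil_frame_def rows_indep_def by blast
      then have "c $$ (0, j) = 0" using ij by simp
      then show "(g * T - T' * g) $$ (i, j) = 0\<^sub>m k k $$ (i, j)" using ij unfolding c_def by simp
    qed (use dc in auto)
    then show "g * T = T' * g" by (rule diff_zero_imp_eq_mat[OF gTc T'gc])
  qed
  have "adapted k T g" unfolding adapted_def gT using g gd T' by blast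
  from adapted_connected[OF T this] obtain s where s: "sign_fun s" and j: "adapted_join k T (1\<^sub>m k) (diag_sign k s * g)" by blast
  obtain h where h: "mpath k k h" "h 0 = 1\<^sub>m k" "h 1 = diag_sign k s * g" "\<forall>u\<in>{0..1}. adapted k T (h u)"
    using j unfolding adapted_join_def by blast
  note D = diag_sign_carrier[of k s]
  note mD = minv_unique[OF D D diag_sign_square[OF s]]
  have fr: "frame r k J B (block_diag r k (1\<^sub>m r) (h u) * L) (conj_by (h u) T)" if "u \<in> {0..1}" for u
    using frame_left_mult[OF J(1) f] h(4) that unfolding adapted_def L_def by blast
  have hd: "det (h u) \<noteq> 0" if "u \<in> {0..1}" for u using h(4) that unfolding adapted_def by blast
  have "mpath ?n ?n (\<lambda>u. block_diag r k (1\<^sub>m r) (h u) * L)"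
    unfolding block_diag_def
    by (rule mpath_mult[OF mpath_four_block[OF mpath_const mpath_const mpath_const h(1)] mpath_const[OF L(1)]]) auto
  moreover have "mpath k k (\<lambda>u. conj_by (h u) T)"
    unfolding conj_by_def by (intro mpath_mult[OF mpath_mult[OF h(1) mpath_const[OF Tc]] mpath_minv[OF h(1) hd]])
  moreover have "block_diag r k (1\<^sub>m r) (h 0) * L = X @\<^sub>r W" unfolding h(2) block_diag_one L_def[symmetric] using L(1) by simp
  moreover have "conj_by (h 0) T = T" unfolding h(2) by (rule conj_by_one[OF Tc])
  moreover have "block_diag r k (1\<^sub>m r) (h 1) * L = block_diag r k (1\<^sub>m r) (diag_sign k s) * (X @\<^sub>r W')"
    using assoc_mult_mat[OF D g W] block_diag_append[OF one_carrier_mat mult_carrier_mat[OF D g] X W]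
      block_diag_append[OF one_carrier_mat D X W'] unfolding h(3) L_def by (simp add: W'g[symmetric])
  moreover have "conj_by (h 1) T = conj_by (diag_sign k s) T'"
    unfolding h(3) conj_by_mult(1)[OF D mD(1) g gd Tc] gT ..
  ultimately have "joined r k J (X @\<^sub>r W) T (block_diag r k (1\<^sub>m r) (diag_sign k s) * (X @\<^sub>r W')) (conj_by (diag_sign k s) T')"
    unfolding joined_def using fr pos
    by (intro exI[of _ "\<lambda>u. block_diag r k (1\<^sub>m r) (h u) * L"] exI[of _ "\<lambda>u. conj_by (h u) T"] conjI ballI) blast+
  with s show ?thesis by blast
qed

lemma frame_matrix_eq:
  assumes f: "frame r k J B L T" and J: "J \<in> carrier_mat r r"
  shows "B = minv L * (block_diag r k J T * L)"
proof -
  have B: "B \<in> carrier_mat (r + k) (r + k)" and L: "L \<in> carrier_mat (r + k) (r + k)" "det L \<noteq> 0" and e: "L * B = block_diag r k J T * L"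
    using f unfolding frame_def by auto
  show ?thesis unfolding e[symmetric]
    using assoc_mult_mat[OF minv_carrier[OF L(1)] L(1) B] minv_left[OF L] left_mult_one_mat[OF B] by simp
qed

lemma frame_of_basis:
  assumes L: "L \<in> carrier_mat (r + k) (r + k)" "det L \<noteq> 0" and J: "J \<in> carrier_mat r r" and T: "strictly_lower k T"
  shows "frame r k J (minv L * (block_diag r k J T * L)) L T"
proof -
  have Tc: "T \<in> carrier_mat k k" using T unfolding strictly_lower_def by blast
  note bL = mult_carrier_mat[OF block_diag_carrier[OF J Tc] L(1)]
  have "L * (minv L * (block_diag r k J T * L)) = block_diag r k J T * L"
    using assoc_mult_mat[OF L(1) minv_carrier[OF L(1)] bL] minv_right[OF L] left_mult_one_mat[OF bL] by simp
  then show ?thesis unfolding frame_def using L T mult_carrier_mat[OF minv_carrier[OF L(1)] bL] by blast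
qed

lemma mtends_interpolate:
  assumes f: "mtends nr nc f M sequentially" and s: "\<And>j. s j \<in> {0..1::real}"
  shows "mtends nr nc (\<lambda>j. (1 - s j) \<cdot>\<^sub>m f j + s j \<cdot>\<^sub>m M) M sequentially"
proof (rule mtendsI)
  note c = mtendsD[OF f]
  show "M \<in> carrier_mat nr nc" by (rule c(1))
  show "(1 - s x) \<cdot>\<^sub>m f x + s x \<cdot>\<^sub>m M \<in> carrier_mat nr nc" for x using c(1) by simp
  fix i j assume ij: "i < nr" "j < nc"
  have e: "((1 - s x) \<cdot>\<^sub>m f x + s x \<cdot>\<^sub>m M) $$ (i, j) = M $$ (i, j) + (1 - s x) * (f x $$ (i, j) - M $$ (i, j))" for x
    using c(1) c(2)[of x] ij by (simp add: algebra_simps)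
  have "(\<lambda>x. f x $$ (i, j) - M $$ (i, j)) \<longlonglongrightarrow> 0" using c(3)[OF ij] by (rule LIM_zero)
  then have "(\<lambda>x. (1 - s x) * (f x $$ (i, j) - M $$ (i, j))) \<longlonglongrightarrow> 0"
  proof (rule Lim_null_comparison[rotated, OF tendsto_rabs_zero])
    have "\<bar>1 - s x\<bar> \<le> 1" for x using s[of x] by auto
    then show "\<forall>\<^sub>F x in sequentially. norm ((1 - s x) * (f x $$ (i, j) - M $$ (i, j))) \<le> \<bar>f x $$ (i, j) - M $$ (i, j)\<bar>"
      by (intro always_eventually) (auto simp: abs_mult intro: mult_left_le_one_le)
  qed
  then have "(\<lambda>x. M $$ (i, j) + (1 - s x) * (f x $$ (i, j) - M $$ (i, j))) \<longlonglongrightarrow> M $$ (i, j) + 0"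
    by (intro tendsto_add tendsto_const)
  then show "(\<lambda>x. ((1 - s x) \<cdot>\<^sub>m f x + s x \<cdot>\<^sub>m M) $$ (i, j)) \<longlonglongrightarrow> M $$ (i, j)" unfolding e by simp
qed

text \<open>
  On the line from \<open>(Ls j, Ts j)\<close> to \<open>(L, T)\<close> choose the worst parameter for each \<open>j\<close>.  These
  points still tend to \<open>(L, T)\<close>, so their matrices tend to \<open>A\<close> and are positive eventually.
\<close>

lemma eventually_joined:
  assumes J: "J \<in> carrier_mat r r" and L: "mtends (r + k) (r + k) Ls L sequentially" and T: "mtends k k Ts T sequentially"
    and f: "frame r k J A L T" and pos: "positive_mat A" and sl: "\<And>j. strictly_lower k (Ts j)"
  shows "eventually (\<lambda>j. joined r k J (Ls j) (Ts j) L T) sequentially"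
proof -
  let ?n = "r + k"
  have Lc: "L \<in> carrier_mat ?n ?n" "det L \<noteq> 0" and slT: "strictly_lower k T" using f unfolding frame_def by auto
  note LL = mtendsD(2)[OF L] and Tc = mtendsD(1)[OF T] and TT = mtendsD(2)[OF T]
  define l where "l j s = (1 - s) \<cdot>\<^sub>m Ls j + s \<cdot>\<^sub>m L" for j and s :: real
  define t where "t j s = (1 - s) \<cdot>\<^sub>m Ts j + s \<cdot>\<^sub>m T" for j and s :: real
  define good where "good j s \<longleftrightarrow> (\<exists>B. positive_mat B \<and> frame r k J B (l j s) (t j s))" for j s
  \<comment> \<open>a parameter at which positivity fails, if there is one\<close>
  define u where "u j = (if \<exists>s\<in>{0..1}. \<not> good j s then SOME s. s \<in> {0..1} \<and> \<not> good j s else 0)" for j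
  have u01: "u j \<in> {0..1}" and ug: "good j (u j) \<Longrightarrow> s \<in> {0..1} \<Longrightarrow> good j s" for j s
  proof -
    have *: "u j \<in> {0..1} \<and> \<not> good j (u j)" if ex: "\<exists>s\<in>{0..1}. \<not> good j s"
    proof -
      have "\<exists>s. s \<in> {0..1} \<and> \<not> good j s" using ex by blast
      from someI_ex[OF this] show ?thesis unfolding u_def using ex by simp
    qed
    show "u j \<in> {0..1}" using * unfolding u_def by (cases "\<exists>s\<in>{0..1}. \<not> good j s") auto
    show "good j (u j) \<Longrightarrow> s \<in> {0..1} \<Longrightarrow> good j s" using * by blast
  qed
  have lc: "l j s \<in> carrier_mat ?n ?n" for j s unfolding l_def using Lc LL by simp
  have tl: "strictly_lower k (t j s)" for j s
    using sl[of j] slT unfolding strictly_lower_def t_def by auto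
  have ml: "mtends ?n ?n (\<lambda>j. l j (u j)) L sequentially" unfolding l_def by (rule mtends_interpolate[OF L u01])
  have mt: "mtends k k (\<lambda>j. t j (u j)) T sequentially" unfolding t_def by (rule mtends_interpolate[OF T u01])
  have mb: "mtends ?n ?n (\<lambda>j. block_diag r k J (t j (u j))) (block_diag r k J T) sequentially"
    unfolding block_diag_def by (intro mtends_four_block mtends_const mt J) auto
  have mB: "mtends ?n ?n (\<lambda>j. minv (l j (u j)) * (block_diag r k J (t j (u j)) * l j (u j))) A sequentially"
    using mtends_mult[OF mtends_minv[OF ml Lc(2)] mtends_mult[OF mb ml]] unfolding frame_matrix_eq[OF f J, symmetric] .
  have "eventually (\<lambda>j. det (l j (u j)) \<noteq> 0) sequentially" by (rule mtends_eventually_det[OF ml Lc(2)])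
  moreover have "eventually (\<lambda>j. positive_mat (minv (l j (u j)) * (block_diag r k J (t j (u j)) * l j (u j)))) sequentially"
    by (rule mtends_eventually_positive[OF mB pos])
  ultimately have "eventually (\<lambda>j. good j (u j)) sequentially"
    by eventually_elim (use frame_of_basis[OF lc _ J tl] good_def in blast)
  then show ?thesis
  proof eventually_elim
    case (elim j)
    have "\<forall>s\<in>{0..1}. good j s" using ug[OF elim] by blast
    moreover have "mpath ?n ?n (l j)" unfolding l_def
      by (intro mpath_add mpath_smult mpath_const Lc LL continuous_intros)
    moreover have "mpath k k (t j)" unfolding t_def
      by (intro mpath_add mpath_smult mpath_const Tc TT continuous_intros)
    moreover have "l j 0 = Ls j" "l j 1 = L" "t j 0 = Ts j" "t j 1 = T"
      unfolding l_def t_def using Lc(1) LL[of j] Tc TT[of j] by (auto intro!: eq_matI)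
    ultimately show ?case unfolding joined_def good_def by (intro exI[of _ "l j"] exI[of _ "t j"]) simp
  qed
qed

lemma SE_nbhdD:
  assumes "B \<in> SE_nbhd \<delta> A" "A \<in> carrier_mat n n" "n \<ge> 1"
  shows "B \<in> carrier_mat n n" "shift_equivalent B A" "\<And>i j. i < n \<Longrightarrow> j < n \<Longrightarrow> \<bar>B $$ (i, j) - A $$ (i, j)\<bar> < \<delta>"
proof -
  show B: "B \<in> carrier_mat n n" and "shift_equivalent B A" using assms unfolding SE_nbhd_def by auto
  fix i j assume ij: "i < n" "j < n"
  have BA: "B - A \<in> carrier_mat n n" by (rule minus_carrier_mat[OF assms(2)])
  have "(B - A) $$ (i, j) \<in> elements_mat (B - A)" by (rule elements_matI[OF BA ij refl])
  moreover have "finite (elements_mat (B - A))" unfolding elements_mat_def by simp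
  ultimately have "\<bar>(B - A) $$ (i, j)\<bar> \<le> max_norm (B - A)" unfolding max_norm_def by (intro Max_ge) auto
  also have "\<dots> < \<delta>" using assms(1) unfolding SE_nbhd_def by auto
  finally show "\<bar>B $$ (i, j) - A $$ (i, j)\<bar> < \<delta>" using ij assms(2) by simp
qed

text \<open>
  Otherwise there is a sequence \<open>B j\<close> tending to \<open>A\<close> of matrices without such joins.  Passing to a
  subsequence, solutions \<open>Y j\<close> of \<open>Y B = J Y\<close> tend to \<open>X0\<close>, and orthonormal rows \<open>W j\<close> of the nilpotent
  parts tend to orthonormal rows \<open>W'\<close>, which again carry an invariant flag.  So frames of \<open>B j\<close> tend
  to a frame of \<open>A\<close>, and are eventually joined to it.
\<close>

lemma near_frames:
  assumes A: "A \<in> carrier_mat (r + k) (r + k)" and n: "r + k \<ge> 1" and pos: "positive_mat A"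
    and W0: "full_frame (r + k) k A W0"
    and J: "J \<in> carrier_mat r r" "det J \<noteq> 0" and X0: "rows_indep r (r + k) X0" "X0 * A = J * X0"
  shows "\<exists>\<delta>>0. \<forall>B\<in>SE_nbhd \<delta> A. \<exists>Y W T W' T'. Y \<in> carrier_mat r (r + k) \<and> W \<in> carrier_mat k (r + k) \<and> W' \<in> carrier_mat k (r + k) \<and>
     frame r k J B (Y @\<^sub>r W) T \<and> frame r k J A (X0 @\<^sub>r W') T' \<and> joined r k J (Y @\<^sub>r W) T (X0 @\<^sub>r W') T'"
proof (rule ccontr)
  let ?n = "r + k"
  define good where "good B \<longleftrightarrow> (\<exists>Y W T W' T'. Y \<in> carrier_mat r ?n \<and> W \<in> carrier_mat k ?n \<and> W' \<in> carrier_mat k ?n \<and>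
     frame r k J B (Y @\<^sub>r W) T \<and> frame r k J A (X0 @\<^sub>r W') T' \<and> joined r k J (Y @\<^sub>r W) T (X0 @\<^sub>r W') T')" for B
  assume "\<not> ?thesis"
  then have bad: "\<And>\<delta>. \<delta> > 0 \<Longrightarrow> \<exists>B\<in>SE_nbhd \<delta> A. \<not> good B" unfolding good_def by blast
  have "\<exists>B. B \<in> SE_nbhd (inverse (real (Suc j))) A \<and> \<not> good B" for j using bad[of "inverse (real (Suc j))"] by auto
  then have "\<forall>j. \<exists>B. B \<in> SE_nbhd (inverse (real (Suc j))) A \<and> \<not> good B" by blast
  from choice[OF this] obtain B where B0: "\<forall>j. B j \<in> SE_nbhd (inverse (real (Suc j))) A \<and> \<not> good (B j)" by (elim exE)
  then have Bn: "\<And>j. B j \<in> SE_nbhd (inverse (real (Suc j))) A" and nb: "\<And>j. \<not> good (B j)" by auto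
  note Bc = SE_nbhdD[OF Bn A n]
  have mB: "mtends ?n ?n B A sequentially"
  proof (rule mtendsI[OF A Bc(1)])
    fix i j assume ij: "i < ?n" "j < ?n"
    show "(\<lambda>x. B x $$ (i, j)) \<longlonglongrightarrow> A $$ (i, j)"
    proof (rule LIM_zero_cancel, rule Lim_null_comparison[OF _ LIMSEQ_inverse_real_of_nat])
      show "\<forall>\<^sub>F x in sequentially. norm (B x $$ (i, j) - A $$ (i, j)) \<le> inverse (real (Suc x))"
        using Bc(3)[OF ij] by (intro always_eventually) (auto intro: less_imp_le)
    qed
  qed
  have "\<exists>W. orthonormal_rows k ?n W \<and> full_frame ?n k (B j) W" for j
  proof -
    obtain k' W where W: "orthonormal_rows k' ?n W" "full_frame ?n k' (B j) W"
      using full_frame_orthonormal[OF Bc(1)] by blast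
    have "k' = k" by (rule full_frame_size_unique[OF Bc(2) A Bc(1) W0 W(2)])
    with W show ?thesis by blast
  qed
  then have "\<forall>j. \<exists>W. orthonormal_rows k ?n W \<and> full_frame ?n k (B j) W" by blast
  from choice[OF this] obtain W where W00: "\<forall>j. orthonormal_rows k ?n (W j) \<and> full_frame ?n k (B j) (W j)" by (elim exE)
  then have Wo: "\<And>j. orthonormal_rows k ?n (W j)" and Wf: "\<And>j. full_frame ?n k (B j) (W j)" by auto
  have Wc: "W j \<in> carrier_mat k ?n" for j using Wo[of j] unfolding orthonormal_rows_def by blast
  have X0c: "X0 \<in> carrier_mat r ?n" using X0(1) unfolding rows_indep_def by blast
  obtain \<sigma> Y where s: "strict_mono (\<sigma> :: nat \<Rightarrow> nat)" and Y: "mtends r ?n Y X0 sequentially" and YB: "\<forall>j. Y j * B (\<sigma> j) = J * Y j"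
    using intertwiner_limit[OF mB Bc(2) J X0c X0(2)] by blast
  have "\<exists>\<tau>. strict_mono \<tau> \<and> (\<forall>e\<in>{..<k} \<times> {..<?n}. convergent (\<lambda>j. W (\<sigma> (\<tau> j)) $$ e))"
    by (rule bounded_family_subsequence[where b = 1]) (use orthonormal_rows_bound[OF Wo] in auto)
  then obtain \<tau> where t: "strict_mono \<tau>" "\<forall>e\<in>{..<k} \<times> {..<?n}. convergent (\<lambda>j. W (\<sigma> (\<tau> j)) $$ e)" by blast
  define w where "w j = W (\<sigma> (\<tau> j))" for j
  define b where "b j = B (\<sigma> (\<tau> j))" for j
  define y where "y j = Y (\<tau> j)" for j
  define W' where "W' = mat k ?n (\<lambda>e. lim (\<lambda>j. w j $$ e))"
  have W'c: "W' \<in> carrier_mat k ?n" unfolding W'_def by simp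
  have wc: "w j \<in> carrier_mat k ?n" "(w j)\<^sup>T \<in> carrier_mat ?n k" for j unfolding w_def using Wc by auto
  have mw: "mtends k ?n w W' sequentially"
    by (rule mtendsI[OF W'c wc(1)]) (use t(2) in \<open>auto simp: W'_def w_def convergent_LIMSEQ_iff\<close>)
  have mb: "mtends ?n ?n b A sequentially" unfolding b_def
    by (rule mtends_compose[OF mtends_compose[OF mB filterlim_subseq[OF s]] filterlim_subseq[OF t(1)]])
  have my: "mtends r ?n y X0 sequentially" unfolding y_def by (rule mtends_compose[OF Y filterlim_subseq[OF t(1)]])
  have mwT: "mtends ?n k (\<lambda>j. (w j)\<^sup>T) W'\<^sup>T sequentially"
  proof (rule mtendsI)
    fix i j assume "i < ?n" "j < k"
    then show "(\<lambda>x. (w x)\<^sup>T $$ (i, j)) \<longlonglongrightarrow> W'\<^sup>T $$ (i, j)"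
      using mtendsD(3)[OF mw, of j i] wc(1) W'c by (auto simp: carrier_matD[OF wc(1)] carrier_matD[OF W'c])
  qed (use wc W'c in auto)
  have ow: "w j * (w j)\<^sup>T = 1\<^sub>m k" for j unfolding w_def using Wo unfolding orthonormal_rows_def by blast
  define T where "T j = w j * b j * (w j)\<^sup>T" for j
  have bc: "b j \<in> carrier_mat ?n ?n" for j unfolding b_def by (rule Bc(1))
  have Tj: "strictly_lower k (T j) \<and> w j * b j = T j * w j" for j
  proof -
    have "nil_frame ?n k (b j) (w j)" using Wf unfolding w_def b_def full_frame_def by blast
    then obtain S where S: "strictly_lower k S" "w j * b j = S * w j" unfolding nil_frame_def by blast
    have Sc: "S \<in> carrier_mat k k" using S unfolding strictly_lower_def by blast
    have "T j = S" unfolding T_def S(2) using assoc_mult_mat[OF Sc wc] ow right_mult_one_mat[OF Sc] by simp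
    with S show ?thesis by simp
  qed
  define T' where "T' = W' * A * W'\<^sup>T"
  have mT: "mtends k k T T' sequentially" unfolding T_def T'_def by (rule mtends_mult[OF mtends_mult[OF mw mb] mwT])
  have slT': "strictly_lower k T'"
    unfolding strictly_lower_def
  proof (intro conjI allI impI)
    show "T' \<in> carrier_mat k k" by (rule mtendsD(1)[OF mT])
    fix i j assume ij: "i < k" "j < k" "i \<le> j"
    have "(\<lambda>x. T x $$ (i, j)) \<longlonglongrightarrow> T' $$ (i, j)" by (rule mtendsD(3)[OF mT ij(1,2)])
    moreover have "T x $$ (i, j) = 0" for x using Tj[of x] ij unfolding strictly_lower_def by blast
    ultimately have "(\<lambda>x :: nat. 0 :: real) \<longlonglongrightarrow> T' $$ (i, j)" by simp
    from LIMSEQ_unique[OF this tendsto_const] show "T' $$ (i, j) = 0" .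
  qed
  have W'A: "W' * A = T' * W'"
  proof (rule mtends_unique[OF mtends_mult[OF mw mb]])
    have "(\<lambda>j. w j * b j) = (\<lambda>j. T j * w j)" using Tj by auto
    then show "mtends k ?n (\<lambda>j. w j * b j) (T' * W') sequentially" using mtends_mult[OF mT mw] by simp
  qed simp
  have oW': "W' * W'\<^sup>T = 1\<^sub>m k"
  proof (rule mtends_unique[OF mtends_mult[OF mw mwT]])
    show "mtends k k (\<lambda>j. w j * (w j)\<^sup>T) (1\<^sub>m k) sequentially" unfolding ow by (rule mtends_const) simp
  qed simp
  have "rows_indep k ?n W'" by (rule orthonormal_rows_indep) (use W'c oW' in \<open>auto simp: orthonormal_rows_def\<close>)
  then have fA: "frame r k J A (X0 @\<^sub>r W') T'" by (rule frame_of_parts[OF A J X0 _ W'A slT'])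
  have mL: "mtends (r + k) ?n (\<lambda>j. y j @\<^sub>r w j) (X0 @\<^sub>r W') sequentially"
  proof (rule mtendsI)
    note yc = mtendsD(2)[OF my]
    show "X0 @\<^sub>r W' \<in> carrier_mat (r + k) ?n" by (rule carrier_append_rows[OF X0c W'c])
    show "y j @\<^sub>r w j \<in> carrier_mat (r + k) ?n" for j by (rule carrier_append_rows[OF yc wc(1)])
    fix i j assume ij: "i < r + k" "j < ?n"
    show "(\<lambda>x. (y x @\<^sub>r w x) $$ (i, j)) \<longlonglongrightarrow> (X0 @\<^sub>r W') $$ (i, j)"
      unfolding append_rows_entry[OF yc wc(1) ij] append_rows_entry[OF X0c W'c ij]
      using mtendsD(3)[OF my, of i j] mtendsD(3)[OF mw, of "i - r" j] ij by auto
  qed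
  have ev: "eventually (\<lambda>j. joined r k J (y j @\<^sub>r w j) (T j) (X0 @\<^sub>r W') T') sequentially"
    by (rule eventually_joined[OF J(1) mL mT fA pos]) (use Tj in blast)
  have dA: "det (X0 @\<^sub>r W') \<noteq> 0" using fA unfolding frame_def by blast
  have ev2: "eventually (\<lambda>j. det (y j @\<^sub>r w j) \<noteq> 0) sequentially" by (rule mtends_eventually_det[OF mL dA])
  from eventually_happens'[OF _ eventually_conj[OF ev ev2]] obtain j where
    j: "joined r k J (y j @\<^sub>r w j) (T j) (X0 @\<^sub>r W') T'" "det (y j @\<^sub>r w j) \<noteq> 0" by auto
  have yc: "y j \<in> carrier_mat r ?n" by (rule mtendsD(2)[OF my])
  have yb: "y j * b j = J * y j" unfolding y_def b_def using YB by blast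
  have sT: "strictly_lower k (T j)" and wb: "w j * b j = T j * w j" using Tj[of j] by blast+
  have Tc: "T j \<in> carrier_mat k k" using sT unfolding strictly_lower_def by blast
  have "(y j @\<^sub>r w j) * b j = block_diag r k J (T j) * (y j @\<^sub>r w j)"
    by (rule frame_append_iff[OF J(1) Tc yc wc(1) bc, THEN iffD2]) (rule conjI[OF yb wb])
  then have "frame r k J (b j) (y j @\<^sub>r w j) (T j)"
    unfolding frame_def using bc carrier_append_rows[OF yc wc(1)] j(2) sT by (intro conjI)
  then have "good (b j)" unfolding good_def using yc wc(1) W'c fA j(1) by blast
  with nb show False unfolding b_def by blast
qed

text \<open>
  The upper rows \<open>X\<close> of a frame need not have entries in \<open>U\<close>, as \<open>J\<close> is fixed by \<open>A\<close>; only the lower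
  ones do.
\<close>

lemma frame_of_subring:
  assumes U: "real_subring U"
    and W: "elements_mat W \<subseteq> U" "W \<in> carrier_mat k (r + k)" and X: "X \<in> carrier_mat r (r + k)" and s: "sign_fun s"
    and i: "r \<le> i" "i < r + k" "j < r + k"
  shows "(block_diag r k (1\<^sub>m r) (diag_sign k s) * (X @\<^sub>r W)) $$ (i, j) \<in> U"
proof -
  note D = diag_sign_carrier[of k s]
  have ik: "i - r < k" using i by simp
  have "(block_diag r k (1\<^sub>m r) (diag_sign k s) * (X @\<^sub>r W)) $$ (i, j) = (diag_sign k s * W) $$ (i - r, j)"
    unfolding block_diag_append[OF one_carrier_mat D X W(2)]
      append_rows_entry[OF mult_carrier_mat[OF one_carrier_mat X] mult_carrier_mat[OF D W(2)] i(2,3)] using i by simp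
  also have "\<dots> = s (i - r) * W $$ (i - r, j)" by (rule diag_sign_mult_entry[OF W(2) ik i(3)])
  also have "\<dots> \<in> U"
  proof -
    have "W $$ (i - r, j) \<in> U" using W ik i unfolding elements_mat_subset_iff[OF W(2)] by blast
    then show ?thesis using s real_subringD(5)[OF U] unfolding sign_fun_def by (metis mult_1 mult_minus1)
  qed
  finally show ?thesis .
qed

lemma diag_sign_mult:
  "diag_sign k s * diag_sign k t = diag_sign k (\<lambda>i. s i * t i)"
proof (rule eq_matI)
  fix i j assume "i < dim_row (diag_sign k (\<lambda>i. s i * t i))" "j < dim_col (diag_sign k (\<lambda>i. s i * t i))"
  then have ij: "i < k" "j < k" unfolding diag_sign_def by auto
  show "(diag_sign k s * diag_sign k t) $$ (i, j) = diag_sign k (\<lambda>i. s i * t i) $$ (i, j)"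
    unfolding diag_sign_mult_entry[OF diag_sign_carrier ij] using ij by (simp add: diag_sign_def)
qed (auto simp: diag_sign_def)

text \<open>
  For \<open>B\<close> and for \<open>C\<close>, first exchange the lower rows by rows over \<open>U\<close>, then move to a frame of \<open>A\<close>.  The
  two frames of \<open>A\<close> so obtained share the invertible part \<open>X0\<close> and are joined up to signs, which are
  absorbed into the frame of \<open>C\<close>.
\<close>

theorem shift_equivalent_frames_joined:
  assumes A: "A \<in> carrier_mat n n" and n: "n \<ge> 1" and pos: "positive_mat A"
  shows "\<exists>r k J. n = r + k \<and> J \<in> carrier_mat r r \<and> det J \<noteq> 0 \<and> (\<exists>W. nil_frame n k A W) \<and>
    (\<exists>\<delta>>0. \<forall>B\<in>SE_nbhd \<delta> A. \<forall>C\<in>SE_nbhd \<delta> A. positive_mat B \<and> positive_mat C \<and>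
      (\<forall>U. real_subring U \<longrightarrow> elements_mat B \<subseteq> U \<longrightarrow> elements_mat C \<subseteq> U \<longrightarrow>
        (\<exists>L T L' T'. frame r k J B L T \<and> frame r k J C L' T' \<and> joined r k J L T L' T' \<and>
          (\<forall>i j. r \<le> i \<longrightarrow> i < n \<longrightarrow> j < n \<longrightarrow> L $$ (i, j) \<in> U \<and> L' $$ (i, j) \<in> U))))"
proof -
  obtain k W0 where W0: "full_frame n k A W0" using full_frame_orthonormal[OF A] by blast
  have nW0: "nil_frame n k A W0" using W0 unfolding full_frame_def by blast
  then have "k \<le> n" using rows_indep_le unfolding nil_frame_def by blast
  define r where "r = n - k"
  have nrk: "n = r + k" using \<open>k \<le> n\<close> unfolding r_def by simp
  obtain X0 J where X0: "X0 \<in> carrier_mat r n" and J: "J \<in> carrier_mat r r" "det J \<noteq> 0" and XA: "X0 * A = J * X0"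
    and ri: "rows_indep n n (X0 @\<^sub>r W0)"
    using full_frame_complement[OF A W0 nrk] by blast
  have W0c: "W0 \<in> carrier_mat k n" by (rule nil_frame_carrier[OF nW0])
  have X0i: "rows_indep r n X0"
    unfolding rows_indep_def
  proof (intro conjI ballI impI X0)
    fix c assume c: "c \<in> carrier_mat 1 r" "c * X0 = 0\<^sub>m 1 n"
    show "c = 0\<^sub>m 1 r"
      by (rule rows_indep_append_left[OF _ X0 W0c c(1), of "0\<^sub>m 1 k"]) (use ri nrk c(2) left_mult_zero_mat[OF W0c, of 1] in auto)
  qed
  note Ark = A[unfolded nrk] and nrk1 = n[unfolded nrk] and W0rk = W0[unfolded nrk] and X0rk = X0i[unfolded nrk]
  have "\<exists>\<delta>>0. \<forall>B\<in>SE_nbhd \<delta> A. \<exists>Y W T W' T'. Y \<in> carrier_mat r (r + k) \<and> W \<in> carrier_mat k (r + k) \<and> W' \<in> carrier_mat k (r + k) \<and>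
     frame r k J B (Y @\<^sub>r W) T \<and> frame r k J A (X0 @\<^sub>r W') T' \<and> joined r k J (Y @\<^sub>r W) T (X0 @\<^sub>r W') T'"
    by (rule near_frames[OF Ark nrk1 pos W0rk J X0rk XA])
  then obtain \<delta>1 where d1: "\<delta>1 > 0" "\<forall>B\<in>SE_nbhd \<delta>1 A. \<exists>Y W T W' T'. Y \<in> carrier_mat r (r + k) \<and> W \<in> carrier_mat k (r + k) \<and> W' \<in> carrier_mat k (r + k) \<and>
     frame r k J B (Y @\<^sub>r W) T \<and> frame r k J A (X0 @\<^sub>r W') T' \<and> joined r k J (Y @\<^sub>r W) T (X0 @\<^sub>r W') T'"
    by (elim exE conjE) (rule that)
  have "\<exists>\<eta>>0. \<forall>P. mclose n n \<eta> P A \<longrightarrow> positive_mat P"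
    by (rule near_by_sequences[OF A]) (rule mtends_eventually_positive[OF _ pos])
  then obtain \<delta>2 where d2: "\<delta>2 > 0" "\<forall>P. mclose n n \<delta>2 P A \<longrightarrow> positive_mat P" by blast
  define \<delta> where "\<delta> = min \<delta>1 \<delta>2"
  have d: "\<delta> > 0" "B \<in> SE_nbhd \<delta> A \<Longrightarrow> B \<in> SE_nbhd \<delta>1 A" for B using d1 d2 unfolding \<delta>_def SE_nbhd_def by auto
  have posB: "positive_mat B" if B: "B \<in> SE_nbhd \<delta> A" for B
  proof -
    note D = SE_nbhdD[OF B A n]
    have "mclose n n \<delta>2 B A" unfolding mclose_def using D(1,3) unfolding \<delta>_def by auto
    with d2 show ?thesis by blast
  qed
  have half: "\<exists>L T W' T'. frame r k J B L T \<and> W' \<in> carrier_mat k (r + k) \<and> frame r k J A (X0 @\<^sub>r W') T' \<and>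
      joined r k J L T (X0 @\<^sub>r W') T' \<and> (\<exists>Y W s. Y \<in> carrier_mat r (r + k) \<and> W \<in> carrier_mat k (r + k) \<and> elements_mat W \<subseteq> U \<and> sign_fun s \<and>
        L = block_diag r k (1\<^sub>m r) (diag_sign k s) * (Y @\<^sub>r W))"
    if B: "B \<in> SE_nbhd \<delta> A" and U: "real_subring U" "elements_mat B \<subseteq> U" for B U
  proof -
    note D = SE_nbhdD[OF B A n]
    have "\<exists>Y W T W' T'. Y \<in> carrier_mat r (r + k) \<and> W \<in> carrier_mat k (r + k) \<and> W' \<in> carrier_mat k (r + k) \<and>
     frame r k J B (Y @\<^sub>r W) T \<and> frame r k J A (X0 @\<^sub>r W') T' \<and> joined r k J (Y @\<^sub>r W) T (X0 @\<^sub>r W') T'"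
      using d1(2) d(2)[OF B] by blast
    then obtain Y W T W' T' where Y: "Y \<in> carrier_mat r (r + k)" "W \<in> carrier_mat k (r + k)" "W' \<in> carrier_mat k (r + k)"
      and f: "frame r k J B (Y @\<^sub>r W) T" "frame r k J A (X0 @\<^sub>r W') T'" and j: "joined r k J (Y @\<^sub>r W) T (X0 @\<^sub>r W') T'"
      by (elim exE conjE) (rule that)
    obtain k' V where V: "elements_mat V \<subseteq> U" "full_frame n k' B V" using full_frame_over_subring[OF U(1) D(1) U(2)] by blast
    have "k' = k" by (rule full_frame_size_unique[OF D(2) A D(1) W0 V(2)])
    then have V': "nil_frame (r + k) k B V" using V(2) nrk unfolding full_frame_def by simp
    have Vc: "V \<in> carrier_mat k (r + k)" by (rule nil_frame_carrier[OF V'])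
    obtain S where S: "strictly_lower k S" "V * B = S * V" and Vi: "rows_indep k (r + k) V" using V' unfolding nil_frame_def by blast
    note p = frame_nilpotent_part[OF f(1) J(1) Y(1,2)]
    have fV: "frame r k J B (Y @\<^sub>r V) S"
      by (rule frame_of_parts[OF _ J p(4,1) Vi S(2,1)]) (use D(1) nrk in simp)
    obtain s where s: "sign_fun s" and js: "joined r k J (Y @\<^sub>r W) T (block_diag r k (1\<^sub>m r) (diag_sign k s) * (Y @\<^sub>r V)) (conj_by (diag_sign k s) S)"
      using frames_connected[OF J posB[OF B] Y(1,2) Vc f(1) fV] by blast
    note Dg = diag_sign_carrier[of k s]
    have "frame r k J B (block_diag r k (1\<^sub>m r) (diag_sign k s) * (Y @\<^sub>r V)) (conj_by (diag_sign k s) S)"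
      by (rule frame_left_mult[OF J(1) fV Dg minv_unique(1)[OF Dg Dg diag_sign_square[OF s]] strictly_lower_diag_sign[OF s S(1)]])
    moreover have "joined r k J (block_diag r k (1\<^sub>m r) (diag_sign k s) * (Y @\<^sub>r V)) (conj_by (diag_sign k s) S) (X0 @\<^sub>r W') T'"
      by (rule joined_trans[OF joined_sym[OF js] j])
    ultimately show ?thesis using Y(1,3) f(2) Vc V(1) s by blast
  qed
  have "\<exists>L T L' T'. frame r k J B L T \<and> frame r k J C L' T' \<and> joined r k J L T L' T' \<and>
      (\<forall>i j. r \<le> i \<longrightarrow> i < n \<longrightarrow> j < n \<longrightarrow> L $$ (i, j) \<in> U \<and> L' $$ (i, j) \<in> U)"
    if B: "B \<in> SE_nbhd \<delta> A" and C: "C \<in> SE_nbhd \<delta> A" and U: "real_subring U" "elements_mat B \<subseteq> U" "elements_mat C \<subseteq> U" for B C U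
  proof -
    obtain L T W1 T1 Y V s where f: "frame r k J B L T" and W1: "W1 \<in> carrier_mat k (r + k)" and f1: "frame r k J A (X0 @\<^sub>r W1) T1"
      and j1: "joined r k J L T (X0 @\<^sub>r W1) T1" and Y: "Y \<in> carrier_mat r (r + k)" and V: "V \<in> carrier_mat k (r + k)" "elements_mat V \<subseteq> U"
      and s: "sign_fun s" and L: "L = block_diag r k (1\<^sub>m r) (diag_sign k s) * (Y @\<^sub>r V)"
      using half[OF B U(1,2)] by (elim exE conjE) (rule that)
    obtain L2 T2 W2 S2 Y' V' s' where f2: "frame r k J C L2 T2" and W2: "W2 \<in> carrier_mat k (r + k)" and f2A: "frame r k J A (X0 @\<^sub>r W2) S2"
      and j2: "joined r k J L2 T2 (X0 @\<^sub>r W2) S2" and Y': "Y' \<in> carrier_mat r (r + k)" and V': "V' \<in> carrier_mat k (r + k)" "elements_mat V' \<subseteq> U"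
      and s': "sign_fun s'" and L2: "L2 = block_diag r k (1\<^sub>m r) (diag_sign k s') * (Y' @\<^sub>r V')"
      using half[OF C U(1,3)] by (elim exE conjE) (rule that)
    have X0c: "X0 \<in> carrier_mat r (r + k)" using X0 nrk by simp
    obtain q where q: "sign_fun q" and jA: "joined r k J (X0 @\<^sub>r W1) T1
       (block_diag r k (1\<^sub>m r) (diag_sign k q) * (X0 @\<^sub>r W2)) (conj_by (diag_sign k q) S2)"
      using frames_connected[OF J pos X0c W1 W2 f1 f2A] by blast
    note jC = joined_sign[OF J(1) j2 q]
    define L' where "L' = block_diag r k (1\<^sub>m r) (diag_sign k q) * L2"
    define T' where "T' = conj_by (diag_sign k q) T2"
    have j: "joined r k J L T L' T'"
      unfolding L'_def T'_def by (rule joined_trans[OF joined_trans[OF j1 jA] joined_sym[OF jC]])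
    note Dq = diag_sign_carrier[of k q]
    have slT2: "strictly_lower k T2" using f2 unfolding frame_def by blast
    have f': "frame r k J C L' T'" unfolding L'_def T'_def
      by (rule frame_left_mult[OF J(1) f2 Dq minv_unique(1)[OF Dq Dq diag_sign_square[OF q]] strictly_lower_diag_sign[OF q slT2]])
    have L'e: "L' = block_diag r k (1\<^sub>m r) (diag_sign k (\<lambda>i. q i * s' i)) * (Y' @\<^sub>r V')"
    proof -
      note Ds' = diag_sign_carrier[of k s']
      have "L' = (block_diag r k (1\<^sub>m r) (diag_sign k q) * block_diag r k (1\<^sub>m r) (diag_sign k s')) * (Y' @\<^sub>r V')"
        unfolding L'_def L2
        by (rule assoc_mult_mat[OF block_diag_carrier[OF one_carrier_mat Dq] block_diag_carrier[OF one_carrier_mat Ds'] carrier_append_rows[OF Y' V'(1)], symmetric])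
      then show ?thesis
        unfolding block_diag_mult[OF one_carrier_mat Dq one_carrier_mat Ds'] diag_sign_mult by simp
    qed
    have qs: "sign_fun (\<lambda>i. q i * s' i)" using q s' unfolding sign_fun_def by (metis mult_1 mult_minus1 minus_minus)
    have "\<forall>i j. r \<le> i \<longrightarrow> i < n \<longrightarrow> j < n \<longrightarrow> L $$ (i, j) \<in> U \<and> L' $$ (i, j) \<in> U"
      unfolding L L'e nrk
      using frame_of_subring[OF U(1) V(2,1) Y s] frame_of_subring[OF U(1) V'(2,1) Y' qs] by blast
    with f f' j show ?thesis by blast
  qed
  then have main: "\<forall>B\<in>SE_nbhd \<delta> A. \<forall>C\<in>SE_nbhd \<delta> A. positive_mat B \<and> positive_mat C \<and>
      (\<forall>U. real_subring U \<longrightarrow> elements_mat B \<subseteq> U \<longrightarrow> elements_mat C \<subseteq> U \<longrightarrow>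
        (\<exists>L T L' T'. frame r k J B L T \<and> frame r k J C L' T' \<and> joined r k J L T L' T' \<and>
          (\<forall>i j. r \<le> i \<longrightarrow> i < n \<longrightarrow> j < n \<longrightarrow> L $$ (i, j) \<in> U \<and> L' $$ (i, j) \<in> U)))"
    by (intro ballI conjI allI impI posB)
  show ?thesis
    by (rule exI[of _ r], rule exI[of _ k], rule exI[of _ J])
      (intro conjI nrk J exI[of "nil_frame n k A", OF nW0] exI[of _ \<delta>] d(1) main)
qed

section \<open>The staircase: making the matrices of a path conjugate\<close>

text \<open>
  Each new index contributes a row with entries left of the diagonal only and a column that is zero on and
  above the diagonal; so the leading blocks of \<open>E'\<close> arise from \<open>E\<close> by adding one row and one zero
  column at a time.
\<close>

definition bordered :: "nat \<Rightarrow> nat \<Rightarrow> real mat \<Rightarrow> real mat \<Rightarrow> bool" where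
  "bordered p m E E' \<longleftrightarrow> p \<le> m \<and> E \<in> carrier_mat p p \<and> E' \<in> carrier_mat m m \<and>
     (\<forall>u<m. \<forall>v<m. (u < p \<and> v < p \<longrightarrow> E' $$ (u, v) = E $$ (u, v)) \<and> (p \<le> v \<and> u \<le> v \<longrightarrow> E' $$ (u, v) = 0))"

lemma bordered_refl: "E \<in> carrier_mat p p \<Longrightarrow> bordered p p E E"
  unfolding bordered_def by auto

lemma bordered_trans:
  assumes "bordered p q E E'" "bordered q m E' E''"
  shows "bordered p m E E''"
  unfolding bordered_def
proof (intro conjI allI impI)
  show "p \<le> m" "E \<in> carrier_mat p p" "E'' \<in> carrier_mat m m" using assms unfolding bordered_def by auto
  fix u v assume uv: "u < m" "v < m"
  show "E'' $$ (u, v) = E $$ (u, v)" if "u < p \<and> v < p"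
  proof -
    have "u < q" "v < q" using that assms(1) unfolding bordered_def by auto
    then show ?thesis using that uv assms unfolding bordered_def by metis
  qed
  show "E'' $$ (u, v) = 0" if z: "p \<le> v \<and> u \<le> v"
  proof (cases "v < q")
    case True
    then have "u < q" using z by simp
    then have "E'' $$ (u, v) = E' $$ (u, v)" using True uv assms(2) unfolding bordered_def by blast
    also have "\<dots> = 0" using True \<open>u < q\<close> z assms(1) unfolding bordered_def by blast
    finally show ?thesis .
  next
    case False
    then show ?thesis using z uv assms(2) unfolding bordered_def by (metis not_less)
  qed
qed

lemma bordered_four_block:
  assumes "E \<in> carrier_mat p p" "Z \<in> carrier_mat s p"
  shows "bordered p (p + s) E (four_block_mat E (0\<^sub>m p s) Z (0\<^sub>m s s))"
  using assms unfolding bordered_def by auto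

lemma mpath_mat:
  assumes "\<And>i j. i < nr \<Longrightarrow> j < nc \<Longrightarrow> continuous_on {0..1} (\<lambda>t. f t (i, j))"
  shows "mpath nr nc (\<lambda>t. mat nr nc (f t))"
  using assms unfolding mpath_def by auto

lemma mpath_entry: "mpath nr nc f \<Longrightarrow> i < nr \<Longrightarrow> j < nc \<Longrightarrow> continuous_on {0..1} (\<lambda>t. f t $$ (i, j))"
  unfolding mpath_def by blast

lemma four_block_mult_eqI:
  fixes A1 B1 C1 D1 :: "real mat"
  assumes "A1 \<in> carrier_mat a a" "B1 \<in> carrier_mat a b" "C1 \<in> carrier_mat b a" "D1 \<in> carrier_mat b b"
    "A2 \<in> carrier_mat a a" "B2 \<in> carrier_mat a b" "C2 \<in> carrier_mat b a" "D2 \<in> carrier_mat b b"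
    and "A1 * A2 + B1 * C2 = A" "A1 * B2 + B1 * D2 = B" "C1 * A2 + D1 * C2 = C" "C1 * B2 + D1 * D2 = D"
  shows "four_block_mat A1 B1 C1 D1 * four_block_mat A2 B2 C2 D2 = four_block_mat A B C D"
  using mult_four_block_mat[OF assms(1-8)] assms(9-12) by simp

lemma add_zero_left: "X \<in> carrier_mat a b \<Longrightarrow> 0\<^sub>m a b + (X :: real mat) = X"
  and add_zero_right: "X \<in> carrier_mat a b \<Longrightarrow> (X :: real mat) + 0\<^sub>m a b = X"
  by auto

text \<open>
  Let \<open>\<kappa>\<^sub>i\<close> be the last \<open>s + 1\<close> rows of \<open>K\<close>, on which \<open>E\<close> acts by \<open>T\<close> and \<open>Y\<close>.  The border \<open>Z K\<close> makes
  \<open>E'\<close> map the new basis vectors \<open>e\<^sub>j\<close> to \<open>\<kappa>\<^sub>j\<close> for \<open>j < s\<close>.  Since \<open>T\<close> is strictly lower triangular, it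
  involves only these \<open>\<kappa>\<^sub>j\<close>, so replacing \<open>\<kappa>\<^sub>i\<close> by \<open>\<kappa>\<^sub>i - \<Sum>\<^sub>j T\<^sub>i\<^sub>j e\<^sub>j\<close> clears \<open>T\<close> from the
  images of these vectors.  It reappears, without its last row and column, in the images of the \<open>e\<^sub>i\<close>.
\<close>

lemma staircase_step:
  assumes C: "C \<in> carrier_mat a a" and Y: "Y \<in> carrier_mat (Suc s) a" and T: "strictly_lower (Suc s) T"
    and K: "K \<in> carrier_mat (a + Suc s) (a + Suc s)" "det K \<noteq> 0" and E: "E \<in> carrier_mat (a + Suc s) (a + Suc s)"
    and e: "K * E = four_block_mat C (0\<^sub>m a (Suc s)) Y T * K"
    and p: "p = a + Suc s"
    and Z: "Z = mat s p (\<lambda>(i, j). if j = a + i then 1 else 0)"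
    and TN: "TN = mat p s (\<lambda>(i, j). if i < a then 0 else - T $$ (i - a, j))"
    and C': "C' = four_block_mat C (0\<^sub>m a (Suc s)) Y (0\<^sub>m (Suc s) (Suc s))"
    and T1: "T1 = mat s s (\<lambda>e. T $$ e)"
    and K': "K' = four_block_mat K TN (0\<^sub>m s p) (1\<^sub>m s)"
    and E': "E' = four_block_mat E (0\<^sub>m p s) (Z * K) (0\<^sub>m s s)"
  shows "K' * E' = four_block_mat C' (0\<^sub>m p s) Z T1 * K'" "det K' \<noteq> 0" "strictly_lower s T1"
proof -
  have Tc: "T \<in> carrier_mat (Suc s) (Suc s)" and sl: "\<And>i j. i < Suc s \<Longrightarrow> j < Suc s \<Longrightarrow> i \<le> j \<Longrightarrow> T $$ (i, j) = 0"
    using T unfolding strictly_lower_def by auto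
  show "strictly_lower s T1" unfolding strictly_lower_def T1 using sl by auto
  note Kp = K(1)[folded p] and Ep = E[folded p]
  have Zc: "Z \<in> carrier_mat s p" unfolding Z by simp
  have TNc: "TN \<in> carrier_mat p s" unfolding TN by simp
  have T1c: "T1 \<in> carrier_mat s s" unfolding T1 by simp
  have C'c: "C' \<in> carrier_mat p p" unfolding C' p using C by auto
  define N where "N = four_block_mat C (0\<^sub>m a (Suc s)) Y T"
  have Nc: "N \<in> carrier_mat p p" unfolding N_def p using C Tc by auto
  note ZK = mult_carrier_mat[OF Zc Kp]
  note TNZ = mult_carrier_mat[OF TNc Zc]
  have N_ent: "N $$ (i, j) = (if i < a then if j < a then C $$ (i, j) else 0 else if j < a then Y $$ (i - a, j) else T $$ (i - a, j - a))"
    if "i < p" "j < p" for i j using that C Tc Y unfolding N_def p by auto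
  have C'_ent: "C' $$ (i, j) = (if i < a then if j < a then C $$ (i, j) else 0 else if j < a then Y $$ (i - a, j) else 0)"
    if "i < p" "j < p" for i j using that C Y unfolding C' p by auto
  have TNZ_ent: "(TN * Z) $$ (i, j) = (if a \<le> j \<and> j < a + s then TN $$ (i, j - a) else 0)" if ij: "i < p" "j < p" for i j
  proof -
    have "(TN * Z) $$ (i, j) = (\<Sum>m<s. if m = j - a \<and> a \<le> j then TN $$ (i, m) else 0)"
      unfolding mult_entry[OF TNc Zc ij] using ij by (intro sum.cong) (auto simp: Z)
    also have "\<dots> = (if a \<le> j \<and> j < a + s then TN $$ (i, j - a) else 0)" by (cases "a \<le> j") auto
    finally show ?thesis .
  qed
  have NTZ: "N + TN * Z = C'"
  proof (rule eq_matI)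
    fix i j assume "i < dim_row C'" "j < dim_col C'"
    then have ij: "i < p" "j < p" using C'c by auto
    have "(N + TN * Z) $$ (i, j) = N $$ (i, j) + (TN * Z) $$ (i, j)" using ij TNZ Zc TNc by simp
    also have "\<dots> = C' $$ (i, j)"
    proof (cases "j < a + s")
      case True
      then show ?thesis unfolding N_ent[OF ij] C'_ent[OF ij] TNZ_ent[OF ij] using ij by (auto simp: TN)
    next
      case False
      then have j: "j - a = s" "\<not> j < a" using ij unfolding p by auto
      have "T $$ (i - a, s) = 0" if "\<not> i < a" using sl[of "i - a" s] ij that unfolding p by auto
      then show ?thesis unfolding N_ent[OF ij] C'_ent[OF ij] TNZ_ent[OF ij] using False j by simp
    qed
    finally show "(N + TN * Z) $$ (i, j) = C' $$ (i, j)" .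
  qed (use C'c TNc Zc in auto)
  have CTN: "C' * TN = 0\<^sub>m p s"
  proof (rule eq_matI)
    fix i j assume "i < dim_row (0\<^sub>m p s :: real mat)" "j < dim_col (0\<^sub>m p s :: real mat)"
    then have ij: "i < p" "j < s" by auto
    have "(C' * TN) $$ (i, j) = 0" unfolding mult_entry[OF C'c TNc ij]
      using ij by (intro sum.neutral) (auto simp: C'_ent TN)
    then show "(C' * TN) $$ (i, j) = 0\<^sub>m p s $$ (i, j)" using ij by simp
  qed (use C'c TNc in auto)
  have ZTN: "Z * TN + T1 = 0\<^sub>m s s"
  proof (rule eq_matI)
    fix i j assume "i < dim_row (0\<^sub>m s s :: real mat)" "j < dim_col (0\<^sub>m s s :: real mat)"
    then have ij: "i < s" "j < s" by auto
    have "(Z * TN) $$ (i, j) = (\<Sum>m<p. if m = a + i then TN $$ (m, j) else 0)"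
      unfolding mult_entry[OF Zc TNc ij] using ij by (intro sum.cong) (auto simp: Z)
    also have "\<dots> = TN $$ (a + i, j)" using ij p by simp
    also have "\<dots> = - T $$ (i, j)" using ij p by (simp add: TN)
    finally show "(Z * TN + T1) $$ (i, j) = 0\<^sub>m s s $$ (i, j)" using ij Zc TNc by (simp add: T1)
  qed (use Zc TNc T1c in auto)
  have K'E': "K' * E' = four_block_mat (C' * K) (0\<^sub>m p s) (Z * K) (0\<^sub>m s s)"
    unfolding K' E'
  proof (rule four_block_mult_eqI[OF Kp TNc zero_carrier_mat one_carrier_mat Ep zero_carrier_mat ZK zero_carrier_mat])
    have "K * E + TN * (Z * K) = N * K + (TN * Z) * K"
      using e assoc_mult_mat[OF TNc Zc Kp] unfolding N_def by simp
    also have "\<dots> = C' * K" using add_mult_distrib_mat[OF Nc TNZ Kp] NTZ by simp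
    finally show "K * E + TN * (Z * K) = C' * K" .
    show "K * 0\<^sub>m p s + TN * 0\<^sub>m s s = 0\<^sub>m p s" using right_mult_zero_mat[OF Kp] right_mult_zero_mat[OF TNc] by simp
    show "0\<^sub>m s p * E + 1\<^sub>m s * (Z * K) = Z * K" using left_mult_zero_mat[OF Ep] left_mult_one_mat[OF ZK] ZK by (simp add: add_zero_left)
    show "0\<^sub>m s p * 0\<^sub>m p s + 1\<^sub>m s * 0\<^sub>m s s = (0\<^sub>m s s :: real mat)"
      using left_mult_zero_mat[of "0\<^sub>m p s :: real mat" p s s] by simp
  qed
  have "four_block_mat C' (0\<^sub>m p s) Z T1 * K' = four_block_mat (C' * K) (0\<^sub>m p s) (Z * K) (0\<^sub>m s s)"
    unfolding K'
  proof (rule four_block_mult_eqI[OF C'c zero_carrier_mat Zc T1c Kp TNc zero_carrier_mat one_carrier_mat])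
    show "C' * K + 0\<^sub>m p s * 0\<^sub>m s p = C' * K"
      using left_mult_zero_mat[of "0\<^sub>m s p :: real mat" s p p] add_zero_right[OF mult_carrier_mat[OF C'c Kp]] by simp
    show "C' * TN + 0\<^sub>m p s * 1\<^sub>m s = 0\<^sub>m p s" unfolding CTN by simp
    show "Z * K + T1 * 0\<^sub>m s p = Z * K" using right_mult_zero_mat[OF T1c] add_zero_right[OF ZK] by simp
    show "Z * TN + T1 * 1\<^sub>m s = 0\<^sub>m s s" using ZTN right_mult_one_mat[OF T1c] by simp
  qed
  with K'E' show "K' * E' = four_block_mat C' (0\<^sub>m p s) Z T1 * K'" by simp
  define iK where "iK = minv K"
  have iK: "iK \<in> carrier_mat p p" unfolding iK_def by (rule minv_carrier[OF Kp])
  have KiK: "K * iK = 1\<^sub>m p" unfolding iK_def by (rule minv_right[OF Kp K(2)])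
  define V where "V = (- 1) \<cdot>\<^sub>m (iK * TN)"
  have V: "V \<in> carrier_mat p s" unfolding V_def using mult_carrier_mat[OF iK TNc] by simp
  have "K' * four_block_mat iK V (0\<^sub>m s p) (1\<^sub>m s) = four_block_mat (1\<^sub>m p) (0\<^sub>m p s) (0\<^sub>m s p) (1\<^sub>m s)"
    unfolding K'
  proof (rule four_block_mult_eqI[OF Kp TNc zero_carrier_mat one_carrier_mat iK V zero_carrier_mat one_carrier_mat])
    show "K * iK + TN * 0\<^sub>m s p = 1\<^sub>m p" unfolding KiK using right_mult_zero_mat[OF TNc, of p] by simp
    have "K * V = (- 1) \<cdot>\<^sub>m (K * (iK * TN))" unfolding V_def by (rule mult_smult_distrib[OF Kp mult_carrier_mat[OF iK TNc]])
    also have "K * (iK * TN) = TN" using assoc_mult_mat[OF Kp iK TNc] KiK left_mult_one_mat[OF TNc] by simp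
    finally have "K * V = (- 1) \<cdot>\<^sub>m TN" .
    then show "K * V + TN * 1\<^sub>m s = 0\<^sub>m p s" using TNc by (intro eq_matI) auto
    show "0\<^sub>m s p * iK + 1\<^sub>m s * 0\<^sub>m s p = 0\<^sub>m s p" using left_mult_zero_mat[OF iK, of s] by simp
    show "0\<^sub>m s p * V + 1\<^sub>m s * 1\<^sub>m s = 1\<^sub>m s" using left_mult_zero_mat[OF V, of s] by simp
  qed
  then have inv: "K' * four_block_mat iK V (0\<^sub>m s p) (1\<^sub>m s) = 1\<^sub>m (p + s)" by simp
  show "det K' \<noteq> 0"
    by (rule minv_unique(1)[OF _ _ inv]) (use Kp iK K' in auto)
qed

text \<open>
  Along the path \<open>E\<close> the bordered matrices \<open>E'\<close> are conjugate to the constant matrix \<open>M\<close>.  Entries in \<open>U\<close>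
  are required at the parameters in \<open>P\<close> only, which will be the two ends.
\<close>

definition staircase_data :: "nat \<Rightarrow> nat \<Rightarrow> (real \<Rightarrow> real mat) \<Rightarrow> (real \<Rightarrow> real mat) \<Rightarrow> (real \<Rightarrow> real mat) \<Rightarrow> real mat \<Rightarrow> real set \<Rightarrow> real set \<Rightarrow> bool" where
  "staircase_data p m E E' K' M P U \<longleftrightarrow> M \<in> carrier_mat m m \<and> mpath m m E' \<and> mpath m m K' \<and>
     (\<forall>t\<in>{0..1}. det (K' t) \<noteq> 0 \<and> K' t * E' t = M * K' t \<and> bordered p m (E t) (E' t)) \<and>
     (\<forall>t\<in>P. elements_mat (E' t) \<subseteq> U)"

text \<open>
  Repeating the step until nothing is left of \<open>T\<close> adds \<open>(s - 1) + \<dots> + 1 + 0\<close> rows.  The blocks \<open>C\<close> and \<open>Y\<close>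
  collect the part that has become constant.  At the parameters in \<open>P\<close> the lower rows of \<open>K\<close> have entries in \<open>U\<close>
  again after every step, so all borders have.
\<close>

lemma staircase:
  assumes U: "real_subring U"
    and "C \<in> carrier_mat a a" "Y \<in> carrier_mat s a" "mpath s s T" "\<And>t. t \<in> {0..1} \<Longrightarrow> strictly_lower s (T t)"
    and "mpath (a + s) (a + s) K" "\<And>t. t \<in> {0..1} \<Longrightarrow> det (K t) \<noteq> 0" "mpath (a + s) (a + s) E"
    and "\<And>t. t \<in> {0..1} \<Longrightarrow> K t * E t = four_block_mat C (0\<^sub>m a s) Y (T t) * K t"
    and "\<And>t. t \<in> P \<Longrightarrow> elements_mat (E t) \<subseteq> U"
    and "\<And>t i j. t \<in> P \<Longrightarrow> a \<le> i \<Longrightarrow> i < a + s \<Longrightarrow> j < a + s \<Longrightarrow> K t $$ (i, j) \<in> U"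
  shows "\<exists>E' K' M. staircase_data (a + s) (a + s + (\<Sum>i<s. i)) E E' K' M P U"
  using assms(2-)
proof (induction s arbitrary: a C Y T K E)
  case 0
  define M where "M = four_block_mat C (0\<^sub>m a 0) Y (0\<^sub>m 0 0)"
  have "T t = 0\<^sub>m 0 0" for t using mpath_carrier[OF 0(3), of t] by (intro eq_matI) auto
  then have "K t * E t = M * K t" if "t \<in> {0..1}" for t unfolding M_def using 0(8)[OF that] by simp
  moreover have "M \<in> carrier_mat a a" unfolding M_def using 0(1) by auto
  moreover have "bordered a a (E t) (E t)" for t by (rule bordered_refl) (use mpath_carrier[OF 0(7), of t] in simp)
  ultimately have "staircase_data (a + 0) (a + 0 + (\<Sum>i<0. i)) E E K M P U"
    unfolding staircase_data_def using 0 by simp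
  then show ?case by blast
next
  case (Suc s)
  define p where "p = a + Suc s"
  define Z where "Z = mat s p (\<lambda>(i, j). if j = a + i then 1 else 0 :: real)"
  define TN where "TN t = mat p s (\<lambda>(i, j). if i < a then 0 else - T t $$ (i - a, j))" for t
  define C' where "C' = four_block_mat C (0\<^sub>m a (Suc s)) Y (0\<^sub>m (Suc s) (Suc s))"
  define T1 where "T1 t = mat s s (\<lambda>e. T t $$ e)" for t
  define K1 where "K1 t = four_block_mat (K t) (TN t) (0\<^sub>m s p) (1\<^sub>m s)" for t
  define E1 where "E1 t = four_block_mat (E t) (0\<^sub>m p s) (Z * K t) (0\<^sub>m s s)" for t
  note Kp = Suc.prems(5)[folded p_def] and Ep = Suc.prems(7)[folded p_def]
  have Zc: "Z \<in> carrier_mat s p" unfolding Z_def by simp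
  have C'c: "C' \<in> carrier_mat p p" unfolding C'_def p_def using Suc.prems(1) by auto
  have step: "K1 t * E1 t = four_block_mat C' (0\<^sub>m p s) Z (T1 t) * K1 t" "det (K1 t) \<noteq> 0" "strictly_lower s (T1 t)"
    if t: "t \<in> {0..1}" for t
    using staircase_step[OF Suc.prems(1,2) Suc.prems(4)[OF t] mpath_carrier[OF Suc.prems(5)] Suc.prems(6)[OF t]
        mpath_carrier[OF Suc.prems(7)] Suc.prems(8)[OF t] p_def Z_def TN_def C'_def T1_def K1_def E1_def] by auto
  have T1: "mpath s s T1" unfolding T1_def by (intro mpath_mat mpath_entry[OF Suc.prems(3)]) auto
  have TN: "mpath p s TN" unfolding TN_def
  proof (intro mpath_mat)
    fix i j assume ij: "i < p" "j < s"
    show "continuous_on {0..1} (\<lambda>t. case (i, j) of (i, j) \<Rightarrow> if i < a then 0 else - T t $$ (i - a, j))"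
    proof (cases "i < a")
      case False
      then have "i - a < Suc s" "j < Suc s" using ij p_def by auto
      from mpath_entry[OF Suc.prems(3) this] False show ?thesis by (auto intro: continuous_intros)
    qed auto
  qed
  have K1: "mpath (p + s) (p + s) K1" unfolding K1_def by (intro mpath_four_block Kp TN mpath_const) auto
  have E1: "mpath (p + s) (p + s) E1" unfolding E1_def
    by (intro mpath_four_block Ep mpath_mult[OF mpath_const[OF Zc] Kp] mpath_const) auto
  have E1U: "elements_mat (E1 t) \<subseteq> U" if t: "t \<in> P" for t
  proof -
    note Kt = mpath_carrier[OF Kp, of t] and Et = mpath_carrier[OF Ep, of t]
    note ZK = mult_carrier_mat[OF Zc Kt]
    have zk: "(Z * K t) $$ (i, j) \<in> U" if ij: "i < s" "j < p" for i j
    proof -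
      have "(Z * K t) $$ (i, j) = (\<Sum>m<p. if m = a + i then K t $$ (m, j) else 0)"
        unfolding mult_entry[OF Zc Kt ij] using ij by (intro sum.cong) (auto simp: Z_def)
      also have "\<dots> = K t $$ (a + i, j)" using ij p_def by simp
      finally show ?thesis using Suc.prems(10)[OF t, of "a + i" j] ij p_def by simp
    qed
    have et: "E t $$ (i, j) \<in> U" if "i < p" "j < p" for i j
      using Suc.prems(9)[OF t] that unfolding elements_mat_subset_iff[OF Et] by blast
    have "E1 t $$ (i, j) \<in> U" if ij: "i < p + s" "j < p + s" for i j
      unfolding E1_def using ij zk[of "i - p" j] et[of i j] Et real_subringD(2)[OF U] by auto
    then show ?thesis unfolding elements_mat_subset_iff[OF mpath_carrier[OF E1]] by blast
  qed
  have K1U: "K1 t $$ (i, j) \<in> U" if "t \<in> P" "p \<le> i" "i < p + s" "j < p + s" for t i j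
    unfolding K1_def using that real_subringD(1,2)[OF U] mpath_carrier[OF Kp, of t] by auto
  obtain E' K' M where IH: "staircase_data (p + s) (p + s + (\<Sum>i<s. i)) E1 E' K' M P U"
    using Suc.IH[OF C'c Zc T1 step(3) K1 step(2) E1 step(1) E1U K1U] by blast
  have size: "p + s + (\<Sum>i<s. i) = a + Suc s + (\<Sum>i<Suc s. i)" unfolding p_def by simp
  have "bordered p (p + s) (E t) (E1 t)" for t
    unfolding E1_def by (rule bordered_four_block[OF mpath_carrier[OF Ep] mult_carrier_mat[OF Zc mpath_carrier[OF Kp]]])
  then have "staircase_data p (a + Suc s + (\<Sum>i<Suc s. i)) E E' K' M P U"
    using IH bordered_trans unfolding staircase_data_def size by blast
  then show ?case unfolding p_def by blast
qed

text \<open>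
  Larger sizes are reached by adding zero borders; splitting turns these into positive rows like all
  others.
\<close>

lemma staircase_pad:
  assumes U: "real_subring U" and d: "staircase_data p m E E' K' M P U"
  shows "\<exists>E'' K'' M'. staircase_data p (m + s) E E'' K'' M' P U"
proof -
  have M: "M \<in> carrier_mat m m" and E': "mpath m m E'" and K': "mpath m m K'"
    and t: "\<And>t. t \<in> {0..1} \<Longrightarrow> det (K' t) \<noteq> 0 \<and> K' t * E' t = M * K' t \<and> bordered p m (E t) (E' t)"
    and PU: "\<And>t. t \<in> P \<Longrightarrow> elements_mat (E' t) \<subseteq> U"
    using d unfolding staircase_data_def by auto
  define E'' where "E'' t = four_block_mat (E' t) (0\<^sub>m m s) (0\<^sub>m s m) (0\<^sub>m s s)" for t
  define K'' where "K'' t = four_block_mat (K' t) (0\<^sub>m m s) (0\<^sub>m s m) (1\<^sub>m s)" for t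
  define M' where "M' = four_block_mat M (0\<^sub>m m s) (0\<^sub>m s m) (0\<^sub>m s s)"
  have b: "E'' t = block_diag m s (E' t) (0\<^sub>m s s)" "K'' t = block_diag m s (K' t) (1\<^sub>m s)" "M' = block_diag m s M (0\<^sub>m s s)" for t
    unfolding block_diag_def E''_def K''_def M'_def by auto
  have "staircase_data p (m + s) E E'' K'' M' P U"
    unfolding staircase_data_def
  proof (intro conjI ballI)
    show "M' \<in> carrier_mat (m + s) (m + s)" unfolding M'_def using M by auto
    show "mpath (m + s) (m + s) E''" "mpath (m + s) (m + s) K''" unfolding E''_def K''_def
      by (intro mpath_four_block E' K' mpath_const; simp)+
    fix u :: real assume u: "u \<in> {0..1}"
    note Eu = mpath_carrier[OF E', of u] and Ku = mpath_carrier[OF K', of u]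
    show "K'' u * E'' u = M' * K'' u"
      unfolding b block_diag_mult[OF Ku one_carrier_mat Eu zero_carrier_mat] block_diag_mult[OF M zero_carrier_mat Ku one_carrier_mat]
      using t[OF u] by simp
    have "K'' u * block_diag m s (minv (K' u)) (1\<^sub>m s) = 1\<^sub>m (m + s)"
      unfolding b block_diag_mult[OF Ku one_carrier_mat minv_carrier[OF Ku] one_carrier_mat]
      using t[OF u] minv_right[OF Ku] by (simp add: block_diag_one)
    then show "det (K'' u) \<noteq> 0"
      by (rule minv_unique(1)[rotated 2]) (use block_diag_carrier[OF Ku one_carrier_mat] block_diag_carrier[OF minv_carrier[OF Ku] one_carrier_mat] b in auto)
    have "bordered m (m + s) (E' u) (E'' u)" unfolding E''_def by (rule bordered_four_block[OF Eu zero_carrier_mat])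
    then show "bordered p (m + s) (E u) (E'' u)" using t[OF u] bordered_trans by blast
  next
    fix u assume u: "u \<in> P"
    note Eu = mpath_carrier[OF E', of u]
    have "E'' u $$ (i, j) \<in> U" if "i < m + s" "j < m + s" for i j
      using that PU[OF u] real_subringD(2)[OF U] Eu unfolding E''_def elements_mat_subset_iff[OF Eu] by auto
    moreover have "E'' u \<in> carrier_mat (m + s) (m + s)" unfolding E''_def using Eu by auto
    ultimately show "elements_mat (E'' u) \<subseteq> U" using elements_mat_subset_iff by blast
  qed
  then show ?thesis by blast
qed

section \<open>Borders that become row splittings\<close>

definition positive_splitting :: "real set \<Rightarrow> nat \<Rightarrow> real mat \<Rightarrow> real mat \<Rightarrow> bool" where
  "positive_splitting U m M N \<longleftrightarrow> elem_row_splitting (U \<inter> {0..}) M N \<and> positive_mat N \<and> dim_row N \<le> m"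

text \<open>
  The uniform bounds on \<open>[0,1]\<close> that make one choice of parameters work along a whole path.
\<close>

lemma compact_bounds:
  assumes f: "mpath nr nc f"
  shows "\<exists>b. b > 0 \<and> (\<forall>t\<in>{0..1}. \<forall>i<nr. \<forall>j<nc. \<bar>f t $$ (i, j)\<bar> \<le> b)"
    and "(\<And>t. t \<in> {0..1} \<Longrightarrow> positive_mat (f t)) \<Longrightarrow> \<exists>a. a > 0 \<and> (\<forall>t\<in>{0..1}. \<forall>i<nr. \<forall>j<nc. a \<le> f t $$ (i, j))"
proof -
  have "\<exists>b. \<forall>t\<in>{0..1}. \<bar>f t $$ e\<bar> \<le> b" if e: "e \<in> {..<nr} \<times> {..<nc}" for e
  proof -
    have c: "continuous_on {0..1} (\<lambda>t. \<bar>f t $$ e\<bar>)" using e mpath_entry[OF f] by (auto intro!: continuous_intros)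
    from continuous_attains_sup[OF compact_Icc _ c] show ?thesis by fastforce
  qed
  then have "\<forall>e\<in>{..<nr} \<times> {..<nc}. \<exists>b. \<forall>t\<in>{0..1}. \<bar>f t $$ e\<bar> \<le> b" by blast
  from bchoice[OF this] obtain b where b: "\<forall>e\<in>{..<nr} \<times> {..<nc}. \<forall>t\<in>{0..1}. \<bar>f t $$ e\<bar> \<le> b e" by (elim exE)
  define B where "B = Max (insert 1 (b ` ({..<nr} \<times> {..<nc})))"
  have fin: "finite (insert 1 (b ` ({..<nr} \<times> {..<nc})))" by simp
  have "1 \<le> B" unfolding B_def by (intro Max_ge fin) simp
  moreover have "\<bar>f t $$ (i, j)\<bar> \<le> B" if "t \<in> {0..1}" "i < nr" "j < nc" for t i j
  proof -
    have "\<bar>f t $$ (i, j)\<bar> \<le> b (i, j)" using b that by auto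
    also have "\<dots> \<le> B" unfolding B_def using that by (intro Max_ge fin) auto
    finally show ?thesis .
  qed
  ultimately show "\<exists>b. b > 0 \<and> (\<forall>t\<in>{0..1}. \<forall>i<nr. \<forall>j<nc. \<bar>f t $$ (i, j)\<bar> \<le> b)" by (intro exI[of _ B]) auto
next
  assume pos: "\<And>t. t \<in> {0..1} \<Longrightarrow> positive_mat (f t)"
  have "\<exists>b>0. \<forall>t\<in>{0..1}. b \<le> f t $$ e" if e: "e \<in> {..<nr} \<times> {..<nc}" for e
  proof -
    have c: "continuous_on {0..1} (\<lambda>t. f t $$ e)" using e mpath_entry[OF f] by auto
    obtain x where x: "x \<in> {0..1}" "\<forall>y\<in>{0..1}. f x $$ e \<le> f y $$ e"
      using continuous_attains_inf[OF compact_Icc _ c] by auto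
    have "f x $$ e > 0" using pos[OF x(1)] e unfolding positive_mat_iff[OF mpath_carrier[OF f]] by auto
    with x show ?thesis by blast
  qed
  then have "\<forall>e\<in>{..<nr} \<times> {..<nc}. \<exists>b. b > 0 \<and> (\<forall>t\<in>{0..1}. b \<le> f t $$ e)" by blast
  from bchoice[OF this] obtain b where b: "\<forall>e\<in>{..<nr} \<times> {..<nc}. b e > 0 \<and> (\<forall>t\<in>{0..1}. b e \<le> f t $$ e)" by (elim exE)
  define B where "B = Min (insert 1 (b ` ({..<nr} \<times> {..<nc})))"
  have fin: "finite (insert 1 (b ` ({..<nr} \<times> {..<nc})))" by simp
  have "B > 0" unfolding B_def using b by (subst Min_gr_iff[OF fin]) auto
  moreover have "B \<le> f t $$ (i, j)" if "t \<in> {0..1}" "i < nr" "j < nc" for t i j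
  proof -
    have "B \<le> b (i, j)" unfolding B_def using that by (intro Min_le fin) auto
    also have "\<dots> \<le> f t $$ (i, j)" using b that by auto
    finally show ?thesis .
  qed
  ultimately show "\<exists>a. a > 0 \<and> (\<forall>t\<in>{0..1}. \<forall>i<nr. \<forall>j<nc. a \<le> f t $$ (i, j))" by (intro exI[of _ B]) auto
qed

text \<open>
  Row \<open>0\<close> is split into its parts \<open>A\<^sub>0 - y\<close> and \<open>y\<close>; the second part becomes the last row, and
  column \<open>0\<close> is repeated as the last column.
\<close>

definition split_row :: "nat \<Rightarrow> real mat \<Rightarrow> real mat \<Rightarrow> real mat" where
  "split_row q A y = mat (Suc q) (Suc q) (\<lambda>(i, j).
     let c = (if j = q then 0 else j) in
     if i = q then y $$ (0, c) else if i = 0 then A $$ (0, c) - y $$ (0, c) else A $$ (i, c))"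

lemma split_row_positive:
  assumes q: "q \<ge> 1" and A: "A \<in> carrier_mat q q" "positive_mat A"
    and y: "y \<in> carrier_mat 1 q" "\<And>j. j < q \<Longrightarrow> 0 < y $$ (0, j) \<and> y $$ (0, j) < A $$ (0, j)"
  shows "positive_mat (split_row q A y)"
proof -
  have sc: "split_row q A y \<in> carrier_mat (Suc q) (Suc q)" unfolding split_row_def by simp
  have Ae: "A $$ (i, j) > 0" if "i < q" "j < q" for i j
    using A that unfolding positive_mat_iff[OF A(1)] by auto
  show ?thesis
    unfolding positive_mat_iff[OF sc]
  proof (intro allI impI)
    fix i j assume ij: "i < Suc q" "j < Suc q"
    define c where "c = (if j = q then 0 else j)"
    have c: "c < q" using ij q unfolding c_def by auto
    have "split_row q A y $$ (i, j) = (if i = q then y $$ (0, c) else if i = 0 then A $$ (0, c) - y $$ (0, c) else A $$ (i, c))"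
      using ij unfolding split_row_def c_def by (simp add: Let_def)
    then show "0 < split_row q A y $$ (i, j)" using Ae[of i c] y(2)[OF c] ij c by auto
  qed
qed

lemma split_row_splitting:
  assumes U: "real_subring U" and q: "q \<ge> 1" and A: "A \<in> carrier_mat q q" "positive_mat A" "elements_mat A \<subseteq> U"
    and y: "y \<in> carrier_mat 1 q" "elements_mat y \<subseteq> U" "\<And>j. j < q \<Longrightarrow> 0 < y $$ (0, j) \<and> y $$ (0, j) < A $$ (0, j)"
  shows "positive_splitting U (Suc q) A (split_row q A y)" "elements_mat (split_row q A y) \<subseteq> U"
proof -
  define X where "X = mat (Suc q) q (\<lambda>(i, j). if i = q then y $$ (0, j) else if i = 0 then A $$ (0, j) - y $$ (0, j) else A $$ (i, j))"
  define V where "V = mat q (Suc q) (\<lambda>(i, j). if i = (if j = q then 0 else j) then 1 else 0 :: real)"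
  have X: "X \<in> carrier_mat (Suc q) q" and V: "V \<in> carrier_mat q (Suc q)" unfolding X_def V_def by auto
  have sc: "split_row q A y \<in> carrier_mat (Suc q) (Suc q)" unfolding split_row_def by simp
  have Ae: "A $$ (i, j) \<in> U" "A $$ (i, j) > 0" if "i < q" "j < q" for i j
    using A that unfolding elements_mat_subset_iff[OF A(1)] positive_mat_iff[OF A(1)] by auto
  have ye: "y $$ (0, j) \<in> U" if "j < q" for j
    using y(2) that unfolding elements_mat_subset_iff[OF y(1)] by auto
  have pos: "positive_mat (split_row q A y)" by (rule split_row_positive[OF q A(1,2) y(1,3)])
  have Xp: "X $$ (i, j) \<in> U \<inter> {0..}" if ij: "i < Suc q" "j < q" for i j
    using ij Ae[of i j] Ae[of 0 j] ye[of j] y(3)[of j] real_subringD(3)[OF U, of "A $$ (0, j)" "y $$ (0, j)"] q unfolding X_def by auto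
  have sU: "split_row q A y $$ (i, j) \<in> U" if ij: "i < Suc q" "j < Suc q" for i j
    using ij Ae[of i "if j = q then 0 else j"] Ae[of 0 "if j = q then 0 else j"] ye[of "if j = q then 0 else j"]
      real_subringD(3)[OF U, of "A $$ (0, if j = q then 0 else j)" "y $$ (0, if j = q then 0 else j)"] q
    unfolding split_row_def by (auto simp: Let_def)
  show sU': "elements_mat (split_row q A y) \<subseteq> U" unfolding elements_mat_subset_iff[OF sc] using sU by blast
  have VX: "A = V * X"
  proof (rule eq_matI)
    fix i j assume "i < dim_row (V * X)" "j < dim_col (V * X)"
    then have ij: "i < q" "j < q" using V X by auto
    have "(V * X) $$ (i, j) = (\<Sum>m<q. V $$ (i, m) * X $$ (m, j)) + V $$ (i, q) * X $$ (q, j)"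
      unfolding mult_entry[OF V X ij] by simp
    also have "(\<Sum>m<q. V $$ (i, m) * X $$ (m, j)) = (\<Sum>m<q. if m = i then X $$ (m, j) else 0)"
      using ij by (intro sum.cong) (auto simp: V_def)
    also have "\<dots> = X $$ (i, j)" using ij by simp
    finally show "A $$ (i, j) = (V * X) $$ (i, j)" using ij by (auto simp: X_def V_def)
  qed (use A V X in auto)
  have XV: "split_row q A y = X * V"
  proof (rule eq_matI)
    fix i j assume "i < dim_row (X * V)" "j < dim_col (X * V)"
    then have ij: "i < Suc q" "j < Suc q" using V X by auto
    define c where "c = (if j = q then 0 else j)"
    have c: "c < q" using ij q unfolding c_def by auto
    have "(X * V) $$ (i, j) = (\<Sum>m<q. if m = c then X $$ (i, m) else 0)"
      unfolding mult_entry[OF X V ij] using ij by (intro sum.cong) (auto simp: V_def c_def)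
    also have "\<dots> = X $$ (i, c)" using c by simp
    finally show "split_row q A y $$ (i, j) = (X * V) $$ (i, j)"
      unfolding split_row_def X_def using ij c by (auto simp: Let_def c_def)
  qed (use sc V X in auto)
  have Ve: "V $$ (i, j) = (if i = (if j = q then 0 else j) then 1 else 0)" if "i < q" "j < Suc q" for i j
    unfolding V_def using that by simp
  have sub: "subdivision_mat V"
    unfolding subdivision_mat_def
  proof (intro conjI allI impI)
    show "elements_mat V \<subseteq> {0, 1}" unfolding elements_mat_subset_iff[OF V] using Ve by auto
    fix j assume "j < dim_col V"
    then have j: "j < Suc q" using V by simp
    show "\<exists>!i. i < dim_row V \<and> V $$ (i, j) = 1"
    proof (rule ex1I[of _ "if j = q then 0 else j"])
      show "(if j = q then 0 else j) < dim_row V \<and> V $$ (if j = q then 0 else j, j) = 1" using j q V Ve[of "if j = q then 0 else j" j] by auto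
      show "i = (if j = q then 0 else j)" if "i < dim_row V \<and> V $$ (i, j) = 1" for i
      proof -
        have "i < q" using that V by simp
        from Ve[OF this j] that show ?thesis by (metis zero_neq_one)
      qed
    qed
  next
    fix i assume "i < dim_row V"
    then have "i < q" using V by simp
    then show "\<exists>j<dim_col V. V $$ (i, j) = 1" using Ve[of i i] V by (intro exI[of _ i]) auto
  qed
  have VU: "elements_mat V \<subseteq> U \<inter> {0..}"
    unfolding elements_mat_subset_iff[OF V] using Ve real_subringD(1,2)[OF U] by auto
  have XU: "elements_mat X \<subseteq> U \<inter> {0..}" unfolding elements_mat_subset_iff[OF X] using Xp by blast
  have "elem_row_splitting (U \<inter> {0..}) A (split_row q A y)"
    unfolding elem_row_splitting_def
  proof (intro conjI)
    show "\<exists>V\<in>carrier_mat (dim_row A) (dim_row (split_row q A y)). \<exists>X\<in>carrier_mat (dim_row (split_row q A y)) (dim_row A).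
      subdivision_mat V \<and> elements_mat V \<subseteq> U \<inter> {0..} \<and> elements_mat X \<subseteq> U \<inter> {0..} \<and> A = V * X \<and> split_row q A y = X * V"
      unfolding carrier_matD(1)[OF A(1)] carrier_matD(1)[OF sc]
      by (intro bexI[of _ V] bexI[of _ X] conjI sub VU XU VX XV V X)
  qed (use A sc sU' positive_elements_mat_subset[OF A(2,3)] positive_elements_mat_subset[OF pos sU'] in auto)
  then show "positive_splitting U (Suc q) A (split_row q A y)" unfolding positive_splitting_def using pos sc by auto
qed

text \<open>
  \<open>G\<close> adds the fraction \<open>u\<close> of row \<open>0\<close> to \<open>\<epsilon>\<close> times the border \<open>z\<close>, which gives \<open>y\<close>; \<open>V\<close> then
  subtracts \<open>y\<close> from row \<open>0\<close>, and on the side of columns it repeats column \<open>0\<close>.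
\<close>

lemma split_row_conjugate:
  assumes q: "q \<ge> 1" and A: "A \<in> carrier_mat q q" and z: "z \<in> carrier_mat 1 q" and y: "y \<in> carrier_mat 1 q"
    and ye: "\<And>j. j < q \<Longrightarrow> y $$ (0, j) = u * A $$ (0, j) + \<epsilon> * z $$ (0, j)"
    and G: "G = four_block_mat (1\<^sub>m q) (0\<^sub>m q 1) (mat 1 q (\<lambda>(_, j). if j = 0 then u else 0)) (mat 1 1 (\<lambda>_. \<epsilon>))"
    and V: "V = four_block_mat (1\<^sub>m q) (mat q 1 (\<lambda>(i, _). if i = 0 then - 1 else 0)) (0\<^sub>m 1 q) (1\<^sub>m 1)"
  shows "(V * G) * four_block_mat A (0\<^sub>m q 1) z (0\<^sub>m 1 1) = split_row q A y * (V * G)"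
proof -
  define W where "W = V * G"
  define E where "E = four_block_mat A (0\<^sub>m q 1) z (0\<^sub>m 1 1)"
  have Gc: "G \<in> carrier_mat (q + 1) (q + 1)" unfolding G by (rule four_block_carrier_mat) auto
  have Vc: "V \<in> carrier_mat (q + 1) (q + 1)" unfolding V by (rule four_block_carrier_mat) auto
  have Ec: "E \<in> carrier_mat (q + 1) (q + 1)" unfolding E_def by (rule four_block_carrier_mat) (use A in auto)
  have Wc: "W \<in> carrier_mat (q + 1) (q + 1)" unfolding W_def by (rule mult_carrier_mat[OF Vc Gc])
  have sc: "split_row q A y \<in> carrier_mat (q + 1) (q + 1)" unfolding split_row_def by simp
  have Gent: "G $$ (i, j) = (if i < q then if i = j then 1 else 0 else if j = q then \<epsilon> else if j = 0 then u else 0)" if "i < q + 1" "j < q + 1" for i j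
    unfolding G using that by auto
  have Vent: "V $$ (i, j) = (if j < q then if i = j then 1 else 0 else if i = q then 1 else if i = 0 then - 1 else 0)"
    if "i < q + 1" "j < q + 1" for i j
    unfolding V using that by auto
  have VM: "(V * M) $$ (i, j) = (if i = 0 then M $$ (0, j) - M $$ (q, j) else M $$ (i, j))"
    if M: "M \<in> carrier_mat (q + 1) (q + 1)" and ij: "i < q + 1" "j < q + 1" for M i j
  proof -
    have "(V * M) $$ (i, j) = (\<Sum>m<q. V $$ (i, m) * M $$ (m, j)) + V $$ (i, q) * M $$ (q, j)"
      unfolding mult_entry[OF Vc M ij] by simp
    also have "(\<Sum>m<q. V $$ (i, m) * M $$ (m, j)) = (\<Sum>m<q. if m = i then M $$ (m, j) else 0)"
      using ij by (intro sum.cong) (auto simp: Vent)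
    also have "\<dots> + V $$ (i, q) * M $$ (q, j) = (if i = 0 then M $$ (0, j) - M $$ (q, j) else M $$ (i, j))"
      using ij q Vent[OF ij(1), of q] by (cases "i = q") auto
    finally show ?thesis .
  qed
  have Went: "W $$ (i, j) = (if i = 0 then (if j = 0 then 1 - u else if j = q then - \<epsilon> else 0)
      else if i = q then (if j = q then \<epsilon> else if j = 0 then u else 0) else if i = j then 1 else 0)"
    if ij: "i < q + 1" "j < q + 1" for i j
    unfolding W_def VM[OF Gc ij] using ij q by (auto simp: Gent)
  have GE: "(G * E) $$ (i, j) = (if j = q then 0 else if i = q then y $$ (0, j) else A $$ (i, j))" if ij: "i < q + 1" "j < q + 1" for i j
  proof -
    have e: "(G * E) $$ (i, j) = (\<Sum>m<q. G $$ (i, m) * E $$ (m, j)) + G $$ (i, q) * E $$ (q, j)"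
      unfolding mult_entry[OF Gc Ec ij] by simp
    show ?thesis
    proof (cases "i = q")
      case True
      have "(\<Sum>m<q. G $$ (i, m) * E $$ (m, j)) = (\<Sum>m<q. if m = 0 then u * E $$ (m, j) else 0)"
        using ij True by (intro sum.cong) (auto simp: Gent)
      also have "\<dots> = u * E $$ (0, j)" using q by simp
      finally show ?thesis unfolding e using True ij q A z ye by (auto simp: Gent E_def)
    next
      case False
      have "(\<Sum>m<q. G $$ (i, m) * E $$ (m, j)) = (\<Sum>m<q. if m = i then E $$ (m, j) else 0)"
        using ij False by (intro sum.cong) (auto simp: Gent)
      also have "\<dots> = E $$ (i, j)" using ij False by simp
      finally show ?thesis unfolding e using False ij A by (auto simp: Gent E_def)
    qed
  qed
  have "W * E = V * (G * E)" unfolding W_def by (rule assoc_mult_mat[OF Vc Gc Ec])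
  moreover have "V * (G * E) = split_row q A y * W"
  proof (rule eq_matI)
    fix i j assume "i < dim_row (split_row q A y * W)" "j < dim_col (split_row q A y * W)"
    then have ij: "i < q + 1" "j < q + 1" using sc Wc by auto
    define S where "S c = (if i = q then y $$ (0, c) else if i = 0 then A $$ (0, c) - y $$ (0, c) else A $$ (i, c))" for c
    have Se: "split_row q A y $$ (i, m) = S (if m = q then 0 else m)" if "m < q + 1" for m
      unfolding split_row_def S_def using that ij by (simp add: Let_def)
    have "(split_row q A y * W) $$ (i, j) = (\<Sum>m<q. split_row q A y $$ (i, m) * W $$ (m, j)) + split_row q A y $$ (i, q) * W $$ (q, j)"
      unfolding mult_entry[OF sc Wc ij] by simp
    also have "(\<Sum>m<q. split_row q A y $$ (i, m) * W $$ (m, j)) = (\<Sum>m<q. (if m = j then S m else 0) + (if m = 0 then S 0 * (W $$ (0, j) - (if j = 0 then 1 else 0)) else 0))"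
    proof (intro sum.cong refl)
      fix m assume m: "m \<in> {..<q}"
      show "split_row q A y $$ (i, m) * W $$ (m, j) = (if m = j then S m else 0) + (if m = 0 then S 0 * (W $$ (0, j) - (if j = 0 then 1 else 0)) else 0)"
      proof (cases "m = 0")
        case True
        then show ?thesis using q by (simp add: Se algebra_simps)
      next
        case False
        then show ?thesis using m ij by (simp add: Se Went)
      qed
    qed
    also have "\<dots> = (if j < q then S j else 0) + S 0 * (W $$ (0, j) - (if j = 0 then 1 else 0))"
      using q by (simp add: sum.distrib)
    finally have sW: "(split_row q A y * W) $$ (i, j) = (if j < q then S j else 0) + S 0 * (W $$ (0, j) - (if j = 0 then 1 else 0))
      + split_row q A y $$ (i, q) * W $$ (q, j)" .
    have "split_row q A y $$ (i, q) = S 0" using Se[of q] by simp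
    moreover have "W $$ (0, j) - (if j = 0 then 1 else 0) + W $$ (q, j) = 0"
      using q ij Went[of 0 j] Went[of q j] by auto
    ultimately have "(split_row q A y * W) $$ (i, j) = (if j < q then S j else 0)"
      unfolding sW by (simp add: add.assoc flip: distrib_left)
    moreover have "(V * (G * E)) $$ (i, j) = (if j < q then S j else 0)"
      unfolding VM[OF mult_carrier_mat[OF Gc Ec] ij] using ij q by (auto simp: GE S_def)
    ultimately show "(V * (G * E)) $$ (i, j) = (split_row q A y * W) $$ (i, j)" by simp
  qed (use Vc Gc Ec sc Wc in auto)
  ultimately show ?thesis unfolding W_def E_def by simp
qed

text \<open>
  The borders are treated one by one.  After the conjugation \<open>S\<close> found for the first ones, a border reads
  \<open>z = y S\<^sup>-\<^sup>1\<close>.  The entries \<open>u A\<^sub>0\<^sub>j + \<epsilon> z\<^sub>j\<close> lie strictly between \<open>0\<close> and \<open>A\<^sub>0\<^sub>j\<close> along the path if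
  \<open>0 < u < 1\<close> and \<open>\<epsilon>\<close> is small.  As \<open>S\<^sup>-\<^sup>1\<close> need not be over \<open>U\<close>, a common
  denominator \<open>d\<close> is carried along and \<open>\<epsilon>\<close> is taken to be a multiple of \<open>d\<close>.
\<close>

lemma split_paths:
  assumes U: "dense_ring U" and P: "P \<subseteq> {0..1}" and n: "n \<ge> 1" and m: "n + e \<le> m"
    and "mpath (n + e) (n + e) E" "\<And>t. t \<in> {0..1} \<Longrightarrow> bordered n (n + e) (B t) (E t) \<and> positive_mat (B t)"
    and "\<And>t. t \<in> P \<Longrightarrow> elements_mat (E t) \<subseteq> U"
  shows "\<exists>S S' d. S \<in> carrier_mat (n + e) (n + e) \<and> S' \<in> carrier_mat (n + e) (n + e) \<and> S * S' = 1\<^sub>m (n + e) \<and> S' * S = 1\<^sub>m (n + e) \<and>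
     d \<in> U \<and> d \<noteq> 0 \<and> elements_mat (d \<cdot>\<^sub>m S') \<subseteq> U \<and> (\<forall>t\<in>{0..1}. positive_mat (S * E t * S')) \<and>
     (\<forall>t\<in>P. elements_mat (S * E t * S') \<subseteq> U \<and> (positive_splitting U m)\<^sup>*\<^sup>* (B t) (S * E t * S'))"
  using m assms(5-)
proof (induction e arbitrary: E)
  case 0
  note R = dense_ringD(1)[OF U]
  have EB: "E t = B t" if "t \<in> {0..1}" for t
    using 0(3)[OF that] mpath_carrier[OF 0(2), of t] unfolding bordered_def by (intro eq_matI) auto
  have Ec: "E t \<in> carrier_mat n n" for t using mpath_carrier[OF 0(2), of t] by simp
  have "1\<^sub>m n * E t * 1\<^sub>m n = E t" for t using Ec[of t] by simp
  moreover have "elements_mat (1 \<cdot>\<^sub>m 1\<^sub>m n) \<subseteq> U"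
    using real_subringD(1,2)[OF R] by (subst elements_mat_subset_iff[of _ n n]) auto
  moreover have "positive_mat (E t)" if "t \<in> {0..1}" for t using EB[OF that] 0(3)[OF that] by simp
  moreover have "elements_mat (E t) \<subseteq> U \<and> (positive_splitting U m)\<^sup>*\<^sup>* (B t) (E t)" if "t \<in> P" for t
    using 0(4)[OF that] EB[of t] that P by auto
  ultimately show ?case using real_subringD(1)[OF R]
    by (intro exI[of _ "1\<^sub>m n"] exI[of _ 1]) simp
next
  case (Suc e)
  note R = dense_ringD(1)[OF U]
  note Us = real_subringD[OF R]
  define q where "q = n + e"
  have q1: "q \<ge> 1" using n unfolding q_def by simp
  have Eq: "mpath (q + 1) (q + 1) E" using Suc.prems(2) unfolding q_def by simp
  note Ec = mpath_carrier[OF Eq]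
  define E0 where "E0 t = mat q q (\<lambda>e. E t $$ e)" for t
  define y where "y t = mat 1 q (\<lambda>(_, j). E t $$ (q, j))" for t
  have E0: "mpath q q E0" unfolding E0_def by (intro mpath_mat mpath_entry[OF Eq]) auto
  have y: "mpath 1 q y" unfolding y_def by (intro mpath_mat) (use mpath_entry[OF Eq] in auto)
  have E0b: "bordered n q (B t) (E0 t) \<and> positive_mat (B t)" if "t \<in> {0..1}" for t
    using Suc.prems(3)[OF that] unfolding bordered_def E0_def q_def by auto
  have Ee: "E t = four_block_mat (E0 t) (0\<^sub>m q 1) (y t) (0\<^sub>m 1 1)" if t: "t \<in> {0..1}" for t
  proof (rule eq_matI)
    fix i j assume "i < dim_row (four_block_mat (E0 t) (0\<^sub>m q 1) (y t) (0\<^sub>m 1 1))" "j < dim_col (four_block_mat (E0 t) (0\<^sub>m q 1) (y t) (0\<^sub>m 1 1))"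
    then have ij: "i < q + 1" "j < q + 1" unfolding E0_def y_def by auto
    have "E t $$ (i, j) = 0" if "j = q" using Suc.prems(3)[OF t] ij that unfolding bordered_def q_def by auto
    then show "E t $$ (i, j) = four_block_mat (E0 t) (0\<^sub>m q 1) (y t) (0\<^sub>m 1 1) $$ (i, j)"
      using ij unfolding E0_def y_def by (auto simp: less_Suc_eq)
  qed (use Ec[of t] in \<open>auto simp: E0_def y_def\<close>)
  have EU: "E t $$ (i, j) \<in> U" if "t \<in> P" "i < q + 1" "j < q + 1" for t i j
    using Suc.prems(4)[OF that(1)] that unfolding elements_mat_subset_iff[OF Ec] by blast
  have E0U: "elements_mat (E0 t) \<subseteq> U" if "t \<in> P" for t
    unfolding elements_mat_subset_iff[OF mpath_carrier[OF E0]] using EU[OF that] by (simp add: E0_def)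
  have yU: "elements_mat (y t) \<subseteq> U" if "t \<in> P" for t
    unfolding elements_mat_subset_iff[OF mpath_carrier[OF y]] using EU[OF that] by (simp add: y_def)
  have qm: "n + e \<le> m" using Suc.prems(1) by simp
  have "\<exists>S S' d. S \<in> carrier_mat q q \<and> S' \<in> carrier_mat q q \<and> S * S' = 1\<^sub>m q \<and> S' * S = 1\<^sub>m q \<and>
     d \<in> U \<and> d \<noteq> 0 \<and> elements_mat (d \<cdot>\<^sub>m S') \<subseteq> U \<and> (\<forall>t\<in>{0..1}. positive_mat (S * E0 t * S')) \<and>
     (\<forall>t\<in>P. elements_mat (S * E0 t * S') \<subseteq> U \<and> (positive_splitting U m)\<^sup>*\<^sup>* (B t) (S * E0 t * S'))"
    unfolding q_def by (rule Suc.IH[OF qm E0[unfolded q_def] E0b[unfolded q_def] E0U])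
  then obtain S S' d where S: "S \<in> carrier_mat q q" and S': "S' \<in> carrier_mat q q" and SS': "S * S' = 1\<^sub>m q" "S' * S = 1\<^sub>m q"
    and d: "d \<in> U" "d \<noteq> 0" "elements_mat (d \<cdot>\<^sub>m S') \<subseteq> U" and pos: "\<forall>t\<in>{0..1}. positive_mat (S * E0 t * S')"
    and chain: "\<forall>t\<in>P. elements_mat (S * E0 t * S') \<subseteq> U \<and> (positive_splitting U m)\<^sup>*\<^sup>* (B t) (S * E0 t * S')"
    by (elim exE conjE) (rule that)
  define A where "A t = S * E0 t * S'" for t
  define z where "z t = y t * S'" for t
  have A: "mpath q q A" unfolding A_def by (intro mpath_mult[OF mpath_mult[OF mpath_const[OF S] E0] mpath_const[OF S']])
  have z: "mpath 1 q z" unfolding z_def by (rule mpath_mult[OF y mpath_const[OF S']])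
  note Ac = mpath_carrier[OF A] and zc = mpath_carrier[OF z]
  have posA: "positive_mat (A t)" if "t \<in> {0..1}" for t using pos that unfolding A_def by blast
  obtain \<alpha> where al: "\<alpha> > 0" "\<forall>t\<in>{0..1}. \<forall>i<q. \<forall>j<q. \<alpha> \<le> A t $$ (i, j)" using compact_bounds(2)[OF A posA] by blast
  obtain \<beta> where be: "\<beta> > 0" "\<forall>t\<in>{0..1}. \<forall>i<1. \<forall>j<q. \<bar>z t $$ (i, j)\<bar> \<le> \<beta>" using compact_bounds(1)[OF z] by blast
  obtain u where u: "u \<in> U" "0 < u" "u < 1" using dense_ringD(2)[OF U, of 0 1] by auto
  \<comment> \<open>small enough for \<open>u A\<^sub>0 + \<epsilon> z\<close> to stay between \<open>0\<close> and \<open>A\<^sub>0\<close> when \<open>\<epsilon> = d \<epsilon>'\<close> with \<open>\<epsilon>' < \<gamma>\<close>\<close>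
  define \<gamma> where "\<gamma> = min u (1 - u) * \<alpha> / (\<beta> * \<bar>d\<bar>)"
  have g0: "\<gamma> > 0" unfolding \<gamma>_def using u al be d by simp
  obtain \<epsilon>' where e': "\<epsilon>' \<in> U" "0 < \<epsilon>'" "\<epsilon>' < \<gamma>" using dense_ringD(2)[OF U g0] by auto
  define \<epsilon> where "\<epsilon> = d * \<epsilon>'"
  have eps: "\<epsilon> \<in> U" "\<epsilon> \<noteq> 0" unfolding \<epsilon>_def using d e' Us(4) by auto
  have eb: "\<bar>\<epsilon>\<bar> * \<beta> < min u (1 - u) * \<alpha>"
  proof -
    have "\<bar>\<epsilon>\<bar> * \<beta> = \<epsilon>' * (\<beta> * \<bar>d\<bar>)" unfolding \<epsilon>_def using e' by (simp add: abs_mult)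
    also have "\<dots> < \<gamma> * (\<beta> * \<bar>d\<bar>)" using e'(3) be d by (intro mult_strict_right_mono) auto
    also have "\<dots> = min u (1 - u) * \<alpha>" unfolding \<gamma>_def using be d by simp
    finally show ?thesis .
  qed
  define y' where "y' t = mat 1 q (\<lambda>(_, j). u * A t $$ (0, j) + \<epsilon> * z t $$ (0, j))" for t
  have y'c: "y' t \<in> carrier_mat 1 q" for t unfolding y'_def by simp
  have y'b: "0 < y' t $$ (0, j) \<and> y' t $$ (0, j) < A t $$ (0, j)" if t: "t \<in> {0..1}" and j: "j < q" for t j
  proof -
    have a: "\<alpha> \<le> A t $$ (0, j)" using al t j q1 by auto
    have "\<bar>\<epsilon> * z t $$ (0, j)\<bar> \<le> \<bar>\<epsilon>\<bar> * \<beta>" unfolding abs_mult using be t j by (intro mult_left_mono) auto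
    then have b: "\<bar>\<epsilon> * z t $$ (0, j)\<bar> < min u (1 - u) * \<alpha>" using eb by simp
    have "min u (1 - u) * \<alpha> \<le> u * A t $$ (0, j)" using a al u by (intro mult_mono) auto
    moreover have "min u (1 - u) * \<alpha> \<le> (1 - u) * A t $$ (0, j)" using a al u by (intro mult_mono) auto
    ultimately show ?thesis using b j unfolding y'_def by (auto simp: algebra_simps)
  qed
  define G where "G = four_block_mat (1\<^sub>m q) (0\<^sub>m q 1) (mat 1 q (\<lambda>(_, j). if j = 0 then u else 0)) (mat 1 1 (\<lambda>_. \<epsilon>))"
  define G' where "G' = four_block_mat (1\<^sub>m q) (0\<^sub>m q 1) (mat 1 q (\<lambda>(_, j). if j = 0 then - u / \<epsilon> else 0)) (mat 1 1 (\<lambda>_. 1 / \<epsilon>))"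
  define V where "V = four_block_mat (1\<^sub>m q) (mat q 1 (\<lambda>(i, _). if i = 0 then - 1 else 0)) (0\<^sub>m 1 q) (1\<^sub>m 1 :: real mat)"
  define V' where "V' = four_block_mat (1\<^sub>m q) (mat q 1 (\<lambda>(i, _). if i = 0 then 1 else 0)) (0\<^sub>m 1 q) (1\<^sub>m 1 :: real mat)"
  define D where "D = four_block_mat S (0\<^sub>m q 1) (0\<^sub>m 1 q) (1\<^sub>m 1)"
  define D' where "D' = four_block_mat S' (0\<^sub>m q 1) (0\<^sub>m 1 q) (1\<^sub>m 1)"
  have c: "G \<in> carrier_mat (q + 1) (q + 1)" "G' \<in> carrier_mat (q + 1) (q + 1)" "V \<in> carrier_mat (q + 1) (q + 1)"
    "V' \<in> carrier_mat (q + 1) (q + 1)" "D \<in> carrier_mat (q + 1) (q + 1)" "D' \<in> carrier_mat (q + 1) (q + 1)"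
    unfolding G_def G'_def V_def V'_def D_def D'_def by (rule four_block_carrier_mat; use S S' in simp)+
  note mc = mult_carrier_mat[of _ "q + 1" "q + 1" _ "q + 1"]
  note as = assoc_mult_mat[of _ "q + 1" "q + 1" _ "q + 1" _ "q + 1"]
  note S_simps = mult_carrier_mat[of _ "Suc q" "Suc q" _ "Suc q"] assoc_mult_mat[of _ "Suc q" "Suc q" _ "Suc q" _ "Suc q"]
  have GG: "G * G' = 1\<^sub>m (q + 1)" "G' * G = 1\<^sub>m (q + 1)"
  proof -
    show "G * G' = 1\<^sub>m (q + 1)"
      unfolding G_def G'_def four_block_one_mat[symmetric]
      by (rule four_block_mult_eqI) (use eps q1 in \<open>auto intro!: eq_matI simp: index_mult_mat(1) scalar_prod_def\<close>)
    show "G' * G = 1\<^sub>m (q + 1)"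
      unfolding G_def G'_def four_block_one_mat[symmetric]
      by (rule four_block_mult_eqI) (use eps q1 in \<open>auto intro!: eq_matI simp: index_mult_mat(1) scalar_prod_def\<close>)
  qed
  have VV: "V * V' = 1\<^sub>m (q + 1)" "V' * V = 1\<^sub>m (q + 1)"
  proof -
    show "V * V' = 1\<^sub>m (q + 1)"
      unfolding V_def V'_def four_block_one_mat[symmetric]
      by (rule four_block_mult_eqI) (use q1 in \<open>auto intro!: eq_matI simp: index_mult_mat(1) scalar_prod_def\<close>)
    show "V' * V = 1\<^sub>m (q + 1)"
      unfolding V_def V'_def four_block_one_mat[symmetric]
      by (rule four_block_mult_eqI) (use q1 in \<open>auto intro!: eq_matI simp: index_mult_mat(1) scalar_prod_def\<close>)
  qed
  have Db: "D = block_diag q 1 S (1\<^sub>m 1)" "D' = block_diag q 1 S' (1\<^sub>m 1)" unfolding D_def D'_def block_diag_def by auto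
  have DD: "D * D' = 1\<^sub>m (q + 1)" "D' * D = 1\<^sub>m (q + 1)"
    unfolding Db block_diag_mult[OF S one_carrier_mat S' one_carrier_mat] block_diag_mult[OF S' one_carrier_mat S one_carrier_mat] SS'
    by (simp_all add: block_diag_one)
  define S1 where "S1 = (V * G) * D"
  define S1' where "S1' = D' * (G' * V')"
  have S1c: "S1 \<in> carrier_mat (q + 1) (q + 1)" "S1' \<in> carrier_mat (q + 1) (q + 1)" unfolding S1_def S1'_def using c by (auto simp: S_simps)
  have inv1: "S1 * S1' = 1\<^sub>m (q + 1)"
  proof -
    have "S1 * S1' = V * (G * ((D * D') * (G' * V')))" unfolding S1_def S1'_def using c by (simp add: S_simps)
    also have "\<dots> = V * ((G * G') * V')" unfolding DD using c by (simp add: S_simps)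
    also have "\<dots> = 1\<^sub>m (q + 1)" unfolding GG using c VV by simp
    finally show ?thesis .
  qed
  have inv2: "S1' * S1 = 1\<^sub>m (q + 1)"
  proof -
    note GD = mc[OF c(1) c(5)]
    have VS: "V' * S1 = G * D"
      unfolding S1_def as[OF c(3,1,5)] as[OF c(4,3) GD, symmetric] VV by (rule left_mult_one_mat[OF GD])
    have "G' * (V' * S1) = D"
      unfolding VS as[OF c(2,1,5), symmetric] GG by (rule left_mult_one_mat[OF c(5)])
    then show ?thesis
      unfolding S1'_def as[OF c(6) mc[OF c(2,4)] S1c(1)] as[OF c(2,4) S1c(1)] using DD by simp
  qed
  have conj: "S1 * E t * S1' = split_row q (A t) (y' t)" if t: "t \<in> {0..1}" for t
  proof -
    note E0t = mpath_carrier[OF E0, of t] and yt = mpath_carrier[OF y, of t]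
    define F where "F = four_block_mat (A t) (0\<^sub>m q 1) (z t) (0\<^sub>m 1 1)"
    have Fc: "F \<in> carrier_mat (q + 1) (q + 1)" unfolding F_def by (rule four_block_carrier_mat) (use Ac[of t] in simp_all)
    note SE = mult_carrier_mat[OF S E0t]
    have AS: "A t * S = S * E0 t"
      unfolding A_def using assoc_mult_mat[OF SE S' S] SS'(2) right_mult_one_mat[OF SE] by simp
    have zS: "z t * S = y t" unfolding z_def using assoc_mult_mat[OF yt S' S] SS'(2) right_mult_one_mat[OF yt] by simp
    have "D * E t = four_block_mat (S * E0 t) (0\<^sub>m q 1) (y t) (0\<^sub>m 1 1)"
      unfolding D_def Ee[OF t]
    proof (rule four_block_mult_eqI[OF S zero_carrier_mat zero_carrier_mat one_carrier_mat E0t zero_carrier_mat yt zero_carrier_mat])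
      show "S * E0 t + 0\<^sub>m q 1 * y t = S * E0 t" using left_mult_zero_mat[OF yt, of q] add_zero_right[OF SE] by simp
      show "S * 0\<^sub>m q 1 + 0\<^sub>m q 1 * 0\<^sub>m 1 1 = 0\<^sub>m q 1" using right_mult_zero_mat[OF S, of 1] left_mult_zero_mat[of "0\<^sub>m 1 1 :: real mat" 1 1 q] by simp
      show "0\<^sub>m 1 q * E0 t + 1\<^sub>m 1 * y t = y t" using left_mult_zero_mat[OF E0t, of 1] left_mult_one_mat[OF yt] add_zero_left[OF yt] by simp
      show "0\<^sub>m 1 q * 0\<^sub>m q 1 + 1\<^sub>m 1 * 0\<^sub>m 1 1 = (0\<^sub>m 1 1 :: real mat)" using left_mult_zero_mat[of "0\<^sub>m q 1 :: real mat" q 1 1] by simp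
    qed
    moreover have "F * D = four_block_mat (S * E0 t) (0\<^sub>m q 1) (y t) (0\<^sub>m 1 1)"
      unfolding D_def F_def
    proof (rule four_block_mult_eqI[OF Ac zero_carrier_mat zc zero_carrier_mat S zero_carrier_mat zero_carrier_mat one_carrier_mat])
      show "A t * S + 0\<^sub>m q 1 * 0\<^sub>m 1 q = S * E0 t" using AS left_mult_zero_mat[of "0\<^sub>m 1 q :: real mat" 1 q q] add_zero_right[OF SE] by simp
      show "A t * 0\<^sub>m q 1 + 0\<^sub>m q 1 * 1\<^sub>m 1 = 0\<^sub>m q 1" using right_mult_zero_mat[OF Ac, of t 1] by simp
      show "z t * S + 0\<^sub>m 1 1 * 0\<^sub>m 1 q = y t" using zS left_mult_zero_mat[of "0\<^sub>m 1 q :: real mat" 1 q 1] add_zero_right[OF yt] by simp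
      show "z t * 0\<^sub>m q 1 + 0\<^sub>m 1 1 * 1\<^sub>m 1 = 0\<^sub>m 1 1" using right_mult_zero_mat[OF zc, of t 1] by simp
    qed
    ultimately have DE: "D * E t = F * D" by simp
    have sc: "split_row q (A t) (y' t) \<in> carrier_mat (q + 1) (q + 1)" unfolding split_row_def by simp
    have VG: "(V * G) * F = split_row q (A t) (y' t) * (V * G)"
      unfolding F_def by (rule split_row_conjugate[OF q1 Ac zc y'c _ G_def V_def]) (simp add: y'_def)
    have "S1 * E t = (V * G) * (D * E t)" unfolding S1_def using c Ec[of t] by (simp add: S_simps)
    also have "\<dots> = ((V * G) * F) * D" unfolding DE using c Fc by (simp add: S_simps)
    also have "\<dots> = split_row q (A t) (y' t) * S1" unfolding VG S1_def using c sc by (simp add: S_simps)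
    finally have "S1 * E t * S1' = split_row q (A t) (y' t) * (S1 * S1')" using S1c sc by (simp add: S_simps)
    then show ?thesis unfolding inv1 using sc by simp
  qed
  have posn: "positive_mat (split_row q (A t) (y' t))" if t: "t \<in> {0..1}" for t
  proof -
    have sc: "split_row q (A t) (y' t) \<in> carrier_mat (Suc q) (Suc q)" unfolding split_row_def by simp
    show ?thesis by (rule split_row_positive[OF q1 Ac posA[OF t] y'c y'b[OF t]])
  qed
  have chn: "elements_mat (split_row q (A t) (y' t)) \<subseteq> U \<and> (positive_splitting U m)\<^sup>*\<^sup>* (B t) (split_row q (A t) (y' t))" if t: "t \<in> P" for t
  proof -
    have t01: "t \<in> {0..1}" using t P by blast
    have AU: "elements_mat (A t) \<subseteq> U" and ch: "(positive_splitting U m)\<^sup>*\<^sup>* (B t) (A t)" using chain t unfolding A_def by auto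
    have dz: "elements_mat (y t * (d \<cdot>\<^sub>m S')) \<subseteq> U"
      by (rule elements_mat_mult[OF R mpath_carrier[OF y] yU[OF t] smult_carrier_mat[OF S'] d(3)])
    have dze: "y t * (d \<cdot>\<^sub>m S') = d \<cdot>\<^sub>m z t" unfolding z_def by (rule mult_smult_distrib[OF mpath_carrier[OF y] S'])
    have "d * z t $$ (0, j) \<in> U" if "j < q" for j
    proof -
      have "(d \<cdot>\<^sub>m z t) $$ (0, j) \<in> U"
        using dz that unfolding dze by (subst (asm) elements_mat_subset_iff[of _ 1 q]) (use zc[of t] in auto)
      then show ?thesis using zc[of t] that by simp
    qed
    then have ez: "\<epsilon> * z t $$ (0, j) \<in> U" if "j < q" for j
      unfolding \<epsilon>_def using that Us(4)[OF e'(1), of "d * z t $$ (0, j)"] by (simp add: mult.assoc mult.left_commute)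
    have "u * A t $$ (0, j) \<in> U" if "j < q" for j
      using AU that Us(4)[OF u(1)] q1 unfolding elements_mat_subset_iff[OF Ac] by auto
    then have "y' t $$ (0, j) \<in> U" if "j < q" for j
      using that ez[OF that] Us(6) unfolding y'_def by simp
    then have "elements_mat (y' t) \<subseteq> U"
      unfolding elements_mat_subset_iff[OF y'c] by simp
    note sp = split_row_splitting[OF R q1 Ac posA[OF t01] AU y'c this y'b[OF t01]]
    have "positive_splitting U m (A t) (split_row q (A t) (y' t))"
      using sp(1) Suc.prems(1) unfolding positive_splitting_def q_def by auto
    with ch sp(2) show ?thesis by (auto intro: rtranclp.rtrancl_into_rtrancl)
  qed
  have den: "elements_mat ((d * \<epsilon>) \<cdot>\<^sub>m S1') \<subseteq> U"
  proof -
    have "elements_mat (d \<cdot>\<^sub>m D') \<subseteq> U"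
    proof -
      have dS: "d * S' $$ (i, j) \<in> U" if "i < q" "j < q" for i j
        using d(3) that S' by (subst (asm) elements_mat_subset_iff[of _ q q]) auto
      have "(d \<cdot>\<^sub>m D') $$ (i, j) \<in> U" if "i < q + 1" "j < q + 1" for i j
        using that dS[of i j] d(1) Us(2) c(6) S' unfolding D'_def by auto
      then show ?thesis by (subst elements_mat_subset_iff[of _ "q + 1" "q + 1"]) (use c(6) in auto)
    qed
    moreover have "elements_mat (\<epsilon> \<cdot>\<^sub>m G') \<subseteq> U"
    proof -
      have "(\<epsilon> \<cdot>\<^sub>m G') $$ (i, j) \<in> U" if "i < q + 1" "j < q + 1" for i j
        using that eps Us(1,2) Us(5)[OF u(1)] c(2) unfolding G'_def by auto
      then show ?thesis by (subst elements_mat_subset_iff[of _ "q + 1" "q + 1"]) (use c(2) in auto)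
    qed
    moreover have "elements_mat V' \<subseteq> U"
    proof -
      have "V' $$ (i, j) \<in> U" if "i < q + 1" "j < q + 1" for i j
        using that Us(1,2) unfolding V'_def by auto
      then show ?thesis by (subst elements_mat_subset_iff[OF c(4)]) auto
    qed
    ultimately have "elements_mat ((d \<cdot>\<^sub>m D') * ((\<epsilon> \<cdot>\<^sub>m G') * V')) \<subseteq> U"
      using c by (intro elements_mat_mult[OF R, of _ "q + 1" "q + 1" _ "q + 1"] mult_carrier_mat[of _ "q + 1" "q + 1"]) auto
    moreover have "(d \<cdot>\<^sub>m D') * ((\<epsilon> \<cdot>\<^sub>m G') * V') = (d * \<epsilon>) \<cdot>\<^sub>m S1'"
    proof -
      have "(\<epsilon> \<cdot>\<^sub>m G') * V' = \<epsilon> \<cdot>\<^sub>m (G' * V')" by (rule mult_smult_assoc_mat[OF c(2,4)])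
      then have "(d \<cdot>\<^sub>m D') * ((\<epsilon> \<cdot>\<^sub>m G') * V') = d \<cdot>\<^sub>m (\<epsilon> \<cdot>\<^sub>m S1')"
        unfolding S1'_def using mult_smult_assoc_mat[OF c(6), of "\<epsilon> \<cdot>\<^sub>m (G' * V')" "q + 1" d] mult_smult_distrib[OF c(6) mult_carrier_mat[OF c(2,4)]]
          mult_carrier_mat[OF c(2,4)] by simp
      then show ?thesis by (auto intro!: eq_matI)
    qed
    ultimately show ?thesis by simp
  qed
  have q': "n + Suc e = q + 1" unfolding q_def by simp
  have "d * \<epsilon> \<in> U" "d * \<epsilon> \<noteq> 0" using d eps Us(4) by auto
  then show ?case unfolding q' using S1c inv1 inv2 den conj posn chn P
    by (intro exI[of _ S1] exI[of _ S1'] exI[of _ "d * \<epsilon>"]) (auto simp: subset_iff)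
qed

section \<open>From frames to splittings and strong shift equivalence\<close>

lemma subring_class_ring_real_subring:
  assumes "subring U (class_ring :: real ring)"
  shows "real_subring U"
proof -
  note E = subringE[OF assms, unfolded class_ring_simps]
  have "x - y \<in> U" if "x \<in> U" "y \<in> U" for x y using E(7)[OF that(1) E(5)[OF that(2)]] by simp
  then show ?thesis unfolding real_subring_def using E(3,6) by auto
qed

text \<open>
  The difference of two close elements is a small positive element \<open>d\<close>, and the integer multiples of \<open>d\<close>
  meet every interval longer than \<open>d\<close>.
\<close>

lemma nondiscrete_subring_dense:
  assumes U: "real_subring U" and nd: "\<not> discrete U"
  shows "dense_ring U"
  unfolding dense_ring_def
proof (intro conjI allI impI U)
  note Us = real_subringD[OF U]
  fix a b :: real assume ab: "a < b"
  obtain x where x: "x \<in> U" "\<not> x isolated_in U" using nd unfolding discrete_def by blast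
  obtain y where y: "y \<in> U" "dist x y < b - a" "y \<noteq> x"
    using x ab unfolding isolated_in_dist_Ex_iff by (metis diff_gt_0_iff_gt)
  define d where "d = \<bar>y - x\<bar>"
  have d: "d > 0" "d < b - a" using y unfolding d_def dist_real_def by auto
  have dU: "d \<in> U" unfolding d_def abs_real_def using Us(3)[OF y(1) x(1)] Us(3)[OF x(1) y(1)] by simp
  have nU: "of_nat j \<in> U" for j by (induction j) (auto intro: Us)
  have iU: "of_int i \<in> U" for i :: int
    by (cases i rule: int_cases2) (use nU Us(5) in auto)
  define i where "i = \<lfloor>a / d\<rfloor> + 1"
  have "a / d < of_int i" "of_int i \<le> a / d + 1" unfolding i_def by linarith+
  then have "a < of_int i * d" "of_int i * d \<le> a + d" using d by (auto simp: field_simps)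
  moreover have "of_int i * d \<in> U" by (rule Us(4)[OF iU dU])
  ultimately show "\<exists>u\<in>U. a < u \<and> u < b" using d by force
qed

lemma subfield_class_ring_inverse:
  assumes "subfield U (class_ring :: real ring)" and x: "x \<in> U"
  shows "inverse x \<in> U"
proof (cases "x = 0")
  case True
  then show ?thesis using x by simp
next
  case False
  have "Units (class_ring\<lparr>carrier := U\<rparr>) = U - {0}"
    using subfield.subfield_Units[OF assms(1)] by simp
  then have "x \<in> Units (class_ring\<lparr>carrier := U\<rparr>)" using x False by blast
  then obtain y where "y \<in> U" "y * x = 1" unfolding Units_def by auto
  moreover from this(2) have "inverse x = y" using False by (metis inverse_unique mult.commute)
  ultimately show ?thesis by simp
qed

lemma positive_mat_pow_pos:
  assumes A: "A \<in> carrier_mat n n" and n: "n \<ge> 1" and pos: "positive_mat A"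
  shows "positive_mat (A ^\<^sub>m Suc p)"
proof (induction p)
  case 0
  then show ?case using A pos by simp
next
  case (Suc p)
  note Ap = pow_carrier_mat[OF A, of "Suc p"]
  have "(A ^\<^sub>m Suc p * A) $$ (i, j) > 0" if "i < n" "j < n" for i j
    unfolding mult_entry[OF Ap A that]
    using Suc pos that n unfolding positive_mat_iff[OF Ap] positive_mat_iff[OF A]
    by (intro sum_pos) auto
  then show ?case
    using positive_mat_iff[OF mult_carrier_mat[OF Ap A]] by simp
qed

text \<open>
  If the nilpotent part were everything, a power of \<open>A\<close> would vanish, but powers of a positive matrix are
  positive.
\<close>

lemma positive_not_nilpotent:
  assumes A: "A \<in> carrier_mat n n" and n: "n \<ge> 1" and pos: "positive_mat A" and W: "nil_frame n k A W"
  shows "k < n"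
proof (rule ccontr)
  assume "\<not> k < n"
  moreover have "k \<le> n" using W rows_indep_le unfolding nil_frame_def by blast
  ultimately have kn: "k = n" by simp
  have Wc: "W \<in> carrier_mat n n" using nil_frame_carrier[OF W] kn by simp
  have d: "det W \<noteq> 0" using W det_nonzero_rows_indep[OF Wc] kn unfolding nil_frame_def by blast
  note An = pow_carrier_mat[OF A, of n]
  have "A ^\<^sub>m n = (minv W * W) * A ^\<^sub>m n" using left_mult_one_mat[OF An] unfolding minv_left[OF Wc d] by (rule sym)
  also have "\<dots> = minv W * (W * A ^\<^sub>m n)" by (rule assoc_mult_mat[OF minv_carrier[OF Wc] Wc An])
  also have "W * A ^\<^sub>m n = 0\<^sub>m n n" using nil_frame_pow[OF A W] kn by simp
  also have "minv W * 0\<^sub>m n n = 0\<^sub>m n n" using minv_carrier[OF Wc] by (rule right_mult_zero_mat)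
  finally have "A ^\<^sub>m n = 0\<^sub>m n n" .
  moreover have "positive_mat (A ^\<^sub>m n)" using positive_mat_pow_pos[OF A n pos, of "n - 1"] n by simp
  ultimately have "positive_mat (0\<^sub>m n n)" by simp
  then have "\<forall>i<n. \<forall>j<n. (0\<^sub>m n n :: real mat) $$ (i, j) > 0" unfolding positive_mat_iff[OF zero_carrier_mat] .
  moreover have "0 < n" using n by simp
  ultimately have "(0\<^sub>m n n :: real mat) $$ (0, 0) > 0" by blast
  then show False using \<open>0 < n\<close> by simp
qed

text \<open>
  With \<open>K s\<close> conjugating the bordered matrix at \<open>s\<close> to the constant matrix \<open>M\<close> of the staircase, and
  \<open>S\<close> turning borders into splittings, the path of splittings is obtained from its starting
  point by conjugation with \<open>G s = S (K s)\<^sup>-\<^sup>1 (K 0) S\<^sup>-\<^sup>1\<close>.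
\<close>

lemma joined_splittings:
  assumes U: "dense_ring U" and J: "J \<in> carrier_mat r r" and n: "r + k \<ge> 1"
    and B: "frame r k J B L T" and C: "frame r k J C L' T'" and j: "joined r k J L T L' T'"
    and BU: "elements_mat B \<subseteq> U" and CU: "elements_mat C \<subseteq> U"
    and LU: "\<And>i j. r \<le> i \<Longrightarrow> i < r + k \<Longrightarrow> j < r + k \<Longrightarrow> L $$ (i, j) \<in> U \<and> L' $$ (i, j) \<in> U"
    and m: "r + k + (\<Sum>i<k. i) \<le> m"
  shows "\<exists>B' C' G. B' \<in> carrier_mat m m \<and> C' \<in> carrier_mat m m \<and> (positive_splitting U m)\<^sup>*\<^sup>* B B' \<and> (positive_splitting U m)\<^sup>*\<^sup>* C C' \<and>
    elements_mat B' \<subseteq> U \<and> elements_mat C' \<subseteq> U \<and> positive_mat C' \<and>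
    mpath m m G \<and> (\<forall>t\<in>{0..1}. det (G t) \<noteq> 0 \<and> positive_mat (conj_by (G t) B')) \<and> G 0 = 1\<^sub>m m \<and> G 1 * B' = C' * G 1"
proof -
  let ?n = "r + k"
  note R = dense_ringD(1)[OF U]
  obtain l t where l: "mpath ?n ?n l" "mpath k k t" "l 0 = L" "t 0 = T" "l 1 = L'" "t 1 = T'"
    and fr: "\<forall>s\<in>{0..1}. \<exists>B. positive_mat B \<and> frame r k J B (l s) (t s)"
    using j unfolding joined_def by (elim exE conjE) (rule that)
  define E where "E s = minv (l s) * (block_diag r k J (t s) * l s)" for s
  have frE: "positive_mat (E s) \<and> frame r k J (E s) (l s) (t s)" if s: "s \<in> {0..1}" for s
  proof -
    obtain D where D: "positive_mat D" "frame r k J D (l s) (t s)" using fr s by blast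
    have "E s = D" unfolding E_def using frame_matrix_eq[OF D(2) J] by simp
    with D show ?thesis by simp
  qed
  have ld: "det (l s) \<noteq> 0" if "s \<in> {0..1}" for s using frE[OF that] unfolding frame_def by blast
  have E: "mpath ?n ?n E" unfolding E_def block_diag_def
    by (intro mpath_mult[OF mpath_minv[OF l(1) ld] mpath_mult[OF mpath_four_block l(1)]] mpath_const l(2) J; simp)
  have E01: "E 0 = B" "E 1 = C"
    unfolding E_def l(3-6) using frame_matrix_eq[OF B J] frame_matrix_eq[OF C J] by auto
  have "\<exists>E' K' M. staircase_data ?n (?n + (\<Sum>i<k. i)) E E' K' M {0, 1} U"
  proof (rule staircase[OF R J zero_carrier_mat l(2) _ l(1) ld E])
    show "strictly_lower k (t s)" if "s \<in> {0..1}" for s using frE[OF that] unfolding frame_def by blast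
    show "l s * E s = four_block_mat J (0\<^sub>m r k) (0\<^sub>m k r) (t s) * l s" if "s \<in> {0..1}" for s
      using frE[OF that] unfolding frame_def block_diag_def by blast
    show "elements_mat (E s) \<subseteq> U" if "s \<in> {0, 1}" for s using that E01 BU CU by auto
    show "l s $$ (i, j) \<in> U" if "s \<in> {0, 1}" "r \<le> i" "i < r + k" "j < r + k" for s i j
      using that l(3,5) LU by auto
  qed auto
  then obtain E1 K1 M1 where "staircase_data ?n (?n + (\<Sum>i<k. i)) E E1 K1 M1 {0, 1} U" by blast
  from staircase_pad[OF R this, of "m - (?n + (\<Sum>i<k. i))"] m
  obtain E' K' M where "staircase_data ?n m E E' K' M {0, 1} U" by auto
  then have M: "M \<in> carrier_mat m m" and E': "mpath m m E'" and K': "mpath m m K'"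
    and st: "\<And>s. s \<in> {0..1} \<Longrightarrow> det (K' s) \<noteq> 0 \<and> K' s * E' s = M * K' s \<and> bordered ?n m (E s) (E' s)"
    and EU: "\<And>s. s \<in> {0, 1} \<Longrightarrow> elements_mat (E' s) \<subseteq> U"
    unfolding staircase_data_def by auto
  define e where "e = m - ?n"
  have me: "?n + e = m" unfolding e_def using m by simp
  have P01: "{0, 1} \<subseteq> {0..1 :: real}" by auto
  have "\<exists>S S' d. S \<in> carrier_mat (?n + e) (?n + e) \<and> S' \<in> carrier_mat (?n + e) (?n + e) \<and> S * S' = 1\<^sub>m (?n + e) \<and> S' * S = 1\<^sub>m (?n + e) \<and>
     d \<in> U \<and> d \<noteq> 0 \<and> elements_mat (d \<cdot>\<^sub>m S') \<subseteq> U \<and> (\<forall>s\<in>{0..1}. positive_mat (S * E' s * S')) \<and>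
     (\<forall>s\<in>{0, 1}. elements_mat (S * E' s * S') \<subseteq> U \<and> (positive_splitting U m)\<^sup>*\<^sup>* (E s) (S * E' s * S'))"
    by (rule split_paths[OF U P01 n]) (use E' st frE EU me in auto)
  then obtain S S' where S: "S \<in> carrier_mat m m" "S' \<in> carrier_mat m m" and SS: "S * S' = 1\<^sub>m m" "S' * S = 1\<^sub>m m"
    and pos: "\<forall>s\<in>{0..1}. positive_mat (S * E' s * S')"
    and chain: "\<forall>s\<in>{0, 1}. elements_mat (S * E' s * S') \<subseteq> U \<and> (positive_splitting U m)\<^sup>*\<^sup>* (E s) (S * E' s * S')"
    unfolding me by (elim exE conjE) (rule that)
  define F where "F s = S * E' s * S'" for s
  define G where "G s = S * (minv (K' s) * K' 0) * S'" for s
  note K'c = mpath_carrier[OF K'] and E'c = mpath_carrier[OF E']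
  have kd: "det (K' s) \<noteq> 0" if "s \<in> {0..1}" for s using st[OF that] by blast
  note iK = minv_carrier[OF K'c]
  note mc = mult_carrier_mat[of _ m m _ m]
  note as = assoc_mult_mat[of _ m m _ m _ m]
  have Fc: "F s \<in> carrier_mat m m" and Gc: "G s \<in> carrier_mat m m" for s
    unfolding F_def G_def using S E'c[of s] iK[of s] K'c[of 0] by (simp_all add: mc)
  have G: "mpath m m G" unfolding G_def
    by (intro mpath_mult[OF mpath_mult[OF mpath_const[OF S(1)] mpath_mult[OF mpath_minv[OF K' kd] mpath_const[OF K'c]]] mpath_const[OF S(2)]])
  have dS: "det S \<noteq> 0" "det S' \<noteq> 0" using minv_unique(1)[OF S SS(1)] minv_unique(1)[OF S(2,1) SS(2)] by auto
  have Gd: "det (G s) \<noteq> 0" if s: "s \<in> {0..1}" for s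
  proof -
    have "det (minv (K' s)) \<noteq> 0" using minv_unique(1)[OF iK K'c minv_left[OF K'c kd[OF s]]] .
    moreover have "det (K' 0) \<noteq> 0" using kd by simp
    ultimately show ?thesis
      unfolding G_def using dS det_mult[OF mc[OF S(1) mc[OF iK K'c]] S(2)] det_mult[OF S(1) mc[OF iK K'c]] det_mult[OF iK K'c] by simp
  qed
  have GF: "G s * F 0 = F s * G s" if s: "s \<in> {0..1}" for s
  proof -
    have KE: "K' s * E' s = M * K' s" and KE0: "K' 0 * E' 0 = M * K' 0" using st[OF s] st[of 0] by auto
    have "G s * F 0 = S * (minv (K' s) * (K' 0 * ((S' * S) * (E' 0 * S'))))"
      unfolding G_def F_def using S E'c[of 0] iK[of s] K'c[of 0] by (simp add: mc as)
    also have "\<dots> = S * (minv (K' s) * ((K' 0 * E' 0) * S'))"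
      unfolding SS using S E'c[of 0] iK[of s] K'c[of 0] by (simp add: mc as)
    also have "\<dots> = S * ((minv (K' s) * M) * (K' 0 * S'))"
      unfolding KE0 using S M iK[of s] K'c[of 0] by (simp add: mc as)
    also have "minv (K' s) * M = E' s * minv (K' s)"
    proof -
      have "E' s * minv (K' s) = (minv (K' s) * K' s) * (E' s * minv (K' s))"
        unfolding minv_left[OF K'c kd[OF s]] using left_mult_one_mat[OF mc[OF E'c iK]] by simp
      also have "\<dots> = minv (K' s) * ((K' s * E' s) * minv (K' s))" using E'c[of s] iK[of s] K'c[of s] by (simp add: mc as)
      also have "\<dots> = minv (K' s) * (M * (K' s * minv (K' s)))" unfolding KE using M iK[of s] K'c[of s] by (simp add: mc as)
      also have "\<dots> = minv (K' s) * M" unfolding minv_right[OF K'c kd[OF s]] using M by simp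
      finally show ?thesis by simp
    qed
    also have "S * ((E' s * minv (K' s)) * (K' 0 * S')) = S * (E' s * ((S' * S) * (minv (K' s) * (K' 0 * S'))))"
      unfolding SS using left_mult_one_mat[OF mc[OF iK mc[OF K'c S(2)]]] S E'c[of s] iK[of s] K'c[of 0] by (simp add: mc as)
    also have "\<dots> = F s * G s"
      unfolding G_def F_def using S E'c[of s] iK[of s] K'c[of 0] by (simp add: mc as)
    finally show ?thesis .
  qed
  have cj: "conj_by (G s) (F 0) = F s" if "s \<in> {0..1}" for s
    by (rule conj_by_eq[OF Gc Fc Fc Gd[OF that] GF[OF that]])
  have "G 0 = 1\<^sub>m m"
    unfolding G_def minv_left[OF K'c kd[of 0, simplified]] using S SS by simp
  moreover have "positive_mat (F 1)" using pos unfolding F_def by simp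
  ultimately show ?thesis
    using chain pos Fc G Gd cj GF[of 1] unfolding E01[symmetric] F_def[symmetric]
    by (intro exI[of _ "F 0"] exI[of _ "F 1"] exI[of _ G]) simp
qed

lemma elem_row_splitting_mono: "elem_row_splitting T M N \<Longrightarrow> T \<subseteq> T' \<Longrightarrow> elem_row_splitting T' M N"
  unfolding elem_row_splitting_def by (meson subset_trans)

lemma positive_splittings_row_splittings:
  assumes "(positive_splitting U m)\<^sup>*\<^sup>* B B'" "U \<inter> {0..} \<subseteq> T" "square_mat B" "elements_mat B \<subseteq> T"
  shows "row_splittings T B B'"
proof -
  have "(positive_splitting U m)\<^sup>*\<^sup>* \<le> (elem_row_splitting T)\<^sup>*\<^sup>*"
    by (rule rtranclp_mono) (use assms(2) elem_row_splitting_mono in \<open>auto simp: positive_splitting_def\<close>)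
  then show ?thesis unfolding row_splittings_def using assms by blast
qed

lemma positive_splittings_ESSE_chain:
  assumes "(positive_splitting U m)\<^sup>*\<^sup>* B B'" "admissible_mat (U \<inter> {0..}) k B" "real m \<le> k"
  shows "(positive_ESSE (U \<inter> {0..}) k)\<^sup>*\<^sup>* B B' \<and> admissible_mat (U \<inter> {0..}) k B'"
  using assms(1)
proof (induction rule: rtranclp_induct)
  case base
  then show ?case using assms(2) by simp
next
  case (step M N)
  have er: "elem_row_splitting (U \<inter> {0..}) M N" and pos: "positive_mat N" and dim: "dim_row N \<le> m"
    using step.hyps(2) unfolding positive_splitting_def by auto
  have "ESSE (U \<inter> {0..}) M N" using er unfolding elem_row_splitting_def ESSE_def by blast
  moreover have "real (dim_row N) \<le> k" using dim assms(3) by linarith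
  then have "admissible_mat (U \<inter> {0..}) k N"
    using er pos unfolding elem_row_splitting_def admissible_mat_def by blast
  ultimately have "positive_ESSE (U \<inter> {0..}) k M N \<and> admissible_mat (U \<inter> {0..}) k N"
    using step.IH unfolding positive_ESSE_def by blast
  then show ?case using step.IH by (meson rtranclp.rtrancl_into_rtrancl)
qed

lemma conjugation_path_positive_conjugate:
  assumes B: "B \<in> carrier_mat m m" and G: "mpath m m G" and d: "\<forall>t\<in>{0..1}. det (G t) \<noteq> 0 \<and> positive_mat (conj_by (G t) B)"
  shows "positive_conjugate_path m (\<lambda>t. conj_by (G t) B)"
proof -
  note Gc = mpath_carrier[OF G]
  have sim: "similar_mat B (conj_by (G t) B)" if t: "t \<in> {0..1}" for t
  proof (rule similar_matI)
    have dt: "det (G t) \<noteq> 0" using d t by blast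
    note iG = minv_carrier[OF Gc, of t] and cj = conj_by_carrier[OF Gc B, of t]
    show "{B, conj_by (G t) B, minv (G t), G t} \<subseteq> carrier_mat m m" using B iG cj Gc by auto
    show "minv (G t) * G t = 1\<^sub>m m" "G t * minv (G t) = 1\<^sub>m m" using minv_left[OF Gc dt] minv_right[OF Gc dt] by auto
    have "minv (G t) * conj_by (G t) B * G t = minv (G t) * (G t * B)"
      unfolding conj_by_intertwines[OF Gc B dt] by (rule assoc_mult_mat[OF iG cj Gc])
    also have "\<dots> = B" using assoc_mult_mat[OF iG Gc[of t] B] minv_left[OF Gc dt] B by simp
    finally show "B = minv (G t) * conj_by (G t) B * G t" by simp
  qed
  have "mpath m m (\<lambda>t. conj_by (G t) B)"
    unfolding conj_by_def by (intro mpath_mult[OF mpath_mult[OF G mpath_const[OF B]] mpath_minv[OF G]]) (use d in blast)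
  moreover have "similar_mat (conj_by (G s) B) (conj_by (G t) B)" if "s \<in> {0..1}" "t \<in> {0..1}" for s t
    by (rule similar_mat_trans[OF similar_mat_sym[OF sim[OF that(1)]] sim[OF that(2)]])
  ultimately show ?thesis unfolding positive_conjugate_path_def mpath_def using d by blast
qed

text \<open>
  By \<open>k \<le> n - 1\<close> the size is at most \<open>n + (n - 1) (n - 2) / 2 = (n\<^sup>2 - n + 2) / 2\<close>, which is at most
  \<open>n\<^sup>2 / 2\<close> for \<open>n \<ge> 2\<close>.  For \<open>n = 1\<close> there is no nilpotent part and the size is \<open>1\<close>.
\<close>

lemma staircase_size:
  assumes "n = r + k" "k < n"
  shows "real (n + (\<Sum>i<k. i)) \<le> max (real n) ((real n)\<^sup>2 / 2)"
    and "real m \<ge> (real n)\<^sup>2 / 2 \<Longrightarrow> n + (\<Sum>i<k. i) \<le> m"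
proof -
  have tri: "2 * real (\<Sum>i<k. i) = real k * (real k - 1)" by (induction k) (auto simp: algebra_simps)
  have big: "real (n + (\<Sum>i<k. i)) \<le> (real n)\<^sup>2 / 2" if n: "n \<ge> 2"
  proof -
    have kn: "real k \<le> real n - 1" "1 \<le> real n - 1" using assms n by auto
    have "real k * (real k - 1) \<le> (real n - 1) * (real n - 2)"
    proof (cases "k = 0")
      case True
      then show ?thesis using n by simp
    next
      case False
      then show ?thesis using kn by (intro mult_mono) auto
    qed
    then have "2 * real (n + (\<Sum>i<k. i)) \<le> 2 * real n + (real n - 1) * (real n - 2)" using tri by simp
    also have "\<dots> = (real n)\<^sup>2 - real n + 2" by (simp add: algebra_simps power2_eq_square)
    also have "\<dots> \<le> (real n)\<^sup>2" using n by simp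
    finally show ?thesis by simp
  qed
  consider "n = 1" "k = 0" | "n \<ge> 2" using assms by linarith
  then show "real (n + (\<Sum>i<k. i)) \<le> max (real n) ((real n)\<^sup>2 / 2)"
    using big by cases auto
  assume m: "real m \<ge> (real n)\<^sup>2 / 2"
  consider "n = 1" "k = 0" | "n \<ge> 2" using assms by linarith
  then show "n + (\<Sum>i<k. i) \<le> m"
  proof cases
    case 1
    then have "real m > 0" using m by simp
    then show ?thesis using 1 by simp
  next
    case 2
    then have "real (n + (\<Sum>i<k. i)) \<le> real m" using big m by linarith
    then show ?thesis by (simp only: of_nat_le_iff)
  qed
qed

text \<open>
  The real case and the case of a subring are both instances, since \<open>\<real>\<close> is a dense subring of itself.
  The neighbourhood depends on neither the ring nor the size \<open>m\<close>.
\<close>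

lemma splittings_near_positive:
  assumes A: "A \<in> carrier_mat n n" and n: "n \<ge> 1" and pos: "positive_mat A"
  shows "\<exists>\<delta>>0. \<forall>B\<in>SE_nbhd \<delta> A. \<forall>C\<in>SE_nbhd \<delta> A. \<forall>U. dense_ring U \<longrightarrow> elements_mat B \<subseteq> U \<longrightarrow> elements_mat C \<subseteq> U \<longrightarrow>
    (\<forall>m::nat. real m \<ge> (real n)\<^sup>2 / 2 \<longrightarrow>
      (\<exists>B' \<in> carrier_mat m m. \<exists>C' \<in> carrier_mat m m.
        row_splittings (U \<inter> {0..}) B B' \<and> row_splittings (U \<inter> {0..}) C C' \<and> row_splittings UNIV B B' \<and> row_splittings UNIV C C' \<and>
        positive_mat B' \<and> positive_mat C' \<and> similar_mat B' C' \<and>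
        (\<exists>\<gamma>. positive_conjugate_path m \<gamma> \<and> \<gamma> 0 = B' \<and> \<gamma> 1 = C'))) \<and>
    ((\<forall>x\<in>U. inverse x \<in> U) \<longrightarrow> SSE_through_positive (U \<inter> {0..}) (max (real n) ((real n)\<^sup>2 / 2)) B C)"
proof -
  have "\<exists>r k J. n = r + k \<and> J \<in> carrier_mat r r \<and> det J \<noteq> 0 \<and> (\<exists>W. nil_frame n k A W) \<and>
    (\<exists>\<delta>>0. \<forall>B\<in>SE_nbhd \<delta> A. \<forall>C\<in>SE_nbhd \<delta> A. positive_mat B \<and> positive_mat C \<and>
      (\<forall>U. real_subring U \<longrightarrow> elements_mat B \<subseteq> U \<longrightarrow> elements_mat C \<subseteq> U \<longrightarrow>
        (\<exists>L T L' T'. frame r k J B L T \<and> frame r k J C L' T' \<and> joined r k J L T L' T' \<and>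
          (\<forall>i j. r \<le> i \<longrightarrow> i < n \<longrightarrow> j < n \<longrightarrow> L $$ (i, j) \<in> U \<and> L' $$ (i, j) \<in> U))))"
    by (rule shift_equivalent_frames_joined[OF A n pos])
  then obtain r k J W \<delta> where nrk: "n = r + k" and J: "J \<in> carrier_mat r r" and W: "nil_frame n k A W" and \<delta>: "\<delta> > 0"
    and main: "\<forall>B\<in>SE_nbhd \<delta> A. \<forall>C\<in>SE_nbhd \<delta> A. positive_mat B \<and> positive_mat C \<and>
      (\<forall>U. real_subring U \<longrightarrow> elements_mat B \<subseteq> U \<longrightarrow> elements_mat C \<subseteq> U \<longrightarrow>
        (\<exists>L T L' T'. frame r k J B L T \<and> frame r k J C L' T' \<and> joined r k J L T L' T' \<and>
          (\<forall>i j. r \<le> i \<longrightarrow> i < n \<longrightarrow> j < n \<longrightarrow> L $$ (i, j) \<in> U \<and> L' $$ (i, j) \<in> U)))"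
    by (elim exE conjE) (rule that)
  have kn: "k < n" by (rule positive_not_nilpotent[OF A n pos W])
  show ?thesis
  proof (intro exI[of _ \<delta>] conjI \<delta> ballI allI impI)
    fix B C U assume B: "B \<in> SE_nbhd \<delta> A" and C: "C \<in> SE_nbhd \<delta> A" and U: "dense_ring U"
      and BU: "elements_mat B \<subseteq> U" and CU: "elements_mat C \<subseteq> U"
    note R = dense_ringD(1)[OF U]
    note Bc = SE_nbhdD(1)[OF B A n] and Cc = SE_nbhdD(1)[OF C A n]
    have pB: "positive_mat B" and pC: "positive_mat C" using main B C by auto
    have "\<exists>L T L' T'. frame r k J B L T \<and> frame r k J C L' T' \<and> joined r k J L T L' T' \<and>
          (\<forall>i j. r \<le> i \<longrightarrow> i < n \<longrightarrow> j < n \<longrightarrow> L $$ (i, j) \<in> U \<and> L' $$ (i, j) \<in> U)"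
      using main B C R BU CU by blast
    then obtain L T L' T' where fB: "frame r k J B L T" and fC: "frame r k J C L' T'" and j: "joined r k J L T L' T'"
      and LU: "\<forall>i j. r \<le> i \<longrightarrow> i < n \<longrightarrow> j < n \<longrightarrow> L $$ (i, j) \<in> U \<and> L' $$ (i, j) \<in> U"
      by (elim exE conjE) (rule that)
    have core: "\<exists>B' C' G. B' \<in> carrier_mat m m \<and> C' \<in> carrier_mat m m \<and> (positive_splitting U m)\<^sup>*\<^sup>* B B' \<and> (positive_splitting U m)\<^sup>*\<^sup>* C C' \<and>
      elements_mat B' \<subseteq> U \<and> elements_mat C' \<subseteq> U \<and> positive_mat C' \<and>
      mpath m m G \<and> (\<forall>t\<in>{0..1}. det (G t) \<noteq> 0 \<and> positive_mat (conj_by (G t) B')) \<and> G 0 = 1\<^sub>m m \<and> G 1 * B' = C' * G 1"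
      if m: "n + (\<Sum>i<k. i) \<le> m" for m
      by (rule joined_splittings[OF U J _ fB fC j BU CU]) (use n nrk LU m in auto)
    {
      fix m :: nat assume m: "real m \<ge> (real n)\<^sup>2 / 2"
      obtain B' C' G where c: "B' \<in> carrier_mat m m" "C' \<in> carrier_mat m m" and sB: "(positive_splitting U m)\<^sup>*\<^sup>* B B'" and sC: "(positive_splitting U m)\<^sup>*\<^sup>* C C'"
        and pC': "positive_mat C'" and G: "mpath m m G" and Gp: "\<forall>t\<in>{0..1}. det (G t) \<noteq> 0 \<and> positive_mat (conj_by (G t) B')"
        and G0: "G 0 = 1\<^sub>m m" and G1: "G 1 * B' = C' * G 1"
        using core[OF staircase_size(2)[OF nrk kn m]] by (elim exE conjE) (rule that)
      have path: "positive_conjugate_path m (\<lambda>t. conj_by (G t) B')" by (rule conjugation_path_positive_conjugate[OF c(1) G Gp])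
      have e0: "conj_by (G 0) B' = B'" unfolding G0 by (rule conj_by_one[OF c(1)])
      have e1: "conj_by (G 1) B' = C'" by (rule conj_by_eq[OF mpath_carrier[OF G] c _ G1]) (use Gp in simp)
      have "positive_mat B'" using Gp e0 by (metis atLeastAtMost_iff order_refl zero_le_one)
      moreover have "similar_mat B' C'"
        using path e0 e1 unfolding positive_conjugate_path_def by (metis atLeastAtMost_iff order_refl zero_le_one)
      moreover have "row_splittings (U \<inter> {0..}) B B'" "row_splittings UNIV B B'"
        using positive_splittings_row_splittings[OF sB] Bc positive_elements_mat_subset[OF pB BU] by auto
      moreover have "row_splittings (U \<inter> {0..}) C C'" "row_splittings UNIV C C'"
        using positive_splittings_row_splittings[OF sC] Cc positive_elements_mat_subset[OF pC CU] by auto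
      ultimately show "\<exists>B' \<in> carrier_mat m m. \<exists>C' \<in> carrier_mat m m.
        row_splittings (U \<inter> {0..}) B B' \<and> row_splittings (U \<inter> {0..}) C C' \<and> row_splittings UNIV B B' \<and> row_splittings UNIV C C' \<and>
        positive_mat B' \<and> positive_mat C' \<and> similar_mat B' C' \<and>
        (\<exists>\<gamma>. positive_conjugate_path m \<gamma> \<and> \<gamma> 0 = B' \<and> \<gamma> 1 = C')"
        using c pC' path e0 e1 by (intro bexI[OF _ c(1)] bexI[OF _ c(2)] conjI exI[of _ "\<lambda>t. conj_by (G t) B'"]) simp_all
    }
    assume inv: "\<forall>x\<in>U. inverse x \<in> U"
    let ?K = "max (real n) ((real n)\<^sup>2 / 2)"
    define m where "m = n + (\<Sum>i<k. i)"
    have mK: "real m \<le> ?K" unfolding m_def by (rule staircase_size(1)[OF nrk kn])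
    obtain B' C' G where c: "B' \<in> carrier_mat m m" "C' \<in> carrier_mat m m" and sB: "(positive_splitting U m)\<^sup>*\<^sup>* B B'" and sC: "(positive_splitting U m)\<^sup>*\<^sup>* C C'"
      and B'U: "elements_mat B' \<subseteq> U" and C'U: "elements_mat C' \<subseteq> U"
      and G: "mpath m m G" and Gp: "\<forall>t\<in>{0..1}. det (G t) \<noteq> 0 \<and> positive_mat (conj_by (G t) B')"
      and G0: "G 0 = 1\<^sub>m m" and G1: "G 1 * B' = C' * G 1"
      using core[OF eq_refl[OF m_def[symmetric]]] by (elim exE conjE) (rule that)
    have aB: "admissible_mat (U \<inter> {0..}) ?K B" and aC: "admissible_mat (U \<inter> {0..}) ?K C"
      unfolding admissible_mat_def using Bc Cc pB pC positive_elements_mat_subset[OF pB BU] positive_elements_mat_subset[OF pC CU] by auto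
    have "(positive_ESSE (U \<inter> {0..}) ?K)\<^sup>*\<^sup>* B B'" "(positive_ESSE (U \<inter> {0..}) ?K)\<^sup>*\<^sup>* C C'"
      using positive_splittings_ESSE_chain[OF sB aB mK] positive_splittings_ESSE_chain[OF sC aC mK] by auto
    moreover have "(positive_ESSE (U \<inter> {0..}) ?K)\<^sup>*\<^sup>* B' C'"
      by (rule SSE_along_conjugation_path[OF U _ c(1) B'U c(2) C'U G _ _ G0 G1 mK]) (use inv Gp in auto)
    ultimately have "(positive_ESSE (U \<inter> {0..}) ?K)\<^sup>*\<^sup>* B C" using positive_ESSE_chain_sym by (meson rtranclp_trans)
    then show "SSE_through_positive (U \<inter> {0..}) ?K B C" by (rule positive_ESSE_chain_SSE[OF _ aB])
  qed
qed

theorem theorem7p3: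
  fixes A :: "real mat" and n :: nat
  assumes "n \<ge> 1" and "A \<in> carrier_mat n n" and "positive_mat A"
  shows "\<exists>\<delta>>0. \<forall>B \<in> SE_nbhd \<delta> A. \<forall>C \<in> SE_nbhd \<delta> A.
    (\<forall>m::nat. real m \<ge> (real n)\<^sup>2 / 2 \<longrightarrow>
      (\<exists>B' \<in> carrier_mat m m. \<exists>C' \<in> carrier_mat m m.
        row_splittings UNIV B B' \<and> row_splittings UNIV C C' \<and>
        positive_mat B' \<and> positive_mat C' \<and> similar_mat B' C' \<and>
        (\<exists>\<gamma>. positive_conjugate_path m \<gamma> \<and> \<gamma> 0 = B' \<and> \<gamma> 1 = C'))) \<and>
    SSE_through_positive {0..} (max (real n) ((real n)\<^sup>2 / 2)) B C \<and>
    (\<forall>U :: real set. subring U class_ring \<and> \<not> discrete U \<and>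
        elements_mat B \<subseteq> U \<and> elements_mat C \<subseteq> U \<longrightarrow>
      (\<forall>m::nat. real m \<ge> (real n)\<^sup>2 / 2 \<longrightarrow>
        (\<exists>B' \<in> carrier_mat m m. \<exists>C' \<in> carrier_mat m m.
          row_splittings (U \<inter> {0..}) B B' \<and> row_splittings (U \<inter> {0..}) C C' \<and>
          positive_mat B' \<and> positive_mat C' \<and> similar_mat B' C' \<and>
          (\<exists>\<gamma>. positive_conjugate_path m \<gamma> \<and> \<gamma> 0 = B' \<and> \<gamma> 1 = C'))) \<and>
      (subfield U class_ring \<longrightarrow>
        SSE_through_positive (U \<inter> {0..}) (max (real n) ((real n)\<^sup>2 / 2)) B C))"
proof -
  let ?K = "max (real n) ((real n)\<^sup>2 / 2)"
  define res where "res T m B C \<longleftrightarrow> (\<exists>B' \<in> carrier_mat m m. \<exists>C' \<in> carrier_mat m m.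
        row_splittings T B B' \<and> row_splittings T C C' \<and>
        positive_mat B' \<and> positive_mat C' \<and> similar_mat B' C' \<and>
        (\<exists>\<gamma>. positive_conjugate_path m \<gamma> \<and> \<gamma> 0 = B' \<and> \<gamma> 1 = C'))" for T m B C
  obtain \<delta> where \<delta>: "\<delta> > 0" and main: "\<forall>B\<in>SE_nbhd \<delta> A. \<forall>C\<in>SE_nbhd \<delta> A. \<forall>U. dense_ring U \<longrightarrow> elements_mat B \<subseteq> U \<longrightarrow> elements_mat C \<subseteq> U \<longrightarrow>
    (\<forall>m::nat. real m \<ge> (real n)\<^sup>2 / 2 \<longrightarrow>
      (\<exists>B' \<in> carrier_mat m m. \<exists>C' \<in> carrier_mat m m.
        row_splittings (U \<inter> {0..}) B B' \<and> row_splittings (U \<inter> {0..}) C C' \<and> row_splittings UNIV B B' \<and> row_splittings UNIV C C' \<and>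
        positive_mat B' \<and> positive_mat C' \<and> similar_mat B' C' \<and>
        (\<exists>\<gamma>. positive_conjugate_path m \<gamma> \<and> \<gamma> 0 = B' \<and> \<gamma> 1 = C'))) \<and>
    ((\<forall>x\<in>U. inverse x \<in> U) \<longrightarrow> SSE_through_positive (U \<inter> {0..}) ?K B C)"
    using splittings_near_positive[OF assms(2,1,3)] by (elim exE conjE) (rule that)
  have split: "res (U \<inter> {0..}) m B C \<and> res UNIV m B C"
    and sse: "(\<forall>x\<in>U. inverse x \<in> U) \<Longrightarrow> SSE_through_positive (U \<inter> {0..}) ?K B C"
    if "B \<in> SE_nbhd \<delta> A" "C \<in> SE_nbhd \<delta> A" "dense_ring U" "elements_mat B \<subseteq> U" "elements_mat C \<subseteq> U"
      "real m \<ge> (real n)\<^sup>2 / 2" for B C U and m :: nat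
  proof -
    have *: "(\<forall>m::nat. real m \<ge> (real n)\<^sup>2 / 2 \<longrightarrow>
      (\<exists>B' \<in> carrier_mat m m. \<exists>C' \<in> carrier_mat m m.
        row_splittings (U \<inter> {0..}) B B' \<and> row_splittings (U \<inter> {0..}) C C' \<and> row_splittings UNIV B B' \<and> row_splittings UNIV C C' \<and>
        positive_mat B' \<and> positive_mat C' \<and> similar_mat B' C' \<and>
        (\<exists>\<gamma>. positive_conjugate_path m \<gamma> \<and> \<gamma> 0 = B' \<and> \<gamma> 1 = C'))) \<and>
      ((\<forall>x\<in>U. inverse x \<in> U) \<longrightarrow> SSE_through_positive (U \<inter> {0..}) ?K B C)"
      using main that(1-5) by blast
    then show "res (U \<inter> {0..}) m B C \<and> res UNIV m B C" unfolding res_def using that(6) by blast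
    show "(\<forall>x\<in>U. inverse x \<in> U) \<Longrightarrow> SSE_through_positive (U \<inter> {0..}) ?K B C" using * by blast
  qed
  \<comment> \<open>any admissible size, needed to specialize the first part when only the chain is wanted\<close>
  obtain m0 :: nat where m0: "real m0 \<ge> (real n)\<^sup>2 / 2" using real_arch_simple by blast
  have claim: "(\<forall>m::nat. real m \<ge> (real n)\<^sup>2 / 2 \<longrightarrow> res UNIV m B C) \<and> SSE_through_positive {0..} ?K B C \<and>
    (\<forall>U. subring U class_ring \<and> \<not> discrete U \<and> elements_mat B \<subseteq> U \<and> elements_mat C \<subseteq> U \<longrightarrow>
      (\<forall>m::nat. real m \<ge> (real n)\<^sup>2 / 2 \<longrightarrow> res (U \<inter> {0..}) m B C) \<and>
      (subfield U class_ring \<longrightarrow> SSE_through_positive (U \<inter> {0..}) ?K B C))"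
    if BC: "B \<in> SE_nbhd \<delta> A" "C \<in> SE_nbhd \<delta> A" for B C
  proof (intro conjI allI impI)
    show "res UNIV m B C" if "real m \<ge> (real n)\<^sup>2 / 2" for m :: nat
      using split[OF BC dense_ring_UNIV _ _ that] by simp
    show "SSE_through_positive {0..} ?K B C"
      using sse[OF BC dense_ring_UNIV _ _ m0] by simp
    fix U :: "real set" assume U: "subring U class_ring \<and> \<not> discrete U \<and> elements_mat B \<subseteq> U \<and> elements_mat C \<subseteq> U"
    then have D: "dense_ring U" using nondiscrete_subring_dense subring_class_ring_real_subring by blast
    show "res (U \<inter> {0..}) m B C" if "real m \<ge> (real n)\<^sup>2 / 2" for m :: nat
      using split[OF BC D _ _ that] U by blast
    show "SSE_through_positive (U \<inter> {0..}) ?K B C" if sf: "subfield U class_ring"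
      using sse[OF BC D _ _ m0] U subfield_class_ring_inverse[OF sf] by blast
  qed
  show ?thesis
    by (rule exI[of _ \<delta>], rule conjI[OF \<delta>], intro ballI, rule claim[unfolded res_def])
qed

end
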